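(* Let $M=\bigoplus_{n\ge 0}M_n=\mathbb{Z}[x,y]$ with the action of $SL_2(\mathbb{Z})$ and of $B_3$ described in the context, and grading $\deg x=\deg y=2$. Then: 1. $H^0(B_3;M)=H^0(SL_2(\mathbb{Z});M)=\mathbb{Z}$, concentrated in degree $n=0$. 2. For every prime $p$ and every $n\ge 0$ there are isomorphisms of abelian groups $$H^1(B_3;M_n)_{(p)}\cong H^1(SL_2(\mathbb{Z});M_n)_{(p)}\cong \Gamma_p^+[\mathcal{P}_p,\mathcal{Q}_p]_{\deg=n},$$ where $\deg\mathcal{P}_p=2(p+1)$ and $\deg\mathcal{Q}_p=2p(p-1)$. 3. $H^1(SL_2(\mathbb{Z});M_0)=0$ and $H^1(B_3;M_0)=\mathbb{Z}$. 4. For every $n>0$, $FH^1(B_3;M_n)\cong FH^1(SL_2(\mathbb{Z});M_n)\cong\mathbb{Z}^{f_n}$, where the ranks $f_n$ are given by $$\sum_{n=0}^\infty f_nt^n=\frac{t^4(1+t^4-t^{12}+t^{16})}{(1-t^8)(1-t^{12})}.$$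
   Context: $B_3=\langle\sigma_1,\sigma_2:\sigma_1\sigma_2\sigma_1=\sigma_2\sigma_1\sigma_2\rangle$ is the braid group on 3 strands, and $\lambda:B_3\to SL_2(\mathbb{Z})$ is the surjection $\sigma_1\mapsto\begin{bmatrix}1&0\\-1&1\end{bmatrix}$, $\sigma_2\mapsto\begin{bmatrix}1&1\\0&1\end{bmatrix}$. The group $SL_2(\mathbb{Z})$ acts on $M=\mathbb{Z}[x,y]$ by graded ring automorphisms determined by $\sigma_1:x\mapsto x-y,\ y\mapsto y$ and $\sigma_2:x\mapsto x,\ y\mapsto x+y$; $B_3$ acts through $\lambda$. The grading is $\deg x=\deg y=2$ (so that $M\cong H^*((\mathbb{CP}^\infty)^2;\mathbb{Z})$), $M_n$ is the homogeneous component of degree $n$ (zero for $n$ odd; $M_{2d}$ consists of the homogeneous polynomials of ordinary degree $d$), and $H^*(G;M)=\bigoplus_nH^*(G;M_n)$. For a finitely generated abelian group $L$ and a prime $p$, $L_{(p)}=\{a\in L: p^ka=0\text{ for some }k\}$, and $FL$ is the free part of $L$ (the isomorphism class of a maximal free direct summand). $\Gamma[z]\subset\mathbb{Q}[z]$ is the divided polynomial algebra, spanned over $\mathbb{Z}$ by $z_i=z^i/i!$, $i\ge0$. With $v$ the $p$-adic valuation, $I_p=(p^{v(i)+1}z_i,\ i\ge1)$ is an ideal of $\Gamma[z]$ and $\Gamma_p[z]=\Gamma[z]/I_p$. Also $\Gamma_p[z,z']=\Gamma_p[z]\otimes_{\mathbb{Z}}\Gamma_p[z']$, and $\Gamma_p^+[z,z']$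 is its part of degree $>0$. Here the formal variables are called $\mathcal{P}_p$ and $\mathcal{Q}_p$, with the stated degrees (they are the degrees of the polynomials $\mathcal{P}_p=xy(x^{p-1}-y^{p-1})$ and $\mathcal{Q}_p=\sum_{h=0}^p(x^{p-1})^{p-h}(y^{p-1})^h$); the subscript $\deg=n$ denotes the component of degree $n$. *)

theory Defs
  imports
    "HOL-Analysis.Determinants"
    "HOL-Algebra.Free_Abelian_Groups"
    "HOL-Algebra.QuotRing"
    "HOL-Computational_Algebra.Polynomial"
    "HOL-Computational_Algebra.Formal_Power_Series"
begin

section \<open>Groups given by generators and relations\<close>

text \<open>
  A word is a list of letters \<open>(a, e)\<close>; \<open>(a, True)\<close> stands for the generator \<open>a\<close> and
  \<open>(a, False)\<close> for its formal inverse. A pair \<open>(r, s)\<close> of words in \<open>R\<close> is the relation \<open>r = s\<close>.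
\<close>

type_synonym 'a word = "('a \<times> bool) list"

inductive pres_cong :: "('a word \<times> 'a word) set \<Rightarrow> 'a word \<Rightarrow> 'a word \<Rightarrow> bool"
  for R :: "('a word \<times> 'a word) set" where
  refl: "pres_cong R u u"
| sym: "pres_cong R u v \<Longrightarrow> pres_cong R v u"
| trans: "pres_cong R u v \<Longrightarrow> pres_cong R v w \<Longrightarrow> pres_cong R u w"
| cancel: "pres_cong R (u @ [(a, e), (a, \<not> e)] @ v) (u @ v)"
| rel: "(r, s) \<in> R \<Longrightarrow> pres_cong R (u @ r @ v) (u @ s @ v)"

definition pres_class :: "('a word \<times> 'a word) set \<Rightarrow> 'a word \<Rightarrow> 'a word set" where
  "pres_class R w = {v. pres_cong R w v}"

definition presented_group :: "('a word \<times> 'a word) set \<Rightarrow> 'a word set monoid" where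
  "presented_group R =
    \<lparr>carrier = range (pres_class R),
     monoid.mult = (\<lambda>C D. \<Union>u\<in>C. \<Union>v\<in>D. pres_class R (u @ v)),
     one = pres_class R []\<rparr>"

definition eval_word :: "('g, 'm) monoid_scheme \<Rightarrow> ('a \<Rightarrow> 'g) \<Rightarrow> 'a word \<Rightarrow> 'g" where
  "eval_word G \<phi> w =
    foldr (\<lambda>(a, e) g. (if e then \<phi> a else inv\<^bsub>G\<^esub> (\<phi> a)) \<otimes>\<^bsub>G\<^esub> g) w \<one>\<^bsub>G\<^esub>"

text \<open>
  The homomorphism from a presented group determined by the images of the generators
  (meaningful if \<open>\<phi>\<close> respects the relations, so that \<open>eval_word\<close> is constant on classes).
\<close>

definition pres_hom :: "('g, 'm) monoid_scheme \<Rightarrow> ('a \<Rightarrow> 'g) \<Rightarrow> 'a word set \<Rightarrow> 'g" where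
  "pres_hom G \<phi> C = the_elem (eval_word G \<phi> ` C)"


section \<open>The groups \<open>B\<^sub>3\<close> and \<open>SL\<^sub>2(\<int>)\<close>\<close>

datatype braid_gen = S1 | S2

definition B3 :: "braid_gen word set monoid" where
  "B3 = presented_group
    {([(S1, True), (S2, True), (S1, True)], [(S2, True), (S1, True), (S2, True)])}"

definition SL2Z :: "(int^2^2) monoid" where
  "SL2Z = \<lparr>carrier = {A. det A = 1}, monoid.mult = (**), one = mat 1\<rparr>"

fun braid_matrix :: "braid_gen \<Rightarrow> int^2^2" where
  "braid_matrix S1 = vector [vector [1, 0], vector [-1, 1]]"
| "braid_matrix S2 = vector [vector [1, 1], vector [0, 1]]"

definition lam :: "braid_gen word set \<Rightarrow> int^2^2" where
  "lam = pres_hom SL2Z braid_matrix"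


section \<open>The module \<open>\<int>[x, y]\<close>\<close>

text \<open>
  \<open>\<int>[x, y]\<close> is \<^typ>\<open>int poly poly\<close>, with \<open>y\<close> the outer and \<open>x\<close> the inner variable: the
  coefficient of \<open>x\<^sup>i y\<^sup>j\<close> in \<open>f\<close> is \<open>coeff (coeff f j) i\<close>.
\<close>

definition var_x :: "int poly poly" where "var_x = [:[:0, 1:]:]"
definition var_y :: "int poly poly" where "var_y = [:0, 1:]"

definition subst2 :: "int poly poly \<Rightarrow> int poly poly \<Rightarrow> int poly poly \<Rightarrow> int poly poly" where
  "subst2 X Y f =
    (\<Sum>j\<le>degree f. \<Sum>i\<le>degree (coeff f j). of_int (coeff (coeff f j) i) * X ^ i * Y ^ j)"

text \<open>
  A matrix acts on \<open>\<int>x \<oplus> \<int>y\<close> as on column vectors, and on \<open>\<int>[x, y]\<close> by the induced ring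
  automorphism. See \<open>sl2_act_generators\<close> below for the two generators.
\<close>

definition sl2_act :: "int^2^2 \<Rightarrow> int poly poly \<Rightarrow> int poly poly" where
  "sl2_act A f = subst2
    (of_int (A$1$1) * var_x + of_int (A$2$1) * var_y)
    (of_int (A$1$2) * var_x + of_int (A$2$2) * var_y) f"

definition b3_act :: "braid_gen word set \<Rightarrow> int poly poly \<Rightarrow> int poly poly" where
  "b3_act g = sl2_act (lam g)"

text \<open>The homogeneous component of degree \<open>n\<close>, where \<open>x\<close> and \<open>y\<close> have degree \<open>2\<close>.\<close>

definition Mdeg :: "nat \<Rightarrow> int poly poly set" where
  "Mdeg n = {f. \<forall>i j. coeff (coeff f j) i \<noteq> 0 \<longrightarrow> 2 * (i + j) = n}"


section \<open>Group cohomology\<close>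

text \<open>
  Inhomogeneous cochains of \<open>G\<close> with values in an additive subgroup \<open>A\<close>, on which \<open>G\<close> acts
  from the left by \<open>\<rho>\<close>. An \<open>n\<close>-tuple is a list of length \<open>n\<close>; cochains are normalised to be
  \<open>0\<close> away from \<open>n\<close>-tuples of elements of \<open>G\<close>, so that they are determined by their values there.
\<close>

definition tuples :: "('g, 'k) monoid_scheme \<Rightarrow> nat \<Rightarrow> 'g list set" where
  "tuples G n = {gs. length gs = n \<and> set gs \<subseteq> carrier G}"

definition cochains :: "('g, 'k) monoid_scheme \<Rightarrow> 'm::ab_group_add set \<Rightarrow> nat \<Rightarrow> ('g list \<Rightarrow> 'm) set" where
  "cochains G A n = {f. (\<forall>gs \<in> tuples G n. f gs \<in> A) \<and> (\<forall>gs. gs \<notin> tuples G n \<longrightarrow> f gs = 0)}"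

definition alt :: "nat \<Rightarrow> 'm::ab_group_add \<Rightarrow> 'm" where
  "alt i m = (if even i then m else - m)"

definition merge_at :: "('g, 'k) monoid_scheme \<Rightarrow> nat \<Rightarrow> 'g list \<Rightarrow> 'g list" where
  "merge_at G i gs = take i gs @ [gs ! i \<otimes>\<^bsub>G\<^esub> gs ! Suc i] @ drop (i + 2) gs"

definition coboundary ::
  "('g, 'k) monoid_scheme \<Rightarrow> ('g \<Rightarrow> 'm \<Rightarrow> 'm) \<Rightarrow> nat \<Rightarrow> ('g list \<Rightarrow> 'm) \<Rightarrow> 'g list \<Rightarrow> 'm::ab_group_add" where
  "coboundary G \<rho> n f gs =
    (if gs \<in> tuples G (Suc n)
     then \<rho> (hd gs) (f (tl gs)) + (\<Sum>i<n. alt (Suc i) (f (merge_at G i gs)))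
          + alt (Suc n) (f (butlast gs))
     else 0)"

definition cocycles ::
  "('g, 'k) monoid_scheme \<Rightarrow> 'm::ab_group_add set \<Rightarrow> ('g \<Rightarrow> 'm \<Rightarrow> 'm) \<Rightarrow> nat \<Rightarrow> ('g list \<Rightarrow> 'm) set" where
  "cocycles G A \<rho> n = {f \<in> cochains G A n. coboundary G \<rho> n f = (\<lambda>_. 0)}"

definition coboundaries ::
  "('g, 'k) monoid_scheme \<Rightarrow> 'm::ab_group_add set \<Rightarrow> ('g \<Rightarrow> 'm \<Rightarrow> 'm) \<Rightarrow> nat \<Rightarrow> ('g list \<Rightarrow> 'm) set" where
  "coboundaries G A \<rho> n =
    (case n of 0 \<Rightarrow> {\<lambda>_. 0} | Suc k \<Rightarrow> coboundary G \<rho> k ` cochains G A k)"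

definition cohomology ::
  "nat \<Rightarrow> ('g, 'k) monoid_scheme \<Rightarrow> 'm::ab_group_add set \<Rightarrow> ('g \<Rightarrow> 'm \<Rightarrow> 'm) \<Rightarrow> ('g list \<Rightarrow> 'm) set monoid" where
  "cohomology i G A \<rho> =
    \<lparr>carrier = cocycles G A \<rho> i, monoid.mult = (\<lambda>f h gs. f gs + h gs), one = (\<lambda>_. 0)\<rparr>
      Mod coboundaries G A \<rho> i"

abbreviation H_B3 :: "nat \<Rightarrow> nat \<Rightarrow> (braid_gen word set list \<Rightarrow> int poly poly) set monoid" where
  "H_B3 i n \<equiv> cohomology i B3 (Mdeg n) b3_act"

abbreviation H_SL2 :: "nat \<Rightarrow> nat \<Rightarrow> ((int^2^2) list \<Rightarrow> int poly poly) set monoid" where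
  "H_SL2 i n \<equiv> cohomology i SL2Z (Mdeg n) sl2_act"


section \<open>Torsion and free part of an abelian group\<close>

abbreviation restrict_group :: "'a monoid \<Rightarrow> 'a set \<Rightarrow> 'a monoid" where
  "restrict_group L K \<equiv> L\<lparr>carrier := K\<rparr>"

definition primary_part :: "nat \<Rightarrow> 'a monoid \<Rightarrow> 'a monoid" where
  "primary_part p L =
    restrict_group L {a \<in> carrier L. \<exists>k::nat. a [^]\<^bsub>L\<^esub> (p ^ k) = \<one>\<^bsub>L\<^esub>}"

definition direct_summand :: "'a monoid \<Rightarrow> 'a set \<Rightarrow> bool" where
  "direct_summand L K \<longleftrightarrow> subgroup K L \<and>
    (\<exists>T. subgroup T L \<and> K <#>\<^bsub>L\<^esub> T = carrier L \<and> K \<inter> T = {\<one>\<^bsub>L\<^esub>})"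

text \<open>A basis of a free abelian group may be taken inside the group, hence of type \<open>'a set\<close>.\<close>

definition free_abelian :: "'a monoid \<Rightarrow> bool" where
  "free_abelian L \<longleftrightarrow> (\<exists>S :: 'a set. L \<cong> free_Abelian_group S)"

definition free_summand :: "'a monoid \<Rightarrow> 'a set \<Rightarrow> bool" where
  "free_summand L K \<longleftrightarrow> direct_summand L K \<and> free_abelian (restrict_group L K)"

definition max_free_summand :: "'a monoid \<Rightarrow> 'a set \<Rightarrow> bool" where
  "max_free_summand L K \<longleftrightarrow>
    free_summand L K \<and> (\<forall>K'. free_summand L K' \<and> K \<subseteq> K' \<longrightarrow> K' = K)"

text \<open>
  The free part of \<open>L\<close> is an isomorphism class: the one of the maximal free direct summands.
\<close>

definition free_part_iso :: "'a monoid \<Rightarrow> 'b monoid \<Rightarrow> bool" where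
  "free_part_iso L Z \<longleftrightarrow> (\<exists>K. max_free_summand L K) \<and>
    (\<forall>K. max_free_summand L K \<longrightarrow> restrict_group L K \<cong> Z)"

definition Z_power :: "nat \<Rightarrow> (nat \<Rightarrow> int) monoid" where
  "Z_power r = product_group {..<r} (\<lambda>_. integer_group)"


section \<open>Divided polynomial algebras\<close>

definition divpow :: "nat \<Rightarrow> rat poly" where
  "divpow i = monom (1 / fact i) i"

definition Gamma :: "rat poly ring" where
  "Gamma = \<lparr>carrier = {\<Sum>i\<le>n. of_int (c i) * divpow i | n c. True},
    monoid.mult = (*), one = 1, zero = 0, add = (+)\<rparr>"

definition I_ideal :: "nat \<Rightarrow> rat poly set" where
  "I_ideal p = genideal Gamma {of_nat (p ^ (multiplicity p i + 1)) * divpow i | i. i \<ge> 1}"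

definition Gamma_p :: "nat \<Rightarrow> rat poly set ring" where
  "Gamma_p p = Gamma Quot I_ideal p"

text \<open>The tensor product over \<open>\<int>\<close> of two abelian groups.\<close>

definition tensor_relators ::
  "'a monoid \<Rightarrow> 'b monoid \<Rightarrow> ('a \<times> 'b \<Rightarrow>\<^sub>0 int) set" where
  "tensor_relators A B =
    {frag_of (a \<otimes>\<^bsub>A\<^esub> a', b) - frag_of (a, b) - frag_of (a', b) | a a' b.
      a \<in> carrier A \<and> a' \<in> carrier A \<and> b \<in> carrier B} \<union>
    {frag_of (a, b \<otimes>\<^bsub>B\<^esub> b') - frag_of (a, b) - frag_of (a, b') | a b b'.
      a \<in> carrier A \<and> b \<in> carrier B \<and> b' \<in> carrier B}"

definition tensor_kernel ::
  "'a monoid \<Rightarrow> 'b monoid \<Rightarrow> ('a \<times> 'b \<Rightarrow>\<^sub>0 int) set" where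
  "tensor_kernel A B =
    generate (free_Abelian_group (carrier A \<times> carrier B)) (tensor_relators A B)"

definition tensor :: "'a monoid \<Rightarrow> 'b monoid \<Rightarrow> ('a \<times> 'b \<Rightarrow>\<^sub>0 int) set monoid" where
  "tensor A B = free_Abelian_group (carrier A \<times> carrier B) Mod tensor_kernel A B"

definition pure_tensor ::
  "'a monoid \<Rightarrow> 'b monoid \<Rightarrow> 'a \<Rightarrow> 'b \<Rightarrow> ('a \<times> 'b \<Rightarrow>\<^sub>0 int) set" where
  "pure_tensor A B a b =
    tensor_kernel A B #>\<^bsub>free_Abelian_group (carrier A \<times> carrier B)\<^esub> frag_of (a, b)"

text \<open>
  The additive group of \<open>\<Gamma>\<^sub>p[z, z'] = \<Gamma>\<^sub>p[z] \<otimes> \<Gamma>\<^sub>p[z']\<close>, and the component of degree \<open>n\<close> of its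
  part of positive degree, where \<open>z\<close> has degree \<open>a\<close> and \<open>z'\<close> has degree \<open>b\<close>. A homogeneous
  component is spanned by the tensors \<open>z\<^sub>i \<otimes> z'\<^sub>j\<close> of that degree; for \<open>n = 0\<close> the spanning
  set is empty and the component of \<open>\<Gamma>\<^sub>p\<^sup>+\<close> is zero.
\<close>

abbreviation Gamma_p_add :: "nat \<Rightarrow> rat poly set monoid" where
  "Gamma_p_add p \<equiv> add_monoid (Gamma_p p)"

definition Gamma_p2 :: "nat \<Rightarrow> (rat poly set \<times> rat poly set \<Rightarrow>\<^sub>0 int) set monoid" where
  "Gamma_p2 p = tensor (Gamma_p_add p) (Gamma_p_add p)"

definition divpow_class :: "nat \<Rightarrow> nat \<Rightarrow> rat poly set" where
  "divpow_class p i = I_ideal p +>\<^bsub>Gamma\<^esub> divpow i"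

definition Gamma_p2_plus_deg ::
  "nat \<Rightarrow> nat \<Rightarrow> nat \<Rightarrow> nat \<Rightarrow> (rat poly set \<times> rat poly set \<Rightarrow>\<^sub>0 int) set monoid" where
  "Gamma_p2_plus_deg p a b n = restrict_group (Gamma_p2 p)
    (generate (Gamma_p2 p)
      {pure_tensor (Gamma_p_add p) (Gamma_p_add p) (divpow_class p i) (divpow_class p j) | i j.
        i * a + j * b = n \<and> n > 0})"


section \<open>The groups and the actions are as intended\<close>

lemma pres_class_eq_iff: "pres_class R u = pres_class R v \<longleftrightarrow> pres_cong R u v"
  unfolding pres_class_def set_eq_iff mem_Collect_eq
  by (meson pres_cong.refl pres_cong.sym pres_cong.trans)

lemma pres_cong_context: "pres_cong R u v \<Longrightarrow> pres_cong R (a @ u @ b) (a @ v @ b)"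
proof (induction rule: pres_cong.induct)
  case (cancel u x e v)
  show ?case using pres_cong.cancel[of R "a @ u" x e "v @ b"] by simp
next
  case (rel r s u v)
  then show ?case using pres_cong.rel[of r s R "a @ u" "v @ b"] by simp
next
  case (trans u v w)
  show ?case using trans.IH by (rule pres_cong.trans)
qed (simp_all add: pres_cong.refl pres_cong.sym)

lemma pres_cong_append:
  assumes "pres_cong R u u'" "pres_cong R v v'"
  shows "pres_cong R (u @ v) (u' @ v')"
proof (rule pres_cong.trans)
  show "pres_cong R (u @ v) (u' @ v)" using pres_cong_context[OF assms(1), of "[]" v] by simp
  show "pres_cong R (u' @ v) (u' @ v')" using pres_cong_context[OF assms(2), of u' "[]"] by simp
qed

lemma presented_group_carrier: "carrier (presented_group R) = range (pres_class R)"
  and presented_group_one: "\<one>\<^bsub>presented_group R\<^esub> = pres_class R []"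
  by (simp_all add: presented_group_def)

lemma presented_group_mult:
  "pres_class R u \<otimes>\<^bsub>presented_group R\<^esub> pres_class R v = pres_class R (u @ v)"
proof -
  have "pres_class R (u' @ v') = pres_class R (u @ v)"
    if "u' \<in> pres_class R u" "v' \<in> pres_class R v" for u' v'
  proof -
    have "pres_cong R (u @ v) (u' @ v')"
      using that by (intro pres_cong_append) (simp_all add: pres_class_def)
    then show ?thesis unfolding pres_class_eq_iff by (rule pres_cong.sym)
  qed
  moreover have "u \<in> pres_class R u" "v \<in> pres_class R v"
    by (auto simp: pres_class_def pres_cong.refl)
  ultimately have "(\<Union>u'\<in>pres_class R u. \<Union>v'\<in>pres_class R v. pres_class R (u' @ v')) = pres_class R (u @ v)"
    by blast
  then show ?thesis by (simp add: presented_group_def)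
qed

lemma pres_class_inverse_word:
  "pres_cong R (rev (map (\<lambda>(a, e). (a, \<not> e)) w) @ w) []"
proof (induction w)
  case (Cons x w)
  obtain a e where x: "x = (a, e)" by force
  let ?r = "rev (map (\<lambda>(a, e). (a, \<not> e)) w)"
  have "pres_cong R (?r @ [(a, \<not> e), (a, \<not> \<not> e)] @ w) (?r @ w)" by (rule pres_cong.cancel)
  then have "pres_cong R (?r @ [(a, \<not> e), (a, \<not> \<not> e)] @ w) []"
    using Cons by (rule pres_cong.trans)
  then show ?case by (simp add: x)
qed (simp add: pres_cong.refl)

lemma group_presented_group: "group (presented_group R)"
proof (rule groupI)
  show "\<exists>y\<in>carrier (presented_group R). y \<otimes>\<^bsub>presented_group R\<^esub> x = \<one>\<^bsub>presented_group R\<^esub>"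
    if x: "x \<in> carrier (presented_group R)" for x
  proof -
    obtain w where w: "x = pres_class R w" using x by (auto simp: presented_group_carrier)
    let ?y = "pres_class R (rev (map (\<lambda>(a, e). (a, \<not> e)) w))"
    have "?y \<otimes>\<^bsub>presented_group R\<^esub> x = pres_class R []"
      using pres_class_inverse_word[of R w] by (simp add: w presented_group_mult pres_class_eq_iff)
    then show ?thesis by (auto simp: presented_group_carrier presented_group_one)
  qed
qed (auto simp: presented_group_carrier presented_group_one presented_group_mult)

lemma eval_word_Nil: "eval_word G \<phi> [] = \<one>\<^bsub>G\<^esub>"
  by (simp add: eval_word_def)

lemma eval_word_Cons:
  "eval_word G \<phi> ((a, e) # w) = (if e then \<phi> a else inv\<^bsub>G\<^esub> (\<phi> a)) \<otimes>\<^bsub>G\<^esub> eval_word G \<phi> w"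
  by (simp add: eval_word_def)

context group
begin

lemma eval_word_closed:
  assumes "range \<phi> \<subseteq> carrier G"
  shows "eval_word G \<phi> w \<in> carrier G"
proof (induction w)
  case (Cons x w)
  obtain a e where x: "x = (a, e)" by force
  have "\<phi> a \<in> carrier G" using assms by auto
  then show ?case using Cons by (simp add: x eval_word_Cons)
qed (simp add: eval_word_Nil)

lemma eval_word_append:
  assumes "range \<phi> \<subseteq> carrier G"
  shows "eval_word G \<phi> (u @ v) = eval_word G \<phi> u \<otimes> eval_word G \<phi> v"
proof (induction u)
  case Nil
  show ?case by (simp add: eval_word_Nil eval_word_closed[OF assms])
next
  case (Cons x u)
  obtain a e where x: "x = (a, e)" by force
  have "\<phi> a \<in> carrier G" using assms by auto
  then show ?case using Cons by (simp add: x eval_word_Cons eval_word_closed[OF assms] m_assoc)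
qed

lemma eval_word_cong:
  assumes "range \<phi> \<subseteq> carrier G"
    and "\<And>r s. (r, s) \<in> R \<Longrightarrow> eval_word G \<phi> r = eval_word G \<phi> s"
    and "pres_cong R u v"
  shows "eval_word G \<phi> u = eval_word G \<phi> v"
  using assms(3)
proof (induction rule: pres_cong.induct)
  case (sym u v)
  from sym.IH show ?case by (rule HOL.sym)
next
  case (trans u v w)
  from trans.IH show ?case by (rule HOL.trans)
next
  case (cancel u a e v)
  have "\<phi> a \<in> carrier G" using assms(1) by auto
  then have "eval_word G \<phi> [(a, e), (a, \<not> e)] = \<one>"
    by (simp add: eval_word_Cons eval_word_Nil)
  then show ?case
    by (simp only: eval_word_append[OF assms(1)] eval_word_closed[OF assms(1)] l_one)
next
  case (rel r s u v)
  then show ?case by (simp only: eval_word_append[OF assms(1)] assms(2)[OF rel])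
qed (rule HOL.refl)

lemma pres_hom_class:
  assumes "range \<phi> \<subseteq> carrier G"
    and "\<And>r s. (r, s) \<in> R \<Longrightarrow> eval_word G \<phi> r = eval_word G \<phi> s"
  shows "pres_hom G \<phi> (pres_class R w) = eval_word G \<phi> w"
proof -
  have "eval_word G \<phi> v = eval_word G \<phi> w" if "v \<in> pres_class R w" for v
    using eval_word_cong[OF assms, where u = w and v = v] that by (simp add: pres_class_def)
  moreover have "w \<in> pres_class R w" by (simp add: pres_class_def pres_cong.refl)
  ultimately have "eval_word G \<phi> ` pres_class R w = {eval_word G \<phi> w}" by blast
  then show ?thesis by (simp add: pres_hom_def)
qed

lemma pres_hom_hom:
  assumes "range \<phi> \<subseteq> carrier G"
    and "\<And>r s. (r, s) \<in> R \<Longrightarrow> eval_word G \<phi> r = eval_word G \<phi> s"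
  shows "pres_hom G \<phi> \<in> hom (presented_group R) G"
proof (rule homI)
  have eval: "pres_hom G \<phi> (pres_class R w) = eval_word G \<phi> w" for w
    using assms by (rule pres_hom_class)
  fix x y assume "x \<in> carrier (presented_group R)" "y \<in> carrier (presented_group R)"
  then obtain u v where xy: "x = pres_class R u" "y = pres_class R v"
    by (auto simp: presented_group_def)
  show "pres_hom G \<phi> x \<in> carrier G"
    unfolding xy eval by (rule eval_word_closed[OF assms(1)])
  show "pres_hom G \<phi> (x \<otimes>\<^bsub>presented_group R\<^esub> y) = pres_hom G \<phi> x \<otimes> pres_hom G \<phi> y"
    by (simp only: xy presented_group_mult eval eval_word_append[OF assms(1)])
qed

end

lemma group_SL2Z: "group SL2Z"
proof (rule groupI)
  fix A assume "A \<in> carrier SL2Z"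
  then have A: "A$1$1 * A$2$2 - A$1$2 * A$2$1 = 1" by (simp add: SL2Z_def det_2)
  define B :: "int^2^2" where "B = vector [vector [A$2$2, - A$1$2], vector [- A$2$1, A$1$1]]"
  have "det B = 1" using A by (simp add: B_def det_2 mult.commute)
  moreover have "B ** A = mat 1"
    using A by (simp add: B_def vec_eq_iff forall_2 matrix_matrix_mult_def sum_2 mat_def algebra_simps)
  ultimately show "\<exists>y\<in>carrier SL2Z. y \<otimes>\<^bsub>SL2Z\<^esub> A = \<one>\<^bsub>SL2Z\<^esub>"
    by (auto simp: SL2Z_def)
qed (auto simp: SL2Z_def det_mul matrix_mul_assoc)

lemma lam_respects:
  "range braid_matrix \<subseteq> carrier SL2Z"
  "(r, s) \<in> {([(S1, True), (S2, True), (S1, True)], [(S2, True), (S1, True), (S2, True)])} \<Longrightarrow>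
    eval_word SL2Z braid_matrix r = eval_word SL2Z braid_matrix s"
proof -
  have "braid_matrix g \<in> carrier SL2Z" for g
    by (cases g) (simp_all add: SL2Z_def det_2)
  then show "range braid_matrix \<subseteq> carrier SL2Z" by auto
qed (auto simp: eval_word_Cons eval_word_Nil SL2Z_def matrix_matrix_mult_def vec_eq_iff
       forall_2 sum_2 mat_def)

lemma lam_hom: "lam \<in> hom B3 SL2Z"
  unfolding lam_def B3_def
  by (rule group.pres_hom_hom) (fact group_SL2Z, fact lam_respects(1), rule lam_respects(2))

lemma lam_generator:
  "lam (pres_class {([(S1, True), (S2, True), (S1, True)], [(S2, True), (S1, True), (S2, True)])}
     [(g, True)]) = braid_matrix g"
proof -
  have "lam (pres_class {([(S1, True), (S2, True), (S1, True)], [(S2, True), (S1, True), (S2, True)])}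
      [(g, True)]) = eval_word SL2Z braid_matrix [(g, True)]"
    unfolding lam_def by (rule group.pres_hom_class) (fact group_SL2Z, fact lam_respects(1), rule lam_respects(2))
  then show ?thesis by (simp add: eval_word_Cons eval_word_Nil SL2Z_def)
qed

text \<open>\<open>subst2 X Y\<close> is the ring homomorphism \<open>\<int>[x, y] \<rightarrow> \<int>[x, y]\<close> sending \<open>x, y\<close> to \<open>X, Y\<close>.\<close>

lemma subst2_bounded:
  assumes "\<And>j i. coeff (coeff f j) i \<noteq> 0 \<Longrightarrow> j \<le> m \<and> i \<le> n"
  shows "subst2 X Y f = (\<Sum>j\<le>m. \<Sum>i\<le>n. of_int (coeff (coeff f j) i) * X ^ i * Y ^ j)"
proof -
  have inner: "(\<Sum>i\<le>degree (coeff f j). of_int (coeff (coeff f j) i) * X ^ i * Y ^ j) =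
      (\<Sum>i\<le>n. of_int (coeff (coeff f j) i) * X ^ i * Y ^ j)" for j
  proof (rule sum.mono_neutral_cong)
    fix i assume "i \<in> {..degree (coeff f j)} - {..n}"
    then show "of_int (coeff (coeff f j) i) * X ^ i * Y ^ j = 0" using assms[of j i] by fastforce
  qed (auto simp: coeff_eq_0)
  have "subst2 X Y f = (\<Sum>j\<le>degree f. \<Sum>i\<le>n. of_int (coeff (coeff f j) i) * X ^ i * Y ^ j)"
    by (simp add: subst2_def inner)
  also have "\<dots> = (\<Sum>j\<le>m. \<Sum>i\<le>n. of_int (coeff (coeff f j) i) * X ^ i * Y ^ j)"
  proof (rule sum.mono_neutral_cong)
    fix j assume "j \<in> {..degree f} - {..m}"
    then show "(\<Sum>i\<le>n. of_int (coeff (coeff f j) i) * X ^ i * Y ^ j) = 0"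
      using assms[of j] by (intro sum.neutral) fastforce
  qed (auto simp: coeff_eq_0)
  finally show ?thesis .
qed

lemma coeff2_bound: "\<exists>N. \<forall>j i. coeff (coeff f j) i \<noteq> 0 \<longrightarrow> j \<le> N \<and> i \<le> N"
proof -
  define N where "N = degree f + (\<Sum>j\<le>degree f. degree (coeff f j))"
  have "j \<le> N \<and> i \<le> N" if nz: "coeff (coeff f j) i \<noteq> 0" for i j
  proof -
    have j: "j \<le> degree f" using nz by (metis coeff_0 le_degree)
    have "i \<le> degree (coeff f j)" using nz by (rule le_degree)
    also have "\<dots> \<le> (\<Sum>j\<le>degree f. degree (coeff f j))" using j by (intro member_le_sum) auto
    finally show ?thesis using j by (simp add: N_def)
  qed
  then show ?thesis by blast
qed

lemma subst2_add: "subst2 X Y (f + g) = subst2 X Y f + subst2 X Y g"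
proof -
  obtain M N where M: "\<forall>j i. coeff (coeff f j) i \<noteq> 0 \<longrightarrow> j \<le> M \<and> i \<le> M"
    and N: "\<forall>j i. coeff (coeff g j) i \<noteq> 0 \<longrightarrow> j \<le> N \<and> i \<le> N"
    using coeff2_bound[of f] coeff2_bound[of g] by blast
  define K where "K = max M N"
  have f: "j \<le> K \<and> i \<le> K" if "coeff (coeff f j) i \<noteq> 0" for i j
    using M that by (auto simp: K_def le_max_iff_disj)
  have g: "j \<le> K \<and> i \<le> K" if "coeff (coeff g j) i \<noteq> 0" for i j
    using N that by (auto simp: K_def le_max_iff_disj)
  have fg: "j \<le> K \<and> i \<le> K" if "coeff (coeff (f + g) j) i \<noteq> 0" for i j
    using f[of j i] g[of j i] that by fastforce
  let ?S = "\<lambda>h. \<Sum>j\<le>K. \<Sum>i\<le>K. of_int (coeff (coeff h j) i) * X ^ i * Y ^ j"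
  have "subst2 X Y f = ?S f" by (rule subst2_bounded) (rule f)
  moreover have "subst2 X Y g = ?S g" by (rule subst2_bounded) (rule g)
  moreover have "subst2 X Y (f + g) = ?S (f + g)" by (rule subst2_bounded) (rule fg)
  ultimately show ?thesis by (simp add: sum.distrib distrib_right)
qed

lemma subst2_0: "subst2 X Y 0 = 0"
  by (simp add: subst2_def)

lemma subst2_monom: "subst2 X Y (monom (monom c i) j) = of_int c * X ^ i * Y ^ j"
proof -
  have "subst2 X Y (monom (monom c i) j) =
      (\<Sum>j'\<le>j. \<Sum>i'\<le>i. of_int (coeff (coeff (monom (monom c i) j) j') i') * X ^ i' * Y ^ j')"
    by (rule subst2_bounded) (auto split: if_splits)
  also have "\<dots> = (\<Sum>j'\<le>j. if j' = j then \<Sum>i'\<le>i. if i' = i then of_int c * X ^ i * Y ^ j else 0 else 0)"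
    by (intro sum.cong refl) (auto simp del: sum.delta sum.delta' intro!: sum.cong sum.neutral)
  finally show ?thesis by simp
qed

lemma poly2_induct [case_names zero monom add]:
  fixes f :: "'a::comm_ring_1 poly poly"
  assumes "P 0" "\<And>c i j. P (monom (monom c i) j)" "\<And>f g. P f \<Longrightarrow> P g \<Longrightarrow> P (f + g)"
  shows "P f"
proof -
  have sums: "P (sum h A)" if "finite A" "\<And>a. a \<in> A \<Longrightarrow> P (h a)" for h :: "nat \<Rightarrow> 'a poly poly" and A
    using that by (induction A rule: finite_induct) (auto intro: assms)
  have "P (monom q j)" for q j
  proof -
    have "monom q j = (\<Sum>i\<le>degree q. monom (monom (coeff q i) i) j)"
      by (subst poly_as_sum_of_monoms[of q, symmetric]) (rule poly_eqI, simp add: coeff_sum)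
    then show ?thesis using sums assms(2) by simp
  qed
  then have "P (\<Sum>j\<le>degree f. monom (coeff f j) j)" using sums by simp
  then show ?thesis by (simp add: poly_as_sum_of_monoms)
qed

lemma subst2_mult: "subst2 X Y (f * g) = subst2 X Y f * subst2 X Y g"
proof (induction f rule: poly2_induct)
  case (monom c i j)
  show ?case
    by (induction g rule: poly2_induct)
       (simp_all add: subst2_0 subst2_add subst2_monom mult_monom power_add algebra_simps)
qed (simp_all add: subst2_0 subst2_add algebra_simps)

lemma subst2_of_int: "subst2 X Y (of_int c) = of_int c"
  using subst2_monom[of X Y c 0 0] by (simp add: monom_0 of_int_poly)

lemma subst2_power: "subst2 X Y (f ^ n) = subst2 X Y f ^ n"
  using subst2_of_int[of X Y 1] by (induction n) (simp_all add: subst2_mult)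

lemma subst2_vars: "subst2 X Y var_x = X" "subst2 X Y var_y = Y"
  using subst2_monom[of X Y 1 1 0] subst2_monom[of X Y 1 0 1]
  by (simp_all add: var_x_def var_y_def monom_altdef flip: one_pCons)

lemma subst2_comp: "subst2 X Y (subst2 X' Y' f) = subst2 (subst2 X Y X') (subst2 X Y Y') f"
  by (induction f rule: poly2_induct)
     (simp_all add: subst2_0 subst2_add subst2_monom subst2_mult subst2_power subst2_of_int)

lemma sl2_act_mult: "sl2_act (A ** B) f = sl2_act A (sl2_act B f)"
  by (simp add: sl2_act_def subst2_comp subst2_add subst2_mult subst2_of_int subst2_vars
      matrix_matrix_mult_def sum_2 algebra_simps)

lemma sl2_act_generators:
  "sl2_act (braid_matrix S1) var_x = var_x - var_y" "sl2_act (braid_matrix S1) var_y = var_y"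
  "sl2_act (braid_matrix S2) var_x = var_x" "sl2_act (braid_matrix S2) var_y = var_x + var_y"
  by (simp_all add: sl2_act_def subst2_vars)

lemma sl2_act_ring_hom:
  "sl2_act A (f + g) = sl2_act A f + sl2_act A g"
  "sl2_act A (f * g) = sl2_act A f * sl2_act A g"
  "sl2_act A 1 = 1"
  using subst2_of_int[of _ _ 1] by (simp_all add: sl2_act_def subst2_add subst2_mult)

end

theory Submission
  imports Defs "HOL-Library.Function_Algebras"
begin

text \<open>
  Since \<open>M\<close> has no invariants in positive degree, a class of order \<open>p\<^sup>k\<close> in \<open>H\<^sup>1\<close> is represented by
  \<open>g \<mapsto> (g h - h) / p\<^sup>k\<close> for a form \<open>h\<close> that is invariant modulo \<open>p\<^sup>k\<close>, uniquely up to multiples of \<open>p\<^sup>k\<close>. Modulo \<open>p\<close>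
  the invariants are the polynomials in the Dickson invariants \<open>P\<close> and \<open>Q\<close>. Comparing coefficients under
  \<open>y \<mapsto> y + p x\<close> shows that an invariant modulo \<open>p\<^sup>k\<^sup>+\<^sup>1\<close> is a \<open>p\<^sup>k\<close>-th power modulo \<open>p\<close>, so the invariants modulo
  \<open>p\<^sup>k\<close> are spanned by the \<open>p\<^sup>e P\<^sup>i Q\<^sup>j\<close> with \<open>e = max 0 (k - m - 1)\<close>, where \<open>m\<close> is the valuation of \<open>gcd i j\<close>. Hence
  \<open>P\<^sup>i Q\<^sup>j\<close> contributes a cyclic group of order \<open>p\<^sup>m\<^sup>+\<^sup>1\<close>, as it does to the divided polynomial algebra.

  For the ranks let \<open>u = \<sigma>\<^sub>1 \<sigma>\<^sub>2 \<sigma>\<^sub>1\<close> and \<open>v = \<sigma>\<^sub>1 \<sigma>\<^sub>2\<close>, so that \<open>c = u\<^sup>2 = v\<^sup>3\<close> is central and acts on forms of degree \<open>d\<close> by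
  \<open>(-1)\<^sup>d\<close>. If \<open>d\<close> is odd, \<open>2\<close> annihilates \<open>H\<^sup>1\<close>. If \<open>d > 0\<close> is even, \<open>H\<^sup>1\<close> is rationally \<open>M / (M\<^sup>u + M\<^sup>v)\<close>, and the ranks
  of \<open>M\<^sup>u\<close> and \<open>M\<^sup>v\<close> are found by evaluating forms at \<open>(\<zeta>, 1)\<close> for a primitive fourth or sixth root of unity \<open>\<zeta>\<close>.
\<close>

section \<open>Evaluation of integral polynomials in two variables\<close>

text \<open>Torsion and free part of H^1 are read off from explicit cocycles. A torsion class is a
  function of the acting matrix, so B_3 and SL_2(Z) share one argument, valid for every group
  mapping onto SL_2(Z). The obstacle is the upper bound on the invariants modulo p^(k+1), since not
  every invariant modulo p lifts. The substitution y -> y + p x is trivial modulo p, but modulo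
  p^(k+1) it gives p^k | j a_j for the coefficient a_j of x^(d-j) y^j, and exchanging the variables
  gives p^k | (d - j) a_j; this leaves only p^k-th powers modulo p. Conversely, a congruence modulo
  p turns into one modulo p^(k+1) between p^k-th powers, so these do lift. The torsion of H^1 and
  the component of the divided polynomial algebra are compared through a common model: integer
  families indexed by (i, j), modulo those whose entries at the monomials of the given degree are
  divisible by p^(m+1).\<close>

definition eval2 :: "int poly poly \<Rightarrow> 'r::comm_ring_1 \<Rightarrow> 'r \<Rightarrow> 'r" where
  "eval2 f X Y =
    (\<Sum>j\<le>degree f. \<Sum>i\<le>degree (coeff f j). of_int (coeff (coeff f j) i) * X ^ i * Y ^ j)"

lemma eval2_bounded:
  assumes "\<And>j i. coeff (coeff f j) i \<noteq> 0 \<Longrightarrow> j \<le> m \<and> i \<le> n"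
  shows "eval2 f X Y = (\<Sum>j\<le>m. \<Sum>i\<le>n. of_int (coeff (coeff f j) i) * X ^ i * Y ^ j)"
proof -
  have inner: "(\<Sum>i\<le>degree (coeff f j). of_int (coeff (coeff f j) i) * X ^ i * Y ^ j) =
      (\<Sum>i\<le>n. of_int (coeff (coeff f j) i) * X ^ i * Y ^ j)" for j
  proof (rule sum.mono_neutral_cong)
    fix i assume "i \<in> {..degree (coeff f j)} - {..n}"
    then show "of_int (coeff (coeff f j) i) * X ^ i * Y ^ j = 0" using assms[of j i] by fastforce
  qed (auto simp: coeff_eq_0)
  have "eval2 f X Y = (\<Sum>j\<le>degree f. \<Sum>i\<le>n. of_int (coeff (coeff f j) i) * X ^ i * Y ^ j)"
    by (simp add: eval2_def inner)
  also have "\<dots> = (\<Sum>j\<le>m. \<Sum>i\<le>n. of_int (coeff (coeff f j) i) * X ^ i * Y ^ j)"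
  proof (rule sum.mono_neutral_cong)
    fix j assume "j \<in> {..degree f} - {..m}"
    then show "(\<Sum>i\<le>n. of_int (coeff (coeff f j) i) * X ^ i * Y ^ j) = 0"
      using assms[of j] by (intro sum.neutral) fastforce
  qed (auto simp: coeff_eq_0)
  finally show ?thesis .
qed

lemma eval2_add: "eval2 (f + g) X Y = eval2 f X Y + eval2 g X Y"
proof -
  obtain M N where M: "\<forall>j i. coeff (coeff f j) i \<noteq> 0 \<longrightarrow> j \<le> M \<and> i \<le> M"
    and N: "\<forall>j i. coeff (coeff g j) i \<noteq> 0 \<longrightarrow> j \<le> N \<and> i \<le> N"
    using coeff2_bound[of f] coeff2_bound[of g] by blast
  define K where "K = max M N"
  have f: "j \<le> K \<and> i \<le> K" if "coeff (coeff f j) i \<noteq> 0" for i j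
    using M that by (auto simp: K_def le_max_iff_disj)
  have g: "j \<le> K \<and> i \<le> K" if "coeff (coeff g j) i \<noteq> 0" for i j
    using N that by (auto simp: K_def le_max_iff_disj)
  have fg: "j \<le> K \<and> i \<le> K" if "coeff (coeff (f + g) j) i \<noteq> 0" for i j
    using f[of j i] g[of j i] that by fastforce
  let ?S = "\<lambda>h. \<Sum>j\<le>K. \<Sum>i\<le>K. of_int (coeff (coeff h j) i) * X ^ i * Y ^ j"
  have "eval2 f X Y = ?S f" by (rule eval2_bounded) (rule f)
  moreover have "eval2 g X Y = ?S g" by (rule eval2_bounded) (rule g)
  moreover have "eval2 (f + g) X Y = ?S (f + g)" by (rule eval2_bounded) (rule fg)
  ultimately show ?thesis by (simp add: sum.distrib distrib_right)
qed

lemma eval2_0 [simp]: "eval2 0 X Y = 0"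
  by (simp add: eval2_def)

lemma eval2_minus: "eval2 (- f) X Y = - eval2 f X Y"
  using eval2_add[of f "- f" X Y] by (simp add: eq_neg_iff_add_eq_0 add.commute)

lemma eval2_diff: "eval2 (f - g) X Y = eval2 f X Y - eval2 g X Y"
  using eval2_add[of f "- g" X Y] by (simp add: eval2_minus)

lemma eval2_sum: "eval2 (\<Sum>k\<in>K. f k) X Y = (\<Sum>k\<in>K. eval2 (f k) X Y)"
  by (induction K rule: infinite_finite_induct) (simp_all add: eval2_add)

lemma eval2_monom: "eval2 (monom (monom c i) j) X Y = of_int c * X ^ i * Y ^ j"
proof -
  have "eval2 (monom (monom c i) j) X Y =
      (\<Sum>j'\<le>j. \<Sum>i'\<le>i. of_int (coeff (coeff (monom (monom c i) j) j') i') * X ^ i' * Y ^ j')"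
    by (rule eval2_bounded) (auto split: if_splits)
  also have "\<dots> = (\<Sum>j'\<le>j. if j' = j then \<Sum>i'\<le>i. if i' = i then of_int c * X ^ i * Y ^ j else 0 else 0)"
    by (intro sum.cong refl) (auto simp del: sum.delta sum.delta' intro!: sum.cong sum.neutral)
  finally show ?thesis by simp
qed

lemma eval2_mult: "eval2 (f * g) X Y = eval2 f X Y * eval2 g X Y"
proof (induction f rule: poly2_induct)
  case (monom c i j)
  show ?case
    by (induction g rule: poly2_induct)
       (simp_all add: eval2_add eval2_monom mult_monom power_add algebra_simps)
qed (simp_all add: eval2_add algebra_simps)

lemma eval2_of_int [simp]: "eval2 (of_int c) X Y = of_int c"
  using eval2_monom[of c 0 0 X Y] by (simp add: monom_0 of_int_poly)

lemma eval2_of_nat [simp]: "eval2 (of_nat c) X Y = of_nat c"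
  using eval2_of_int[of "int c" X Y] by simp

lemma eval2_1 [simp]: "eval2 1 X Y = 1"
  using eval2_of_int[of 1 X Y] by simp

lemma eval2_power: "eval2 (f ^ n) X Y = eval2 f X Y ^ n"
  by (induction n) (simp_all add: eval2_mult)

lemma eval2_vars [simp]: "eval2 var_x X Y = X" "eval2 var_y X Y = Y"
  using eval2_monom[of 1 1 0 X Y] eval2_monom[of 1 0 1 X Y]
  by (simp_all add: var_x_def var_y_def monom_altdef flip: one_pCons)

lemmas eval2_hom = eval2_add eval2_diff eval2_minus eval2_sum eval2_mult eval2_power

text \<open>\<open>eval2\<close> generalises \<open>subst2\<close> to an arbitrary commutative
  target ring. The targets are \<open>int poly\<close> (dehomogenisation), \<open>int\<close> and
  \<open>complex\<close>, and \<open>eval2_sl2_act\<close> turns the action into a substitution of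
  the arguments.\<close>

lemma subst2_eq_eval2: "subst2 X Y f = eval2 f X Y"
  by (simp add: subst2_def eval2_def)

lemma eval2_eval2: "eval2 (eval2 f X Y) P Q = eval2 f (eval2 X P Q) (eval2 Y P Q)"
  by (induction f rule: poly2_induct) (simp_all add: eval2_hom eval2_monom)

lemma sl2_act_eq:
  "sl2_act A f = eval2 f (of_int (A$1$1) * var_x + of_int (A$2$1) * var_y)
    (of_int (A$1$2) * var_x + of_int (A$2$2) * var_y)"
  by (simp add: sl2_act_def subst2_eq_eval2)

lemma eval2_sl2_act:
  "eval2 (sl2_act A f) X Y = eval2 f (of_int (A$1$1) * X + of_int (A$2$1) * Y)
    (of_int (A$1$2) * X + of_int (A$2$2) * Y)"
  by (simp add: sl2_act_eq eval2_eval2 eval2_hom)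

lemma var_powers: "var_x ^ i = monom (monom 1 i) 0" "var_y ^ j = monom 1 j"
proof -
  show "var_x ^ i = monom (monom 1 i) 0" by (induction i) (simp_all add: var_x_def monom_0 monom_Suc flip: one_pCons)
  show "var_y ^ j = monom 1 j" by (simp add: var_y_def monom_altdef)
qed

lemma eval2_var_self: "eval2 f var_x var_y = f"
  by (induction f rule: poly2_induct)
     (simp_all add: eval2_hom eval2_monom var_powers of_int_poly mult_monom smult_monom flip: monom_0)

lemma sl2_act_hom:
  "sl2_act A 0 = 0" "sl2_act A 1 = 1" "sl2_act A (of_int c) = of_int c" "sl2_act A (of_nat k) = of_nat k"
  "sl2_act A (f + g) = sl2_act A f + sl2_act A g"
  "sl2_act A (f - g) = sl2_act A f - sl2_act A g"
  "sl2_act A (- f) = - sl2_act A f"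
  "sl2_act A (f * g) = sl2_act A f * sl2_act A g"
  "sl2_act A (f ^ n) = sl2_act A f ^ n"
  "sl2_act A (\<Sum>k\<in>K. F k) = (\<Sum>k\<in>K. sl2_act A (F k))"
  by (simp_all add: sl2_act_eq eval2_hom)

lemma sl2_act_one [simp]: "sl2_act (mat 1) f = f"
  by (simp add: sl2_act_eq mat_def eval2_var_self)


section \<open>Homogeneous polynomials\<close>

definition hcoeff :: "nat \<Rightarrow> int poly poly \<Rightarrow> nat \<Rightarrow> int" where
  "hcoeff d f j = coeff (coeff f j) (d - j)"

definition hpoly :: "nat \<Rightarrow> (nat \<Rightarrow> int) \<Rightarrow> int poly poly" where
  "hpoly d a = (\<Sum>j\<le>d. monom (monom (a j) (d - j)) j)"

lemma coeff_hpoly: "coeff (coeff (hpoly d a) j) i = (if i + j = d then a j else 0)"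
proof -
  have "coeff (coeff (hpoly d a) j) i = (\<Sum>j'\<le>d. if j' = j then (if d - j = i then a j else 0) else 0)"
    by (auto simp: hpoly_def coeff_sum intro!: sum.cong)
  then show ?thesis by auto
qed

lemma hpoly_in_Mdeg: "hpoly d a \<in> Mdeg (2 * d)"
  by (auto simp: Mdeg_def coeff_hpoly)

lemma hcoeff_hpoly: "j \<le> d \<Longrightarrow> hcoeff d (hpoly d a) j = a j"
  by (simp add: hcoeff_def coeff_hpoly)

lemma hpoly_hcoeff:
  assumes "f \<in> Mdeg (2 * d)" shows "hpoly d (hcoeff d f) = f"
proof (intro poly_eqI)
  fix i j
  show "coeff (coeff (hpoly d (hcoeff d f)) j) i = coeff (coeff f j) i"
    using assms by (auto simp: coeff_hpoly hcoeff_def Mdeg_def) (smt (verit) mult_cancel1 zero_neq_numeral distrib_left)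
qed

lemma eval2_homog:
  assumes "f \<in> Mdeg (2 * d)"
  shows "eval2 f X Y = (\<Sum>j\<le>d. of_int (hcoeff d f j) * X ^ (d - j) * Y ^ j)"
proof -
  have "eval2 f X Y = eval2 (hpoly d (hcoeff d f)) X Y" by (simp add: hpoly_hcoeff[OF assms])
  also have "\<dots> = (\<Sum>j\<le>d. of_int (hcoeff d f j) * X ^ (d - j) * Y ^ j)"
    unfolding hpoly_def by (simp add: eval2_sum eval2_monom)
  finally show ?thesis .
qed

lemma Mdeg_odd: "odd n \<Longrightarrow> Mdeg n = {0}"
  by (auto simp: Mdeg_def intro!: poly_eqI) (metis distrib_left dvd_triv_left)

lemma Mdeg_0 [simp]: "0 \<in> Mdeg n"
  by (simp add: Mdeg_def)

lemma Mdeg_add: "f \<in> Mdeg n \<Longrightarrow> g \<in> Mdeg n \<Longrightarrow> f + g \<in> Mdeg n"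
  unfolding Mdeg_def by (clarsimp, metis add.left_neutral)

lemma Mdeg_minus: "f \<in> Mdeg n \<Longrightarrow> - f \<in> Mdeg n"
  by (simp add: Mdeg_def)

lemma Mdeg_diff: "f \<in> Mdeg n \<Longrightarrow> g \<in> Mdeg n \<Longrightarrow> f - g \<in> Mdeg n"
  using Mdeg_add[of f n "- g"] Mdeg_minus[of g n] by simp

lemma Mdeg_sum: "(\<And>k. k \<in> K \<Longrightarrow> f k \<in> Mdeg n) \<Longrightarrow> (\<Sum>k\<in>K. f k) \<in> Mdeg n"
  by (induction K rule: infinite_finite_induct) (auto intro: Mdeg_add)

lemma Mdeg_mult:
  assumes "f \<in> Mdeg m" "g \<in> Mdeg n" shows "f * g \<in> Mdeg (m + n)"
proof (cases "f = 0 \<or> g = 0")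
  case False
  then have "even m" "even n" using Mdeg_odd assms by auto
  then obtain d e where de: "m = 2 * d" "n = 2 * e" by (meson dvdE)
  have "monom (monom a (d - i)) i * monom (monom b (e - j)) j \<in> Mdeg (m + n)"
    if "i \<le> d" "j \<le> e" for a b :: int and i j
    using that by (auto simp: mult_monom Mdeg_def de split: if_splits)
  then have "hpoly d (hcoeff d f) * hpoly e (hcoeff e g) \<in> Mdeg (m + n)"
    unfolding hpoly_def sum_product by (intro Mdeg_sum) auto
  then show ?thesis using assms by (simp add: hpoly_hcoeff de)
qed auto

lemma Mdeg_of_int: "of_int c \<in> Mdeg 0"
  by (auto simp: Mdeg_def of_int_poly coeff_pCons split: nat.splits)

lemma Mdeg_of_int_mult: "f \<in> Mdeg n \<Longrightarrow> of_int c * f \<in> Mdeg n"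
  using Mdeg_mult[OF Mdeg_of_int, of f n c] by simp

lemma Mdeg_of_nat_mult: "f \<in> Mdeg n \<Longrightarrow> of_nat c * f \<in> Mdeg n"
  using Mdeg_of_int_mult[of f n "int c"] by simp

lemma Mdeg_power: "f \<in> Mdeg n \<Longrightarrow> f ^ k \<in> Mdeg (k * n)"
proof (induction k)
  case 0
  show ?case using Mdeg_of_int[of 1] by simp
next
  case (Suc k)
  then show ?case using Mdeg_mult[of f n "f ^ k" "k * n"] by simp
qed

lemma Mdeg_vars: "var_x \<in> Mdeg 2" "var_y \<in> Mdeg 2"
  by (auto simp: Mdeg_def var_x_def var_y_def coeff_pCons split: nat.splits)

lemma Mdeg_eval2:
  assumes "f \<in> Mdeg (2 * d)" "X \<in> Mdeg n" "Y \<in> Mdeg n"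
  shows "eval2 f X Y \<in> Mdeg (d * n)"
proof -
  have "of_int a * X ^ (d - j) * Y ^ j \<in> Mdeg (d * n)" if "j \<le> d" for a j
  proof -
    have "(d - j) * n + j * n = d * n" using that by (metis add_mult_distrib le_add_diff_inverse2)
    then show ?thesis
      using Mdeg_of_int_mult[OF Mdeg_mult[OF Mdeg_power[OF assms(2), of "d - j"] Mdeg_power[OF assms(3), of j]], of a]
      by (simp add: mult.assoc)
  qed
  then show ?thesis by (auto simp: eval2_homog[OF assms(1)] intro: Mdeg_sum)
qed

lemma sl2_act_Mdeg: assumes "f \<in> Mdeg n" shows "sl2_act A f \<in> Mdeg n"
proof (cases "even n")
  case True
  then obtain d where "n = 2 * d" by (elim evenE)
  then show ?thesis
    using assms Mdeg_eval2[of f d _ 2, unfolded mult.commute[of d 2]]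
    by (simp add: sl2_act_eq Mdeg_add Mdeg_of_int_mult Mdeg_vars)
next
  case False
  then show ?thesis using assms by (simp add: Mdeg_odd sl2_act_hom)
qed

lemma hcoeff_add: "hcoeff d (f + g) j = hcoeff d f j + hcoeff d g j"
  and hcoeff_diff: "hcoeff d (f - g) j = hcoeff d f j - hcoeff d g j"
  and hcoeff_0 [simp]: "hcoeff d 0 j = 0"
  and hcoeff_of_int_mult: "hcoeff d (of_int c * f) j = c * hcoeff d f j"
  by (simp_all add: hcoeff_def of_int_poly)

lemma Mdeg_eqI:
  assumes "f \<in> Mdeg (2 * d)" "g \<in> Mdeg (2 * d)" "\<And>j. j \<le> d \<Longrightarrow> hcoeff d f j = hcoeff d g j"
  shows "f = g"
proof -
  have "hpoly d (hcoeff d f) = hpoly d (hcoeff d g)" using assms(3) by (simp add: hpoly_def)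
  then show ?thesis using assms(1,2) by (simp add: hpoly_hcoeff)
qed

lemma of_int_dvd_homog_iff:
  assumes "f \<in> Mdeg (2 * d)"
  shows "of_int N dvd f \<longleftrightarrow> (\<forall>j\<le>d. N dvd hcoeff d f j)"
proof
  assume *: "\<forall>j\<le>d. N dvd hcoeff d f j"
  have "f = of_int N * hpoly d (\<lambda>j. hcoeff d f j div N)"
    by (rule Mdeg_eqI[OF assms Mdeg_of_int_mult[OF hpoly_in_Mdeg]])
       (use * in \<open>simp add: hcoeff_of_int_mult hcoeff_hpoly\<close>)
  then show "of_int N dvd f" by (metis dvd_triv_left)
qed (auto simp: hcoeff_of_int_mult elim!: dvdE)

lemma of_int_mult_in_MdegD:
  assumes "of_int c * f \<in> Mdeg n" "c \<noteq> 0" shows "f \<in> Mdeg n"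
  using assms by (auto simp: Mdeg_def of_int_poly)

text \<open>Setting one variable to 1 loses nothing on forms of known degree, so congruences of
  forms become congruences of polynomials in one variable. Setting y = 1 reverses the order of the
  coefficients, hence the index \<open>d - j\<close>.\<close>

lemma coeff_dehomog:
  assumes "f \<in> Mdeg (2 * d)"
  shows "coeff (eval2 f 1 [:0, 1::int:]) j = (if j \<le> d then hcoeff d f j else 0)"
    "coeff (eval2 f [:0, 1::int:] 1) j = (if j \<le> d then hcoeff d f (d - j) else 0)"
proof -
  have X: "[:0, 1::int:] ^ k = monom 1 k" for k by (simp add: monom_altdef)
  have "coeff (eval2 f 1 [:0, 1::int:]) j = (\<Sum>i\<le>d. if i = j then hcoeff d f j else 0)"
    unfolding eval2_homog[OF assms] coeff_sum X by (intro sum.cong) (auto simp: of_int_poly)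
  then show "coeff (eval2 f 1 [:0, 1::int:]) j = (if j \<le> d then hcoeff d f j else 0)" by simp
  have "coeff (eval2 f [:0, 1::int:] 1) j = (\<Sum>i\<le>d. if j \<le> d \<and> i = d - j then hcoeff d f (d - j) else 0)"
    unfolding eval2_homog[OF assms] coeff_sum X by (intro sum.cong) (auto simp: of_int_poly)
  then show "coeff (eval2 f [:0, 1::int:] 1) j = (if j \<le> d then hcoeff d f (d - j) else 0)"
    by (auto simp: sum.delta)
qed

section \<open>Congruences\<close>

lemma of_nat_dvd_of_natI: "m dvd n \<Longrightarrow> (of_nat m :: 'a::comm_semiring_1) dvd of_nat n"
  by (auto elim!: dvdE)

lemma power_power_Suc: "(a :: 'a::monoid_mult) ^ (p ^ Suc k) = (a ^ (p ^ k)) ^ p"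
  by (simp only: power_Suc2 power_mult)

text \<open>Congruence is stated inside any commutative ring and not in a quotient, because forms,
  polynomials in one variable and integers are all compared modulo the same number.\<close>

definition modeq :: "nat \<Rightarrow> 'a::comm_ring_1 \<Rightarrow> 'a \<Rightarrow> bool" where
  "modeq N a b \<longleftrightarrow> of_nat N dvd a - b"

lemma modeq_refl [simp]: "modeq N a a"
  by (simp add: modeq_def)

lemma modeq_sym: "modeq N a b \<Longrightarrow> modeq N b a"
  unfolding modeq_def by (metis dvd_minus_iff minus_diff_eq)

lemma modeq_trans [trans]: "modeq N a b \<Longrightarrow> modeq N b c \<Longrightarrow> modeq N a c"
  unfolding modeq_def using dvd_add by fastforce

lemma modeq_add: "modeq N a b \<Longrightarrow> modeq N c d \<Longrightarrow> modeq N (a + c) (b + d)"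
  unfolding modeq_def using dvd_add[of "of_nat N" "a - b" "c - d"] by (simp add: algebra_simps)

lemma modeq_diff: "modeq N a b \<Longrightarrow> modeq N c d \<Longrightarrow> modeq N (a - c) (b - d)"
  unfolding modeq_def using dvd_diff[of "of_nat N" "a - b" "c - d"] by (simp add: algebra_simps)

lemma modeq_mult: "modeq N a b \<Longrightarrow> modeq N c d \<Longrightarrow> modeq N (a * c) (b * d)"
proof -
  assume "modeq N a b" "modeq N c d"
  then have "of_nat N dvd (a - b) * c + b * (c - d)" by (auto simp: modeq_def)
  then show ?thesis by (simp add: modeq_def algebra_simps)
qed

lemma modeq_power: "modeq N a b \<Longrightarrow> modeq N (a ^ n) (b ^ n)"
  by (induction n) (simp_all add: modeq_mult)

lemma modeq_sum: "(\<And>k. k \<in> K \<Longrightarrow> modeq N (f k) (g k)) \<Longrightarrow> modeq N (\<Sum>k\<in>K. f k) (\<Sum>k\<in>K. g k)"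
  by (induction K rule: infinite_finite_induct) (simp_all add: modeq_add)

lemma modeq_0_iff: "modeq N a 0 \<longleftrightarrow> of_nat N dvd a"
  by (simp add: modeq_def)

lemma modeq_dvd_mono: "modeq N a b \<Longrightarrow> M dvd N \<Longrightarrow> modeq M a b"
  unfolding modeq_def by (meson dvd_trans of_nat_dvd_of_natI)

lemma modeq_of_int: "int N dvd a - b \<Longrightarrow> modeq N (of_int a) (of_int b)"
  by (auto simp: modeq_def simp flip: of_int_diff elim!: dvdE)

lemma modeq_mult_left: "modeq N a b \<Longrightarrow> modeq (M * N) (of_nat M * a) (of_nat M * b)"
  unfolding modeq_def by (metis mult_dvd_mono dvd_refl of_nat_mult right_diff_distrib)

text \<open>a^p - b^p is (a - b) times the sum of the a^i b^(p-1-i). Modulo p that sum is p b^(p-1),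
  so it contributes one more factor p.\<close>

lemma modeq_prime_power:
  assumes "modeq (p ^ Suc n) a b" shows "modeq (p ^ Suc (Suc n)) (a ^ p) (b ^ p)"
proof (cases p)
  case (Suc m)
  have ab: "modeq p a b" using assms by (rule modeq_dvd_mono) simp
  have "modeq p (\<Sum>i<Suc m. a ^ i * b ^ (m - i)) (\<Sum>i<Suc m. b ^ i * b ^ (m - i))"
    by (intro modeq_sum modeq_mult modeq_power ab modeq_refl)
  also have "(\<Sum>i<Suc m. b ^ i * b ^ (m - i)) = of_nat p * b ^ m"
    by (simp add: Suc flip: power_add)
  also have "modeq p (of_nat p * b ^ m) 0" by (simp add: modeq_def)
  finally have "of_nat p dvd (\<Sum>i<Suc m. a ^ i * b ^ (m - i))" by (simp only: modeq_0_iff)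
  moreover have "of_nat (p ^ Suc n) dvd a - b" using assms by (simp add: modeq_def)
  ultimately have "of_nat (p ^ Suc n) * of_nat p dvd (a - b) * (\<Sum>i<Suc m. a ^ i * b ^ (m - i))"
    by (intro mult_dvd_mono)
  moreover have "a ^ p - b ^ p = (a - b) * (\<Sum>i<Suc m. a ^ i * b ^ (m - i))"
    by (simp only: Suc diff_power_eq_sum)
  moreover have "of_nat (p ^ Suc (Suc n)) = of_nat (p ^ Suc n) * (of_nat p :: 'a)"
    by (metis of_nat_mult power_Suc2)
  ultimately show ?thesis unfolding modeq_def by (simp only:)
qed simp

lemma modeq_prime_power_power:
  assumes "modeq p a b" shows "modeq (p ^ Suc k) (a ^ (p ^ k)) (b ^ (p ^ k))"
proof (induction k)
  case (Suc k)
  then show ?case using modeq_prime_power[OF Suc] by (simp only: power_power_Suc)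
qed (use assms in simp)

lemma modeq_freshman:
  assumes "prime p" shows "modeq p ((a + b) ^ p) (a ^ p + b ^ p)"
proof -
  have p: "p > 0" using assms by (simp add: prime_gt_0_nat)
  have "(a + b) ^ p = (\<Sum>k\<le>p. of_nat (p choose k) * a ^ k * b ^ (p - k))" by (rule binomial_ring)
  also have "modeq p \<dots> (\<Sum>k\<le>p. if k = 0 \<or> k = p then a ^ k * b ^ (p - k) else 0)"
  proof (rule modeq_sum)
    fix k assume k: "k \<in> {..p}"
    show "modeq p (of_nat (p choose k) * a ^ k * b ^ (p - k)) (if k = 0 \<or> k = p then a ^ k * b ^ (p - k) else 0)"
    proof (cases "k = 0 \<or> k = p")
      case False
      then have "p dvd p choose k" using assms k by (intro dvd_choose_prime) auto
      then have "(of_nat p :: 'a) dvd of_nat (p choose k)" by (rule of_nat_dvd_of_natI)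
      then show ?thesis using False by (auto simp: modeq_def mult.assoc)
    qed auto
  qed
  also have "(\<Sum>k\<le>p. if k = 0 \<or> k = p then a ^ k * b ^ (p - k) else 0) = (\<Sum>k\<in>{0, p}. a ^ k * b ^ (p - k))"
    by (rule sum.mono_neutral_cong_right) auto
  also have "\<dots> = a ^ p + b ^ p" using p by simp
  finally show ?thesis .
qed

lemma modeq_freshman_power:
  assumes "prime p" shows "modeq p ((a + b) ^ p ^ k) (a ^ p ^ k + b ^ p ^ k)"
proof (induction k)
  case (Suc k)
  have "(a + b) ^ p ^ Suc k = ((a + b) ^ p ^ k) ^ p" by (rule power_power_Suc)
  also have "modeq p \<dots> ((a ^ p ^ k + b ^ p ^ k) ^ p)" by (rule modeq_power) (rule Suc)
  also have "modeq p \<dots> ((a ^ p ^ k) ^ p + (b ^ p ^ k) ^ p)" by (rule modeq_freshman) fact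
  finally show ?case by (simp only: power_power_Suc)
qed simp

lemma modeq_freshman_sum:
  assumes "prime p" "finite K"
  shows "modeq p ((\<Sum>i\<in>K. f i) ^ p ^ k) (\<Sum>i\<in>K. f i ^ p ^ k)"
  using assms(2)
proof (induction K rule: finite_induct)
  case empty
  then show ?case using assms(1) by (simp add: prime_gt_0_nat power_0_left)
next
  case (insert x F)
  then show ?case
    using modeq_trans[OF modeq_freshman_power[OF assms(1)] modeq_add[OF modeq_refl insert.IH]] by simp
qed

lemma modeq_fermat:
  assumes "prime p" shows "modeq p (of_int c ^ p ^ k :: 'a::comm_ring_1) (of_int c)"
proof -
  have p0: "p > 0" using assms by (simp add: prime_gt_0_nat)
  have nat: "modeq p (of_nat m ^ p ^ k :: 'a) (of_nat m)" for m
  proof (induction m)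
    case 0
    then show ?case using p0 by (simp add: power_0_left)
  next
    case (Suc m)
    then show ?case
      using modeq_trans[OF modeq_freshman_power[OF assms, of 1 "of_nat m :: 'a" k] modeq_add[OF modeq_refl Suc]]
      by simp
  qed
  show ?thesis
  proof (cases "c \<ge> 0")
    case True
    then show ?thesis using nat[of "nat c"] by simp
  next
    case False
    define m where "m = nat (- c)"
    have c: "of_int c = - (of_nat m :: 'a)" using False by (simp add: m_def)
    \<comment> \<open>The additive rule applied to m + (-m) = 0 treats odd p and p = 2
      alike.\<close>
    have "modeq p (0 :: 'a) (of_nat m ^ p ^ k + (- of_nat m) ^ p ^ k)"
      using modeq_freshman_power[OF assms, of "of_nat m :: 'a" "- of_nat m" k] p0 by (simp add: power_0_left)
    from modeq_diff[OF this modeq_sym[OF nat[of m]]] have "modeq p (- of_nat m :: 'a) ((- of_nat m) ^ p ^ k)" by simp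
    then show ?thesis unfolding c by (rule modeq_sym)
  qed
qed

lemma prime_elem_of_nat_poly2: "prime p \<Longrightarrow> prime_elem (of_nat p :: int poly poly)"
  by (simp add: of_nat_poly prime_elem_const_poly_iff)

lemma eval2_modeq: "modeq N f g \<Longrightarrow> modeq N (eval2 f X Y) (eval2 g X Y)"
  unfolding modeq_def by (metis dvd_def eval2_diff eval2_mult eval2_of_nat)

lemma modeq_sl2_act: "modeq N f g \<Longrightarrow> modeq N (sl2_act A f) (sl2_act A g)"
  unfolding sl2_act_eq by (rule eval2_modeq)

lemma modeq_homog_iff:
  assumes "f \<in> Mdeg (2 * d)" "g \<in> Mdeg (2 * d)"
  shows "modeq N f g \<longleftrightarrow> (\<forall>j\<le>d. int N dvd hcoeff d f j - hcoeff d g j)"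
  using of_int_dvd_homog_iff[OF Mdeg_diff[OF assms], of "int N"] by (simp add: modeq_def hcoeff_diff)

lemma int_poly_modeq_iff: "modeq N F G \<longleftrightarrow> (\<forall>j. int N dvd coeff F j - coeff (G :: int poly) j)"
  by (simp add: modeq_def of_nat_poly const_poly_dvd_iff)

lemma modeq_homog_dehomog:
  assumes "f \<in> Mdeg (2 * d)" "g \<in> Mdeg (2 * d)" "modeq N (eval2 f [:0, 1::int:] 1) (eval2 g [:0, 1:] 1)"
  shows "modeq N f g"
  unfolding modeq_homog_iff[OF assms(1,2)]
proof (intro allI impI)
  fix j assume j: "j \<le> d"
  then show "int N dvd hcoeff d f j - hcoeff d g j"
    using spec[OF assms(3)[unfolded int_poly_modeq_iff], of "d - j"]
    by (simp add: coeff_dehomog(2)[OF assms(1)] coeff_dehomog(2)[OF assms(2)])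
qed

text \<open>Lagrange's bound on the number of roots over the field with p elements, splitting off
  one root s at a time by R = (t - s) Q + R(s). At a point incongruent to s the factor t - s is
  prime to p and can be cancelled.\<close>

lemma poly_vanishing_mod_prime:
  fixes R :: "int poly"
  assumes "prime p" "finite S" "degree R < card S"
    and "\<And>s. s \<in> S \<Longrightarrow> int p dvd poly R s"
    and "\<And>s t. s \<in> S \<Longrightarrow> t \<in> S \<Longrightarrow> int p dvd s - t \<Longrightarrow> s = t"
  shows "modeq p R 0"
  using assms(2-5)
proof (induction "card S" arbitrary: S R)
  case (Suc n)
  then obtain s where s: "s \<in> S" by (metis card_eq_0_iff ex_in_conv nat.distinct(1))
  define Q where "Q = synthetic_div R s"
  have R: "R + smult s Q = pCons (poly R s) Q" by (simp add: Q_def synthetic_div_correct)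
  have "poly R t + s * poly Q t = poly R s + t * poly Q t" for t
    using arg_cong[OF R, of "\<lambda>f. poly f t"] by simp
  then have Rt: "poly R t = poly R s + (t - s) * poly Q t" for t
    by (metis add_diff_cancel_right' add_diff_eq left_diff_distrib)
  have degQ: "degree Q = degree R - 1" by (simp add: Q_def degree_synthetic_div)
  show ?case
  proof (cases "degree R = 0")
    case True
    then obtain r where "R = [:r:]" by (elim degree_eq_zeroE)
    then show ?thesis using Suc.prems(3)[OF s] by (simp add: int_poly_modeq_iff coeff_pCons split: nat.splits)
  next
    case False
    have "modeq p Q 0"
    proof (rule Suc.hyps(1)[of "S - {s}"])
      show "n = card (S - {s})" using Suc.hyps(2) s by simp
      show "degree Q < card (S - {s})" using Suc.hyps(2) s degQ False Suc.prems(2) by simp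
      fix t assume t: "t \<in> S - {s}"
      have "int p dvd poly R t - poly R s" using Suc.prems(3) s t by (meson DiffD1 dvd_diff)
      then have "int p dvd (t - s) * poly Q t" by (simp add: Rt[of t])
      moreover have "\<not> int p dvd t - s" using Suc.prems(4) s t by blast
      ultimately show "int p dvd poly Q t" using assms(1) prime_dvd_mult_iff[of "int p"] by simp
    qed (use Suc.prems in auto)
    then have "int p dvd coeff Q j" for j by (simp add: int_poly_modeq_iff)
    moreover have "coeff R j = coeff (pCons (poly R s) Q) j - s * coeff Q j" for j
      by (metis R add_diff_cancel_right' coeff_add coeff_smult)
    ultimately show ?thesis using Suc.prems(3)[OF s]
      by (auto simp: int_poly_modeq_iff coeff_pCons intro!: dvd_diff split: nat.splits)
  qed
qed simp

text \<open>Pseudo-division by a monic polynomial is a genuine division over Z. The bound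
  \<open>D\<close> on the quotient is kept because the quotient is later homogenised in a prescribed
  degree.\<close>

lemma int_monic_division:
  fixes F g :: "int poly"
  assumes "lead_coeff g = 1" "degree F < D" "degree g \<le> D"
  obtains G R where "F = g * G + R" "R = 0 \<or> degree R < degree g" "G = 0 \<or> degree G + degree g < D"
proof -
  obtain G R where GR: "pseudo_divmod F g = (G, R)" by force
  have g: "g \<noteq> 0" using assms(1) by auto
  have F: "F = g * G + R" and R: "R = 0 \<or> degree R < degree g"
    using pseudo_divmod[OF g GR] assms(1) by simp_all
  have "degree G + degree g < D" if "G \<noteq> 0"
  proof -
    have "degree G + degree g = degree (F - R)" using that g F by (simp add: degree_mult_eq)
    also have "\<dots> \<le> max (degree F) (degree R)" by (rule degree_diff_le_max)
    also have "\<dots> < D" using assms R by auto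
    finally show ?thesis .
  qed
  then show ?thesis using that F R by blast
qed

section \<open>Invariants modulo powers of a prime\<close>

definition mat2 :: "int \<Rightarrow> int \<Rightarrow> int \<Rightarrow> int \<Rightarrow> int^2^2" where
  "mat2 a b c d = vector [vector [a, b], vector [c, d]]"

lemma mat2_nth [simp]:
  "mat2 a b c d $ 1 $ 1 = a" "mat2 a b c d $ 1 $ 2 = b" "mat2 a b c d $ 2 $ 1 = c" "mat2 a b c d $ 2 $ 2 = d"
  by (simp_all add: mat2_def)

lemma det_mat2: "det (mat2 a b c d) = a * d - b * c"
  by (simp add: det_2)

text \<open>Such a form represents an element of H^0(SL_2(Z); M/N). It is kept as an integral
  polynomial so that it can be lifted to a higher modulus and divided by p.\<close>

definition sl2_inv :: "nat \<Rightarrow> int poly poly \<Rightarrow> bool" where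
  "sl2_inv N f \<longleftrightarrow> (\<forall>A. det A = 1 \<longrightarrow> modeq N (sl2_act A f) f)"

lemma sl2_invD: "sl2_inv N f \<Longrightarrow> det A = 1 \<Longrightarrow> modeq N (sl2_act A f) f"
  by (simp add: sl2_inv_def)

lemma sl2_inv_diff: "sl2_inv N f \<Longrightarrow> sl2_inv N g \<Longrightarrow> sl2_inv N (f - g)"
  and sl2_inv_mult: "sl2_inv N f \<Longrightarrow> sl2_inv N g \<Longrightarrow> sl2_inv N (f * g)"
  and sl2_inv_power: "sl2_inv N f \<Longrightarrow> sl2_inv N (f ^ n)"
  and sl2_inv_of_int: "sl2_inv N (of_int c)"
  by (simp_all add: sl2_inv_def sl2_act_hom modeq_diff modeq_mult modeq_power)

lemma sl2_inv_sum: "(\<And>k. k \<in> K \<Longrightarrow> sl2_inv N (f k)) \<Longrightarrow> sl2_inv N (\<Sum>k\<in>K. f k)"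
  by (simp add: sl2_inv_def sl2_act_hom modeq_sum)

lemma sl2_inv_modeq: "sl2_inv N f \<Longrightarrow> modeq N f g \<Longrightarrow> sl2_inv N g"
  unfolding sl2_inv_def by (meson modeq_sl2_act modeq_sym modeq_trans)

lemma sl2_inv_mono: "sl2_inv N f \<Longrightarrow> M dvd N \<Longrightarrow> sl2_inv M f"
  unfolding sl2_inv_def by (meson modeq_dvd_mono)

text \<open>p remains prime in Z[x, y], so if p divides P (A f - f) but not P, it divides A f -
  f.\<close>

lemma sl2_inv_cancel:
  assumes "prime p" "sl2_inv p P" "sl2_inv p (P * f)" "\<not> of_nat p dvd P"
  shows "sl2_inv p f"
  unfolding sl2_inv_def
proof (intro allI impI)
  fix A :: "int^2^2" assume A: "det A = 1"
  have "modeq p (P * sl2_act A f) (sl2_act A P * sl2_act A f)"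
    by (intro modeq_mult modeq_sym[OF sl2_invD[OF assms(2) A]] modeq_refl)
  also have "modeq p (sl2_act A P * sl2_act A f) (P * f)"
    using sl2_invD[OF assms(3) A] by (simp add: sl2_act_hom)
  finally have "of_nat p dvd P * (sl2_act A f - f)" by (simp add: modeq_def algebra_simps)
  then show "modeq p (sl2_act A f) f"
    using prime_elem_dvd_multD[OF prime_elem_of_nat_poly2[OF assms(1)]] assms(4) by (auto simp: modeq_def)
qed

text \<open>The p-adic valuation of l is less than l, so at least k + 1 of the k + l factors p fall
  on T.\<close>

lemma prime_power_dvd_multD:
  assumes "prime p" "l \<ge> 1" "int p ^ (k + l) dvd int l * T"
  shows "int p ^ Suc k dvd T"
proof -
  obtain l' where l': "l = p ^ multiplicity p l * l'" "\<not> p dvd l'"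
    using multiplicity_decompose'[of l p] assms(1,2) not_prime_unit by (metis not_one_le_zero)
  define v where "v = multiplicity p l"
  have "p ^ v \<le> l" using assms(2) by (simp add: v_def dvd_imp_le multiplicity_dvd)
  moreover have "l < p ^ l" using assms(1) less_exp[of l] prime_ge_2_nat[of p] power_mono[of 2 p l] by linarith
  ultimately have "p ^ v < p ^ l" by linarith
  then have v: "v < l" using assms(1) prime_gt_1_nat by (simp add: power_less_imp_less_exp)
  have "int p ^ (k + l) = int p ^ v * int p ^ (k + l - v)" using v by (simp flip: power_add)
  moreover have "int l = int p ^ v * int l'" using l'(1) by (metis of_nat_mult of_nat_power v_def)
  ultimately have "int p ^ (k + l - v) dvd int l' * T"
    using assms(1,3) by (simp add: prime_gt_0_nat)
  moreover have "coprime (int p ^ (k + l - v)) (int l')"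
    using l'(2) assms(1) by (simp add: prime_imp_coprime)
  ultimately have "int p ^ (k + l - v) dvd T" by (simp add: coprime_dvd_mult_right_iff)
  moreover have "Suc k \<le> k + l - v" using v by simp
  ultimately show ?thesis using power_le_dvd by blast
qed

text \<open>The substitution is y -> y + p x. The coefficient of y^(j-1) in the difference is p j
  a_j plus multiples of p^(l-j+1) a_l for l > j. By descending induction on j the latter vanish
  modulo p^(k+1), which leaves p j a_j.\<close>

lemma unipotent_invariant_coeffs:
  assumes "prime p" "f \<in> Mdeg (2 * d)" "modeq (p ^ Suc k) (sl2_act (mat2 1 (int p) 0 1) f) f" "j \<le> d"
  shows "int p ^ k dvd int j * hcoeff d f j"
proof -
  define a where "a = hcoeff d f"
  have coef: "int p ^ Suc k dvd (\<Sum>j\<le>d. a j * (int (j choose i) * int p ^ (j - i))) - a i" if "i \<le> d" for i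
  proof -
    have "eval2 (sl2_act (mat2 1 (int p) 0 1) f) 1 [:0, 1::int:] = eval2 f 1 [:int p, 1:]"
      by (simp add: eval2_sl2_act of_nat_poly)
    moreover have lin: "coeff ([:int p, 1:] ^ j) i = int (j choose i) * int p ^ (j - i)" for j
      by (cases "i \<le> j") (simp_all add: coeff_linear_poly_power coeff_eq_0 degree_linear_power binomial_eq_0)
    ultimately have "coeff (eval2 (sl2_act (mat2 1 (int p) 0 1) f) 1 [:0, 1::int:]) i =
        (\<Sum>j\<le>d. a j * (int (j choose i) * int p ^ (j - i)))"
      by (simp add: eval2_homog[OF assms(2)] coeff_sum of_int_poly lin a_def)
    moreover have "modeq (p ^ Suc k) (eval2 (sl2_act (mat2 1 (int p) 0 1) f) 1 [:0, 1::int:]) (eval2 f 1 [:0, 1::int:])"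
      using assms(3) by (rule eval2_modeq)
    moreover have "coeff (eval2 f 1 [:0, 1::int:]) i = a i"
      using that coeff_dehomog(1)[OF assms(2), of i] by (simp add: a_def)
    ultimately show ?thesis unfolding int_poly_modeq_iff by (metis of_nat_power)
  qed
  have "int p ^ k dvd int j * a j" if "j \<le> d" for j
    using that
  proof (induction "d - j" arbitrary: j rule: less_induct)
    case less
    show ?case
    proof (cases j)
      case (Suc i)
      \<comment> \<open>Here i = j - 1. From (l - i) C(l, i) = l C(l - 1, l - i - 1) and p^k | l
        a_l, the term times l - i is divisible by p^(k+l-i); \<open>prime_power_dvd_multD\<close>
        removes the factor l - i.\<close>
      have rest: "int p ^ Suc k dvd a l * (int (l choose i) * int p ^ (l - i))" if l: "l \<in> {i + 2..d}" for l
      proof (rule prime_power_dvd_multD[OF assms(1), of "l - i"])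
        have "int p ^ k dvd int l * a l" using less.hyps[of l] l Suc less.prems by auto
        then have "int p ^ k * int p ^ (l - i) dvd (int l * a l) * (int p ^ (l - i) * int (l - 1 choose (l - i - 1)))"
          by (intro mult_dvd_mono) simp_all
        moreover have "(l - i) * (l choose i) = l * (l - 1 choose (l - i - 1))"
          using l binomial_symmetric[of i l] times_binomial_minus1_eq[of "l - i" l] by (simp add: mult.commute)
        then have "int (l - i) * int (l choose i) = int l * int (l - 1 choose (l - i - 1))"
          by (metis of_nat_mult)
        then have "(int l * a l) * (int p ^ (l - i) * int (l - 1 choose (l - i - 1))) =
            (int (l - i) * int (l choose i)) * (a l * int p ^ (l - i))" by (simp add: mult_ac)
        ultimately show "int p ^ (k + (l - i)) dvd int (l - i) * (a l * (int (l choose i) * int p ^ (l - i)))"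
          by (simp only: power_add mult_ac)
      qed (use l in auto)
      have "(\<Sum>j\<le>d. a j * (int (j choose i) * int p ^ (j - i))) =
          (\<Sum>j\<in>{i..d}. a j * (int (j choose i) * int p ^ (j - i)))"
        by (rule sum.mono_neutral_right) auto
      also have "\<dots> = a i + (int j * a j * int p + (\<Sum>l=i+2..d. a l * (int (l choose i) * int p ^ (l - i))))"
        using Suc less.prems by (simp add: sum.atLeast_Suc_atMost)
      finally have "int p ^ Suc k dvd int j * a j * int p + (\<Sum>l=i+2..d. a l * (int (l choose i) * int p ^ (l - i)))"
        using coef[of i] Suc less.prems by simp
      moreover have "int p ^ Suc k dvd (\<Sum>l=i+2..d. a l * (int (l choose i) * int p ^ (l - i)))"
        using rest by (rule dvd_sum)
      ultimately have "int p ^ Suc k dvd int j * a j * int p" by (simp add: dvd_add_left_iff)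
      then show ?thesis using assms(1) by (simp add: prime_gt_0_nat)
    qed simp
  qed
  then show ?thesis using assms(4) by (simp add: a_def)
qed

text \<open>This matrix acts by x -> -y, y -> x, so it reverses the coefficients up to sign.\<close>

lemma hcoeff_weyl:
  assumes "f \<in> Mdeg (2 * d)" "j \<le> d"
  shows "hcoeff d (sl2_act (mat2 0 1 (-1) 0) f) (d - j) = (-1) ^ (d - j) * hcoeff d f j"
proof -
  have X: "[:0, 1::int:] ^ k = monom 1 k" for k by (simp add: monom_altdef)
  have "(- [:0, 1::int:]) ^ k = [:(-1) ^ k:] * [:0, 1:] ^ k" for k
    by (induction k) (simp_all add: one_pCons)
  then have Y: "(- [:0, 1::int:]) ^ k = [:(-1) ^ k:] * monom 1 k" for k by (simp add: X)
  have "hcoeff d (sl2_act (mat2 0 1 (-1) 0) f) (d - j) =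
      coeff (eval2 (sl2_act (mat2 0 1 (-1) 0) f) 1 [:0, 1:]) (d - j)"
    using coeff_dehomog(1)[OF sl2_act_Mdeg[OF assms(1)]] by simp
  also have "\<dots> = coeff (eval2 f (- [:0, 1:]) 1) (d - j)"
    by (simp add: eval2_sl2_act)
  also have "\<dots> = (\<Sum>i\<le>d. if i = j then (-1) ^ (d - j) * hcoeff d f j else 0)"
    unfolding eval2_homog[OF assms(1)] coeff_sum Y using assms(2)
    by (intro sum.cong) (auto simp: of_int_poly)
  also have "\<dots> = (-1) ^ (d - j) * hcoeff d f j" using assms(2) by simp
  finally show ?thesis .
qed

text \<open>Invariance under x -> -y, y -> x identifies a_j with a_(d-j) up to sign modulo p^(k+1),
  so the second divisibility is the first one for the reflected coefficient.\<close>

lemma invariant_coeffs: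
  assumes "prime p" "f \<in> Mdeg (2 * d)" "sl2_inv (p ^ Suc k) f" "j \<le> d"
  shows "int p ^ k dvd int j * hcoeff d f j" "int p ^ k dvd int (d - j) * hcoeff d f j"
proof -
  have coef: "int p ^ k dvd int j * hcoeff d f j" if "j \<le> d" for j
    using unipotent_invariant_coeffs[OF assms(1,2) sl2_invD[OF assms(3)] that] by (simp add: det_mat2)
  then show "int p ^ k dvd int j * hcoeff d f j" using assms(4) .
  have "modeq (p ^ Suc k) (sl2_act (mat2 0 1 (-1) 0) f) f"
    by (rule sl2_invD[OF assms(3)]) (simp add: det_mat2)
  then have "int (p ^ Suc k) dvd (-1) ^ (d - j) * hcoeff d f j - hcoeff d f (d - j)"
    using hcoeff_weyl[OF assms(2,4)] assms(4)
    unfolding modeq_homog_iff[OF sl2_act_Mdeg[OF assms(2)] assms(2)] by (metis diff_le_self)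
  moreover have "int p ^ k dvd int (p ^ Suc k)" by simp
  ultimately have "int p ^ k dvd (-1) ^ (d - j) * hcoeff d f j - hcoeff d f (d - j)"
    by (rule dvd_trans[rotated])
  then have "int p ^ k dvd int (d - j) * ((-1) ^ (d - j) * hcoeff d f j - hcoeff d f (d - j))"
    by (rule dvd_mult)
  moreover have "int p ^ k dvd int (d - j) * hcoeff d f (d - j)" using coef by simp
  ultimately have "int p ^ k dvd int (d - j) * ((-1) ^ (d - j) * hcoeff d f j)"
    unfolding right_diff_distrib by (simp only: dvd_diff_right_iff dvd_diff_left_iff)
  then show "int p ^ k dvd int (d - j) * hcoeff d f j"
    by (cases "even (d - j)") simp_all
qed

text \<open>An invariant form is invariant modulo every power of 2, so j a_j and (d - j) a_j are
  divisible by all powers of 2 and vanish. For d > 0 one of j and d - j is nonzero.\<close>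

lemma invariant_eq_0:
  assumes "f \<in> Mdeg n" "n > 0" "\<And>A. det A = 1 \<Longrightarrow> sl2_act A f = f"
  shows "f = 0"
proof (cases "even n")
  case True
  then obtain d where n: "n = 2 * d" by (elim evenE)
  have "hcoeff d f j = 0" if j: "j \<le> d" for j
  proof -
    have zero: "z = 0" if "\<And>k. (2::int) ^ k dvd z" for z :: int
    proof (rule ccontr)
      assume "z \<noteq> 0"
      then have "2 ^ nat \<bar>z\<bar> \<le> \<bar>z\<bar>" using that[of "nat \<bar>z\<bar>"] by (simp add: zdvd_imp_le)
      moreover have "int (nat \<bar>z\<bar>) < 2 ^ nat \<bar>z\<bar>" by (metis less_exp of_nat_less_iff of_nat_numeral of_nat_power)
      ultimately show False by simp
    qed
    have "sl2_inv (2 ^ Suc k) f" for k using assms(3) by (simp add: sl2_inv_def)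
    then have "2 ^ k dvd int j * hcoeff d f j" "2 ^ k dvd int (d - j) * hcoeff d f j" for k
      using invariant_coeffs[of 2 f d k j] assms(1) j by (simp_all add: n)
    then have "int j * hcoeff d f j = 0" "int (d - j) * hcoeff d f j = 0" using zero by blast+
    then show ?thesis using j assms(2) n by auto
  qed
  then show ?thesis using Mdeg_eqI[of f d 0] assms(1) by (simp add: n)
qed (use assms Mdeg_odd in auto)

section \<open>The Dickson invariants\<close>

lemma linear_form_power:
  assumes "prime p"
  shows "modeq p ((of_int a * X + of_int c * Y) ^ (p ^ k)) (of_int a * X ^ (p ^ k) + of_int c * (Y :: 'a::comm_ring_1) ^ (p ^ k))"
proof -
  have "modeq p ((of_int a * X + of_int c * Y) ^ (p ^ k)) ((of_int a * X) ^ p ^ k + (of_int c * Y) ^ p ^ k)"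
    by (rule modeq_freshman_power) fact
  also have "modeq p \<dots> (of_int a * X ^ p ^ k + of_int c * Y ^ p ^ k)"
    unfolding power_mult_distrib by (intro modeq_add modeq_mult modeq_fermat assms modeq_refl)
  finally show ?thesis .
qed

text \<open>x^q y - x y^q is the determinant with rows (x^q, y^q) and (x, y). For q a power of p the
  Frobenius map commutes modulo p with integral matrices, so a matrix multiplies this form by its
  determinant.\<close>

definition frob_form :: "nat \<Rightarrow> int poly poly" where
  "frob_form q = var_x ^ q * var_y - var_x * var_y ^ q"

lemma frob_form_invariant:
  assumes "prime p" shows "sl2_inv p (frob_form (p ^ k))"
  unfolding sl2_inv_def
proof (intro allI impI)
  fix A :: "int^2^2" assume A: "det A = 1"
  define a b c d where "a = A $ 1 $ 1" and "b = A $ 1 $ 2" and "c = A $ 2 $ 1" and "d = A $ 2 $ 2"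
  have "a * d - b * c = 1" using A by (simp add: det_2 a_def b_def c_def d_def)
  then have det: "of_int (a * d - b * c) = (1 :: int poly poly)" by simp
  let ?X = "of_int a * var_x + of_int c * var_y" and ?Y = "of_int b * var_x + of_int d * var_y"
  let ?q = "p ^ k"
  have "sl2_act A (frob_form ?q) = ?X ^ ?q * ?Y - ?X * ?Y ^ ?q"
    by (simp add: sl2_act_eq frob_form_def eval2_hom a_def b_def c_def d_def)
  also have "modeq p \<dots> ((of_int a * var_x ^ ?q + of_int c * var_y ^ ?q) * ?Y
      - ?X * (of_int b * var_x ^ ?q + of_int d * var_y ^ ?q))"
    by (intro modeq_diff modeq_mult modeq_refl linear_form_power assms)
  also have "\<dots> = of_int (a * d - b * c) * frob_form ?q"
    by (simp add: frob_form_def algebra_simps)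
  finally show "modeq p (sl2_act A (frob_form ?q)) (frob_form ?q)" by (simp only: det mult_1_left)
qed

definition dickP :: "nat \<Rightarrow> int poly poly" where
  "dickP p = frob_form p"

definition dickQ :: "nat \<Rightarrow> int poly poly" where
  "dickQ p = (\<Sum>h\<le>p. (var_x ^ (p - 1)) ^ h * (var_y ^ (p - 1)) ^ (p - h))"

lemma dickP_factor: "prime p \<Longrightarrow> dickP p = var_x * var_y * (var_x ^ (p - 1) - var_y ^ (p - 1))"
  using prime_gt_0_nat[of p] by (cases p) (simp_all add: dickP_def frob_form_def algebra_simps)

text \<open>By the geometric sum, P Q is again a determinant, for q = p^2. The invariance of Q
  follows by cancelling P.\<close>

lemma dickP_dickQ:
  assumes "prime p" shows "dickP p * dickQ p = frob_form (p ^ 2)"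
proof -
  have "(p - 1) * Suc p + 1 = p ^ 2"
    using prime_gt_0_nat[OF assms] by (cases p) (simp_all add: power2_eq_square)
  then have pow: "z * (z ^ (p - 1)) ^ Suc p = z ^ p\<^sup>2" for z :: "int poly poly"
    by (metis Suc_eq_plus1 power_Suc power_mult)
  have "dickP p * dickQ p = var_x * var_y * ((var_x ^ (p - 1)) ^ Suc p - (var_y ^ (p - 1)) ^ Suc p)"
    unfolding dickP_factor[OF assms] dickQ_def diff_power_eq_sum by (simp add: lessThan_Suc_atMost mult.assoc)
  also have "\<dots> = (var_x * (var_x ^ (p - 1)) ^ Suc p) * var_y - var_x * (var_y * (var_y ^ (p - 1)) ^ Suc p)"
    by (simp only: algebra_simps)
  finally show ?thesis by (simp only: pow frob_form_def)
qed

lemma dickP_invariant: "prime p \<Longrightarrow> sl2_inv p (dickP p)"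
  using frob_form_invariant[of p 1] by (simp add: dickP_def)

lemma dickP_Mdeg: "dickP p \<in> Mdeg (2 * (p + 1))"
  unfolding dickP_def frob_form_def
  using Mdeg_mult[OF Mdeg_power[OF Mdeg_vars(1), of p] Mdeg_vars(2)]
    Mdeg_mult[OF Mdeg_vars(1) Mdeg_power[OF Mdeg_vars(2), of p]]
  by (auto intro!: Mdeg_diff simp: algebra_simps)

lemma dickQ_Mdeg: "dickQ p \<in> Mdeg (2 * p * (p - 1))"
  unfolding dickQ_def
proof (rule Mdeg_sum)
  fix h assume "h \<in> {..p}"
  then have "h * ((p - 1) * 2) + (p - h) * ((p - 1) * 2) = 2 * p * (p - 1)"
    by (metis atMost_iff add_mult_distrib le_add_diff_inverse mult.commute mult.left_commute)
  then show "(var_x ^ (p - 1)) ^ h * (var_y ^ (p - 1)) ^ (p - h) \<in> Mdeg (2 * p * (p - 1))"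
    using Mdeg_mult[OF Mdeg_power[OF Mdeg_power[OF Mdeg_vars(1), of "p - 1"], of h]
        Mdeg_power[OF Mdeg_power[OF Mdeg_vars(2), of "p - 1"], of "p - h"]] by simp
qed

definition dick_mono :: "nat \<Rightarrow> nat \<times> nat \<Rightarrow> int poly poly" where
  "dick_mono p = (\<lambda>(i, j). dickP p ^ i * dickQ p ^ j)"

definition dick_deg :: "nat \<Rightarrow> nat \<times> nat \<Rightarrow> nat" where
  "dick_deg p = (\<lambda>(i, j). i * (2 * (p + 1)) + j * (2 * p * (p - 1)))"

definition dick_idx :: "nat \<Rightarrow> nat \<Rightarrow> (nat \<times> nat) set" where
  "dick_idx p n = {k. dick_deg p k = n}"

lemma finite_dick_idx: assumes "prime p" shows "finite (dick_idx p n)"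
proof (rule finite_subset)
  show "dick_idx p n \<subseteq> {..n} \<times> {..n}"
  proof (rule subsetI)
    fix k assume "k \<in> dick_idx p n"
    moreover obtain i j where k: "k = (i, j)" by force
    ultimately have ij: "i * (2 * (p + 1)) + j * (2 * p * (p - 1)) = n"
      by (simp add: dick_idx_def dick_deg_def)
    have "2 * p * (p - 1) \<ge> 1" using prime_ge_2_nat[OF assms] by (cases p) auto
    then have "j \<le> j * (2 * p * (p - 1))" by (metis mult_le_mono2 nat_mult_1_right)
    moreover have "i \<le> i * (2 * (p + 1))" by simp
    ultimately have "i \<le> n \<and> j \<le> n" using ij by linarith
    then show "k \<in> {..n} \<times> {..n}" using k by simp
  qed
qed simp

lemma dick_mono_Mdeg: "dick_mono p k \<in> Mdeg (dick_deg p k)"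
proof (cases k)
  case (Pair i j)
  show ?thesis unfolding Pair dick_mono_def dick_deg_def prod.case
    by (rule Mdeg_mult[OF Mdeg_power[OF dickP_Mdeg] Mdeg_power[OF dickQ_Mdeg]])
qed

lemma dick_mono_power: "dick_mono p (i, j) ^ m = dick_mono p (m * i, m * j)"
  by (simp add: dick_mono_def power_mult_distrib mult.commute flip: power_mult)

text \<open>As a polynomial in \<open>y\<close>, the monomial \<open>P\<^sup>i Q\<^sup>j\<close> has lowest term \<open>x\<^sup>e y\<^sup>i\<close>.\<close>

lemma dick_mono_lowest:
  assumes "prime p"
  shows "l < i \<Longrightarrow> coeff (dick_mono p (i, j)) l = 0"
    and "coeff (dick_mono p (i, j)) i = monom 1 (p * i + p * (p - 1) * j)"
proof -
  have p: "p \<ge> 2" using assms by (rule prime_ge_2_nat)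
  define R where "R = (var_x ^ p - var_x * var_y ^ (p - 1)) ^ i * dickQ p ^ j"
  have "dickP p = var_y * (var_x ^ p - var_x * var_y ^ (p - 1))"
    using p by (cases p) (simp_all add: dickP_def frob_form_def algebra_simps)
  then have "dick_mono p (i, j) = var_y ^ i * R"
    by (simp add: dick_mono_def R_def power_mult_distrib)
  then have eq: "dick_mono p (i, j) = monom 1 i * R" by (simp add: var_powers)
  then show "l < i \<Longrightarrow> coeff (dick_mono p (i, j)) l = 0" by (simp add: coeff_monom_mult)
  have Y: "poly var_y (0 :: int poly) = 0" and X: "poly var_x 0 = monom (1::int) 1"
    by (simp_all add: var_y_def var_x_def monom_altdef)
  have Q: "poly (dickQ p) 0 = (monom 1 (p * (p - 1)) :: int poly)"
  proof -
    have "poly (dickQ p) 0 = (\<Sum>h\<le>p. if h = p then monom 1 (p * (p - 1)) else (0 :: int poly))"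
      unfolding dickQ_def poly_sum
    proof (rule sum.cong)
      fix h assume "h \<in> {..p}"
      then show "poly ((var_x ^ (p - 1)) ^ h * (var_y ^ (p - 1)) ^ (p - h)) 0 =
          (if h = p then monom 1 (p * (p - 1)) else (0 :: int poly))"
        using p by (auto simp: poly_power Y X power_0_left monom_power mult.commute simp flip: power_mult)
    qed simp
    then show ?thesis by simp
  qed
  have "coeff R 0 = poly R 0" by (simp add: poly_0_coeff_0)
  also have "\<dots> = monom 1 p ^ i * monom 1 (p * (p - 1)) ^ j"
    using p by (simp add: R_def poly_power Y X Q power_0_left monom_power)
  also have "\<dots> = monom 1 (p * i + p * (p - 1) * j)" by (simp add: monom_power mult_monom mult.commute)
  finally show "coeff (dick_mono p (i, j)) i = monom 1 (p * i + p * (p - 1) * j)"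
    by (simp add: eq coeff_monom_mult)
qed

lemma dickP_not_dvd:
  assumes "prime p" shows "\<not> of_nat p dvd dickP p"
proof
  assume "of_nat p dvd dickP p"
  then have "[:int p:] dvd coeff (dickP p) 1"
    by (simp add: of_nat_poly const_poly_dvd_iff[of "[:int p:]"])
  moreover have "coeff (dickP p) 1 = monom 1 p"
    using dick_mono_lowest(2)[OF assms, of 1 0] by (simp add: dick_mono_def)
  ultimately have "int p dvd coeff (monom 1 p) p" unfolding const_poly_dvd_iff by metis
  then show False using assms by (auto simp: prime_gt_1_nat)
qed

lemma dickQ_invariant:
  assumes "prime p" shows "sl2_inv p (dickQ p)"
proof (rule sl2_inv_cancel[OF assms dickP_invariant[OF assms] _ dickP_not_dvd[OF assms]])
  show "sl2_inv p (dickP p * dickQ p)"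
    using frob_form_invariant[OF assms, of 2] by (simp add: dickP_dickQ[OF assms])
qed

lemma dick_mono_invariant: "prime p \<Longrightarrow> sl2_inv p (dick_mono p k)"
  unfolding dick_mono_def by (cases k) (simp add: sl2_inv_mult sl2_inv_power dickP_invariant dickQ_invariant)

lemma sl2_inv_prime_power: "sl2_inv p f \<Longrightarrow> sl2_inv (p ^ Suc k) (f ^ (p ^ k))"
  unfolding sl2_inv_def by (simp add: sl2_act_hom modeq_prime_power_power del: power_Suc)

definition dick_mult :: "nat \<Rightarrow> nat \<times> nat \<Rightarrow> nat" where
  "dick_mult p = (\<lambda>(i, j). multiplicity p (gcd i j))"

lemma dick_mult_dvd: "p ^ dick_mult p (i, j) dvd i" "p ^ dick_mult p (i, j) dvd j"
  unfolding dick_mult_def prod.case by (meson gcd_dvd1 gcd_dvd2 dvd_trans multiplicity_dvd)+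

lemma dick_mult_ge:
  assumes "prime p" "p ^ k dvd i" "p ^ k dvd j" "(i, j) \<noteq> (0, 0)"
  shows "k \<le> dick_mult p (i, j)"
  unfolding dick_mult_def prod.case
  by (rule multiplicity_geI) (use assms in \<open>auto simp: not_prime_unit\<close>)

text \<open>P^i Q^j is the p^m-th power of P^(i/p^m) Q^(j/p^m), which is invariant modulo p.\<close>

lemma dick_mono_invariant_mult:
  assumes "prime p" shows "sl2_inv (p ^ Suc (dick_mult p k)) (dick_mono p k)"
proof -
  obtain i j where k: "k = (i, j)" by force
  obtain i' j' where ij: "i = p ^ dick_mult p (i, j) * i'" "j = p ^ dick_mult p (i, j) * j'"
    using dick_mult_dvd[of p i j] by (meson dvdE)
  have "dick_mono p k = dick_mono p (i', j') ^ (p ^ dick_mult p k)"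
    unfolding dick_mono_power k using ij by metis
  then show ?thesis using sl2_inv_prime_power[OF dick_mono_invariant[OF assms]] by metis
qed

lemma dick_idx_fst_inj:
  assumes "prime p" "(i, j) \<in> dick_idx p n" "(i, j') \<in> dick_idx p n" shows "j = j'"
  using assms prime_ge_2_nat[of p] by (auto simp: dick_idx_def dick_deg_def)

text \<open>Within one degree i determines j, so the monomials have different lowest terms x^e y^i.
  For the least i whose coefficient is prime to p, the coefficient of x^e y^i is
  \<open>b (i, j)\<close> modulo p.\<close>

lemma dick_mono_independent_prime:
  assumes "prime p" "of_nat p dvd (\<Sum>k\<in>dick_idx p n. of_int (b k) * dick_mono p k)" "k \<in> dick_idx p n"
  shows "int p dvd b k"
proof (rule ccontr)
  assume "\<not> int p dvd b k"
  then have "\<exists>i. \<exists>j. (i, j) \<in> dick_idx p n \<and> \<not> int p dvd b (i, j)"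
    using assms(3) by (cases k) auto
  then obtain i j where ij: "(i, j) \<in> dick_idx p n" "\<not> int p dvd b (i, j)"
    and min: "\<And>i' j'. (i', j') \<in> dick_idx p n \<Longrightarrow> i' < i \<Longrightarrow> int p dvd b (i', j')"
    using exists_least_iff[of "\<lambda>i. \<exists>j. (i, j) \<in> dick_idx p n \<and> \<not> int p dvd b (i, j)"] by metis
  define e where "e = p * i + p * (p - 1) * j"
  have rest: "int p dvd coeff (coeff (of_int (b l) * dick_mono p l) i) e"
    if l: "l \<in> dick_idx p n - {(i, j)}" for l
  proof -
    obtain i' j' where l': "l = (i', j')" by force
    consider "i' < i" | "i' > i"
      using l l' ij(1) dick_idx_fst_inj[OF assms(1)] by (metis DiffD1 DiffD2 insertI1 nat_neq_iff)
    then show ?thesis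
    proof cases
      case 1
      then show ?thesis using min[of i' j'] l l' by (simp add: of_int_poly)
    next
      case 2
      then show ?thesis using dick_mono_lowest(1)[OF assms(1)] l' by (simp add: of_int_poly)
    qed
  qed
  obtain g where g: "(\<Sum>k\<in>dick_idx p n. of_int (b k) * dick_mono p k) = of_nat p * g"
    using assms(2) by (elim dvdE)
  have "coeff (coeff (\<Sum>k\<in>dick_idx p n. of_int (b k) * dick_mono p k) i) e =
      coeff (coeff (of_int (b (i, j)) * dick_mono p (i, j)) i) e +
      (\<Sum>l\<in>dick_idx p n - {(i, j)}. coeff (coeff (of_int (b l) * dick_mono p l) i) e)"
    unfolding coeff_sum by (rule sum.remove[OF finite_dick_idx[OF assms(1)] ij(1)])
  moreover have "coeff (coeff (of_int (b (i, j)) * dick_mono p (i, j)) i) e = b (i, j)"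
    by (simp add: of_int_poly dick_mono_lowest(2)[OF assms(1)] e_def)
  moreover have "int p dvd (\<Sum>l\<in>dick_idx p n - {(i, j)}. coeff (coeff (of_int (b l) * dick_mono p l) i) e)"
    using rest by (rule dvd_sum)
  moreover have "int p dvd coeff (coeff (\<Sum>k\<in>dick_idx p n. of_int (b k) * dick_mono p k) i) e"
    by (simp add: g of_nat_poly)
  ultimately have "int p dvd b (i, j)" by (simp add: dvd_add_left_iff)
  then show False using ij(2) by simp
qed

lemma dick_mono_independent:
  assumes "prime p" "of_nat (p ^ K) dvd (\<Sum>k\<in>dick_idx p n. of_int (b k) * dick_mono p k)" "k \<in> dick_idx p n"
  shows "int p ^ K dvd b k"
  using assms(2,3)
proof (induction K arbitrary: b)
  case (Suc K)
  have "of_nat p dvd (\<Sum>k\<in>dick_idx p n. of_int (b k) * dick_mono p k)"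
    using Suc.prems(1) by (metis dvd_triv_left dvd_trans of_nat_mult power_Suc)
  then have "int p dvd b k" if "k \<in> dick_idx p n" for k
    using dick_mono_independent_prime[OF assms(1)] that by blast
  then have b: "b k = int p * (b k div int p)" if "k \<in> dick_idx p n" for k using that by simp
  have "(\<Sum>k\<in>dick_idx p n. of_int (b k) * dick_mono p k) =
      (\<Sum>k\<in>dick_idx p n. of_nat p * (of_int (b k div int p) * dick_mono p k))"
  proof (rule sum.cong)
    fix k assume "k \<in> dick_idx p n"
    then have "(of_int (b k) :: int poly poly) = of_int (int p * (b k div int p))" using b by simp
    then show "of_int (b k) * dick_mono p k = of_nat p * (of_int (b k div int p) * dick_mono p k)"
      by (simp add: mult.assoc)
  qed simp
  then have "of_nat p * of_nat (p ^ K) dvd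
      of_nat p * (\<Sum>k\<in>dick_idx p n. of_int (b k div int p) * dick_mono p k)"
    using Suc.prems(1) by (simp add: sum_distrib_left)
  then have "of_nat (p ^ K) dvd (\<Sum>k\<in>dick_idx p n. of_int (b k div int p) * dick_mono p k)"
    using assms(1) by (simp add: prime_gt_0_nat del: of_nat_power)
  then have "int p ^ K dvd b k div int p" by (rule Suc.IH) fact
  then show ?case using b[OF Suc.prems(2)] by (metis mult_dvd_mono dvd_refl power_Suc)
qed simp

section \<open>Dickson's theorem on the invariants modulo a prime\<close>

lemma poly_eval2: "poly (eval2 f X Y) s = eval2 f (poly X s) (poly Y (s :: 'a::comm_ring_1))"
  by (induction f rule: poly2_induct) (simp_all add: eval2_add eval2_monom)

lemma modeq_poly: "modeq N F G \<Longrightarrow> modeq N (poly F s) (poly G (s :: 'a::comm_ring_1))"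
  unfolding modeq_def by (metis dvd_def poly_diff poly_mult poly_of_nat)

lemma eval2_at_1_0:
  assumes "f \<in> Mdeg (2 * d)" shows "eval2 f 1 (0 :: int) = hcoeff d f 0"
proof -
  have "eval2 f 1 (0 :: int) = (\<Sum>j\<le>d. if j = 0 then hcoeff d f 0 else 0)"
    unfolding eval2_homog[OF assms] by (intro sum.cong) (auto simp: power_0_left)
  then show ?thesis by simp
qed

text \<open>SL_2(Z) is transitive on coprime pairs, so modulo p the value at each of them agrees
  with the value at (1, 0), which is the coefficient of x^d.\<close>

lemma invariant_eval_coprime:
  assumes "f \<in> Mdeg (2 * d)" "sl2_inv p f" "coprime a (b :: int)"
  shows "modeq p (eval2 f a b) (hcoeff d f 0)"
proof -
  obtain u v where uv: "u * a + v * b = 1" using bezout_int[of a b] assms(3) by auto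
  have "modeq p (sl2_act (mat2 a b (- v) u) f) f"
    by (rule sl2_invD[OF assms(2)]) (use uv in \<open>simp add: det_mat2 algebra_simps\<close>)
  from eval2_modeq[OF this, of "1 :: int" 0] show ?thesis
    by (simp add: eval2_sl2_act eval2_at_1_0[OF assms(1)])
qed

text \<open>If f(1, 0) is 0 modulo p, so is f(s, 1) for every s, and t^p - t divides f(t, 1) modulo
  p. Now t^p - t is P(t, 1), and the missing top coefficient f(1, 0) supplies the factor y of
  P.\<close>

lemma dickson_divides:
  assumes p: "prime p" and f: "f \<in> Mdeg (2 * d)" "sl2_inv p f" "int p dvd hcoeff d f 0" and d: "d > 0"
  obtains g where "g = 0 \<or> (p < d \<and> g \<in> Mdeg (2 * (d - p - 1)))" "modeq p f (dickP p * g)"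
proof -
  have p2: "p \<ge> 2" using p by (rule prime_ge_2_nat)
  define F where "F = eval2 f [:0, 1::int:] 1"
  \<comment> \<open>Dropping the coefficient of t^d, which is divisible by p, brings the degree
    below d, so that the quotient fits into degree d - p - 1.\<close>
  define F' where "F' = F - monom (coeff F d) d"
  define g0 :: "int poly" where "g0 = monom 1 p - monom 1 1"
  have coeffF: "coeff F j = (if j \<le> d then hcoeff d f (d - j) else 0)" for j
    by (simp add: F_def coeff_dehomog(2)[OF f(1)])
  \<comment> \<open>The bound \<open>max d p\<close> includes the case d <= p, where the quotient by
    t^p - t is forced to be 0.\<close>
  have degF': "degree F' < max d p"
    by (rule degree_lessI) (use d in \<open>auto simp: F'_def coeffF\<close>)
  have FF': "modeq p F F'"
    using f(3) by (simp add: int_poly_modeq_iff F'_def coeffF)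
  have degg0: "degree g0 = p" and lead: "lead_coeff g0 = 1"
  proof -
    have "degree g0 = degree (monom (1::int) p)" unfolding g0_def diff_conv_add_uminus
      by (rule degree_add_eq_left) (use p2 in \<open>simp add: degree_monom_eq\<close>)
    then show deg: "degree g0 = p" by (simp add: degree_monom_eq)
    show "lead_coeff g0 = 1" using p2 unfolding deg by (simp add: g0_def)
  qed
  obtain G R where GR: "F' = g0 * G + R" "R = 0 \<or> degree R < p" "G = 0 \<or> degree G + p < max d p"
    using int_monic_division[OF lead degF'] degg0 by auto
  have R: "modeq p R 0"
  proof (cases "R = 0")
    case False
    show ?thesis
    proof (rule poly_vanishing_mod_prime[OF p, of "int ` {..<p}"])
      show "degree R < card (int ` {..<p})" using False GR(2) by (simp add: card_image)
      fix s assume "s \<in> int ` {..<p}"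
      have "modeq p (poly F' s) (poly F s)"
        by (rule modeq_poly[OF modeq_sym[OF FF']])
      also have "poly F s = eval2 f s 1" by (simp add: F_def poly_eval2)
      also have "modeq p (eval2 f s 1) 0"
        using modeq_trans[OF invariant_eval_coprime[OF f(1,2), of s 1], of 0] f(3) by (simp add: modeq_def)
      finally have "modeq p (poly F' s) 0" .
      moreover have "modeq p (poly g0 s * poly G s) (0 * poly G s)"
        using modeq_fermat[OF p, of s 1, where 'a = int]
        by (intro modeq_mult modeq_refl) (simp add: g0_def poly_monom modeq_def)
      ultimately have "modeq p (poly F' s - poly g0 s * poly G s) 0"
        using modeq_diff[of p "poly F' s" 0 "poly g0 s * poly G s" 0] by simp
      then show "int p dvd poly R s" by (simp add: GR(1) modeq_def)
    next
      fix s t assume "s \<in> int ` {..<p}" "t \<in> int ` {..<p}" "int p dvd s - t"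
      then show "s = t" by (auto simp: mod_eq_dvd_iff[symmetric])
    qed simp
  qed simp
  have F: "modeq p F (g0 * G)"
    using modeq_trans[OF FF', of "g0 * G"] R by (simp add: GR(1) modeq_def)
  show ?thesis
  proof (cases "G = 0")
    case True
    then have "modeq p f (dickP p * 0)"
      using F by (intro modeq_homog_dehomog[OF f(1)]) (simp_all add: F_def)
    then show ?thesis using that[of 0] by simp
  next
    case False
    define e where "e = d - p - 1"
    have de: "p < d" "degree G \<le> e" using GR(3) False by (auto simp: e_def)
    define g where "g = hpoly e (\<lambda>j. coeff G (e - j))"
    have g: "g \<in> Mdeg (2 * e)" by (simp add: g_def hpoly_in_Mdeg)
    have "2 * (p + 1) + 2 * e = 2 * d" using de(1) by (simp add: e_def)
    then have Pg: "dickP p * g \<in> Mdeg (2 * d)" using Mdeg_mult[OF dickP_Mdeg g, of p] by simp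
    have "eval2 g [:0, 1::int:] 1 = G"
    proof (rule poly_eqI)
      fix j show "coeff (eval2 g [:0, 1::int:] 1) j = coeff G j"
      proof (cases "j \<le> e")
        case True
        then have "hcoeff e g (e - j) = coeff G j" by (simp add: g_def hcoeff_hpoly)
        then show ?thesis using True by (simp add: coeff_dehomog(2)[OF g])
      qed (use de(2) in \<open>simp add: coeff_dehomog(2)[OF g] coeff_eq_0\<close>)
    qed
    moreover have "eval2 (dickP p) [:0, 1::int:] 1 = g0"
      by (simp add: dickP_def frob_form_def eval2_hom g0_def monom_altdef)
    ultimately have "modeq p (eval2 f [:0, 1::int:] 1) (eval2 (dickP p * g) [:0, 1:] 1)"
      using F by (simp add: F_def eval2_mult)
    then have "modeq p f (dickP p * g)" by (rule modeq_homog_dehomog[OF f(1) Pg])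
    then show ?thesis using that[of g] g de(1) by (simp add: e_def)
  qed
qed

text \<open>Under x -> x + y the coefficient of x^(d-1) y changes by d a_0, so p | d. At (s, p) with
  s prime to p the form is a_0 s^d modulo p, so transitivity on coprime pairs gives s^d = 1 modulo
  p, and this for all such s forces p - 1 | d.\<close>

lemma dickson_degree:
  assumes p: "prime p" and f: "f \<in> Mdeg (2 * d)" "sl2_inv p f" "\<not> int p dvd hcoeff d f 0" and d: "d > 0"
  shows "p * (p - 1) dvd d"
proof -
  have p2: "p \<ge> 2" using p by (rule prime_ge_2_nat)
  have pp: "prime (int p)" using p by simp
  define a where "a = hcoeff d f"
  have "p dvd d"
  proof -
    have lin: "coeff ([:1, 1::int:] ^ m) i = int (m choose i)" for m i
      by (cases "i \<le> m") (simp_all add: coeff_linear_poly_power coeff_eq_0 degree_linear_power binomial_eq_0)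
    have X: "[:0, 1::int:] ^ k = monom 1 k" for k by (simp add: monom_altdef)
    have act: "modeq p (sl2_act (mat2 1 0 1 1) f) f" by (rule sl2_invD[OF f(2)]) (simp add: det_mat2)
    have "coeff (eval2 (sl2_act (mat2 1 0 1 1) f) 1 [:0, 1::int:]) 1 = coeff (eval2 f [:1, 1:] [:0, 1:]) 1"
      by (simp add: eval2_sl2_act one_pCons)
    also have "\<dots> = (\<Sum>j\<le>d. if j = 0 then int d * a 0 else if j = 1 then a 1 else 0)"
      unfolding eval2_homog[OF f(1)] coeff_sum X
      by (intro sum.cong) (auto simp: of_int_poly coeff_monom_mult mult.commute[of _ "monom _ _"] lin a_def)
    also have "\<dots> = (\<Sum>j\<in>{0, 1::nat}. if j = 0 then int d * a 0 else if j = 1 then a 1 else 0)"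
      using d by (intro sum.mono_neutral_right) auto
    also have "\<dots> = int d * a 0 + a 1" by simp
    finally have "coeff (eval2 (sl2_act (mat2 1 0 1 1) f) 1 [:0, 1::int:]) 1 = int d * a 0 + a 1" .
    moreover have "coeff (eval2 f 1 [:0, 1::int:]) 1 = a 1"
      using coeff_dehomog(1)[OF f(1), of 1] d by (simp add: a_def)
    ultimately have "int p dvd int d * a 0 + a 1 - a 1"
      using eval2_modeq[OF act, of 1 "[:0, 1::int:]"] unfolding int_poly_modeq_iff by metis
    then show ?thesis using f(3) pp by (simp add: prime_dvd_mult_iff a_def)
  qed
  moreover have "p - 1 dvd d"
  proof (rule ccontr)
    assume "\<not> p - 1 dvd d"
    define r where "r = d mod (p - 1)"
    have r: "0 < r" "r < p - 1" using \<open>\<not> p - 1 dvd d\<close> p2 by (auto simp: r_def dvd_eq_mod_eq_0)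
    \<comment> \<open>Since s^d = s^r modulo p, the polynomial t^r - 1 of degree r < p - 1 would
      have p - 1 roots.\<close>
    define R :: "int poly" where "R = monom 1 r - 1"
    have degR: "degree R = r"
      unfolding R_def diff_conv_add_uminus by (subst degree_add_eq_left) (use r in \<open>simp_all add: degree_monom_eq\<close>)
    have "modeq p R 0"
    proof (rule poly_vanishing_mod_prime[OF p, of "int ` {1..<p}"])
      show "degree R < card (int ` {1..<p})" using degR r by (simp add: card_image)
      fix s assume s: "s \<in> int ` {1..<p}"
      then have nd: "\<not> int p dvd s" by (auto dest: zdvd_imp_le)
      have "coprime s (int p)" using prime_imp_coprime[OF pp nd] by (simp add: coprime_commute)
      then have "modeq p (eval2 f s (int p)) (a 0)"
        using invariant_eval_coprime[OF f(1,2)] by (simp add: a_def)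
      moreover have "modeq p (eval2 f s (int p)) (\<Sum>j\<le>d. if j = 0 then a 0 * s ^ d else 0)"
        unfolding eval2_homog[OF f(1)]
        by (rule modeq_sum) (auto simp: modeq_def a_def power_0_left dvd_mult dvd_power)
      moreover have "(\<Sum>j\<le>d. if j = 0 then a 0 * s ^ d else 0) = a 0 * s ^ d" by simp
      ultimately have "modeq p (a 0 * s ^ d) (a 0)" by (metis modeq_sym modeq_trans)
      then have "int p dvd a 0 * (s ^ d - 1)" by (simp add: modeq_def right_diff_distrib)
      then have sd: "int p dvd s ^ d - 1" using f(3) pp by (simp add: prime_dvd_mult_iff a_def)
      have "modeq p (s ^ p) s" using modeq_fermat[OF p, of s 1, where 'a = int] by simp
      then have "int p dvd s * (s ^ (p - 1) - 1)"
        using p2 by (cases p) (simp_all add: modeq_def right_diff_distrib)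
      then have "modeq p (s ^ (p - 1)) 1" using nd pp by (simp add: prime_dvd_mult_iff modeq_def)
      then have "modeq p ((s ^ (p - 1)) ^ (d div (p - 1)) * s ^ r) (1 ^ (d div (p - 1)) * s ^ r)"
        by (intro modeq_mult modeq_power modeq_refl)
      moreover have "(s ^ (p - 1)) ^ (d div (p - 1)) * s ^ r = s ^ d"
        by (simp add: r_def flip: power_mult power_add)
      ultimately have "modeq p (s ^ d) (s ^ r)" by simp
      moreover have "modeq p (s ^ d) 1" using sd by (simp add: modeq_def)
      ultimately have "modeq p (s ^ r) 1" by (meson modeq_sym modeq_trans)
      then show "int p dvd poly R s" by (simp add: R_def poly_monom modeq_def)
    next
      fix s t assume "s \<in> int ` {1..<p}" "t \<in> int ` {1..<p}" "int p dvd s - t"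
      then show "s = t" by (auto simp: mod_eq_dvd_iff[symmetric])
    qed simp
    then have "int p dvd coeff R r" by (simp add: int_poly_modeq_iff)
    then show False using r p2 by (simp add: R_def)
  qed
  moreover have "coprime p (p - 1)" using p2 by (cases p) simp_all
  ultimately show ?thesis by (simp add: divides_mult)
qed

definition dick_span :: "nat \<Rightarrow> nat \<Rightarrow> int poly poly set" where
  "dick_span p n = {f. \<exists>c. modeq p f (\<Sum>k\<in>dick_idx p n. of_int (c k) * dick_mono p k)}"

lemma dick_span_cong: "modeq p f g \<Longrightarrow> g \<in> dick_span p n \<Longrightarrow> f \<in> dick_span p n"
  unfolding dick_span_def using modeq_trans by blast

lemma dick_span_0: "0 \<in> dick_span p n"
  unfolding dick_span_def by (auto intro!: exI[of _ "\<lambda>_. 0"])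

lemma dick_span_dickP:
  assumes "prime p" "g \<in> dick_span p n" shows "dickP p * g \<in> dick_span p (n + 2 * (p + 1))"
proof -
  obtain c where c: "modeq p g (\<Sum>k\<in>dick_idx p n. of_int (c k) * dick_mono p k)"
    using assms(2) by (auto simp: dick_span_def)
  define sh :: "nat \<times> nat \<Rightarrow> nat \<times> nat" where "sh = (\<lambda>(i, j). (Suc i, j))"
  define c' :: "nat \<times> nat \<Rightarrow> int" where "c' = (\<lambda>(i, j). if i = 0 then 0 else c (i - 1, j))"
  let ?n = "n + 2 * (p + 1)"
  have inj: "inj_on sh (dick_idx p n)" by (auto simp: inj_on_def sh_def)
  have deg: "dick_deg p (sh k) = dick_deg p k + 2 * (p + 1)" for k
    by (cases k) (simp add: sh_def dick_deg_def)
  have "(\<Sum>k\<in>dick_idx p ?n. of_int (c' k) * dick_mono p k) =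
      (\<Sum>k\<in>sh ` dick_idx p n. of_int (c' k) * dick_mono p k)"
  proof (rule sum.mono_neutral_right[OF finite_dick_idx[OF assms(1)]])
    show "sh ` dick_idx p n \<subseteq> dick_idx p ?n" by (auto simp: dick_idx_def deg)
    show "\<forall>k\<in>dick_idx p ?n - sh ` dick_idx p n. of_int (c' k) * dick_mono p k = 0"
    proof
      fix k assume k: "k \<in> dick_idx p ?n - sh ` dick_idx p n"
      obtain i j where ij: "k = (i, j)" by force
      have "i = 0"
      proof (rule ccontr)
        assume "i \<noteq> 0"
        then have "k = sh (i - 1, j)" by (simp add: sh_def ij)
        moreover from this have "(i - 1, j) \<in> dick_idx p n"
          using k deg[of "(i - 1, j)"] by (simp add: dick_idx_def)
        ultimately show False using k by blast
      qed
      then show "of_int (c' k) * dick_mono p k = 0" by (simp add: c'_def ij)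
    qed
  qed
  also have "\<dots> = (\<Sum>k\<in>dick_idx p n. of_int (c' (sh k)) * dick_mono p (sh k))"
    by (simp add: sum.reindex[OF inj])
  also have "\<dots> = dickP p * (\<Sum>k\<in>dick_idx p n. of_int (c k) * dick_mono p k)"
    unfolding sum_distrib_left
    by (intro sum.cong) (auto simp: sh_def c'_def dick_mono_def mult_ac)
  finally have "modeq p (dickP p * g) (\<Sum>k\<in>dick_idx p ?n. of_int (c' k) * dick_mono p k)"
    using modeq_mult[OF modeq_refl[of p "dickP p"] c] by simp
  then show ?thesis by (auto simp: dick_span_def)
qed

lemma dick_span_add_mono:
  assumes "prime p" "f \<in> dick_span p n" "k \<in> dick_idx p n"
  shows "f + of_int b * dick_mono p k \<in> dick_span p n"
proof -
  obtain c where c: "modeq p f (\<Sum>k\<in>dick_idx p n. of_int (c k) * dick_mono p k)"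
    using assms(2) by (auto simp: dick_span_def)
  have "(\<Sum>l\<in>dick_idx p n. of_int (c l + (if l = k then b else 0)) * dick_mono p l) =
      (\<Sum>l\<in>dick_idx p n. of_int (c l) * dick_mono p l) +
      (\<Sum>l\<in>dick_idx p n. if l = k then of_int b * dick_mono p k else 0)"
    unfolding sum.distrib[symmetric] by (intro sum.cong) (auto simp: distrib_right)
  also have "(\<Sum>l\<in>dick_idx p n. if l = k then of_int b * dick_mono p k else 0) = of_int b * dick_mono p k"
    using assms(3) finite_dick_idx[OF assms(1)] by simp
  finally have "modeq p (f + of_int b * dick_mono p k)
      (\<Sum>l\<in>dick_idx p n. of_int (c l + (if l = k then b else 0)) * dick_mono p l)"
    using modeq_add[OF c modeq_refl] by metis
  then show ?thesis unfolding dick_span_def mem_Collect_eq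
    by (rule exI[of _ "\<lambda>l. c l + (if l = k then b else 0)"])
qed

text \<open>Induction on the degree. If the coefficient of x^d is prime to p, the degree is that of
  some Q^j, where x^d has coefficient 1, and subtracting a multiple of Q^j removes it. What remains
  is, modulo p, P times an invariant of smaller degree.\<close>

theorem dickson:
  assumes p: "prime p" and "f \<in> Mdeg n" "sl2_inv p f" shows "f \<in> dick_span p n"
  using assms(2,3)
proof (induction n arbitrary: f rule: less_induct)
  case (less n)
  have step: "h \<in> dick_span p n" if h: "h \<in> Mdeg n" "sl2_inv p h" and d: "n = 2 * d" "d > 0" "int p dvd hcoeff d h 0" for h d
  proof -
    have hd: "h \<in> Mdeg (2 * d)" using h(1) d(1) by simp
    obtain g where g: "g = 0 \<or> (p < d \<and> g \<in> Mdeg (2 * (d - p - 1)))" "modeq p h (dickP p * g)"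
      by (rule dickson_divides[OF p hd h(2) d(3,2)])
    show ?thesis
    proof (cases "g = 0")
      case True
      then show ?thesis using g(2) dick_span_0 dick_span_cong by force
    next
      case False
      then have g': "p < d" "g \<in> Mdeg (2 * (d - p - 1))" using g(1) by auto
      have "sl2_inv p (dickP p * g)" using h(2) g(2) by (rule sl2_inv_modeq)
      then have "sl2_inv p g"
        by (rule sl2_inv_cancel[OF p dickP_invariant[OF p] _ dickP_not_dvd[OF p]])
      then have "g \<in> dick_span p (2 * (d - p - 1))"
        using less.IH[of "2 * (d - p - 1)" g] g' d by auto
      moreover have "2 * (d - p - 1) + 2 * (p + 1) = n" using g'(1) d(1) by simp
      ultimately have "dickP p * g \<in> dick_span p n" using dick_span_dickP[OF p] by metis
      then show ?thesis by (rule dick_span_cong[OF g(2)])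
    qed
  qed
  show ?case
  proof (cases "even n")
    case False
    then show ?thesis using less.prems dick_span_0 by (simp add: Mdeg_odd)
  next
    case True
    then obtain d where d: "n = 2 * d" by (elim evenE)
    then have f: "f \<in> Mdeg (2 * d)" using less.prems(1) by simp
    define a where "a = hcoeff d f 0"
    show ?thesis
    proof (cases "d = 0 \<or> \<not> int p dvd a")
      case False
      then show ?thesis using step less.prems d by (auto simp: a_def)
    next
      case True
      have "p * (p - 1) dvd d"
        using True dickson_degree[OF p f less.prems(2)] by (cases "d = 0") (auto simp: a_def)
      then obtain j where j: "d = p * (p - 1) * j" by (elim dvdE)
      then have k: "(0, j) \<in> dick_idx p n" by (simp add: dick_idx_def dick_deg_def d mult_ac)
      then have mono: "dick_mono p (0, j) \<in> Mdeg (2 * d)"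
        using dick_mono_Mdeg[of p "(0, j)"] d by (simp add: dick_idx_def)
      define h where "h = f - of_int a * dick_mono p (0, j)"
      have "hcoeff d (dick_mono p (0, j)) 0 = 1"
        using dick_mono_lowest(2)[OF p, of 0 j] by (simp add: hcoeff_def j)
      then have h0: "hcoeff d h 0 = 0"
        by (simp add: h_def hcoeff_diff hcoeff_of_int_mult a_def)
      have hM: "h \<in> Mdeg (2 * d)" unfolding h_def by (intro Mdeg_diff f Mdeg_of_int_mult mono)
      have hinv: "sl2_inv p h" unfolding h_def
        by (intro sl2_inv_diff less.prems sl2_inv_mult sl2_inv_of_int dick_mono_invariant p)
      have "h \<in> dick_span p n"
      proof (cases "d = 0")
        case True
        then have "h = 0" using Mdeg_eqI[of h d 0] hM h0 by simp
        then show ?thesis by (simp add: dick_span_0)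
      next
        case False
        then show ?thesis using step[of h d] hM hinv d h0 by simp
      qed
      then show ?thesis using dick_span_add_mono[OF p _ k, of h a] by (simp add: h_def)
    qed
  qed
qed

section \<open>Invariants modulo higher powers of a prime\<close>

lemma homog_expand:
  "f \<in> Mdeg (2 * d) \<Longrightarrow> f = (\<Sum>j\<le>d. of_int (hcoeff d f j) * var_x ^ (d - j) * var_y ^ j)"
  using eval2_homog[of f d var_x var_y] by (simp add: eval2_var_self)

text \<open>An invariant modulo \<open>p\<^sup>k\<^sup>+\<^sup>1\<close> is modulo \<open>p\<close> a \<open>p\<^sup>k\<close>-th power, whose root is again invariant.\<close>

lemma invariant_frobenius_root:
  assumes p: "prime p" and f: "f \<in> Mdeg (2 * d)" "sl2_inv (p ^ Suc k) f" and nz: "\<not> of_nat p dvd f"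
  obtains e g where "d = p ^ k * e" "g \<in> Mdeg (2 * e)" "sl2_inv p g" "modeq p f (g ^ (p ^ k))"
proof -
  define q where "q = p ^ k"
  have q: "q > 0" using p by (simp add: q_def prime_gt_0_nat)
  define a where "a = hcoeff d f"
  \<comment> \<open>A coefficient prime to p can be cancelled from the divisibilities of j a_j and
    (d - j) a_j by q, so only exponents divisible by q survive modulo p.\<close>
  have div: "q dvd j \<and> q dvd d - j" if "j \<le> d" "\<not> int p dvd a j" for j
  proof -
    have "coprime (int p) (a j)" using p that(2) by (simp add: prime_imp_coprime)
    then have "coprime (int q) (a j)" by (simp add: q_def)
    moreover have "int q dvd int j * a j" "int q dvd int (d - j) * a j"
      using invariant_coeffs[OF p f that(1)] by (simp_all add: q_def a_def)
    ultimately have "int q dvd int j" "int q dvd int (d - j)"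
      by (simp_all add: coprime_dvd_mult_left_iff)
    then show ?thesis by simp
  qed
  obtain j0 where "j0 \<le> d" "\<not> int p dvd a j0"
    using nz of_int_dvd_homog_iff[OF f(1), of "int p"] by (auto simp: a_def)
  then have "q dvd (d - j0) + j0" using div by (meson dvd_add)
  then obtain e where e: "d = q * e" using \<open>j0 \<le> d\<close> by (auto elim!: dvdE)
  \<comment> \<open>The q-th root has the same coefficients as f, because c^q = c modulo p for
    integers c.\<close>
  define g where "g = hpoly e (\<lambda>l. a (q * l))"
  have g: "g \<in> Mdeg (2 * e)" by (simp add: g_def hpoly_in_Mdeg)
  let ?t = "\<lambda>j. of_int (a j) * var_x ^ (d - j) * var_y ^ j"
  have "f = (\<Sum>j\<le>d. ?t j)" unfolding a_def by (rule homog_expand) (rule f)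
  also have "modeq p \<dots> (\<Sum>j\<le>d. if q dvd j then ?t j else 0)"
  proof (rule modeq_sum)
    fix j assume "j \<in> {..d}"
    then have "q dvd j \<or> int p dvd a j" using div by auto
    then show "modeq p (?t j) (if q dvd j then ?t j else 0)"
      using modeq_of_int[of p "a j" 0] by (auto simp: modeq_def)
  qed
  also have "(\<Sum>j\<le>d. if q dvd j then ?t j else 0) = (\<Sum>j\<in>(*) q ` {..e}. ?t j)"
    by (rule sum.mono_neutral_cong_right) (auto simp: e q elim!: dvdE)
  also have "\<dots> = (\<Sum>l\<le>e. ?t (q * l))"
    using q by (subst sum.reindex) (auto simp: inj_on_def)
  finally have f_sum: "modeq p f (\<Sum>l\<le>e. ?t (q * l))" .
  have "g ^ q = (\<Sum>l\<le>e. of_int (a (q * l)) * var_x ^ (e - l) * var_y ^ l) ^ q"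
    using homog_expand[OF g] by (simp add: g_def hcoeff_hpoly)
  also have "modeq p \<dots> (\<Sum>l\<le>e. (of_int (a (q * l)) * var_x ^ (e - l) * var_y ^ l) ^ q)"
    unfolding q_def by (rule modeq_freshman_sum[OF p]) simp
  also have "modeq p \<dots> (\<Sum>l\<le>e. ?t (q * l))"
  proof (rule modeq_sum)
    fix l
    have "(of_int (a (q * l)) * var_x ^ (e - l) * var_y ^ l) ^ q =
        of_int (a (q * l)) ^ q * var_x ^ (d - q * l) * var_y ^ (q * l)"
      by (simp add: power_mult_distrib e diff_mult_distrib2 mult.commute flip: power_mult)
    moreover have "modeq p ((of_int (a (q * l)) :: int poly poly) ^ q) (of_int (a (q * l)))"
      unfolding q_def by (rule modeq_fermat[OF p])
    ultimately show "modeq p ((of_int (a (q * l)) * var_x ^ (e - l) * var_y ^ l) ^ q) (?t (q * l))"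
      by (simp add: modeq_mult)
  qed
  finally have fg: "modeq p f (g ^ q)" using f_sum by (meson modeq_sym modeq_trans)
  \<comment> \<open>(A g - g)^q is A f - f modulo p, hence divisible by p, and p is prime in
    Z[x, y].\<close>
  have "modeq p (sl2_act A g) g" if A: "det A = 1" for A
  proof -
    have "modeq p (sl2_act A f) f"
      by (rule sl2_invD[OF _ A]) (use sl2_inv_mono[OF f(2), of p] in simp)
    then have "modeq p (sl2_act A (g ^ q)) (g ^ q)"
      using fg modeq_sl2_act by (meson modeq_sym modeq_trans)
    then have "modeq p (sl2_act A g ^ q - g ^ q) 0" by (simp add: sl2_act_hom modeq_def)
    moreover have "modeq p (sl2_act A g ^ q) ((sl2_act A g - g) ^ q + g ^ q)"
      using modeq_freshman_power[OF p, of "sl2_act A g - g" g k] by (simp add: q_def)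
    then have "modeq p (sl2_act A g ^ q - g ^ q) ((sl2_act A g - g) ^ q)"
      by (simp add: modeq_def algebra_simps)
    ultimately have "of_nat p dvd (sl2_act A g - g) ^ q"
      by (metis modeq_0_iff modeq_sym modeq_trans)
    then show ?thesis
      using prime_elem_dvd_power[OF prime_elem_of_nat_poly2[OF p]] by (auto simp: modeq_def)
  qed
  then have "sl2_inv p g" by (simp add: sl2_inv_def)
  then show ?thesis using that[of e g] e g fg by (simp add: q_def)
qed

lemma dick_deg_eq_0: "(i, j) \<in> dick_idx p n \<Longrightarrow> n > 0 \<Longrightarrow> (i, j) \<noteq> (0, 0)"
  by (auto simp: dick_idx_def dick_deg_def)

text \<open>With q = p^k, write f as g^q modulo p, expand g by Dickson's theorem and raise the
  expansion to the q-th power: both exponents of every monomial become multiples of q.\<close>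

lemma invariant_mod_prime_power_leading:
  assumes p: "prime p" and f: "f \<in> Mdeg n" "sl2_inv (p ^ Suc k) f" and n: "n > 0"
  obtains c where "\<And>i j. c (i, j) \<noteq> 0 \<Longrightarrow> p ^ k dvd i \<and> p ^ k dvd j"
    "modeq p f (\<Sum>l\<in>dick_idx p n. of_int (c l) * dick_mono p l)"
proof (cases "of_nat p dvd f")
  case True
  then show ?thesis using that[of "\<lambda>_. 0"] by (simp add: modeq_def)
next
  case False
  define q where "q = p ^ k"
  have q: "q > 0" using p by (simp add: q_def prime_gt_0_nat)
  have "even n" using False f(1) Mdeg_odd by fastforce
  then obtain d where d: "n = 2 * d" by (elim evenE)
  obtain e g where eg: "d = q * e" "g \<in> Mdeg (2 * e)" "sl2_inv p g" "modeq p f (g ^ q)"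
    using invariant_frobenius_root[OF p _ f(2) False] f(1) unfolding d q_def by blast
  obtain c where c: "modeq p g (\<Sum>l\<in>dick_idx p (2 * e). of_int (c l) * dick_mono p l)"
    using dickson[OF p eg(2,3)] by (auto simp: dick_span_def)
  define sh :: "nat \<times> nat \<Rightarrow> nat \<times> nat" where "sh = (\<lambda>(i, j). (q * i, q * j))"
  define c' :: "nat \<times> nat \<Rightarrow> int" where
    "c' = (\<lambda>(i, j). if q dvd i \<and> q dvd j then c (i div q, j div q) else 0)"
  have c'sh: "c' (sh l) = c l" for l using q by (cases l) (simp add: c'_def sh_def)
  have inj: "inj_on sh (dick_idx p (2 * e))" using q by (auto simp: inj_on_def sh_def)
  have deg: "dick_deg p (sh l) = q * dick_deg p l" for l
    by (cases l) (simp add: sh_def dick_deg_def algebra_simps)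
  have n_eq: "n = q * (2 * e)" using d eg(1) by simp
  have "(\<Sum>l\<in>dick_idx p n. of_int (c' l) * dick_mono p l) =
      (\<Sum>l\<in>sh ` dick_idx p (2 * e). of_int (c' l) * dick_mono p l)"
  proof (rule sum.mono_neutral_right[OF finite_dick_idx[OF p]])
    show "sh ` dick_idx p (2 * e) \<subseteq> dick_idx p n" by (auto simp: dick_idx_def deg n_eq)
    show "\<forall>l\<in>dick_idx p n - sh ` dick_idx p (2 * e). of_int (c' l) * dick_mono p l = 0"
    proof
      fix l assume l: "l \<in> dick_idx p n - sh ` dick_idx p (2 * e)"
      obtain i j where ij: "l = (i, j)" by force
      have "\<not> (q dvd i \<and> q dvd j)"
      proof
        assume "q dvd i \<and> q dvd j"
        then have "l = sh (i div q, j div q)" by (simp add: sh_def ij)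
        moreover from this have "(i div q, j div q) \<in> dick_idx p (2 * e)"
          using l deg[of "(i div q, j div q)"] q n_eq by (simp add: dick_idx_def)
        ultimately show False using l by blast
      qed
      then show "of_int (c' l) * dick_mono p l = 0" by (auto simp: c'_def ij)
    qed
  qed
  also have "\<dots> = (\<Sum>l\<in>dick_idx p (2 * e). of_int (c l) * dick_mono p (sh l))"
    by (simp add: sum.reindex[OF inj] c'sh)
  finally have sum_eq: "(\<Sum>l\<in>dick_idx p n. of_int (c' l) * dick_mono p l) =
      (\<Sum>l\<in>dick_idx p (2 * e). of_int (c l) * dick_mono p (sh l))" .
  have "modeq p (g ^ q) ((\<Sum>l\<in>dick_idx p (2 * e). of_int (c l) * dick_mono p l) ^ q)"
    by (rule modeq_power) (rule c)
  also have "modeq p \<dots> (\<Sum>l\<in>dick_idx p (2 * e). (of_int (c l) * dick_mono p l) ^ q)"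
    unfolding q_def by (rule modeq_freshman_sum[OF p finite_dick_idx[OF p]])
  also have "modeq p \<dots> (\<Sum>l\<in>dick_idx p (2 * e). of_int (c l) * dick_mono p (sh l))"
  proof (rule modeq_sum)
    fix l
    have "dick_mono p l ^ q = dick_mono p (sh l)"
      by (cases l) (simp add: sh_def dick_mono_power)
    moreover have "modeq p ((of_int (c l) :: int poly poly) ^ q) (of_int (c l))"
      unfolding q_def by (rule modeq_fermat[OF p])
    ultimately show "modeq p ((of_int (c l) * dick_mono p l) ^ q) (of_int (c l) * dick_mono p (sh l))"
      by (simp add: power_mult_distrib modeq_mult)
  qed
  finally have "modeq p f (\<Sum>l\<in>dick_idx p n. of_int (c' l) * dick_mono p l)"
    using eg(4) sum_eq modeq_trans by metis
  moreover have "p ^ k dvd i \<and> p ^ k dvd j" if "c' (i, j) \<noteq> 0" for i j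
    using that by (auto simp: c'_def q_def split: if_splits)
  ultimately show ?thesis using that by blast
qed

text \<open>The monomials in the leading part have m >= k, so this part is invariant modulo p^(k+1)
  as an integral form. Subtracting it and dividing by p leaves an invariant modulo p^k, to which the
  induction hypothesis applies.\<close>

theorem invariant_mod_prime_power:
  assumes p: "prime p" and n: "n > 0" and h: "h \<in> Mdeg n" "sl2_inv (p ^ k) h"
  shows "\<exists>c. modeq (p ^ k) h
    (\<Sum>l\<in>dick_idx p n. of_int (c l) * of_nat (p ^ (k - Suc (dick_mult p l))) * dick_mono p l)"
  using h
proof (induction k arbitrary: h)
  case 0
  then show ?case by (simp add: modeq_def)
next
  case (Suc k)
  obtain c0 where c0: "\<And>i j. c0 (i, j) \<noteq> 0 \<Longrightarrow> p ^ k dvd i \<and> p ^ k dvd j"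
    "modeq p h (\<Sum>l\<in>dick_idx p n. of_int (c0 l) * dick_mono p l)"
    using invariant_mod_prime_power_leading[OF p Suc.prems n] by metis
  define S0 where "S0 = (\<Sum>l\<in>dick_idx p n. of_int (c0 l) * dick_mono p l)"
  have mult: "k \<le> dick_mult p l" if "l \<in> dick_idx p n" "c0 l \<noteq> 0" for l
    using that c0(1) dick_mult_ge[OF p] dick_deg_eq_0[OF _ n] by (cases l) blast
  have S0: "S0 \<in> Mdeg n" "sl2_inv (p ^ Suc k) S0"
  proof -
    show "S0 \<in> Mdeg n" unfolding S0_def
    proof (intro Mdeg_sum Mdeg_of_int_mult)
      fix l assume "l \<in> dick_idx p n"
      then show "dick_mono p l \<in> Mdeg n" using dick_mono_Mdeg[of p l] by (simp add: dick_idx_def)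
    qed
    show "sl2_inv (p ^ Suc k) S0" unfolding S0_def
    proof (rule sl2_inv_sum)
      fix l assume l: "l \<in> dick_idx p n"
      show "sl2_inv (p ^ Suc k) (of_int (c0 l) * dick_mono p l)"
      proof (cases "c0 l = 0")
        case True
        then show ?thesis using sl2_inv_of_int[of "p ^ Suc k" 0] by simp
      next
        case False
        have "sl2_inv (p ^ Suc k) (dick_mono p l)"
          by (rule sl2_inv_mono[OF dick_mono_invariant_mult[OF p]]) (use mult[OF l False] in \<open>simp add: le_imp_power_dvd\<close>)
        then show ?thesis by (intro sl2_inv_mult sl2_inv_of_int)
      qed
    qed
  qed
  obtain h1 where h1: "h - S0 = of_nat p * h1" using c0(2) by (auto simp: modeq_def S0_def elim: dvdE)
  have "of_int (int p) * h1 \<in> Mdeg n" using Mdeg_diff[OF Suc.prems(1) S0(1)] by (simp add: h1)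
  then have "h1 \<in> Mdeg n" by (rule of_int_mult_in_MdegD) (use p in \<open>simp add: prime_gt_0_nat\<close>)
  moreover have "sl2_inv (p ^ k) h1"
    unfolding sl2_inv_def
  proof (intro allI impI)
    fix A :: "int^2^2" assume "det A = 1"
    then have "modeq (p ^ Suc k) (sl2_act A (of_nat p * h1)) (of_nat p * h1)"
      using sl2_invD[OF sl2_inv_diff[OF Suc.prems(2) S0(2)]] by (simp only: h1)
    then have "of_nat p * of_nat (p ^ k) dvd of_nat p * (sl2_act A h1 - h1)"
      by (simp add: modeq_def sl2_act_hom right_diff_distrib)
    then show "modeq (p ^ k) (sl2_act A h1) h1"
      using p by (simp add: modeq_def prime_gt_0_nat del: of_nat_power)
  qed
  ultimately obtain c1 where c1: "modeq (p ^ k) h1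
    (\<Sum>l\<in>dick_idx p n. of_int (c1 l) * of_nat (p ^ (k - Suc (dick_mult p l))) * dick_mono p l)"
    using Suc.IH by blast
  \<comment> \<open>For k <= m both truncated exponents are 0, so the factor p of
    \<open>of_nat p * h1\<close> has to go into the coefficient. The power of p written here is p in
    that case and 1 otherwise.\<close>
  define c where "c l = c0 l + c1 l * int p ^ (Suc (k - Suc (dick_mult p l)) - (Suc k - Suc (dick_mult p l)))" for l
  have "modeq (p ^ Suc k) (S0 + of_nat p * h1) (S0 + of_nat p *
      (\<Sum>l\<in>dick_idx p n. of_int (c1 l) * of_nat (p ^ (k - Suc (dick_mult p l))) * dick_mono p l))"
    using modeq_mult_left[OF c1, of p] by (intro modeq_add) simp_all
  also have "S0 + of_nat p * (\<Sum>l\<in>dick_idx p n. of_int (c1 l) * of_nat (p ^ (k - Suc (dick_mult p l))) * dick_mono p l) =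
      (\<Sum>l\<in>dick_idx p n. of_int (c l) * of_nat (p ^ (Suc k - Suc (dick_mult p l))) * dick_mono p l)"
    unfolding S0_def sum_distrib_left sum.distrib[symmetric]
  proof (rule sum.cong)
    fix l assume l: "l \<in> dick_idx p n"
    define m where "m = dick_mult p l"
    have e: "Suc (k - Suc m) = (Suc (k - Suc m) - (Suc k - Suc m)) + (Suc k - Suc m)" by simp
    have "c l * int p ^ (Suc k - Suc m) = c0 l + c1 l * int p ^ Suc (k - Suc m)"
    proof (cases "c0 l = 0")
      case True
      have "int p ^ Suc (k - Suc m) =
          int p ^ (Suc (k - Suc m) - (Suc k - Suc m)) * int p ^ (Suc k - Suc m)"
        using e by (metis power_add)
      then show ?thesis by (simp only: c_def True m_def mult.assoc add_0)
    next
      case False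
      then show ?thesis using mult[OF l False] by (simp add: c_def m_def)
    qed
    from arg_cong[OF this, of "of_int :: int \<Rightarrow> int poly poly"]
    have "of_int (c l) * of_nat (p ^ (Suc k - Suc m)) =
        (of_int (c0 l) + of_nat p * (of_int (c1 l) * of_nat (p ^ (k - Suc m))) :: int poly poly)"
      by (simp add: mult_ac)
    then show "of_int (c0 l) * dick_mono p l + of_nat p * (of_int (c1 l) * of_nat (p ^ (k - Suc (dick_mult p l))) * dick_mono p l) =
        of_int (c l) * of_nat (p ^ (Suc k - Suc (dick_mult p l))) * dick_mono p l"
      by (simp only: m_def distrib_right mult.assoc)
  qed simp
  finally have "modeq (p ^ Suc k) (S0 + of_nat p * h1)
    (\<Sum>l\<in>dick_idx p n. of_int (c l) * of_nat (p ^ (Suc k - Suc (dick_mult p l))) * dick_mono p l)" .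
  moreover have "S0 + of_nat p * h1 = h" by (simp flip: h1)
  ultimately show ?case by metis
qed

declare One_nat_def [simp del]

section \<open>Quotients of additive groups\<close>

text \<open>Cochains and formal sums live in types of class \<open>ab_group_add\<close>. Viewing
  each group as Z modulo B inside such a type makes all computations additive ones on
  representatives.\<close>

definition add_grp :: "'a::ab_group_add set \<Rightarrow> 'a monoid" where
  "add_grp Z = \<lparr>carrier = Z, monoid.mult = (+), one = 0\<rparr>"

definition add_sub :: "'a::ab_group_add set \<Rightarrow> bool" where
  "add_sub Z \<longleftrightarrow> 0 \<in> Z \<and> (\<forall>x\<in>Z. \<forall>y\<in>Z. x - y \<in> Z)"

lemma add_grp_simps [simp]:
  "carrier (add_grp Z) = Z" "x \<otimes>\<^bsub>add_grp Z\<^esub> y = x + y" "\<one>\<^bsub>add_grp Z\<^esub> = 0"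
  by (simp_all add: add_grp_def)

lemma add_subD:
  assumes "add_sub Z"
  shows "0 \<in> Z" "x \<in> Z \<Longrightarrow> y \<in> Z \<Longrightarrow> x - y \<in> Z" "x \<in> Z \<Longrightarrow> - x \<in> Z" "x \<in> Z \<Longrightarrow> y \<in> Z \<Longrightarrow> x + y \<in> Z"
proof -
  show 0: "0 \<in> Z" and diff: "x \<in> Z \<Longrightarrow> y \<in> Z \<Longrightarrow> x - y \<in> Z" for x y using assms by (auto simp: add_sub_def)
  show minus: "x \<in> Z \<Longrightarrow> - x \<in> Z" for x using diff[OF 0, of x] by simp
  show "x \<in> Z \<Longrightarrow> y \<in> Z \<Longrightarrow> x + y \<in> Z" using diff[of x "- y"] minus by simp
qed

lemma comm_group_add_grp: assumes "add_sub Z" shows "comm_group (add_grp Z)"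
proof (rule comm_groupI)
  fix x assume "x \<in> carrier (add_grp Z)"
  then show "\<exists>y\<in>carrier (add_grp Z). y \<otimes>\<^bsub>add_grp Z\<^esub> x = \<one>\<^bsub>add_grp Z\<^esub>"
    using add_subD(3)[OF assms] by (intro bexI[of _ "- x"]) simp_all
qed (use add_subD[OF assms] in \<open>auto simp: add_ac\<close>)

lemma inv_add_grp: assumes "add_sub Z" "x \<in> Z" shows "inv\<^bsub>add_grp Z\<^esub> x = - x"
  using comm_group_add_grp[OF assms(1)] add_subD(3)[OF assms(1)] assms(2)
  by (intro group.inv_equality) (auto simp: comm_group_def)

locale add_quotient =
  fixes Z B :: "'a::ab_group_add set"
  assumes Z: "add_sub Z" and B: "add_sub B" and BZ: "B \<subseteq> Z"
begin

definition cls :: "'a \<Rightarrow> 'a set" where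
  "cls x = B #>\<^bsub>add_grp Z\<^esub> x"

abbreviation Q :: "'a set monoid" where
  "Q \<equiv> add_grp Z Mod B"

lemma normal_B: "B \<lhd> add_grp Z"
proof -
  have "comm_group (add_grp Z)" using Z by (rule comm_group_add_grp)
  moreover have "subgroup B (add_grp Z)"
    using \<open>comm_group (add_grp Z)\<close> BZ add_subD[OF B] inv_add_grp[OF Z]
    by (intro group.subgroupI) (auto simp: comm_group_def subset_iff)
  ultimately show ?thesis by (simp add: comm_group.normal_iff_subgroup)
qed

lemma cls_eq: "cls x = (\<lambda>b. b + x) ` B"
  by (auto simp: cls_def r_coset_def)

lemma cls_eq_iff: "cls x = cls y \<longleftrightarrow> x - y \<in> B"
proof
  assume "cls x = cls y"
  then have "x \<in> cls y" using add_subD(1)[OF B] by (auto simp: cls_eq image_iff intro: exI[of _ 0])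
  then show "x - y \<in> B" by (auto simp: cls_eq)
next
  assume xy: "x - y \<in> B"
  show "cls x = cls y"
  proof (intro equalityI subsetI)
    fix w assume "w \<in> cls x"
    then obtain b where "b \<in> B" "w = b + x" by (auto simp: cls_eq)
    then show "w \<in> cls y" using add_subD(4)[OF B _ xy] unfolding cls_eq by (intro image_eqI[of _ _ "b + (x - y)"]) auto
  next
    fix w assume "w \<in> cls y"
    then obtain b where "b \<in> B" "w = b + y" by (auto simp: cls_eq)
    then show "w \<in> cls x" using add_subD(2)[OF B _ xy] unfolding cls_eq by (intro image_eqI[of _ _ "b - (x - y)"]) auto
  qed
qed

lemma one_Q: "\<one>\<^bsub>Q\<^esub> = cls 0"
  by (simp add: FactGroup_def cls_eq)

lemma carrier_Q: "carrier Q = cls ` Z"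
  by (auto simp: FactGroup_def RCOSETS_def cls_def)

lemma mult_Q: "x \<in> Z \<Longrightarrow> y \<in> Z \<Longrightarrow> cls x \<otimes>\<^bsub>Q\<^esub> cls y = cls (x + y)"
  using normal.rcos_sum[OF normal_B, of x y] by (simp add: FactGroup_def cls_def)

lemma cls_eq_one_iff: "cls x = \<one>\<^bsub>Q\<^esub> \<longleftrightarrow> x \<in> B"
  unfolding one_Q cls_eq_iff by simp

lemma group_Q: "group Q"
  by (rule normal.factorgroup_is_group[OF normal_B])

lemma comm_group_Q: "comm_group Q"
proof (rule group.group_comm_groupI[OF group_Q])
  fix x y assume "x \<in> carrier Q" "y \<in> carrier Q"
  then obtain a b where "x = cls a" "y = cls b" "a \<in> Z" "b \<in> Z" unfolding carrier_Q by blast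
  then show "x \<otimes>\<^bsub>Q\<^esub> y = y \<otimes>\<^bsub>Q\<^esub> x" by (simp only: mult_Q add.commute)
qed

lemma pow_Q: "x \<in> Z \<Longrightarrow> cls x [^]\<^bsub>Q\<^esub> (n::nat) = cls (((+) x ^^ n) 0) \<and> ((+) x ^^ n) 0 \<in> Z"
proof (induction n)
  case 0
  then show ?case using add_subD(1)[OF Z] one_Q by (simp add: nat_pow_def)
next
  case (Suc n)
  define y where "y = ((+) x ^^ n) 0"
  have y: "cls x [^]\<^bsub>Q\<^esub> n = cls y" "y \<in> Z" using Suc by (simp_all add: y_def)
  have "cls x [^]\<^bsub>Q\<^esub> Suc n = cls x [^]\<^bsub>Q\<^esub> n \<otimes>\<^bsub>Q\<^esub> cls x"
    by (simp add: nat_pow_def del: mult_FactGroup)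
  also have "\<dots> = cls (x + y)" using y mult_Q[OF y(2) Suc.prems] by (simp only: add.commute)
  finally show ?case using y(2) Suc.prems add_subD(4)[OF Z] by (simp add: y_def)
qed

end

lemma funpow_add_fun: "((+) z ^^ n) 0 = (\<lambda>x. of_nat n * (z x :: 'b::comm_ring_1))"
  by (induction n) (simp_all add: fun_eq_iff algebra_simps)

text \<open>The device for comparing groups of different origin: each is exhibited as the quotient
  of one additive type by the same subgroup \<open>K\<close>.\<close>

lemma iso_add_grp_Mod:
  fixes h :: "'b::ab_group_add \<Rightarrow> 'c" and H :: "('c, 'd) monoid_scheme"
  assumes "comm_group H" "\<And>x y. h (x + y) = h x \<otimes>\<^bsub>H\<^esub> h y"
    and "range h = carrier H" "\<And>x. h x = \<one>\<^bsub>H\<^esub> \<longleftrightarrow> x \<in> K"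
  shows "H \<cong> add_grp UNIV Mod K"
proof -
  have U: "comm_group (add_grp (UNIV :: 'b set))" by (rule comm_group_add_grp) (simp add: add_sub_def)
  have "h \<in> hom (add_grp UNIV) H" using assms(2,3) by (intro homI) auto
  then have "group_hom (add_grp UNIV) H h"
    using assms(1) U by (simp add: group_hom_def group_hom_axioms_def comm_group_def)
  then have "add_grp UNIV Mod kernel (add_grp UNIV) H h \<cong> H"
    using group_hom.FactGroup_iso assms(3) by force
  moreover have "kernel (add_grp UNIV) H h = K" using assms(4) by (auto simp: kernel_def)
  moreover have "group (add_grp UNIV Mod kernel (add_grp UNIV) H h)"
    using group_hom.normal_kernel[OF \<open>group_hom (add_grp UNIV) H h\<close>] by (rule normal.factorgroup_is_group)
  ultimately show ?thesis using group.iso_sym by metis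
qed

section \<open>First cohomology\<close>

locale group_module = group G for G :: "('g, 'k) monoid_scheme" (structure) +
  fixes A :: "'m::ab_group_add set" and \<rho> :: "'g \<Rightarrow> 'm \<Rightarrow> 'm"
  assumes A: "add_sub A"
    and act_closed: "g \<in> carrier G \<Longrightarrow> a \<in> A \<Longrightarrow> \<rho> g a \<in> A"
    and act_diff: "g \<in> carrier G \<Longrightarrow> a \<in> A \<Longrightarrow> b \<in> A \<Longrightarrow> \<rho> g (a - b) = \<rho> g a - \<rho> g b"
    and act_mult: "g \<in> carrier G \<Longrightarrow> h \<in> carrier G \<Longrightarrow> a \<in> A \<Longrightarrow> \<rho> (g \<otimes> h) a = \<rho> g (\<rho> h a)"
begin

lemma tuples_1: "gs \<in> tuples G 1 \<longleftrightarrow> (\<exists>g\<in>carrier G. gs = [g])"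
  by (auto simp: tuples_def length_Suc_conv One_nat_def)

lemma tuples_0: "gs \<in> tuples G 0 \<longleftrightarrow> gs = []"
  by (auto simp: tuples_def)

lemma tuples_2: "gs \<in> tuples G (Suc 1) \<longleftrightarrow> (\<exists>g\<in>carrier G. \<exists>h\<in>carrier G. gs = [g, h])"
  by (auto simp: tuples_def length_Suc_conv One_nat_def)

abbreviation Z1 :: "('g list \<Rightarrow> 'm) set" where "Z1 \<equiv> cocycles G A \<rho> 1"
abbreviation B1 :: "('g list \<Rightarrow> 'm) set" where "B1 \<equiv> coboundaries G A \<rho> 1"

definition cob :: "'m \<Rightarrow> 'g list \<Rightarrow> 'm" where
  "cob m gs = (if gs \<in> tuples G 1 then \<rho> (hd gs) m - m else 0)"

lemma cob_apply: "g \<in> carrier G \<Longrightarrow> cob m [g] = \<rho> g m - m"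
  by (auto simp: cob_def tuples_1)

text \<open>The passage from the bar complex to crossed homomorphisms, the form in which 1-cocycles
  are handled from here on.\<close>

lemma cocycle_iff:
  "z \<in> Z1 \<longleftrightarrow> (\<forall>gs. gs \<notin> tuples G 1 \<longrightarrow> z gs = 0) \<and> (\<forall>g\<in>carrier G. z [g] \<in> A) \<and>
    (\<forall>g\<in>carrier G. \<forall>h\<in>carrier G. z [g \<otimes> h] = \<rho> g (z [h]) + z [g])"
proof -
  have eq: "coboundary G \<rho> 1 z gs = (if gs \<in> tuples G (Suc 1)
      then \<rho> (hd gs) (z (tl gs)) - z [gs ! 0 \<otimes> gs ! 1] + z [hd gs] else 0)" for gs
    using tuples_2[of gs] by (auto simp: coboundary_def alt_def merge_at_def One_nat_def)
  have "coboundary G \<rho> 1 z = (\<lambda>_. 0) \<longleftrightarrow>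
      (\<forall>g\<in>carrier G. \<forall>h\<in>carrier G. \<rho> g (z [h]) - z [g \<otimes> h] + z [g] = 0)"
  proof (intro iffI ballI)
    fix g h assume "coboundary G \<rho> 1 z = (\<lambda>_. 0)" "g \<in> carrier G" "h \<in> carrier G"
    moreover from this have "[g, h] \<in> tuples G (Suc 1)" unfolding tuples_2 by blast
    ultimately show "\<rho> g (z [h]) - z [g \<otimes> h] + z [g] = 0"
      using eq[of "[g, h]"] by simp
  next
    assume *: "\<forall>g\<in>carrier G. \<forall>h\<in>carrier G. \<rho> g (z [h]) - z [g \<otimes> h] + z [g] = 0"
    show "coboundary G \<rho> 1 z = (\<lambda>_. 0)"
    proof
      fix gs show "coboundary G \<rho> 1 z gs = 0"
      proof (cases "gs \<in> tuples G (Suc 1)")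
        case True
        then obtain g h where "gs = [g, h]" "g \<in> carrier G" "h \<in> carrier G" unfolding tuples_2 by blast
        then show ?thesis using eq[of gs] True * by simp
      qed (use eq[of gs] in simp)
    qed
  qed
  moreover have "\<rho> g (z [h]) - z [g \<otimes> h] + z [g] = 0 \<longleftrightarrow> z [g \<otimes> h] = \<rho> g (z [h]) + z [g]" for g h
  proof -
    have "\<rho> g (z [h]) - z [g \<otimes> h] + z [g] = \<rho> g (z [h]) + z [g] - z [g \<otimes> h]" by simp
    then show ?thesis by (simp only: right_minus_eq) (rule eq_commute)
  qed
  moreover have "z \<in> cochains G A 1 \<longleftrightarrow>
      (\<forall>gs. gs \<notin> tuples G 1 \<longrightarrow> z gs = 0) \<and> (\<forall>g\<in>carrier G. z [g] \<in> A)"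
    by (auto simp: cochains_def tuples_1)
  ultimately show ?thesis by (simp add: cocycles_def conj_assoc)
qed

lemma cocycleD:
  assumes "z \<in> Z1"
  shows "gs \<notin> tuples G 1 \<Longrightarrow> z gs = 0" "g \<in> carrier G \<Longrightarrow> z [g] \<in> A"
    "g \<in> carrier G \<Longrightarrow> h \<in> carrier G \<Longrightarrow> z [g \<otimes> h] = \<rho> g (z [h]) + z [g]"
  using assms unfolding cocycle_iff by blast+

lemma cocycle_eqI:
  assumes "z \<in> Z1" "z' \<in> Z1" "\<And>g. g \<in> carrier G \<Longrightarrow> z [g] = z' [g]"
  shows "z = z'"
proof
  fix gs show "z gs = z' gs"
    using assms(3) cocycleD(1)[OF assms(1)] cocycleD(1)[OF assms(2)]
    by (cases "gs \<in> tuples G 1") (auto simp: tuples_1)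
qed

lemma coboundaries_eq: "B1 = cob ` A"
proof -
  have eq: "coboundary G \<rho> 0 c = cob (c [])" for c
    by (auto simp: coboundary_def cob_def alt_def fun_eq_iff tuples_def length_Suc_conv One_nat_def)
  have "(\<lambda>c. c []) ` cochains G A 0 = A"
  proof (intro equalityI subsetI)
    fix m assume "m \<in> A"
    then have "(\<lambda>gs. if gs = [] then m else 0) \<in> cochains G A 0" by (auto simp: cochains_def tuples_0)
    then show "m \<in> (\<lambda>c. c []) ` cochains G A 0" by (rule rev_image_eqI) simp
  qed (auto simp: cochains_def tuples_0)
  moreover have "B1 = (\<lambda>c. cob (c [])) ` cochains G A 0" by (simp add: coboundaries_def One_nat_def eq)
  then have "B1 = cob ` (\<lambda>c. c []) ` cochains G A 0" by (simp only: image_image)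
  ultimately show ?thesis by simp
qed

lemma act_0: "g \<in> carrier G \<Longrightarrow> \<rho> g 0 = 0"
  using act_diff[of g 0 0] add_subD(1)[OF A] by simp

lemma cob_in_Z1: assumes "m \<in> A" shows "cob m \<in> Z1"
  unfolding cocycle_iff
proof (intro conjI ballI)
  fix g h assume "g \<in> carrier G" "h \<in> carrier G"
  then show "cob m [g \<otimes> h] = \<rho> g (cob m [h]) + cob m [g]"
    using assms by (simp add: cob_apply act_mult act_diff act_closed)
qed (use assms add_subD[OF A] act_closed in \<open>auto simp: cob_apply\<close>, auto simp: cob_def)

lemma cob_diff: "a \<in> A \<Longrightarrow> b \<in> A \<Longrightarrow> cob (a - b) = cob a - cob b"
  by (auto simp: cob_def fun_eq_iff tuples_1 act_diff)

sublocale H1: add_quotient Z1 B1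
proof
  show "add_sub Z1"
    unfolding add_sub_def
  proof (intro conjI ballI)
    show "0 \<in> Z1" using add_subD[OF A] by (auto simp: cocycle_iff act_0)
    fix x y assume xy: "x \<in> Z1" "y \<in> Z1"
    show "x - y \<in> Z1"
      unfolding cocycle_iff
    proof (intro conjI allI ballI impI)
      fix g h assume "g \<in> carrier G" "h \<in> carrier G"
      then show "(x - y) [g \<otimes> h] = \<rho> g ((x - y) [h]) + (x - y) [g]"
        using cocycleD(2,3)[OF xy(1)] cocycleD(2,3)[OF xy(2)] by (simp add: act_diff)
    qed (use cocycleD[OF xy(1)] cocycleD[OF xy(2)] add_subD[OF A] in auto)
  qed
  show "add_sub B1"
    unfolding add_sub_def coboundaries_eq
  proof (intro conjI ballI)
    show "0 \<in> cob ` A" using cob_diff[of 0 0] add_subD(1)[OF A] by (metis cancel_comm_monoid_add_class.diff_cancel image_eqI)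
    fix x y assume "x \<in> cob ` A" "y \<in> cob ` A"
    then obtain a b where "a \<in> A" "b \<in> A" "x = cob a" "y = cob b" by blast
    then show "x - y \<in> cob ` A" using cob_diff[of a b] add_subD(2)[OF A] by (metis image_eqI)
  qed
  show "B1 \<subseteq> Z1" using cob_in_Z1 by (auto simp: coboundaries_eq)
qed

lemma cohomology_1: "cohomology 1 G A \<rho> = H1.Q"
proof -
  have "(+) = (\<lambda>f h (gs :: 'g list). f gs + (h gs :: 'm))" by (simp add: fun_eq_iff)
  then show ?thesis by (simp only: cohomology_def add_grp_def zero_fun_def)
qed

end

section \<open>The p-primary part of H^1 in positive degree\<close>

lemma comm_group_primary_part:
  assumes "comm_group L" shows "comm_group (primary_part p L)"
proof -
  interpret L: comm_group L by fact
  have up: "x [^]\<^bsub>L\<^esub> (p ^ (k + l)) = \<one>\<^bsub>L\<^esub>" if "x \<in> carrier L" "x [^]\<^bsub>L\<^esub> (p ^ k) = \<one>\<^bsub>L\<^esub>" for x and k l :: nat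
    using that by (simp add: power_add flip: L.nat_pow_pow)
  have "subgroup {a \<in> carrier L. \<exists>k::nat. a [^]\<^bsub>L\<^esub> (p ^ k) = \<one>\<^bsub>L\<^esub>} L"
  proof (rule L.subgroupI)
    fix a b assume "a \<in> {a \<in> carrier L. \<exists>k::nat. a [^]\<^bsub>L\<^esub> (p ^ k) = \<one>\<^bsub>L\<^esub>}"
      "b \<in> {a \<in> carrier L. \<exists>k::nat. a [^]\<^bsub>L\<^esub> (p ^ k) = \<one>\<^bsub>L\<^esub>}"
    then obtain k l where *: "a \<in> carrier L" "b \<in> carrier L"
      "a [^]\<^bsub>L\<^esub> (p ^ k) = \<one>\<^bsub>L\<^esub>" "b [^]\<^bsub>L\<^esub> (p ^ l) = \<one>\<^bsub>L\<^esub>" by blast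
    then have "(a \<otimes>\<^bsub>L\<^esub> b) [^]\<^bsub>L\<^esub> (p ^ (k + l)) = \<one>\<^bsub>L\<^esub>"
      using up[of a k l] up[of b l k] by (simp add: L.nat_pow_distrib add.commute)
    then show "a \<otimes>\<^bsub>L\<^esub> b \<in> {a \<in> carrier L. \<exists>k::nat. a [^]\<^bsub>L\<^esub> (p ^ k) = \<one>\<^bsub>L\<^esub>}" using * by blast
  next
    have "\<one>\<^bsub>L\<^esub> \<in> {a \<in> carrier L. \<exists>k::nat. a [^]\<^bsub>L\<^esub> (p ^ k) = \<one>\<^bsub>L\<^esub>}" by simp
    then show "{a \<in> carrier L. \<exists>k::nat. a [^]\<^bsub>L\<^esub> (p ^ k) = \<one>\<^bsub>L\<^esub>} \<noteq> {}" by blast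
  qed (auto simp: L.nat_pow_inv)
  then have "group (primary_part p L)" unfolding primary_part_def by (rule L.subgroup_imp_group)
  then show ?thesis
    by (rule group.group_comm_groupI) (auto simp: primary_part_def L.m_comm)
qed

text \<open>The quotient of all integer families by this subgroup is the sum of cyclic groups of
  order p^(m+1) over the monomials of degree n: entries at other pairs are unconstrained and
  disappear. In degree 0 every family is a relation and the quotient is trivial.\<close>

definition dick_rel :: "nat \<Rightarrow> nat \<Rightarrow> (nat \<times> nat \<Rightarrow> int) set" where
  "dick_rel p n = {c. n > 0 \<longrightarrow> (\<forall>k\<in>dick_idx p n. int (p ^ Suc (dick_mult p k)) dvd c k)}"

text \<open>Treats B_3 and SL_2(Z) together: torsion of H^1 comes from invariants modulo p^k, and
  these depend only on the image of \<open>lam\<close>, which is all of SL_2(Z).\<close>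

locale sl2_group = group G for G :: "('g, 'k) monoid_scheme" (structure) +
  fixes lam :: "'g \<Rightarrow> int^2^2"
  assumes lam_hom: "lam \<in> hom G SL2Z" and lam_surj: "lam ` carrier G = carrier SL2Z"
begin

definition act :: "'g \<Rightarrow> int poly poly \<Rightarrow> int poly poly" where "act g = sl2_act (lam g)"

lemma lam_mult: "g \<in> carrier G \<Longrightarrow> h \<in> carrier G \<Longrightarrow> lam (g \<otimes> h) = lam g ** lam h"
  using hom_mult[OF lam_hom] by (simp add: SL2Z_def)

lemma det_lam: "g \<in> carrier G \<Longrightarrow> det (lam g) = 1"
  using hom_in_carrier[OF lam_hom] by (simp add: SL2Z_def)

lemma obtain_lam: assumes "det A = 1" obtains g where "g \<in> carrier G" "lam g = A"
proof -
  have "A \<in> lam ` carrier G" using assms by (simp add: lam_surj SL2Z_def)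
  then show ?thesis using that by blast
qed

end

locale sl2_module = sl2_group +
  fixes n :: nat
begin

sublocale group_module G "Mdeg n" act
proof
  show "add_sub (Mdeg n)" by (simp add: add_sub_def Mdeg_diff)
qed (simp_all add: act_def sl2_act_Mdeg sl2_act_hom lam_mult sl2_act_mult)

lemma invariant_0: "f \<in> Mdeg n \<Longrightarrow> n > 0 \<Longrightarrow> (\<And>g. g \<in> carrier G \<Longrightarrow> act g f = f) \<Longrightarrow> f = 0"
proof (rule invariant_eq_0[of f n])
  fix A :: "int^2^2"
  assume inv: "\<And>g. g \<in> carrier G \<Longrightarrow> act g f = f" and "det A = 1"
  from this(2) obtain g where "g \<in> carrier G" "lam g = A" by (rule obtain_lam)
  then show "sl2_act A f = f" using inv[of g] by (simp add: act_def)
qed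

text \<open>The Bockstein image of P^i Q^j, regarded as an invariant modulo p^(m+1). The division is
  exact by \<open>dick_mono_invariant_mult\<close>.\<close>

definition dick_cocycle :: "nat \<Rightarrow> nat \<times> nat \<Rightarrow> 'a list \<Rightarrow> int poly poly" where
  "dick_cocycle p k gs = cob (dick_mono p k) gs div of_nat (p ^ Suc (dick_mult p k))"

definition dick_comb :: "nat \<Rightarrow> (nat \<times> nat \<Rightarrow> int) \<Rightarrow> 'a list \<Rightarrow> int poly poly" where
  "dick_comb p c gs = (\<Sum>k\<in>dick_idx p n. of_int (c k) * dick_cocycle p k gs)"

context
  fixes p :: nat
  assumes p: "prime p" and n: "n > 0"
begin

lemma p_pow_nonzero: "(of_nat (p ^ k) :: int poly poly) \<noteq> 0"
  using p by (simp add: prime_gt_0_nat)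

lemma dick_cocycle_apply:
  assumes "g \<in> carrier G"
  shows "of_nat (p ^ Suc (dick_mult p k)) * dick_cocycle p k [g] = act g (dick_mono p k) - dick_mono p k"
proof -
  have "of_nat (p ^ Suc (dick_mult p k)) dvd act g (dick_mono p k) - dick_mono p k"
    using sl2_invD[OF dick_mono_invariant_mult[OF p] det_lam[OF assms]]
    by (simp only: act_def modeq_def)
  then show ?thesis
    unfolding dick_cocycle_def cob_apply[OF assms] by (rule dvd_mult_div_cancel)
qed

lemma dick_cocycle_Z1: assumes "k \<in> dick_idx p n" shows "dick_cocycle p k \<in> Z1"
proof -
  define w :: "int poly poly" where "w = of_nat (p ^ Suc (dick_mult p k))"
  have w0: "w \<noteq> 0" unfolding w_def by (rule p_pow_nonzero)
  have w: "w * dick_cocycle p k [g] = act g (dick_mono p k) - dick_mono p k" if "g \<in> carrier G" for g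
    using dick_cocycle_apply[OF that] by (simp only: w_def)
  have actw: "act g (w * f) = w * act g f" for g f
    unfolding act_def sl2_act_hom w_def by (simp only: sl2_act_hom)
  have m: "dick_mono p k \<in> Mdeg n" using assms dick_mono_Mdeg[of p k] by (simp add: dick_idx_def)
  show ?thesis
    unfolding cocycle_iff
  proof (intro conjI ballI allI impI)
    fix gs assume "gs \<notin> tuples G 1"
    then show "dick_cocycle p k gs = 0" by (simp add: dick_cocycle_def cob_def)
  next
    fix g assume g: "g \<in> carrier G"
    have "of_int (int (p ^ Suc (dick_mult p k))) * dick_cocycle p k [g] \<in> Mdeg n"
      using w[OF g] Mdeg_diff[OF act_closed[OF g m] m] by (simp only: w_def of_int_of_nat_eq)
    then show "dick_cocycle p k [g] \<in> Mdeg n"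
      by (rule of_int_mult_in_MdegD) (use p in \<open>simp add: prime_gt_0_nat\<close>)
  next
    fix g h assume gh: "g \<in> carrier G" "h \<in> carrier G"
    have "w * dick_cocycle p k [g \<otimes> h] = w * (act g (dick_cocycle p k [h]) + dick_cocycle p k [g])"
      unfolding distrib_left actw[symmetric] w[OF gh(1)] w[OF gh(2)] w[OF m_closed[OF gh]]
        act_mult[OF gh m] by (simp add: act_diff[OF gh(1) act_closed[OF gh(2) m] m])
    then show "dick_cocycle p k [g \<otimes> h] = act g (dick_cocycle p k [h]) + dick_cocycle p k [g]"
      using w0 by simp
  qed
qed

lemma dick_comb_Z1: "dick_comb p c \<in> Z1"
  unfolding cocycle_iff
proof (intro conjI ballI allI impI)
  fix g h assume gh: "g \<in> carrier G" "h \<in> carrier G"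
  have "dick_comb p c [g \<otimes> h] =
      (\<Sum>k\<in>dick_idx p n. of_int (c k) * (act g (dick_cocycle p k [h]) + dick_cocycle p k [g]))"
    unfolding dick_comb_def
  proof (rule sum.cong)
    fix k assume "k \<in> dick_idx p n"
    from cocycleD(3)[OF dick_cocycle_Z1[OF this] gh]
    show "of_int (c k) * dick_cocycle p k [g \<otimes> h] =
        of_int (c k) * (act g (dick_cocycle p k [h]) + dick_cocycle p k [g])" by (simp only:)
  qed simp
  then show "dick_comb p c [g \<otimes> h] = act g (dick_comb p c [h]) + dick_comb p c [g]"
    by (simp add: dick_comb_def act_def sl2_act_hom distrib_left sum.distrib)
next
  fix g assume "g \<in> carrier G"
  then show "dick_comb p c [g] \<in> Mdeg n" unfolding dick_comb_def
    by (intro Mdeg_sum Mdeg_of_int_mult cocycleD(2)[OF dick_cocycle_Z1])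
qed (simp add: dick_comb_def cocycleD(1)[OF dick_cocycle_Z1])

text \<open>Over the common denominator p^K the combination of cocycles is the coboundary of this
  form, so that statements about cocycles become statements about forms.\<close>

definition dick_pow_comb :: "nat \<Rightarrow> (nat \<times> nat \<Rightarrow> int) \<Rightarrow> int poly poly" where
  "dick_pow_comb K c = (\<Sum>k\<in>dick_idx p n. of_int (c k * int (p ^ (K - Suc (dick_mult p k)))) * dick_mono p k)"

lemma dick_pow_comb_Mdeg: "dick_pow_comb K c \<in> Mdeg n"
  unfolding dick_pow_comb_def
proof (intro Mdeg_sum Mdeg_of_int_mult)
  fix k assume "k \<in> dick_idx p n"
  then show "dick_mono p k \<in> Mdeg n" using dick_mono_Mdeg[of p k] by (simp add: dick_idx_def)
qed

lemma dick_comb_scaled: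
  assumes "\<And>k. k \<in> dick_idx p n \<Longrightarrow> Suc (dick_mult p k) \<le> K" "g \<in> carrier G"
  shows "of_nat (p ^ K) * dick_comb p c [g] = act g (dick_pow_comb K c) - dick_pow_comb K c"
proof -
  have "of_nat (p ^ K) * dick_comb p c [g] = (\<Sum>k\<in>dick_idx p n.
      of_int (c k * int (p ^ (K - Suc (dick_mult p k)))) * (act g (dick_mono p k) - dick_mono p k))"
    unfolding dick_comb_def sum_distrib_left
  proof (rule sum.cong)
    fix k assume "k \<in> dick_idx p n"
    then have "p ^ K = p ^ (K - Suc (dick_mult p k)) * p ^ Suc (dick_mult p k)"
      using assms(1) by (metis le_add_diff_inverse2 power_add)
    then have "(of_nat (p ^ K) :: int poly poly) =
        of_nat (p ^ (K - Suc (dick_mult p k))) * of_nat (p ^ Suc (dick_mult p k))"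
      by (simp only: of_nat_mult)
    then have "of_nat (p ^ K) * (of_int (c k) * dick_cocycle p k [g]) =
        of_int (c k) * of_nat (p ^ (K - Suc (dick_mult p k))) *
        (of_nat (p ^ Suc (dick_mult p k)) * dick_cocycle p k [g])"
      by (simp only: mult_ac)
    then show "of_nat (p ^ K) * (of_int (c k) * dick_cocycle p k [g]) =
        of_int (c k * int (p ^ (K - Suc (dick_mult p k)))) * (act g (dick_mono p k) - dick_mono p k)"
      unfolding dick_cocycle_apply[OF assms(2)] by (simp only: of_int_mult of_int_of_nat_eq)
  qed simp
  also have "\<dots> = act g (dick_pow_comb K c) - dick_pow_comb K c"
    by (simp add: dick_pow_comb_def act_def sl2_act_hom right_diff_distrib sum_subtractf)
  finally show ?thesis .
qed

lemma dick_exponent_bound: obtains K where "\<And>k. k \<in> dick_idx p n \<Longrightarrow> Suc (dick_mult p k) \<le> K"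
proof
  fix k assume "k \<in> dick_idx p n"
  then show "Suc (dick_mult p k) \<le> (\<Sum>k\<in>dick_idx p n. Suc (dick_mult p k))"
    using finite_dick_idx[OF p] by (intro member_le_sum) auto
qed

lemma scaled_cocycle_eqI:
  assumes "z \<in> Z1" "z' \<in> Z1" "\<And>g. g \<in> carrier G \<Longrightarrow> of_nat (p ^ K) * z [g] = of_nat (p ^ K) * z' [g]"
  shows "z = z'"
proof (rule cocycle_eqI[OF assms(1,2)])
  fix g assume "g \<in> carrier G"
  from assms(3)[OF this] show "z [g] = z' [g]"
    by (rule mult_left_cancel[OF p_pow_nonzero, THEN iffD1])
qed

lemma B1I:
  assumes "m \<in> Mdeg n" "z \<in> Z1" "\<And>g. g \<in> carrier G \<Longrightarrow> z [g] = act g m - m"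
  shows "z \<in> B1"
proof -
  have "z = cob m" by (rule cocycle_eqI[OF assms(2) cob_in_Z1[OF assms(1)]]) (simp add: assms(3) cob_apply)
  then show ?thesis using assms(1) by (simp add: coboundaries_eq)
qed

lemma B1E:
  assumes "z \<in> B1"
  obtains m where "m \<in> Mdeg n" "\<And>g. g \<in> carrier G \<Longrightarrow> z [g] = act g m - m"
proof -
  obtain m where "m \<in> Mdeg n" "z = cob m" using assms unfolding coboundaries_eq by blast
  then show ?thesis using that[of m] by (simp add: cob_apply)
qed

text \<open>If the combination is the coboundary of h, then \<open>dick_pow_comb K c\<close> minus
  p^K h is an honest invariant of positive degree, hence 0. Independence of the monomials modulo p^K
  then yields the divisibilities.\<close>

lemma dick_comb_B1_iff: "dick_comb p c \<in> B1 \<longleftrightarrow> c \<in> dick_rel p n"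
proof
  obtain K where K: "\<And>k. k \<in> dick_idx p n \<Longrightarrow> Suc (dick_mult p k) \<le> K" by (rule dick_exponent_bound) blast
  assume "dick_comb p c \<in> B1"
  then obtain h where h: "h \<in> Mdeg n" "\<And>g. g \<in> carrier G \<Longrightarrow> dick_comb p c [g] = act g h - h"
    by (elim B1E) blast
  have "dick_pow_comb K c - of_nat (p ^ K) * h = 0"
  proof (rule invariant_0[OF Mdeg_diff[OF dick_pow_comb_Mdeg Mdeg_of_nat_mult[OF h(1)]] n])
    fix g assume g: "g \<in> carrier G"
    have "act g (dick_pow_comb K c) - dick_pow_comb K c = of_nat (p ^ K) * (act g h - h)"
      using dick_comb_scaled[OF K g, of c] h(2)[OF g] by simp
    then show "act g (dick_pow_comb K c - of_nat (p ^ K) * h) = dick_pow_comb K c - of_nat (p ^ K) * h"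
      by (simp add: act_def sl2_act_hom algebra_simps)
  qed
  then have "of_nat (p ^ K) dvd dick_pow_comb K c" by simp
  then have *: "int p ^ K dvd c k * int (p ^ (K - Suc (dick_mult p k)))" if "k \<in> dick_idx p n" for k
    unfolding dick_pow_comb_def by (rule dick_mono_independent[OF p _ that])
  have "int (p ^ Suc (dick_mult p k)) dvd c k" if k: "k \<in> dick_idx p n" for k
  proof -
    have "int p ^ K = int (p ^ Suc (dick_mult p k)) * int (p ^ (K - Suc (dick_mult p k)))"
      using K[OF k] by (simp add: of_nat_power flip: power_add power_Suc)
    then show ?thesis using *[OF k] p by (simp add: prime_gt_0_nat del: of_nat_power power_Suc)
  qed
  then show "c \<in> dick_rel p n" by (simp add: dick_rel_def)
next
  assume c: "c \<in> dick_rel p n"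
  define b where "b k = c k div int (p ^ Suc (dick_mult p k))" for k
  have cb: "c k = b k * int (p ^ Suc (dick_mult p k))" if "k \<in> dick_idx p n" for k
    using c n that by (simp add: dick_rel_def b_def del: of_nat_power)
  let ?m = "\<Sum>k\<in>dick_idx p n. of_int (b k) * dick_mono p k"
  show "dick_comb p c \<in> B1"
  proof (rule B1I[OF _ dick_comb_Z1])
    show "?m \<in> Mdeg n"
    proof (intro Mdeg_sum Mdeg_of_int_mult)
      fix k assume "k \<in> dick_idx p n"
      then show "dick_mono p k \<in> Mdeg n" using dick_mono_Mdeg[of p k] by (simp add: dick_idx_def)
    qed
    fix g assume g: "g \<in> carrier G"
    have "dick_comb p c [g] = (\<Sum>k\<in>dick_idx p n. of_int (b k) * (act g (dick_mono p k) - dick_mono p k))"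
      unfolding dick_comb_def
    proof (rule sum.cong)
      fix k assume "k \<in> dick_idx p n"
      from cb[OF this] have "of_int (c k) * dick_cocycle p k [g] =
          of_int (b k) * (of_nat (p ^ Suc (dick_mult p k)) * dick_cocycle p k [g])"
        by (simp only: of_int_mult of_int_of_nat_eq mult.assoc)
      then show "of_int (c k) * dick_cocycle p k [g] = of_int (b k) * (act g (dick_mono p k) - dick_mono p k)"
        unfolding dick_cocycle_apply[OF g] .
    qed simp
    then show "dick_comb p c [g] = act g ?m - ?m"
      by (simp add: act_def sl2_act_hom right_diff_distrib sum_subtractf)
  qed
qed

text \<open>p^k z is the coboundary of a form h, which is therefore invariant modulo p^k. Splitting
  h into a combination of Dickson monomials and p^k h' splits z into a combination of the standard
  cocycles and the coboundary of h'.\<close>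

lemma torsion_cocycle:
  assumes z: "z \<in> Z1" and B: "(\<lambda>gs. of_nat (p ^ k) * z gs) \<in> B1"
  obtains c where "z - dick_comb p c \<in> B1"
proof -
  obtain h where h: "h \<in> Mdeg n" "\<And>g. g \<in> carrier G \<Longrightarrow> of_nat (p ^ k) * z [g] = act g h - h"
    using B by (elim B1E) blast
  have "sl2_inv (p ^ k) h"
    unfolding sl2_inv_def
  proof (intro allI impI)
    fix A :: "int^2^2" assume "det A = 1"
    then obtain g where "g \<in> carrier G" "lam g = A" by (rule obtain_lam)
    then show "modeq (p ^ k) (sl2_act A h) h"
      using h(2)[of g] unfolding modeq_def act_def by (metis dvd_triv_left)
  qed
  then obtain c where "modeq (p ^ k) h
    (\<Sum>l\<in>dick_idx p n. of_int (c l) * of_nat (p ^ (k - Suc (dick_mult p l))) * dick_mono p l)"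
    using invariant_mod_prime_power[OF p n h(1)] by blast
  then obtain h' where h': "h - (\<Sum>l\<in>dick_idx p n. of_int (c l) * of_nat (p ^ (k - Suc (dick_mult p l))) * dick_mono p l)
      = of_nat (p ^ k) * h'" unfolding modeq_def by (elim dvdE)
  \<comment> \<open>With truncated subtraction, k + (m + 1 - k) = (k - m - 1) + (m + 1). This power
    of p therefore converts the division by p^k into the division by p^(m+1) built into
    \<open>dick_cocycle\<close>.\<close>
  define c' where "c' l = c l * int (p ^ (Suc (dick_mult p l) - k))" for l
  let ?S = "\<Sum>l\<in>dick_idx p n. of_int (c l) * of_nat (p ^ (k - Suc (dick_mult p l))) * dick_mono p l"
  have "of_int (int (p ^ k)) * h' \<in> Mdeg n"
    unfolding of_int_of_nat_eq h'[symmetric]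
  proof (rule Mdeg_diff[OF h(1)], rule Mdeg_sum)
    fix l assume "l \<in> dick_idx p n"
    then have "dick_mono p l \<in> Mdeg n" using dick_mono_Mdeg[of p l] by (simp add: dick_idx_def)
    then have "of_int (c l) * (of_nat (p ^ (k - Suc (dick_mult p l))) * dick_mono p l) \<in> Mdeg n"
      by (intro Mdeg_of_int_mult Mdeg_of_nat_mult)
    then show "of_int (c l) * of_nat (p ^ (k - Suc (dick_mult p l))) * dick_mono p l \<in> Mdeg n"
      by (simp only: mult.assoc)
  qed
  then have h'M: "h' \<in> Mdeg n" by (rule of_int_mult_in_MdegD) (use p in \<open>simp add: prime_gt_0_nat\<close>)
  have key: "of_nat (p ^ k) * dick_comb p c' [g] = act g ?S - ?S" if g: "g \<in> carrier G" for g
  proof -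
    have "of_nat (p ^ k) * dick_comb p c' [g] = (\<Sum>l\<in>dick_idx p n. of_int (c l) *
        of_nat (p ^ (k - Suc (dick_mult p l))) * (act g (dick_mono p l) - dick_mono p l))"
      unfolding dick_comb_def sum_distrib_left
    proof (rule sum.cong)
      fix l
      have "k + (Suc (dick_mult p l) - k) = (k - Suc (dick_mult p l)) + Suc (dick_mult p l)" by simp
      then have "p ^ k * p ^ (Suc (dick_mult p l) - k) = p ^ (k - Suc (dick_mult p l)) * p ^ Suc (dick_mult p l)"
        by (simp only: power_add[symmetric])
      then have "(of_nat (p ^ k) * of_nat (p ^ (Suc (dick_mult p l) - k)) :: int poly poly) =
          of_nat (p ^ (k - Suc (dick_mult p l))) * of_nat (p ^ Suc (dick_mult p l))"
        by (simp only: of_nat_mult[symmetric])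
      moreover have "of_nat (p ^ k) * (of_int (c' l) * dick_cocycle p l [g]) =
          of_int (c l) * ((of_nat (p ^ k) * of_nat (p ^ (Suc (dick_mult p l) - k))) * dick_cocycle p l [g])"
        unfolding c'_def of_int_mult of_int_of_nat_eq by (simp only: mult_ac)
      ultimately show "of_nat (p ^ k) * (of_int (c' l) * dick_cocycle p l [g]) = of_int (c l) *
        of_nat (p ^ (k - Suc (dick_mult p l))) * (act g (dick_mono p l) - dick_mono p l)"
        by (simp only: dick_cocycle_apply[OF g, symmetric] mult.assoc)
    qed simp
    then show ?thesis by (simp add: act_def sl2_act_hom right_diff_distrib sum_subtractf)
  qed
  have "z - dick_comb p c' = cob h'"
  proof (rule scaled_cocycle_eqI[of _ _ k, OF add_subD(2)[OF H1.Z z dick_comb_Z1] cob_in_Z1[OF h'M]])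
    fix g assume g: "g \<in> carrier G"
    have "of_nat (p ^ k) * (z - dick_comb p c') [g] = of_nat (p ^ k) * z [g] - of_nat (p ^ k) * dick_comb p c' [g]"
      by (simp add: right_diff_distrib)
    also have "\<dots> = act g (h - ?S) - (h - ?S)"
      unfolding h(2)[OF g] key[OF g] by (simp add: act_def sl2_act_hom)
    also have "\<dots> = of_nat (p ^ k) * cob h' [g]"
      unfolding h' cob_apply[OF g] act_def sl2_act_hom(8) sl2_act_hom(4) by (simp only: right_diff_distrib)
    finally show "of_nat (p ^ k) * (z - dick_comb p c') [g] = of_nat (p ^ k) * cob h' [g]" .
  qed
  then show ?thesis using that h'M coboundaries_eq by blast
qed

theorem primary_part_H1_pos: "primary_part p (cohomology 1 G (Mdeg n) act) \<cong> add_grp UNIV Mod dick_rel p n"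
proof (rule iso_add_grp_Mod)
  let ?P = "primary_part p (cohomology 1 G (Mdeg n) act)"
  have carr: "carrier ?P = {a \<in> carrier H1.Q. \<exists>k::nat. a [^]\<^bsub>H1.Q\<^esub> (p ^ k) = \<one>\<^bsub>H1.Q\<^esub>}"
    unfolding primary_part_def cohomology_1 by simp
  have mult: "x \<otimes>\<^bsub>?P\<^esub> y = x \<otimes>\<^bsub>H1.Q\<^esub> y" and one: "\<one>\<^bsub>?P\<^esub> = \<one>\<^bsub>H1.Q\<^esub>" for x y
    unfolding primary_part_def cohomology_1 by simp_all
  have tors: "H1.cls z [^]\<^bsub>H1.Q\<^esub> (p ^ k) = \<one>\<^bsub>H1.Q\<^esub> \<longleftrightarrow> (\<lambda>gs. of_nat (p ^ k) * z gs) \<in> B1"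
    if "z \<in> Z1" for z and k :: nat
    using H1.pow_Q[OF that, of "p ^ k"] by (simp only: funpow_add_fun H1.cls_eq_one_iff)
  show "comm_group ?P"
    unfolding cohomology_1 by (intro comm_group_primary_part H1.comm_group_Q)
  show "H1.cls (dick_comb p (x + y)) = H1.cls (dick_comb p x) \<otimes>\<^bsub>?P\<^esub> H1.cls (dick_comb p y)" for x y
  proof -
    have "dick_comb p (x + y) = dick_comb p x + dick_comb p y"
      by (simp add: dick_comb_def fun_eq_iff distrib_right sum.distrib)
    then show ?thesis unfolding mult by (simp only: H1.mult_Q[OF dick_comb_Z1 dick_comb_Z1])
  qed
  show "H1.cls (dick_comb p x) = \<one>\<^bsub>?P\<^esub> \<longleftrightarrow> x \<in> dick_rel p n" for x
    unfolding one H1.cls_eq_one_iff by (rule dick_comb_B1_iff)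
  show "range (\<lambda>c. H1.cls (dick_comb p c)) = carrier ?P"
  proof (intro equalityI subsetI)
    fix a assume "a \<in> range (\<lambda>c. H1.cls (dick_comb p c))"
    then obtain c where a: "a = H1.cls (dick_comb p c)" by blast
    obtain K where K: "\<And>k. k \<in> dick_idx p n \<Longrightarrow> Suc (dick_mult p k) \<le> K" by (rule dick_exponent_bound) blast
    have "(\<lambda>gs. of_nat (p ^ K) * dick_comb p c gs) = cob (dick_pow_comb K c)"
    proof
      fix gs show "of_nat (p ^ K) * dick_comb p c gs = cob (dick_pow_comb K c) gs"
      proof (cases "gs \<in> tuples G 1")
        case True
        then obtain g where "gs = [g]" "g \<in> carrier G" unfolding tuples_1 by blast
        then show ?thesis using dick_comb_scaled[OF K, of g c] cob_apply[of g] by metis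
      next
        case False
        then show ?thesis using cocycleD(1)[OF dick_comb_Z1, of gs c] by (simp add: cob_def)
      qed
    qed
    then have "(\<lambda>gs. of_nat (p ^ K) * dick_comb p c gs) \<in> B1"
      unfolding coboundaries_eq using dick_pow_comb_Mdeg by (metis imageI)
    then have "a [^]\<^bsub>H1.Q\<^esub> (p ^ K) = \<one>\<^bsub>H1.Q\<^esub>" unfolding a by (rule tors[OF dick_comb_Z1, THEN iffD2])
    then show "a \<in> carrier ?P" unfolding carr using dick_comb_Z1 H1.carrier_Q a by blast
  next
    fix a assume "a \<in> carrier ?P"
    then obtain z and k :: nat where z: "a = H1.cls z" "z \<in> Z1" "a [^]\<^bsub>H1.Q\<^esub> (p ^ k) = \<one>\<^bsub>H1.Q\<^esub>"
      unfolding carr H1.carrier_Q by blast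
    then have "(\<lambda>gs. of_nat (p ^ k) * z gs) \<in> B1" using tors by blast
    then obtain c where "z - dick_comb p c \<in> B1" using torsion_cocycle[OF z(2)] by blast
    then have "a = H1.cls (dick_comb p c)" by (simp add: z(1) H1.cls_eq_iff)
    then show "a \<in> range (\<lambda>c. H1.cls (dick_comb p c))" by blast
  qed
qed

end

end

section \<open>The divided polynomial algebra\<close>

text \<open>The coordinate on z_i = z^i / i!. It is integral on \<open>Gamma\<close>, where the
  floor only changes the type.\<close>

definition gcoef :: "nat \<Rightarrow> rat poly \<Rightarrow> int" where
  "gcoef i F = \<lfloor>fact i * coeff F i\<rfloor>"

lemma coeff_divpow: "coeff (divpow i) j = (if i = j then 1 / fact i else 0)"
  by (simp add: divpow_def)

lemma Gamma_carrier_iff: "F \<in> carrier Gamma \<longleftrightarrow> (\<forall>i. fact i * coeff F i \<in> \<int>)"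
proof
  assume "F \<in> carrier Gamma"
  then obtain n c where F: "F = (\<Sum>i\<le>n. of_int (c i) * divpow i)" by (auto simp: Gamma_def)
  show "\<forall>i. fact i * coeff F i \<in> \<int>"
  proof
    fix i
    have "coeff F i = (\<Sum>j\<le>n. if j = i then of_int (c i) / fact i else 0)"
      unfolding F coeff_sum by (intro sum.cong) (auto simp: of_int_poly coeff_divpow)
    then have "fact i * coeff F i = (if i \<le> n then of_int (c i) else 0)" by simp
    then show "fact i * coeff F i \<in> \<int>" by simp
  qed
next
  assume *: "\<forall>i. fact i * coeff F i \<in> \<int>"
  have "F = (\<Sum>i\<le>degree F. of_int (gcoef i F) * divpow i)"
  proof (rule poly_eqI)
    fix j
    have "coeff (\<Sum>i\<le>degree F. of_int (gcoef i F) * divpow i) j =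
        (\<Sum>i\<le>degree F. if i = j then of_int (gcoef j F) / fact j else 0)"
      unfolding coeff_sum by (intro sum.cong) (auto simp: of_int_poly coeff_divpow)
    also have "of_int (gcoef j F) = fact j * coeff F j" using * by (simp add: gcoef_def)
    finally show "coeff F j = coeff (\<Sum>i\<le>degree F. of_int (gcoef i F) * divpow i) j"
      by (simp add: coeff_eq_0)
  qed
  then show "F \<in> carrier Gamma" by (auto simp: Gamma_def)
qed

lemma of_int_gcoef: "F \<in> carrier Gamma \<Longrightarrow> of_int (gcoef i F) = fact i * coeff F i"
  by (simp add: Gamma_carrier_iff gcoef_def)

lemma gcoef_eqI: "F \<in> carrier Gamma \<Longrightarrow> of_int m = fact i * coeff F i \<Longrightarrow> gcoef i F = m"
  using of_int_gcoef[of F i] by (metis of_int_eq_iff)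

lemma Gamma_expand: "F \<in> carrier Gamma \<Longrightarrow> F = (\<Sum>i\<le>degree F. of_int (gcoef i F) * divpow i)"
proof (rule poly_eqI)
  fix j assume F: "F \<in> carrier Gamma"
  have "coeff (\<Sum>i\<le>degree F. of_int (gcoef i F) * divpow i) j =
      (\<Sum>i\<le>degree F. if i = j then of_int (gcoef j F) / fact j else 0)"
    unfolding coeff_sum by (intro sum.cong) (auto simp: of_int_poly coeff_divpow)
  then show "coeff F j = coeff (\<Sum>i\<le>degree F. of_int (gcoef i F) * divpow i) j"
    by (simp add: coeff_eq_0 of_int_gcoef[OF F])
qed

lemma Gamma_add_sub: "add_sub (carrier Gamma)"
  by (auto simp: add_sub_def Gamma_carrier_iff right_diff_distrib)

lemma gcoef_diff: "F \<in> carrier Gamma \<Longrightarrow> G \<in> carrier Gamma \<Longrightarrow> gcoef i (F - G) = gcoef i F - gcoef i G"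
  by (rule gcoef_eqI) (simp_all add: add_subD(2)[OF Gamma_add_sub] of_int_gcoef right_diff_distrib)

lemma gcoef_add: "F \<in> carrier Gamma \<Longrightarrow> G \<in> carrier Gamma \<Longrightarrow> gcoef i (F + G) = gcoef i F + gcoef i G"
  by (rule gcoef_eqI) (simp_all add: add_subD(4)[OF Gamma_add_sub] of_int_gcoef distrib_left)

lemma divpow_in_Gamma: "divpow i \<in> carrier Gamma"
  by (simp add: Gamma_carrier_iff coeff_divpow)

lemma of_int_in_Gamma: "of_int c \<in> carrier Gamma"
  by (auto simp: Gamma_carrier_iff of_int_poly coeff_pCons split: nat.splits)

lemma gcoef_divpow: "gcoef i (divpow j) = (if i = j then 1 else 0)"
  by (rule gcoef_eqI[OF divpow_in_Gamma]) (simp add: coeff_divpow)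

text \<open>In the basis z_i the multiplication is z_i z_j = C(i + j, i) z_(i+j).\<close>

lemma gcoef_mult_aux:
  assumes "F \<in> carrier Gamma" "G \<in> carrier Gamma"
  shows "fact k * coeff (F * G) k = of_int (\<Sum>i\<le>k. int (k choose i) * gcoef i F * gcoef (k - i) G)"
proof -
  have "fact k * (coeff F i * coeff G (k - i)) = of_int (int (k choose i) * gcoef i F * gcoef (k - i) G)"
    if "i \<le> k" for i
    by (simp add: of_int_gcoef assms binomial_fact[OF that, where 'a = rat])
  then show ?thesis by (simp add: coeff_mult sum_distrib_left)
qed

lemma Gamma_mult_closed: "F \<in> carrier Gamma \<Longrightarrow> G \<in> carrier Gamma \<Longrightarrow> F * G \<in> carrier Gamma"
  unfolding Gamma_carrier_iff[of "F * G"] by (simp add: gcoef_mult_aux del: of_int_sum)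

lemma gcoef_mult:
  "F \<in> carrier Gamma \<Longrightarrow> G \<in> carrier Gamma \<Longrightarrow>
    gcoef k (F * G) = (\<Sum>i\<le>k. int (k choose i) * gcoef i F * gcoef (k - i) G)"
  by (rule gcoef_eqI) (simp_all only: Gamma_mult_closed gcoef_mult_aux)

lemma Gamma_ops: "x \<otimes>\<^bsub>Gamma\<^esub> y = x * y" "x \<oplus>\<^bsub>Gamma\<^esub> y = x + y" "\<zero>\<^bsub>Gamma\<^esub> = 0" "\<one>\<^bsub>Gamma\<^esub> = 1"
  by (simp_all add: Gamma_def)

lemma ring_Gamma: "ring Gamma"
proof (rule ringI)
  show "abelian_group Gamma"
  proof (rule abelian_groupI)
    fix x assume "x \<in> carrier Gamma"
    then show "\<exists>y\<in>carrier Gamma. y \<oplus>\<^bsub>Gamma\<^esub> x = \<zero>\<^bsub>Gamma\<^esub>"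
      using add_subD(3)[OF Gamma_add_sub] by (intro bexI[of _ "- x"]) (simp_all add: Gamma_ops)
  qed (use add_subD[OF Gamma_add_sub] in \<open>simp_all add: Gamma_ops add_ac\<close>)
  show "monoid Gamma"
    using of_int_in_Gamma[of 1] by (intro monoidI) (simp_all add: Gamma_ops Gamma_mult_closed mult.assoc)
qed (simp_all add: Gamma_ops algebra_simps)

text \<open>From i C(k, i) = k C(k - 1, i - 1), the valuation of k is at most that of i plus that of
  C(k, i). This is why the span of the p^(v(i)+1) z_i with i >= 1 is closed under multiplication by
  \<open>Gamma\<close>.\<close>

lemma prime_power_dvd_binomial:
  assumes p: "prime p" and i: "1 \<le> i" "i \<le> k"
  shows "p ^ (multiplicity p k + 1) dvd (k choose i) * p ^ (multiplicity p i + 1)"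
proof -
  obtain i' where i': "i = p ^ multiplicity p i * i'" "\<not> p dvd i'"
    using multiplicity_decompose'[of i p] i(1) p not_prime_unit by (metis not_one_le_zero)
  have "i * (k choose i) = k * (k - 1 choose (i - 1))"
    using i times_binomial_minus1_eq[of i k] by simp
  then have "p ^ multiplicity p k dvd i * (k choose i)"
    by (simp add: dvd_mult2 multiplicity_dvd)
  then have "p ^ multiplicity p k dvd i' * (p ^ multiplicity p i * (k choose i))"
    using i'(1) by (metis mult.assoc mult.commute)
  moreover have "coprime (p ^ multiplicity p k) i'" using i'(2) p by (simp add: prime_imp_coprime)
  ultimately have "p ^ multiplicity p k dvd p ^ multiplicity p i * (k choose i)"
    by (simp add: coprime_dvd_mult_right_iff)
  then have "p ^ multiplicity p k * p dvd p ^ multiplicity p i * (k choose i) * p" by (rule mult_dvd_mono) simp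
  then show ?thesis unfolding power_add power_one_right by (simp only: mult_ac)
qed

text \<open>The additive span of the generators of I_p, in coordinates. It is already an ideal, so
  additively Gamma_p is Z plus a cyclic group of order p^(v(i)+1) for each i >= 1.\<close>

definition I_set :: "nat \<Rightarrow> rat poly set" where
  "I_set p = {F \<in> carrier Gamma. gcoef 0 F = 0 \<and> (\<forall>i\<ge>1. int (p ^ (multiplicity p i + 1)) dvd gcoef i F)}"

lemma I_set_add_sub: "add_sub (I_set p)"
proof -
  have "gcoef i 0 = 0" for i by (simp add: gcoef_def)
  then show ?thesis
    using add_subD[OF Gamma_add_sub]
    by (auto simp: add_sub_def I_set_def gcoef_diff simp del: of_nat_power intro!: dvd_diff)
qed

lemma I_set_mult:
  assumes p: "prime p" and "F \<in> I_set p" "G \<in> carrier Gamma" shows "F * G \<in> I_set p"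
proof -
  have F: "F \<in> carrier Gamma" "gcoef 0 F = 0" "\<And>i. i \<ge> 1 \<Longrightarrow> int (p ^ (multiplicity p i + 1)) dvd gcoef i F"
    using assms(2) by (auto simp: I_set_def)
  have "int (p ^ (multiplicity p k + 1)) dvd int (k choose i) * gcoef i F * gcoef (k - i) G" if "i \<le> k" for i k
  proof (cases "i = 0")
    case False
    then have "int (p ^ (multiplicity p k + 1)) dvd int ((k choose i) * p ^ (multiplicity p i + 1))"
      using prime_power_dvd_binomial[OF p _ that] by (simp only: of_nat_dvd_iff)
    also have "\<dots> dvd int (k choose i) * gcoef i F"
      unfolding of_nat_mult using F(3)[of i] False by (intro mult_dvd_mono) auto
    finally show ?thesis by (rule dvd_mult2)
  qed (simp add: F(2))
  then have "int (p ^ (multiplicity p k + 1)) dvd gcoef k (F * G)" for k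
    unfolding gcoef_mult[OF F(1) assms(3)] by (intro dvd_sum) simp
  then show ?thesis
    unfolding I_set_def mem_Collect_eq using Gamma_mult_closed[OF F(1) assms(3)] F(2)
    by (simp add: gcoef_mult[OF F(1) assms(3), of 0] del: of_nat_power power_Suc)
qed

lemma I_ideal_eq: assumes p: "prime p" shows "I_ideal p = I_set p"
proof
  interpret ring Gamma by (rule ring_Gamma)
  let ?S = "{of_nat (p ^ (multiplicity p i + 1)) * divpow i | i. i \<ge> 1}"
  have gen: "of_nat (p ^ (multiplicity p i + 1)) * divpow i \<in> carrier Gamma" for i
    using Gamma_mult_closed[OF of_int_in_Gamma divpow_in_Gamma, of "int (p ^ (multiplicity p i + 1))" i] by simp
  have "ideal (I_set p) Gamma"
  proof (rule idealI)
    show "subgroup (I_set p) (add_monoid Gamma)"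
    proof (rule add.subgroupI)
      fix a b assume ab: "a \<in> I_set p" "b \<in> I_set p"
      then show "a \<oplus>\<^bsub>Gamma\<^esub> b \<in> I_set p" using add_subD(4)[OF I_set_add_sub] by (simp add: Gamma_ops)
      have "a \<in> carrier Gamma" using ab by (simp add: I_set_def)
      then have "\<ominus>\<^bsub>Gamma\<^esub> a = - a"
        using add_subD(3)[OF Gamma_add_sub] by (intro minus_equality) (simp_all add: Gamma_ops)
      then show "\<ominus>\<^bsub>Gamma\<^esub> a \<in> I_set p" using ab add_subD(3)[OF I_set_add_sub] by simp
    qed (use add_subD(1)[OF I_set_add_sub, of p] in \<open>auto simp: I_set_def\<close>)
  qed (use I_set_mult[OF p] in \<open>simp_all add: Gamma_ops ring_Gamma mult.commute\<close>)
  moreover have "?S \<subseteq> I_set p"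
  proof
    fix x assume "x \<in> ?S"
    then obtain i where x: "x = of_nat (p ^ (multiplicity p i + 1)) * divpow i" "i \<ge> 1" by blast
    have "gcoef j x = (if j = i then int (p ^ (multiplicity p i + 1)) else 0)" for j
      unfolding x(1) by (rule gcoef_eqI[OF gen]) (simp add: of_nat_poly coeff_divpow)
    then show "x \<in> I_set p" using x gen by (simp add: I_set_def)
  qed
  ultimately show "I_ideal p \<subseteq> I_set p" unfolding I_ideal_def by (rule genideal_minimal)
  have S: "?S \<subseteq> carrier Gamma" using gen by blast
  interpret I: ideal "I_ideal p" Gamma unfolding I_ideal_def by (rule genideal_ideal[OF S])
  have self: "?S \<subseteq> I_ideal p" unfolding I_ideal_def by (rule genideal_self[OF S])
  show "I_set p \<subseteq> I_ideal p"
  proof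
    fix F assume F: "F \<in> I_set p"
    have "of_int (gcoef i F) * divpow i \<in> I_ideal p" for i
    proof (cases "i = 0")
      case True
      then show ?thesis using F I.zero_closed by (simp add: I_set_def Gamma_ops)
    next
      case False
      moreover have "\<forall>i\<ge>1. int (p ^ (multiplicity p i + 1)) dvd gcoef i F"
        using F unfolding I_set_def by blast
      ultimately have "int (p ^ (multiplicity p i + 1)) dvd gcoef i F" by (metis One_nat_def Suc_leI neq0_conv)
      then obtain m where m: "gcoef i F = int (p ^ (multiplicity p i + 1)) * m" by (rule dvdE)
      have "of_nat (p ^ (multiplicity p i + 1)) * divpow i \<in> I_ideal p" using self False by fastforce
      from I.I_l_closed[OF this of_int_in_Gamma[of m]] show ?thesis
        unfolding m Gamma_ops of_int_mult of_int_of_nat_eq by (simp only: mult_ac)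
    qed
    then have "(\<Sum>i\<le>k. of_int (gcoef i F) * divpow i) \<in> I_ideal p" for k
      using I.a_closed by (induction k) (simp_all add: Gamma_ops)
    note sums = this
    have "F \<in> carrier Gamma" using F by (simp add: I_set_def)
    then show "F \<in> I_ideal p" by (subst Gamma_expand) (simp, rule sums)
  qed
qed

lemma Gamma_p_add_eq: "Gamma_p_add p = add_grp (carrier Gamma) Mod I_ideal p"
  and divpow_class_eq: "divpow_class p i = I_ideal p #>\<^bsub>add_grp (carrier Gamma)\<^esub> divpow i"
proof -
  have "add_monoid Gamma = add_grp (carrier Gamma)" by (simp add: add_grp_def Gamma_def)
  then show "Gamma_p_add p = add_grp (carrier Gamma) Mod I_ideal p"
    "divpow_class p i = I_ideal p #>\<^bsub>add_grp (carrier Gamma)\<^esub> divpow i"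
    by (simp_all add: Gamma_p_def FactRing_def FactGroup_def A_RCOSETS_def' set_add_def divpow_class_def
        a_r_coset_def RCOSETS_def)
qed

section \<open>Subgroups generated in quotients, and tensor squares\<close>

lemma free_Abelian_group_eq: "free_Abelian_group S = add_grp {c. Poly_Mapping.keys c \<subseteq> S}"
  by (simp add: free_Abelian_group_def add_grp_def)

lemma add_sub_sum: "add_sub Z \<Longrightarrow> (\<And>k. k \<in> K \<Longrightarrow> f k \<in> Z) \<Longrightarrow> (\<Sum>k\<in>K. f k) \<in> Z"
  by (induction K rule: infinite_finite_induct) (simp_all add: add_subD)

lemma add_sub_frag_cmul: assumes "add_sub P" "w \<in> P" shows "frag_cmul m w \<in> P"
proof -
  have *: "frag_cmul (int k) w \<in> P" for k
    by (induction k) (use add_subD[OF assms(1)] assms(2) in \<open>simp_all add: frag_cmul_distrib\<close>)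
  have "frag_cmul (- int k) w \<in> P" for k using add_subD(3)[OF assms(1) *[of k]] by simp
  then show ?thesis using * by (cases m rule: int_cases2) metis+
qed

context add_quotient
begin

text \<open>The map \<open>h\<close> parametrises the additive span of \<open>E\<close>: its range
  contains \<open>E\<close> and lies in every additive subgroup that does. The generated subgroup of
  the quotient thus becomes the image of a homomorphism, whose kernel can be computed.\<close>

lemma generate_cls:
  fixes h :: "'b::ab_group_add \<Rightarrow> 'a"
  assumes add: "\<And>x y. h (x + y) = h x + h y" and Z_h: "\<And>x. h x \<in> Z" and E: "E \<subseteq> range h"
    and span: "\<And>P. add_sub P \<Longrightarrow> E \<subseteq> P \<Longrightarrow> range h \<subseteq> P"
  shows "generate Q (cls ` E) = cls ` range h"
proof
  interpret Q: comm_group Q by (rule comm_group_Q)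
  have zero: "h 0 = 0" using add[of 0 0] by simp
  have hm: "cls (h x) \<otimes>\<^bsub>Q\<^esub> cls (h y) = cls (h (x + y))" for x y
    unfolding add by (rule mult_Q[OF Z_h Z_h])
  have carr: "cls x \<in> carrier Q" if "x \<in> Z" for x unfolding carrier_Q using that by blast
  have inv: "inv\<^bsub>Q\<^esub> cls x = cls (- x)" if "x \<in> Z" for x
  proof (rule Q.inv_equality)
    show "cls (- x) \<otimes>\<^bsub>Q\<^esub> cls x = \<one>\<^bsub>Q\<^esub>"
      using mult_Q[OF add_subD(3)[OF Z that] that] by (simp only: one_Q left_minus)
  qed (intro carr that add_subD(3)[OF Z])+
  have "subgroup (cls ` range h) Q"
  proof (rule Q.subgroupI)
    show "cls ` range h \<subseteq> carrier Q" using carr Z_h by blast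
    fix a b assume "a \<in> cls ` range h" "b \<in> cls ` range h"
    then obtain x y where xy: "a = cls (h x)" "b = cls (h y)" by blast
    show "a \<otimes>\<^bsub>Q\<^esub> b \<in> cls ` range h" unfolding xy hm by blast
    have "- h x = h (- x)" using add[of x "- x"] zero by (intro minus_unique) simp
    then show "inv\<^bsub>Q\<^esub> a \<in> cls ` range h" unfolding xy(1) inv[OF Z_h] by simp
  qed blast
  moreover have "cls ` E \<subseteq> cls ` range h" using E by blast
  ultimately show "generate Q (cls ` E) \<subseteq> cls ` range h" by (intro Q.generate_subgroup_incl)
  define P where "P = {x \<in> Z. cls x \<in> generate Q (cls ` E)}"
  have EC: "cls ` E \<subseteq> carrier Q" using E carr Z_h by blast
  interpret S: subgroup "generate Q (cls ` E)" Q by (rule Q.generate_is_subgroup[OF EC])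
  have "0 \<in> P" using S.one_closed add_subD(1)[OF Z] unfolding P_def one_Q by blast
  moreover have "x - y \<in> P" if "x \<in> P" "y \<in> P" for x y
  proof -
    have xy: "x \<in> Z" "y \<in> Z" "cls x \<in> generate Q (cls ` E)" "cls y \<in> generate Q (cls ` E)"
      using that by (auto simp: P_def)
    have "cls x \<otimes>\<^bsub>Q\<^esub> inv\<^bsub>Q\<^esub> cls y \<in> generate Q (cls ` E)" using xy by (intro S.m_closed S.m_inv_closed)
    then have "cls (x + - y) \<in> generate Q (cls ` E)"
      unfolding inv[OF xy(2)] mult_Q[OF xy(1) add_subD(3)[OF Z xy(2)]] .
    then show ?thesis using add_subD(2)[OF Z xy(1,2)] by (simp add: P_def)
  qed
  ultimately have "add_sub P" by (simp add: add_sub_def)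
  moreover have "E \<subseteq> P" using E Z_h generate.incl[of _ "cls ` E" Q] by (auto simp: P_def)
  ultimately have "range h \<subseteq> P" by (rule span)
  then show "cls ` range h \<subseteq> generate Q (cls ` E)" by (auto simp: P_def)
qed

lemma generate_cls_iso:
  fixes h :: "'b::ab_group_add \<Rightarrow> 'a"
  assumes add: "\<And>x y. h (x + y) = h x + h y" and Z_h: "\<And>x. h x \<in> Z" and E: "E \<subseteq> range h"
    and span: "\<And>P. add_sub P \<Longrightarrow> E \<subseteq> P \<Longrightarrow> range h \<subseteq> P"
    and K: "\<And>x. h x \<in> B \<longleftrightarrow> x \<in> K"
  shows "restrict_group Q (generate Q (cls ` E)) \<cong> add_grp UNIV Mod K"
proof (rule iso_add_grp_Mod)
  interpret Q: comm_group Q by (rule comm_group_Q)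
  have EC: "cls ` E \<subseteq> carrier Q" unfolding carrier_Q using E Z_h by blast
  note sub = Q.generate_is_subgroup[OF EC]
  show "comm_group (restrict_group Q (generate Q (cls ` E)))"
  proof (rule group.group_comm_groupI[OF Q.subgroup_imp_group[OF sub]])
    fix x y assume "x \<in> carrier (restrict_group Q (generate Q (cls ` E)))"
      "y \<in> carrier (restrict_group Q (generate Q (cls ` E)))"
    then have "x \<in> carrier Q" "y \<in> carrier Q" using subgroup.subset[OF sub] by auto
    then have "x \<otimes>\<^bsub>Q\<^esub> y = y \<otimes>\<^bsub>Q\<^esub> x" by (rule Q.m_comm)
    then show "x \<otimes>\<^bsub>restrict_group Q (generate Q (cls ` E))\<^esub> y = y \<otimes>\<^bsub>restrict_group Q (generate Q (cls ` E))\<^esub> x"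
      by simp
  qed
  have mult: "x \<otimes>\<^bsub>restrict_group Q (generate Q (cls ` E))\<^esub> y = x \<otimes>\<^bsub>Q\<^esub> y"
    and one: "\<one>\<^bsub>restrict_group Q (generate Q (cls ` E))\<^esub> = \<one>\<^bsub>Q\<^esub>" for x y by simp_all
  show "cls (h (x + y)) = cls (h x) \<otimes>\<^bsub>restrict_group Q (generate Q (cls ` E))\<^esub> cls (h y)" for x y
    unfolding mult add by (rule mult_Q[OF Z_h Z_h, symmetric])
  show "range (\<lambda>x. cls (h x)) = carrier (restrict_group Q (generate Q (cls ` E)))"
    using generate_cls[OF add Z_h E span] by (simp add: image_image)
  show "cls (h x) = \<one>\<^bsub>restrict_group Q (generate Q (cls ` E))\<^esub> \<longleftrightarrow> x \<in> K" for x
    unfolding one cls_eq_one_iff by (rule K)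
qed

end

lemma image_case_prod_Collect:
  "(\<lambda>k. g (case k of (i, j) \<Rightarrow> f i j)) ` {(i, j). P i j} = {g (f i j) | i j. P i j}"
  by force

lemma add_sub_keys: "add_sub {c :: 'a \<Rightarrow>\<^sub>0 int. Poly_Mapping.keys c \<subseteq> S}"
  using keys_diff by (fastforce simp: add_sub_def)

locale tensor_square = comm_group A for A :: "'a monoid"
begin

abbreviation S :: "('a \<times> 'a) set" where "S \<equiv> carrier A \<times> carrier A"
abbreviation Fc :: "('a \<times> 'a \<Rightarrow>\<^sub>0 int) set" where "Fc \<equiv> {c. Poly_Mapping.keys c \<subseteq> S}"
abbreviation Ker :: "('a \<times> 'a \<Rightarrow>\<^sub>0 int) set" where "Ker \<equiv> tensor_kernel A A"

lemma relators_in_Fc: assumes "w \<in> tensor_relators A A" shows "w \<in> Fc"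
proof -
  have f: "frag_of (a, b) \<in> Fc" if "a \<in> carrier A" "b \<in> carrier A" for a b using that by simp
  show ?thesis
    using assms unfolding tensor_relators_def
  proof (elim UnE CollectE exE conjE)
    fix a a' b assume w: "w = frag_of (a \<otimes>\<^bsub>A\<^esub> a', b) - frag_of (a, b) - frag_of (a', b)"
      and c: "a \<in> carrier A" "a' \<in> carrier A" "b \<in> carrier A"
    show "w \<in> Fc" unfolding w by (intro add_subD(2)[OF add_sub_keys] f m_closed c)
  next
    fix a b b' assume w: "w = frag_of (a, b \<otimes>\<^bsub>A\<^esub> b') - frag_of (a, b) - frag_of (a, b')"
      and c: "a \<in> carrier A" "b \<in> carrier A" "b' \<in> carrier A"
    show "w \<in> Fc" unfolding w by (intro add_subD(2)[OF add_sub_keys] f m_closed c)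
  qed
qed

lemma subgroup_Ker: "subgroup Ker (free_Abelian_group S)"
  unfolding tensor_kernel_def
  by (rule group.generate_is_subgroup[OF group_free_Abelian_group]) (use relators_in_Fc in auto)

text \<open>Torsion coordinates on Gamma_p have no additive integral lifts, so \<open>f\<close> and
  \<open>f'\<close> are additive only modulo N. Their product is extended additively from the basis
  of the free group, and each tensor relator goes to a multiple of N.\<close>

lemma tensor_functional:
  assumes f: "\<And>a a'. a \<in> carrier A \<Longrightarrow> a' \<in> carrier A \<Longrightarrow> N dvd f (a \<otimes>\<^bsub>A\<^esub> a') - f a - f a'"
    and f': "\<And>a a'. a \<in> carrier A \<Longrightarrow> a' \<in> carrier A \<Longrightarrow> N dvd f' (a \<otimes>\<^bsub>A\<^esub> a') - f' a - f' a'"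
  obtains h :: "('a \<times> 'a \<Rightarrow>\<^sub>0 int) \<Rightarrow> int" where "\<And>x y. x \<in> Fc \<Longrightarrow> y \<in> Fc \<Longrightarrow> h (x + y) = h x + h y"
    "\<And>a b. a \<in> carrier A \<Longrightarrow> b \<in> carrier A \<Longrightarrow> h (frag_of (a, b)) = f a * f' b"
    "\<And>w. w \<in> Ker \<Longrightarrow> N dvd h w"
proof -
  interpret integer: comm_group integer_group by (rule abelian_integer_group)
  obtain h where h: "h \<in> hom (free_Abelian_group S) integer_group"
    "\<And>x. x \<in> S \<Longrightarrow> h (frag_of x) = (\<lambda>(a, b). f a * f' b) x"
    using integer.free_Abelian_group_universal[of "\<lambda>(a, b). f a * f' b" S] by (metis carrier_integer_group subset_UNIV)
  have add: "h (x + y) = h x + h y" if "x \<in> Fc" "y \<in> Fc" for x y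
    using hom_mult[OF h(1), of x y] that by simp
  have of: "h (frag_of (a, b)) = f a * f' b" if "a \<in> carrier A" "b \<in> carrier A" for a b
    using h(2)[of "(a, b)"] that by simp
  have zero: "h 0 = 0" using add[of 0 0] by simp
  have diff: "h (x - y) = h x - h y" if "x \<in> Fc" "y \<in> Fc" for x y
    using add[OF add_subD(2)[OF add_sub_keys that] that(2)] by simp
  have neg: "h (- x) = - h x" if "x \<in> Fc" for x using diff[of 0 x] that by (simp add: zero)
  have fr: "frag_of (a, b) \<in> Fc" if "a \<in> carrier A" "b \<in> carrier A" for a b using that by simp
  have rel: "N dvd h w" if "w \<in> tensor_relators A A" for w
    using that unfolding tensor_relators_def
  proof (elim UnE CollectE exE conjE)
    fix a a' b assume w: "w = frag_of (a \<otimes>\<^bsub>A\<^esub> a', b) - frag_of (a, b) - frag_of (a', b)"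
      and c: "a \<in> carrier A" "a' \<in> carrier A" "b \<in> carrier A"
    have "h w = (h (frag_of (a \<otimes>\<^bsub>A\<^esub> a', b)) - h (frag_of (a, b))) - h (frag_of (a', b))"
      unfolding w using diff[OF add_subD(2)[OF add_sub_keys fr fr] fr] diff[OF fr fr] m_closed c by metis
    also have "\<dots> = (f (a \<otimes>\<^bsub>A\<^esub> a') - f a - f a') * f' b"
      using c by (simp add: of left_diff_distrib)
    finally show ?thesis using f[OF c(1,2)] by simp
  next
    fix a b b' assume w: "w = frag_of (a, b \<otimes>\<^bsub>A\<^esub> b') - frag_of (a, b) - frag_of (a, b')"
      and c: "a \<in> carrier A" "b \<in> carrier A" "b' \<in> carrier A"
    have "h w = (h (frag_of (a, b \<otimes>\<^bsub>A\<^esub> b')) - h (frag_of (a, b))) - h (frag_of (a, b'))"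
      unfolding w using diff[OF add_subD(2)[OF add_sub_keys fr fr] fr] diff[OF fr fr] m_closed c by metis
    also have "\<dots> = f a * (f' (b \<otimes>\<^bsub>A\<^esub> b') - f' b - f' b')"
      using c by (simp add: of right_diff_distrib)
    finally show ?thesis using f'[OF c(2,3)] by simp
  qed
  have "w \<in> Fc \<and> N dvd h w" if "w \<in> Ker" for w
    using that unfolding tensor_kernel_def
  proof (induction rule: generate.induct)
    case (inv x)
    then have "x \<in> Fc" by (rule relators_in_Fc)
    moreover from this have "inv\<^bsub>free_Abelian_group S\<^esub> x = - x" by simp
    ultimately show ?case using rel[OF inv] neg[of x] add_subD(3)[OF add_sub_keys[of S], of x] by simp
  next
    case (eng x y)
    then show ?case using add[of x y] add_subD(4)[OF add_sub_keys[of S], of x y] by simp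
  next
    case one
    then show ?case by (simp add: zero)
  next
    case (incl w)
    then show ?case using rel relators_in_Fc by blast
  qed
  then show ?thesis using that[of h] add of by blast
qed

sublocale W: add_quotient Fc Ker
proof
  show "add_sub Fc" by (rule add_sub_keys)
  interpret K: subgroup Ker "free_Abelian_group S" by (rule subgroup_Ker)
  show sub: "Ker \<subseteq> Fc" using K.subset unfolding free_Abelian_group_eq add_grp_simps .
  have "x - y \<in> Ker" if "x \<in> Ker" "y \<in> Ker" for x y
  proof -
    have "inv\<^bsub>free_Abelian_group S\<^esub> y = - y" using that(2) sub by (intro inv_free_Abelian_group) blast
    then show ?thesis using K.m_closed[OF that(1) K.m_inv_closed[OF that(2)]] by simp
  qed
  moreover have "0 \<in> Ker" using K.one_closed by simp
  ultimately show "add_sub Ker" by (simp add: add_sub_def)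
qed

lemma tensor_eq: "tensor A A = W.Q"
  by (simp add: tensor_def free_Abelian_group_eq)

lemma pure_tensor_eq: "pure_tensor A A a b = W.cls (frag_of (a, b))"
  by (simp add: pure_tensor_def W.cls_def free_Abelian_group_eq)

lemma relator_in_Ker:
  "a \<in> carrier A \<Longrightarrow> a' \<in> carrier A \<Longrightarrow> b \<in> carrier A \<Longrightarrow>
    frag_of (a \<otimes>\<^bsub>A\<^esub> a', b) - frag_of (a, b) - frag_of (a', b) \<in> Ker"
  "a \<in> carrier A \<Longrightarrow> b \<in> carrier A \<Longrightarrow> b' \<in> carrier A \<Longrightarrow>
    frag_of (a, b \<otimes>\<^bsub>A\<^esub> b') - frag_of (a, b) - frag_of (a, b') \<in> Ker"
  unfolding tensor_kernel_def tensor_relators_def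
  by (rule generate.incl, rule UnI1, blast) (rule generate.incl, rule UnI2, blast)

lemma pow_in_Ker:
  assumes "a \<in> carrier A" "b \<in> carrier A"
  shows "frag_cmul (int m) (frag_of (a, b)) - frag_of (a [^]\<^bsub>A\<^esub> m, b) \<in> Ker"
    "frag_cmul (int m) (frag_of (a, b)) - frag_of (a, b [^]\<^bsub>A\<^esub> m) \<in> Ker"
proof -
  show "frag_cmul (int m) (frag_of (a, b)) - frag_of (a [^]\<^bsub>A\<^esub> m, b) \<in> Ker"
  proof (induction m)
    case 0
    show ?case using relator_in_Ker(1)[OF one_closed one_closed assms(2)] by simp
  next
    case (Suc m)
    from add_subD(2)[OF W.B Suc relator_in_Ker(1)[OF nat_pow_closed[OF assms(1), of m] assms]]
    show ?case by (simp add: frag_cmul_distrib algebra_simps)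
  qed
  show "frag_cmul (int m) (frag_of (a, b)) - frag_of (a, b [^]\<^bsub>A\<^esub> m) \<in> Ker"
  proof (induction m)
    case 0
    show ?case using relator_in_Ker(2)[OF assms(1) one_closed one_closed] by simp
  next
    case (Suc m)
    from add_subD(2)[OF W.B Suc relator_in_Ker(2)[OF assms(1) nat_pow_closed[OF assms(2), of m] assms(2)]]
    show ?case by (simp add: frag_cmul_distrib algebra_simps)
  qed
qed

text \<open>A multiple m of a pure tensor can be moved into either factor, so it is enough that m
  annihilates one of them.\<close>

lemma torsion_in_Ker:
  assumes "a \<in> carrier A" "b \<in> carrier A" "a [^]\<^bsub>A\<^esub> m = \<one>\<^bsub>A\<^esub> \<or> b [^]\<^bsub>A\<^esub> m = \<one>\<^bsub>A\<^esub>"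
  shows "frag_cmul (int m) (frag_of (a, b)) \<in> Ker"
proof -
  have "frag_of (\<one>\<^bsub>A\<^esub>, b) \<in> Ker"
    using add_subD(3)[OF W.B relator_in_Ker(1)[OF one_closed one_closed assms(2)]] by simp
  moreover have "frag_of (a, \<one>\<^bsub>A\<^esub>) \<in> Ker"
    using add_subD(3)[OF W.B relator_in_Ker(2)[OF assms(1) one_closed one_closed]] by simp
  ultimately show ?thesis
    using add_subD(4)[OF W.B pow_in_Ker(1)[OF assms(1,2), of m]] add_subD(4)[OF W.B pow_in_Ker(2)[OF assms(1,2), of m]] assms(3)
    by force
qed

end

section \<open>The graded components of Gamma_p[z, z']\<close>

locale gamma_prime =
  fixes p :: nat
  assumes p: "prime p"
begin

sublocale T: add_quotient "carrier Gamma" "I_ideal p"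
  by standard (auto simp: Gamma_add_sub I_ideal_eq[OF p] I_set_add_sub, simp add: I_set_def)

abbreviation TA :: "rat poly set monoid" where "TA \<equiv> Gamma_p_add p"

lemma TA_eq: "TA = T.Q"
  by (rule Gamma_p_add_eq)

definition gam :: "nat \<Rightarrow> rat poly set" where "gam i = T.cls (divpow i)"

lemma divpow_class_gam: "divpow_class p i = gam i"
  by (simp add: divpow_class_eq gam_def T.cls_def)

lemma gam_carrier: "gam i \<in> carrier TA"
  unfolding TA_eq T.carrier_Q gam_def using divpow_in_Gamma by blast

text \<open>An integer lift of the i-th coordinate, read off a chosen representative. It is
  determined modulo p^(v(i)+1) for i > 0, and exactly for i = 0.\<close>

definition rc :: "nat \<Rightarrow> rat poly set \<Rightarrow> int" where
  "rc i a = gcoef i (SOME F. F \<in> a)"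

text \<open>Expresses that the i-th coordinate on Gamma_p is well defined modulo N. Elements of the
  ideal have coordinate 0 at z_0, so any N is allowed for i = 0.\<close>

definition kills :: "int \<Rightarrow> nat \<Rightarrow> bool" where
  "kills N i \<longleftrightarrow> i = 0 \<or> N dvd int (p ^ (multiplicity p i + 1))"

lemma rc_cls:
  assumes "F \<in> carrier Gamma" "kills N i" shows "N dvd rc i (T.cls F) - gcoef i F"
proof -
  define F' where "F' = (SOME F'. F' \<in> T.cls F)"
  have "F \<in> T.cls F" unfolding T.cls_eq using add_subD(1)[OF T.B] by (auto simp: image_iff intro: bexI[of _ 0])
  then have "F' \<in> T.cls F" unfolding F'_def by (rule someI)
  then have "F' \<in> (\<lambda>b. b + F) ` I_ideal p" by (simp only: T.cls_eq)
  then obtain b where b: "b \<in> I_set p" "F' = b + F" unfolding I_ideal_eq[OF p] by blast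
  then have "gcoef i F' = gcoef i b + gcoef i F" using assms(1) by (simp add: gcoef_add I_set_def)
  moreover have "N dvd gcoef i b"
  proof (cases "i = 0")
    case False
    then have "int (p ^ (multiplicity p i + 1)) dvd gcoef i b"
      using b(1) unfolding I_set_def by (metis (mono_tags, lifting) One_nat_def Suc_leI mem_Collect_eq neq0_conv)
    then show ?thesis using assms(2) False unfolding kills_def by (meson dvd_trans)
  qed (use b in \<open>simp add: I_set_def\<close>)
  ultimately show ?thesis by (simp add: rc_def F'_def)
qed

lemma rc_mult:
  assumes "a \<in> carrier TA" "a' \<in> carrier TA" "kills N i"
  shows "N dvd rc i (a \<otimes>\<^bsub>TA\<^esub> a') - rc i a - rc i a'"
proof -
  obtain F F' where F: "a = T.cls F" "a' = T.cls F'" "F \<in> carrier Gamma" "F' \<in> carrier Gamma"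
    using assms(1,2) unfolding TA_eq T.carrier_Q by blast
  have aa: "a \<otimes>\<^bsub>TA\<^esub> a' = T.cls (F + F')" unfolding TA_eq F(1,2) using F(3,4) by (rule T.mult_Q)
  have "N dvd (rc i (T.cls (F + F')) - gcoef i (F + F')) - (rc i a - gcoef i F) - (rc i a' - gcoef i F')"
    unfolding F(1,2)
    using rc_cls[OF add_subD(4)[OF Gamma_add_sub F(3,4)] assms(3)] rc_cls[OF F(3) assms(3)] rc_cls[OF F(4) assms(3)]
    by (rule dvd_diff[OF dvd_diff])
  also have "(rc i (T.cls (F + F')) - gcoef i (F + F')) - (rc i a - gcoef i F) - (rc i a' - gcoef i F') =
      rc i (T.cls (F + F')) - rc i a - rc i a'" by (simp add: gcoef_add[OF F(3,4)])
  finally show ?thesis unfolding aa .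
qed

sublocale W: tensor_square TA
  unfolding TA_eq by (rule tensor_square.intro) (rule T.comm_group_Q)

lemma gam_pow: assumes "i \<ge> 1" shows "gam i [^]\<^bsub>TA\<^esub> (p ^ (multiplicity p i + 1)) = \<one>\<^bsub>TA\<^esub>"
proof -
  have "((+) (divpow i) ^^ m) 0 = of_nat m * divpow i" for m
    by (induction m) (simp_all add: algebra_simps)
  moreover have "of_nat (p ^ (multiplicity p i + 1)) * divpow i \<in> I_ideal p"
  proof -
    have "{of_nat (p ^ (multiplicity p i + 1)) * divpow i | i. i \<ge> 1} \<subseteq> carrier Gamma"
      using Gamma_mult_closed[OF of_int_in_Gamma[of "int m" for m] divpow_in_Gamma] by (auto simp del: of_nat_power)
    from ring.genideal_self[OF ring_Gamma this] show ?thesis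
      unfolding I_ideal_def using assms by blast
  qed
  ultimately show ?thesis
    unfolding TA_eq gam_def T.pow_Q[OF divpow_in_Gamma, THEN conjunct1] T.cls_eq_one_iff by metis
qed

lemma kills_dick_mult:
  assumes "(i, j) \<noteq> (0, 0)"
  shows "kills (int (p ^ Suc (dick_mult p (i, j)))) i" "kills (int (p ^ Suc (dick_mult p (i, j)))) j"
proof -
  have le: "k > 0 \<Longrightarrow> p ^ dick_mult p (i, j) dvd k \<Longrightarrow> dick_mult p (i, j) \<le> multiplicity p k" for k
    using p by (intro multiplicity_geI) (auto simp: not_prime_unit)
  have "k > 0 \<Longrightarrow> p ^ dick_mult p (i, j) dvd k \<Longrightarrow> p ^ Suc (dick_mult p (i, j)) dvd p ^ (multiplicity p k + 1)" for k
    using le[of k] by (intro le_imp_power_dvd) simp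
  then show "kills (int (p ^ Suc (dick_mult p (i, j)))) i" "kills (int (p ^ Suc (dick_mult p (i, j)))) j"
    unfolding kills_def int_dvd_int_iff using dick_mult_dvd by blast+
qed

text \<open>m is the smaller of v(i) and v(j), with v(0) infinite, so the factor that attains it is
  annihilated by p^(m+1).\<close>

lemma torsion_gam:
  assumes "(i, j) \<noteq> (0, 0)"
  shows "gam i [^]\<^bsub>TA\<^esub> (p ^ Suc (dick_mult p (i, j))) = \<one>\<^bsub>TA\<^esub> \<or> gam j [^]\<^bsub>TA\<^esub> (p ^ Suc (dick_mult p (i, j))) = \<one>\<^bsub>TA\<^esub>"
proof -
  have *: "gam k [^]\<^bsub>TA\<^esub> (p ^ Suc (dick_mult p (i, j))) = \<one>\<^bsub>TA\<^esub>"
    if "k > 0" "p ^ multiplicity p k dvd i" "p ^ multiplicity p k dvd j" for k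
  proof -
    have "multiplicity p k \<le> dick_mult p (i, j)" using dick_mult_ge[OF p that(2,3) assms] .
    then have "p ^ (multiplicity p k + 1) dvd p ^ Suc (dick_mult p (i, j))" by (intro le_imp_power_dvd) simp
    then obtain m where m: "p ^ Suc (dick_mult p (i, j)) = p ^ (multiplicity p k + 1) * m" by (rule dvdE)
    have "gam k [^]\<^bsub>TA\<^esub> (p ^ (multiplicity p k + 1) * m) = (gam k [^]\<^bsub>TA\<^esub> (p ^ (multiplicity p k + 1))) [^]\<^bsub>TA\<^esub> m"
      by (rule W.nat_pow_pow[symmetric]) (rule gam_carrier)
    then show ?thesis unfolding m using that(1) gam_pow[of k] W.nat_pow_one by simp
  qed
  show ?thesis
  proof (cases "i = 0 \<or> j = 0")
    case True
    then show ?thesis using assms *[of i] *[of j] multiplicity_dvd[of p i] multiplicity_dvd[of p j] by auto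
  next
    case False
    have "multiplicity p i \<le> multiplicity p j \<or> multiplicity p j \<le> multiplicity p i" by linarith
    then show ?thesis
      using False *[of i] *[of j] multiplicity_dvd[of p i] multiplicity_dvd[of p j]
        multiplicity_dvd'[of "multiplicity p i" p j] multiplicity_dvd'[of "multiplicity p j" p i] by auto
  qed
qed

definition mono_tensor :: "nat \<times> nat \<Rightarrow> (rat poly set \<times> rat poly set) \<Rightarrow>\<^sub>0 int" where
  "mono_tensor = (\<lambda>(i, j). frag_of (gam i, gam j))"

lemma mono_tensor_Fc: "mono_tensor k \<in> W.Fc"
  using gam_carrier by (cases k) (simp add: mono_tensor_def)

lemma Gamma_p2_eq: "Gamma_p2 p = W.W.Q"
  unfolding Gamma_p2_def by (rule W.tensor_eq)

lemma frag_cmul_Fc: "w \<in> W.Fc \<Longrightarrow> frag_cmul m w \<in> W.Fc"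
  using keys_cmul[of m w] by blast

lemmas sum_Fc = add_sub_sum[OF add_sub_keys[of W.S]]
lemmas sum_Ker = add_sub_sum[OF W.W.B]

context
  fixes n :: nat
begin

definition idx :: "(nat \<times> nat) set" where "idx = (if n > 0 then dick_idx p n else {})"

definition tensor_comb :: "(nat \<times> nat \<Rightarrow> int) \<Rightarrow> (rat poly set \<times> rat poly set) \<Rightarrow>\<^sub>0 int" where
  "tensor_comb c = (\<Sum>k\<in>idx. frag_cmul (c k) (mono_tensor k))"

lemma finite_idx: "finite idx"
  by (simp add: idx_def finite_dick_idx[OF p])

lemma idx_nonzero: "(i, j) \<in> idx \<Longrightarrow> (i, j) \<noteq> (0, 0)"
  unfolding idx_def using dick_deg_eq_0[of i j p n] by (simp split: if_splits)

lemma tensor_comb_Fc: "tensor_comb c \<in> W.Fc"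
  unfolding tensor_comb_def by (intro sum_Fc frag_cmul_Fc mono_tensor_Fc)

text \<open>Torsion of the factors gives one direction. For the other, the product of the i-th and
  the j-th coordinate is a functional modulo N = p^(m+1) with value 1 at z_i tensor z_j and 0 at the
  other monomials, so it isolates \<open>c (i, j)\<close>.\<close>

lemma tensor_comb_Ker_iff: "tensor_comb c \<in> W.Ker \<longleftrightarrow> c \<in> dick_rel p n"
proof
  assume c: "c \<in> dick_rel p n"
  show "tensor_comb c \<in> W.Ker"
    unfolding tensor_comb_def
  proof (rule sum_Ker)
    fix k assume k: "k \<in> idx"
    obtain i j where ij: "k = (i, j)" by force
    have "int (p ^ Suc (dick_mult p k)) dvd c k"
      using c k unfolding dick_rel_def idx_def by (simp del: of_nat_power power_Suc split: if_splits)
    then obtain m where m: "c k = m * int (p ^ Suc (dick_mult p k))" by (metis dvdE mult.commute)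
    have "frag_cmul (int (p ^ Suc (dick_mult p k))) (mono_tensor k) \<in> W.Ker"
      unfolding mono_tensor_def ij prod.case
      by (rule W.torsion_in_Ker[OF gam_carrier gam_carrier torsion_gam]) (use idx_nonzero k ij in blast)
    then have "frag_cmul m (frag_cmul (int (p ^ Suc (dick_mult p k))) (mono_tensor k)) \<in> W.Ker"
      by (rule add_sub_frag_cmul[OF W.W.B])
    then show "frag_cmul (c k) (mono_tensor k) \<in> W.Ker" by (simp only: m frag_cmul_cmul)
  qed
next
  assume K: "tensor_comb c \<in> W.Ker"
  have "int (p ^ Suc (dick_mult p k)) dvd c k" if k: "k \<in> idx" for k
  proof -
    obtain i j where ij: "k = (i, j)" by force
    define N where "N = int (p ^ Suc (dick_mult p k))"
    have kills: "kills N i" "kills N j" using kills_dick_mult[OF idx_nonzero] k unfolding N_def ij by blast+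
    obtain h where h: "\<And>x y. x \<in> W.Fc \<Longrightarrow> y \<in> W.Fc \<Longrightarrow> h (x + y) = h x + h y"
      "\<And>a b. a \<in> carrier TA \<Longrightarrow> b \<in> carrier TA \<Longrightarrow> h (frag_of (a, b)) = rc i a * rc j b"
      "\<And>w. w \<in> W.Ker \<Longrightarrow> N dvd h w"
      by (rule W.tensor_functional[of N "rc i" "rc j", OF rc_mult[OF _ _ kills(1)] rc_mult[OF _ _ kills(2)]]) blast+
    have h0: "h 0 = 0" using h(1)[of 0 0] by simp
    have hcmul_nat: "h (frag_cmul (int m) w) = int m * h w" if "w \<in> W.Fc" for m w
    proof (induction m)
      case (Suc m)
      have "frag_cmul (int (Suc m)) w = w + frag_cmul (int m) w" by (simp add: frag_cmul_distrib)
      then show ?case using h(1)[OF that frag_cmul_Fc[OF that]] Suc by (simp add: distrib_right)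
    qed (simp add: h0)
    have hneg: "h (- w) = - h w" if "w \<in> W.Fc" for w
      using h(1)[OF that add_subD(3)[OF add_sub_keys that]] h0 by simp
    have hcmul: "h (frag_cmul m w) = m * h w" if "w \<in> W.Fc" for m w
    proof (cases m rule: int_cases2)
      case (nonneg l)
      then show ?thesis using hcmul_nat[OF that] by simp
    next
      case (nonpos l)
      then have "frag_cmul m w = - frag_cmul (int l) w" by simp
      then show ?thesis using hneg[OF frag_cmul_Fc[OF that]] hcmul_nat[OF that] nonpos by simp
    qed
    have hsum: "h (\<Sum>k\<in>K. f k) = (\<Sum>k\<in>K. h (f k))" if "\<And>k. f k \<in> W.Fc" for f and K :: "(nat \<times> nat) set"
    proof (induction K rule: infinite_finite_induct)
      case (insert x F)
      then show ?case using h(1)[OF that[of x] sum_Fc[of F f, OF that]] by simp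
    qed (simp_all add: h0)
    have rcg: "N dvd rc l (gam m) - (if l = m then 1 else 0)" if "kills N l" for l m
      using rc_cls[OF divpow_in_Gamma that] by (simp add: gam_def gcoef_divpow)
    have hmono: "N dvd h (mono_tensor l) - (if l = k then 1 else 0)" for l
    proof -
      obtain i' j' where l: "l = (i', j')" by force
      have "N dvd (rc i (gam i') - (if i = i' then 1 else 0)) * rc j (gam j') +
          (if i = i' then 1 else 0) * (rc j (gam j') - (if j = j' then 1 else 0))"
        using rcg[OF kills(1)] rcg[OF kills(2)] by (intro dvd_add dvd_mult dvd_mult2)
      also have "\<dots> = h (mono_tensor l) - (if l = k then 1 else 0)"
        using h(2)[OF gam_carrier gam_carrier] by (auto simp: l ij mono_tensor_def algebra_simps)
      finally show ?thesis .
    qed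
    have "h (tensor_comb c) = (\<Sum>l\<in>idx. c l * h (mono_tensor l))"
      unfolding tensor_comb_def by (simp only: hsum[OF frag_cmul_Fc[OF mono_tensor_Fc]] hcmul[OF mono_tensor_Fc])
    also have "\<dots> = (\<Sum>l\<in>idx. c l * (h (mono_tensor l) - (if l = k then 1 else 0))) +
        (\<Sum>l\<in>idx. if l = k then c k else 0)"
      unfolding sum.distrib[symmetric] by (intro sum.cong) (auto simp: algebra_simps)
    also have "(\<Sum>l\<in>idx. if l = k then c k else 0) = c k" using k finite_idx by simp
    finally have "N dvd (\<Sum>l\<in>idx. c l * (h (mono_tensor l) - (if l = k then 1 else 0))) + c k"
      using h(3)[OF K] by simp
    moreover have "N dvd (\<Sum>l\<in>idx. c l * (h (mono_tensor l) - (if l = k then 1 else 0)))"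
      by (intro dvd_sum dvd_mult hmono)
    ultimately show ?thesis unfolding N_def by (simp only: dvd_add_right_iff)
  qed
  then show "c \<in> dick_rel p n" unfolding dick_rel_def idx_def by auto
qed

lemma degree_component_iso:
  "Gamma_p2_plus_deg p (2 * (p + 1)) (2 * p * (p - 1)) n \<cong> add_grp UNIV Mod dick_rel p n"
proof -
  have idx: "idx = {(i, j). i * (2 * (p + 1)) + j * (2 * p * (p - 1)) = n \<and> n > 0}"
    by (auto simp: idx_def dick_idx_def dick_deg_def)
  have gens: "{pure_tensor TA TA (divpow_class p i) (divpow_class p j) | i j.
      i * (2 * (p + 1)) + j * (2 * p * (p - 1)) = n \<and> n > 0} = W.W.cls ` mono_tensor ` idx"
    unfolding W.pure_tensor_eq divpow_class_gam mono_tensor_def idx image_image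
    by (simp only: image_case_prod_Collect)
  have "restrict_group W.W.Q (generate W.W.Q (W.W.cls ` mono_tensor ` idx)) \<cong> add_grp UNIV Mod dick_rel p n"
  proof (rule W.W.generate_cls_iso)
    show "tensor_comb (x + y) = tensor_comb x + tensor_comb y" for x y
      by (simp add: tensor_comb_def frag_cmul_distrib sum.distrib)
    show "mono_tensor ` idx \<subseteq> range tensor_comb"
    proof
      fix a assume "a \<in> mono_tensor ` idx"
      then obtain k where k: "k \<in> idx" "a = mono_tensor k" by blast
      have "tensor_comb (\<lambda>l. if l = k then 1 else 0) = (\<Sum>l\<in>idx. if l = k then mono_tensor k else 0)"
        unfolding tensor_comb_def by (intro sum.cong) auto
      also have "\<dots> = a" using k finite_idx by simp
      finally show "a \<in> range tensor_comb" by (metis rangeI)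
    qed
    show "range tensor_comb \<subseteq> P" if "add_sub P" "mono_tensor ` idx \<subseteq> P" for P
      unfolding tensor_comb_def using that by (auto intro!: add_sub_sum add_sub_frag_cmul)
  qed (rule tensor_comb_Fc, rule tensor_comb_Ker_iff)
  then show ?thesis unfolding Gamma_p2_plus_deg_def gens Gamma_p2_eq .
qed

end

end

section \<open>The braid group and its action\<close>

lemma (in group) cancel_l: "x \<in> carrier G \<Longrightarrow> y \<in> carrier G \<Longrightarrow> inv x \<otimes> (x \<otimes> y) = y"
  and cancel_r: "x \<in> carrier G \<Longrightarrow> y \<in> carrier G \<Longrightarrow> x \<otimes> (inv x \<otimes> y) = y"
  by (simp_all flip: m_assoc)

lemma (in group) inv_commute:
  assumes "x \<in> carrier G" "y \<in> carrier G" "x \<otimes> y = y \<otimes> x" shows "inv x \<otimes> y = y \<otimes> inv x"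
proof -
  have "inv x \<otimes> y = inv x \<otimes> (y \<otimes> x) \<otimes> inv x" using assms(1,2) by (simp add: m_assoc)
  also have "\<dots> = inv x \<otimes> (x \<otimes> (y \<otimes> inv x))" using assms by (simp add: m_assoc flip: assms(3))
  finally show ?thesis using assms(1,2) by (simp add: cancel_l)
qed

lemma (in group) subgroup_centralizer:
  assumes "x \<in> carrier G" shows "subgroup {g \<in> carrier G. g \<otimes> x = x \<otimes> g} G"
proof (rule subgroupI)
  fix g h assume "g \<in> {g \<in> carrier G. g \<otimes> x = x \<otimes> g}" "h \<in> {g \<in> carrier G. g \<otimes> x = x \<otimes> g}"
  then have gh: "g \<in> carrier G" "h \<in> carrier G" "g \<otimes> x = x \<otimes> g" "h \<otimes> x = x \<otimes> h" by auto
  have "g \<otimes> h \<otimes> x = g \<otimes> x \<otimes> h" using gh(1,2,4) assms by (simp add: m_assoc)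
  also have "\<dots> = x \<otimes> (g \<otimes> h)" using gh(1,2) assms unfolding gh(3) by (simp add: m_assoc)
  finally show "g \<otimes> h \<in> {g \<in> carrier G. g \<otimes> x = x \<otimes> g}" using gh by simp
qed (use assms inv_commute in auto)

text \<open>Both B_3 and SL_2(Z) are instances, so the generators u and v and the central element c
  are available in either group.\<close>

locale braid = group G for G (structure) +
  fixes a b :: 'a
  assumes a: "a \<in> carrier G" and b: "b \<in> carrier G"
    and braid_rel: "a \<otimes> b \<otimes> a = b \<otimes> a \<otimes> b"
    and gen: "generate G {a, b} = carrier G"
begin

definition u :: 'a where "u = a \<otimes> b \<otimes> a"
definition v :: 'a where "v = a \<otimes> b"
definition c :: 'a where "c = u \<otimes> u"

lemma uvc [simp]: "u \<in> carrier G" "v \<in> carrier G" "c \<in> carrier G" "a \<in> carrier G" "b \<in> carrier G"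
  using a b by (simp_all add: u_def v_def c_def)

lemma b_v: "b \<otimes> v = u"
  using braid_rel by (simp add: u_def v_def m_assoc)

lemma v_a: "v \<otimes> a = u"
  by (simp add: u_def v_def)

lemma inv_a_v: "inv a \<otimes> v = b"
  by (simp add: v_def cancel_l)

lemma a_eq: "a = inv v \<otimes> u"
  using cancel_l[of v a] v_a by simp

lemma b_eq: "b = u \<otimes> inv v"
  by (simp add: m_assoc flip: b_v)

lemma v_cube: "v \<otimes> v \<otimes> v = c"
proof -
  have "v \<otimes> v \<otimes> v = (a \<otimes> b \<otimes> a) \<otimes> (b \<otimes> a \<otimes> b)" by (simp add: v_def m_assoc)
  then show ?thesis by (simp add: c_def u_def braid_rel)
qed

lemma c_u: "c \<otimes> u = u \<otimes> c"
  by (simp add: c_def m_assoc)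

lemma c_v: "c \<otimes> v = v \<otimes> c"
  by (simp add: m_assoc flip: v_cube)

lemma u_v: "u \<otimes> v = c \<otimes> inv a"
proof -
  have "c \<otimes> inv a = u \<otimes> (v \<otimes> a) \<otimes> inv a" by (simp only: v_a c_def)
  then show ?thesis by (simp add: m_assoc)
qed

lemma inv_eqs: "inv u = inv c \<otimes> u" "inv v = inv c \<otimes> (v \<otimes> v)"
proof -
  show "inv u = inv c \<otimes> u" by (rule inv_equality) (simp_all add: m_assoc flip: c_def)
  have "inv c \<otimes> (v \<otimes> v) \<otimes> v = inv c \<otimes> (v \<otimes> v \<otimes> v)" by (simp add: m_assoc)
  then show "inv v = inv c \<otimes> (v \<otimes> v)" by (intro inv_equality) (simp_all add: v_cube)
qed

text \<open>Under \<open>lam\<close> the elements a^(-1) and b of B_3 become the two elementary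
  matrices with nonnegative entries. Products of these have no cancellation, which detects
  nontrivial words.\<close>

inductive_set pos_monoid :: "'a set" where
  one: "\<one> \<in> pos_monoid"
| inv_a: "w \<in> pos_monoid \<Longrightarrow> w \<otimes> inv a \<in> pos_monoid"
| b: "w \<in> pos_monoid \<Longrightarrow> w \<otimes> b \<in> pos_monoid"

lemma pos_monoid_carrier: "w \<in> pos_monoid \<Longrightarrow> w \<in> carrier G"
  by (induction rule: pos_monoid.induct) simp_all

text \<open>Right multiplication by \<open>u\<close> and \<open>v\<close> acts on the normal forms \<open>c\<^sup>k v\<^sup>i w u\<^sup>e\<close> because
  \<open>a\<^sup>-\<^sup>1 v = b\<close>, \<open>b v = u\<close> and \<open>u v = c a\<^sup>-\<^sup>1\<close>.\<close>

definition nform :: "'a set" where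
  "nform = {c [^] (k::int) \<otimes> (x \<otimes> (w \<otimes> y)) | k x w y. x \<in> {\<one>, v, v \<otimes> v} \<and> w \<in> pos_monoid \<and> y \<in> {\<one>, u}}"

lemma nformI: "x \<in> {\<one>, v, v \<otimes> v} \<Longrightarrow> w \<in> pos_monoid \<Longrightarrow> y \<in> {\<one>, u} \<Longrightarrow>
  c [^] (k::int) \<otimes> (x \<otimes> (w \<otimes> y)) \<in> nform"
  unfolding nform_def by blast

lemma nform_carrier: "g \<in> nform \<Longrightarrow> g \<in> carrier G"
  unfolding nform_def by (auto simp: pos_monoid_carrier)

lemma c_int_pow_Suc: "c [^] (k + 1 :: int) = c [^] k \<otimes> c" "c [^] (k - 1 :: int) = c [^] k \<otimes> inv c"
  using int_pow_mult[of c k 1] int_pow_diff[of c k 1] by simp_all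

lemma c_comm: assumes "g \<in> carrier G" shows "c \<otimes> g = g \<otimes> c"
proof -
  interpret C: subgroup "{g \<in> carrier G. g \<otimes> c = c \<otimes> g}" G by (rule subgroup_centralizer) simp
  have uv: "u \<in> {g \<in> carrier G. g \<otimes> c = c \<otimes> g}" "v \<in> {g \<in> carrier G. g \<otimes> c = c \<otimes> g}"
    by (rule CollectI, rule conjI, rule uvc, rule c_u[symmetric], rule CollectI, rule conjI, rule uvc, rule c_v[symmetric])
  have "a \<in> {g \<in> carrier G. g \<otimes> c = c \<otimes> g}" 
    using C.m_closed[OF C.m_inv_closed[OF uv(2)] uv(1)] by (simp only: a_eq[symmetric])
  moreover have "b \<in> {g \<in> carrier G. g \<otimes> c = c \<otimes> g}" 
    using C.m_closed[OF uv(1) C.m_inv_closed[OF uv(2)]] by (simp only: b_eq[symmetric])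
  ultimately have "generate G {a, b} \<subseteq> {g \<in> carrier G. g \<otimes> c = c \<otimes> g}"
    by (intro generate_subgroup_incl C.subgroup_axioms) blast
  then have "g \<otimes> c = c \<otimes> g" using assms unfolding gen by blast
  then show ?thesis by (rule HOL.sym)
qed

lemma inv_c_comm: "g \<in> carrier G \<Longrightarrow> inv c \<otimes> g = g \<otimes> inv c"
  by (rule inv_commute) (simp_all add: c_comm)

lemma nform_c: assumes "g \<in> nform" shows "g \<otimes> c \<in> nform" "g \<otimes> inv c \<in> nform"
proof -
  obtain k :: int and x w y where g: "g = c [^] k \<otimes> (x \<otimes> (w \<otimes> y))"
    and xwy: "x \<in> {\<one>, v, v \<otimes> v}" "w \<in> pos_monoid" "y \<in> {\<one>, u}"
    using assms unfolding nform_def by blast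
  define h where "h = x \<otimes> (w \<otimes> y)"
  have h: "h \<in> carrier G" using xwy pos_monoid_carrier by (auto simp: h_def)
  have "g \<otimes> c = c [^] (k + 1) \<otimes> h"
    unfolding g h_def[symmetric] c_int_pow_Suc using h c_comm[OF h] by (simp add: m_assoc)
  then show "g \<otimes> c \<in> nform" unfolding h_def using nformI[OF xwy] by metis
  have "g \<otimes> inv c = c [^] (k - 1) \<otimes> h"
    unfolding g h_def[symmetric] c_int_pow_Suc using h inv_c_comm[OF h] by (simp add: m_assoc)
  then show "g \<otimes> inv c \<in> nform" unfolding h_def using nformI[OF xwy] by metis
qed

lemma nform_u: assumes "g \<in> nform" shows "g \<otimes> u \<in> nform"
proof -
  obtain k :: int and x w y where g: "g = c [^] k \<otimes> (x \<otimes> (w \<otimes> y))"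
    and xwy: "x \<in> {\<one>, v, v \<otimes> v}" "w \<in> pos_monoid" "y \<in> {\<one>, u}"
    using assms unfolding nform_def by blast
  have carr: "x \<in> carrier G" "w \<in> carrier G" using xwy pos_monoid_carrier by auto
  show ?thesis
  proof (cases "y = u")
    case True
    have "g \<otimes> u = c [^] k \<otimes> (x \<otimes> (w \<otimes> \<one>)) \<otimes> c"
      unfolding g True c_def using carr by (simp add: m_assoc flip: c_def)
    then show ?thesis using nform_c(1)[OF nformI[OF xwy(1,2), of \<one> k]] by simp
  next
    case False
    then have "g \<otimes> u = c [^] k \<otimes> (x \<otimes> (w \<otimes> u))" unfolding g using xwy carr by (auto simp: m_assoc)
    then show ?thesis using nformI[OF xwy(1,2), of u k] by simp
  qed
qed

lemma nform_v: assumes "g \<in> nform" shows "g \<otimes> v \<in> nform"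
proof -
  obtain k :: int and x w y where g: "g = c [^] k \<otimes> (x \<otimes> (w \<otimes> y))"
    and xwy: "x \<in> {\<one>, v, v \<otimes> v}" "w \<in> pos_monoid" "y \<in> {\<one>, u}"
    using assms unfolding nform_def by blast
  have carr: "x \<in> carrier G" "w \<in> carrier G" using xwy pos_monoid_carrier by auto
  show ?thesis
  proof (cases "y = u")
    case True
    have "g \<otimes> v = c [^] k \<otimes> (x \<otimes> (w \<otimes> (u \<otimes> v)))"
      unfolding g True using carr by (simp add: m_assoc)
    also have "u \<otimes> v = inv a \<otimes> c" unfolding u_v by (rule c_comm) simp
    also have "c [^] k \<otimes> (x \<otimes> (w \<otimes> (inv a \<otimes> c))) = c [^] k \<otimes> (x \<otimes> ((w \<otimes> inv a) \<otimes> \<one>)) \<otimes> c"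
      using carr by (simp add: m_assoc)
    finally show ?thesis
      using nform_c(1)[OF nformI[OF xwy(1) pos_monoid.inv_a[OF xwy(2)], of \<one> k]] by simp
  next
    case False
    then have g': "g = c [^] k \<otimes> (x \<otimes> w)" using xwy carr g by simp
    from xwy(2) show ?thesis
    proof (cases rule: pos_monoid.cases)
      case one
      then have gx: "g \<otimes> v = c [^] k \<otimes> (x \<otimes> v)" unfolding g' using carr by (simp add: m_assoc)
      consider "x = \<one>" | "x = v" | "x = v \<otimes> v" using xwy(1) by blast
      then show ?thesis
      proof cases
        case 1
        then show ?thesis using gx nformI[of v \<one> \<one> k] pos_monoid.one by simp
      next
        case 2
        then show ?thesis using gx nformI[of "v \<otimes> v" \<one> \<one> k] pos_monoid.one by simp
      next
        case 3
        then show ?thesis using gx nform_c(1)[OF nformI[of \<one> \<one> \<one> k]] pos_monoid.one by (simp add: v_cube)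
      qed
    next
      case (inv_a w')
      have w': "w' \<in> carrier G" using inv_a pos_monoid_carrier by blast
      have "g \<otimes> v = c [^] k \<otimes> (x \<otimes> (w' \<otimes> (inv a \<otimes> v)))" unfolding g' inv_a using carr w' by (simp add: m_assoc)
      then have "g \<otimes> v = c [^] k \<otimes> (x \<otimes> ((w' \<otimes> b) \<otimes> \<one>))" unfolding inv_a_v using w' by simp
      then show ?thesis using nformI[OF xwy(1) pos_monoid.b[OF inv_a(2)], of \<one> k] by simp
    next
      case (b w')
      have w': "w' \<in> carrier G" using b pos_monoid_carrier by blast
      have "g \<otimes> v = c [^] k \<otimes> (x \<otimes> (w' \<otimes> (b \<otimes> v)))" unfolding g' b using carr w' by (simp add: m_assoc)
      then show ?thesis unfolding b_v using nformI[OF xwy(1) b(2), of u k] by simp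
    qed
  qed
qed

text \<open>The elements that preserve \<open>nform\<close> under right multiplication, together
  with their inverses, form a subgroup. It contains u and v, hence the generators.\<close>

lemma nform_all: "g \<in> carrier G \<Longrightarrow> g \<in> nform"
proof -
  define H where "H = {x \<in> carrier G. \<forall>g\<in>nform. g \<otimes> x \<in> nform \<and> g \<otimes> inv x \<in> nform}"
  have "subgroup H G"
  proof (rule subgroupI)
    show "H \<noteq> {}" using nform_carrier unfolding H_def by (auto intro!: exI[of _ \<one>])
    fix x y assume "x \<in> H" "y \<in> H"
    then show "x \<otimes> y \<in> H" using nform_carrier
      unfolding H_def by (auto simp: inv_mult_group simp flip: m_assoc)
  qed (auto simp: H_def)
  \<comment> \<open>u^(-1) = c^(-1) u and v^(-1) = c^(-1) v^2 reduce the inverses to u, v and the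
    central c.\<close>
  moreover have "u \<in> H"
    unfolding H_def using nform_u nform_c nform_carrier inv_c_comm[of u] inv_eqs(1)
    by (auto simp flip: m_assoc)
  moreover have "v \<in> H"
    unfolding H_def using nform_v nform_c nform_carrier inv_c_comm[of "v \<otimes> v"] inv_eqs(2)
    by (auto simp flip: m_assoc)
  ultimately have "inv v \<otimes> u \<in> H" "u \<otimes> inv v \<in> H"
    using subgroup.m_closed[of H G] subgroup.m_inv_closed[of H G] by blast+
  then have "a \<in> H" "b \<in> H" by (simp_all only: a_eq[symmetric] b_eq[symmetric])
  then have "generate G {a, b} \<subseteq> H" using \<open>subgroup H G\<close> by (intro generate_subgroup_incl) auto
  moreover have "\<one> \<in> nform" using nformI[of \<one> \<one> \<one> 0] pos_monoid.one by simp
  moreover assume "g \<in> carrier G"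
  ultimately have "\<one> \<otimes> g \<in> nform" unfolding gen H_def by blast
  then show "g \<in> nform" using \<open>g \<in> carrier G\<close> by simp
qed

end

section \<open>The kernel and the image of the map from B_3 to SL_2(Z)\<close>

lemma mat2_mult: "mat2 a b c d ** mat2 a' b' c' d' = mat2 (a * a' + b * c') (a * b' + b * d') (c * a' + d * c') (c * b' + d * d')"
  by (simp add: mat2_def matrix_matrix_mult_def vec_eq_iff forall_2 sum_2)

lemma mat2_eta: "mat2 (A$1$1) (A$1$2) (A$2$1) (A$2$2) = A"
  by (simp add: mat2_def vec_eq_iff forall_2)

lemma mat2_one: "mat 1 = mat2 1 0 0 1"
  by (simp add: mat2_def vec_eq_iff forall_2 mat_def)

lemma mat2_eq_iff: "mat2 a b c d = mat2 a' b' c' d' \<longleftrightarrow> a = a' \<and> b = b' \<and> c = c' \<and> d = d'"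
  by (simp add: mat2_def vec_eq_iff forall_2)

lemma mat2_inv: "det A = 1 \<Longrightarrow> inv\<^bsub>SL2Z\<^esub> A = mat2 (A$2$2) (- A$1$2) (- A$2$1) (A$1$1)"
proof (rule group.inv_equality[OF group_SL2Z])
  assume A: "det A = 1"
  then have "A$1$1 * A$2$2 - A$1$2 * A$2$1 = 1" by (simp add: det_2)
  then show "mat2 (A$2$2) (- A$1$2) (- A$2$1) (A$1$1) \<otimes>\<^bsub>SL2Z\<^esub> A = \<one>\<^bsub>SL2Z\<^esub>"
    by (subst mat2_eta[of A, symmetric]) (simp add: SL2Z_def mat2_mult mat2_one mat2_eq_iff mult.commute)
  show "A \<in> carrier SL2Z" "mat2 (A$2$2) (- A$1$2) (- A$2$1) (A$1$1) \<in> carrier SL2Z"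
    using A by (simp_all add: SL2Z_def det_mat2 det_2 mult.commute)
qed

lemma SL2Z_simps [simp]: "x \<otimes>\<^bsub>SL2Z\<^esub> y = x ** y" "\<one>\<^bsub>SL2Z\<^esub> = mat2 1 0 0 1"
  "x \<in> carrier SL2Z \<longleftrightarrow> det x = 1"
  by (simp_all add: SL2Z_def mat2_one)

lemma inv_mat2 [simp]: "a * d - b * c = 1 \<Longrightarrow> inv\<^bsub>SL2Z\<^esub> mat2 a b c d = mat2 d (- b) (- c) a"
  by (subst mat2_inv) (simp_all add: det_mat2)

definition braid_rels :: "(braid_gen word \<times> braid_gen word) set" where
  "braid_rels = {([(S1, True), (S2, True), (S1, True)], [(S2, True), (S1, True), (S2, True)])}"

definition sa :: "braid_gen word set" where "sa = pres_class braid_rels [(S1, True)]"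
definition sb :: "braid_gen word set" where "sb = pres_class braid_rels [(S2, True)]"

lemma B3_eq: "B3 = presented_group braid_rels"
  by (simp add: B3_def braid_rels_def)

lemma group_B3: "group B3"
  unfolding B3_eq by (rule group_presented_group)

lemma sab_carrier: "sa \<in> carrier B3" "sb \<in> carrier B3"
  by (simp_all add: B3_eq presented_group_carrier sa_def sb_def)

lemma B3_generate: "generate B3 {sa, sb} = carrier B3"
proof
  interpret group B3 by (rule group_B3)
  have sub: "subgroup (generate B3 {sa, sb}) B3" by (rule generate_is_subgroup) (simp add: sab_carrier)
  show "generate B3 {sa, sb} \<subseteq> carrier B3" using sub by (rule subgroup.subset)
  have single: "pres_class braid_rels [(x, e)] \<in> generate B3 {sa, sb}" for x e
  proof -
    define t where "t = pres_class braid_rels [(x, True)]"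
    have t: "t \<in> {sa, sb}" by (cases x) (simp_all add: t_def sa_def sb_def)
    have "pres_class braid_rels [(x, False)] = inv\<^bsub>B3\<^esub> t"
    proof (rule inv_equality[symmetric])
      show "pres_class braid_rels [(x, False)] \<otimes>\<^bsub>B3\<^esub> t = \<one>\<^bsub>B3\<^esub>"
        using pres_cong.cancel[of braid_rels "[]" x False "[]"]
        by (simp add: t_def B3_eq presented_group_mult presented_group_one pres_class_eq_iff)
    qed (simp_all add: t_def B3_eq presented_group_carrier)
    then show ?thesis using generate.incl[OF t, of B3] generate.inv[OF t, of B3] by (cases e) (simp_all add: t_def)
  qed
  have "pres_class braid_rels w \<in> generate B3 {sa, sb}" for w
  proof (induction w)
    case Nil
    then show ?case using generate.one[of B3] by (simp add: B3_eq presented_group_one)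
  next
    case (Cons l w)
    obtain x e where l: "l = (x, e)" by force
    have "pres_class braid_rels (l # w) = pres_class braid_rels [(x, e)] \<otimes>\<^bsub>B3\<^esub> pres_class braid_rels w"
      by (simp add: B3_eq presented_group_mult l)
    then show ?case using subgroup.m_closed[OF sub single Cons] by simp
  qed
  then show "carrier B3 \<subseteq> generate B3 {sa, sb}" by (auto simp: B3_eq presented_group_carrier)
qed

interpretation B3: braid B3 sa sb
proof (rule braid.intro[OF group_B3], unfold_locales)
  have "pres_cong braid_rels [(S1, True), (S2, True), (S1, True)] [(S2, True), (S1, True), (S2, True)]"
    using pres_cong.rel[of "[(S1, True), (S2, True), (S1, True)]" "[(S2, True), (S1, True), (S2, True)]" braid_rels "[]" "[]"]
    by (simp add: braid_rels_def)
  then show "sa \<otimes>\<^bsub>B3\<^esub> sb \<otimes>\<^bsub>B3\<^esub> sa = sb \<otimes>\<^bsub>B3\<^esub> sa \<otimes>\<^bsub>B3\<^esub> sb"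
    by (simp add: sa_def sb_def B3_eq presented_group_mult pres_class_eq_iff)
qed (rule sab_carrier B3_generate)+

lemma lam_sab: "lam sa = mat2 1 0 (-1) 1" "lam sb = mat2 1 1 0 1"
  using lam_generator[of S1] lam_generator[of S2]
  by (simp_all add: sa_def sb_def braid_rels_def mat2_def)

interpretation lam: group_hom B3 SL2Z lam
  using group_B3 group_SL2Z lam_hom by (simp add: group_hom_def group_hom_axioms_def)

lemma lam_mult: "x \<in> carrier B3 \<Longrightarrow> y \<in> carrier B3 \<Longrightarrow> lam (x \<otimes>\<^bsub>B3\<^esub> y) = lam x ** lam y"
  using lam.hom_mult by (simp add: SL2Z_def)

lemma det_lam: "x \<in> carrier B3 \<Longrightarrow> det (lam x) = 1"
  using lam.hom_closed[of x] by (simp add: SL2Z_def)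

lemma lam_inv: "x \<in> carrier B3 \<Longrightarrow> lam (inv\<^bsub>B3\<^esub> x) = mat2 (lam x$2$2) (- lam x$1$2) (- lam x$2$1) (lam x$1$1)"
  using mat2_inv[OF det_lam] by simp

lemma lam_one: "lam \<one>\<^bsub>B3\<^esub> = mat2 1 0 0 1"
  using lam.hom_one by (simp add: SL2Z_def mat2_one)

lemma lam_uvc: "lam B3.u = mat2 0 1 (-1) 0" "lam B3.v = mat2 1 1 (-1) 0" "lam B3.c = mat2 (-1) 0 0 (-1)"
  by (simp_all add: B3.u_def B3.v_def B3.c_def lam_mult lam_sab mat2_mult)

text \<open>Multiplication by either elementary matrix keeps the entries nonnegative and decreases
  none of them, so a nonempty product retains a positive entry off the diagonal.\<close>

lemma lam_pos_monoid:
  assumes "w \<in> B3.pos_monoid"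
  shows "lam w $ 1 $ 1 \<ge> 1 \<and> lam w $ 2 $ 2 \<ge> 1 \<and> lam w $ 1 $ 2 \<ge> 0 \<and> lam w $ 2 $ 1 \<ge> 0 \<and>
    (w = \<one>\<^bsub>B3\<^esub> \<or> lam w $ 1 $ 2 + lam w $ 2 $ 1 \<ge> 1)"
  using assms
proof (induction rule: B3.pos_monoid.induct)
  case one
  then show ?case by (simp add: lam_one)
next
  case (inv_a w)
  have "lam (w \<otimes>\<^bsub>B3\<^esub> inv\<^bsub>B3\<^esub> sa) = mat2 (lam w$1$1) (lam w$1$2) (lam w$2$1) (lam w$2$2) ** mat2 1 0 1 1"
    using B3.pos_monoid_carrier[OF inv_a(1)] by (simp add: lam_mult lam_inv lam_sab mat2_eta)
  then show ?case using inv_a.IH by (simp add: mat2_mult)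
next
  case (b w)
  have "lam (w \<otimes>\<^bsub>B3\<^esub> sb) = mat2 (lam w$1$1) (lam w$1$2) (lam w$2$1) (lam w$2$2) ** mat2 1 1 0 1"
    using B3.pos_monoid_carrier[OF b(1)] by (simp add: lam_mult lam_sab mat2_eta)
  then show ?case using b.IH by (simp add: mat2_mult)
qed

lemma lam_c_pow: "\<exists>s. s \<in> {1, -1} \<and> lam (B3.c [^]\<^bsub>B3\<^esub> (k::int)) = mat2 s 0 0 s"
proof -
  have nat: "\<exists>s. s \<in> {1, -1} \<and> lam (B3.c [^]\<^bsub>B3\<^esub> (m::nat)) = mat2 s 0 0 s" for m
  proof (induction m)
    case 0
    show ?case by (rule exI[of _ 1]) simp
  next
    case (Suc m)
    then obtain s where "s \<in> {1, -1}" "lam (B3.c [^]\<^bsub>B3\<^esub> m) = mat2 s 0 0 s" by blast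
    then show ?case by (intro exI[of _ "- s"]) (auto simp: lam_mult lam_uvc mat2_mult)
  qed
  show ?thesis
  proof (cases k rule: int_cases2)
    case (nonneg m)
    then show ?thesis using nat[of m] by (simp add: int_pow_int)
  next
    case (nonpos m)
    obtain s where s: "s \<in> {1, -1}" "lam (B3.c [^]\<^bsub>B3\<^esub> m) = mat2 s 0 0 s" using nat by blast
    have "B3.c [^]\<^bsub>B3\<^esub> k = inv\<^bsub>B3\<^esub> (B3.c [^]\<^bsub>B3\<^esub> m)"
      using B3.int_pow_neg[of B3.c "int m"] nonpos by (simp add: int_pow_int)
    then show ?thesis using s by (intro exI[of _ s]) auto
  qed
qed

text \<open>In the normal form of g, the signs and sizes of the entries prevent the image from being
  the identity unless all factors other than the power of c are trivial. Powers of c are what the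
  descent of cocycles to SL_2(Z) calls for.\<close>

lemma lam_kernel:
  assumes "g \<in> carrier B3" "lam g = mat 1"
  shows "\<exists>k::int. g = B3.c [^]\<^bsub>B3\<^esub> k"
proof -
  obtain k :: int and x w y where g: "g = B3.c [^]\<^bsub>B3\<^esub> k \<otimes>\<^bsub>B3\<^esub> (x \<otimes>\<^bsub>B3\<^esub> (w \<otimes>\<^bsub>B3\<^esub> y))"
    and xwy: "x \<in> {\<one>\<^bsub>B3\<^esub>, B3.v, B3.v \<otimes>\<^bsub>B3\<^esub> B3.v}" "w \<in> B3.pos_monoid" "y \<in> {\<one>\<^bsub>B3\<^esub>, B3.u}"
    using B3.nform_all[OF assms(1)] unfolding B3.nform_def by blast
  obtain s where s: "s \<in> {1, -1}" "lam (B3.c [^]\<^bsub>B3\<^esub> k) = mat2 s 0 0 s" using lam_c_pow by blast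
  have carr: "x \<in> carrier B3" "w \<in> carrier B3" "y \<in> carrier B3"
    using xwy B3.pos_monoid_carrier by auto
  define m1 m2 m3 m4 where "m1 = lam w $ 1 $ 1" and "m2 = lam w $ 1 $ 2" and "m3 = lam w $ 2 $ 1" and "m4 = lam w $ 2 $ 2"
  have w: "lam w = mat2 m1 m2 m3 m4" by (simp add: m1_def m2_def m3_def m4_def mat2_eta)
  have m: "m1 \<ge> 1" "m4 \<ge> 1" "m2 \<ge> 0" "m3 \<ge> 0" "w = \<one>\<^bsub>B3\<^esub> \<or> m2 + m3 \<ge> 1"
    using lam_pos_monoid[OF xwy(2)] by (simp_all add: m1_def m2_def m3_def m4_def)
  have eq: "mat2 s 0 0 s ** (lam x ** (mat2 m1 m2 m3 m4 ** lam y)) = mat2 1 0 0 1"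
    using assms(2) carr unfolding g mat2_one by (simp add: lam_mult s w)
  have "x = \<one>\<^bsub>B3\<^esub> \<and> y = \<one>\<^bsub>B3\<^esub> \<and> w = \<one>\<^bsub>B3\<^esub>"
    using xwy(1,3) s(1) eq m
    by (auto simp: lam_mult lam_uvc lam_one mat2_mult mat2_eq_iff)
  then show ?thesis using g by auto
qed

text \<open>The Euclidean algorithm on the first column, carried out by row operations that come
  from the generators.\<close>

lemma lam_surj: "lam ` carrier B3 = carrier SL2Z"
proof
  show "lam ` carrier B3 \<subseteq> carrier SL2Z" using lam.hom_closed by blast
  let ?H = "lam ` carrier B3"
  have left: "A \<in> ?H" if asm: "g \<in> carrier B3" "lam g ** A \<in> ?H" "det A = 1" for g A
  proof -
    obtain h where h: "h \<in> carrier B3" "lam h = lam g ** A" using asm(2) by (metis imageE)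
    have A: "A \<in> carrier SL2Z" using asm(3) by (simp add: SL2Z_def)
    have "lam (inv\<^bsub>B3\<^esub> g \<otimes>\<^bsub>B3\<^esub> h) = inv\<^bsub>SL2Z\<^esub> (lam g) \<otimes>\<^bsub>SL2Z\<^esub> (lam g \<otimes>\<^bsub>SL2Z\<^esub> A)"
      using asm(1) h by simp
    also have "\<dots> = A" using lam.hom_closed[OF asm(1)] A by (rule lam.H.cancel_l)
    finally show ?thesis using asm(1) h(1) by (metis B3.inv_closed B3.m_closed imageI)
  qed
  have inv_ab: "lam (inv\<^bsub>B3\<^esub> sa) = mat2 1 0 1 1" "lam (inv\<^bsub>B3\<^esub> sb) = mat2 1 (-1) 0 1"
    by (simp_all add: lam_inv lam_sab sab_carrier)
  have upper: "mat2 1 t 0 1 \<in> ?H" for t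
  proof (induction "nat \<bar>t\<bar>" arbitrary: t rule: less_induct)
    case less
    consider "t = 0" | "t > 0" | "t < 0" by linarith
    then show ?case
    proof cases
      case 1
      then show ?thesis using lam_one B3.one_closed by (metis image_eqI)
    next
      case 2
      then have "mat2 1 (t - 1) 0 1 \<in> ?H" using less[of "t - 1"] by simp
      note IH = this
      show ?thesis by (rule left[of "inv\<^bsub>B3\<^esub> sb"]) (use IH in \<open>simp_all add: inv_ab mat2_mult sab_carrier det_mat2\<close>)
    next
      case 3
      then have "mat2 1 (t + 1) 0 1 \<in> ?H" using less[of "t + 1"] by simp
      note IH = this
      show ?thesis by (rule left[of sb]) (use IH in \<open>simp_all add: lam_sab mat2_mult sab_carrier det_mat2 add.commute\<close>)
    qed
  qed
  have zero: "mat2 x y 0 z \<in> ?H" if xz: "x * z = 1" for x y z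
  proof -
    consider "x = 1" "z = 1" | "x = -1" "z = -1" using zmult_eq_1_iff[of x z] xz by blast
    then show ?thesis
    proof cases
      case 1
      then show ?thesis using upper by simp
    next
      case 2
      show ?thesis unfolding 2
        by (rule left[of "B3.c"]) (use upper[of "- y"] in \<open>simp_all add: lam_uvc mat2_mult det_mat2\<close>)
    qed
  qed
  \<comment> \<open>Induction on |x| + |z|: adding one row to the other or subtracting it decreases
    this sum, until the first column contains a zero.\<close>
  have all: "mat2 x y z w \<in> ?H" if "x * w - y * z = 1" for x y z w
    using that
  proof (induction "nat (\<bar>x\<bar> + \<bar>z\<bar>)" arbitrary: x y z w rule: less_induct)
    case less
    note det = less.prems
    consider "z = 0" | "x = 0" | "x * z > 0" "\<bar>x\<bar> \<ge> \<bar>z\<bar>" | "x * z > 0" "\<bar>x\<bar> \<le> \<bar>z\<bar>" | "x * z < 0" "\<bar>x\<bar> \<ge> \<bar>z\<bar>" | "x * z < 0" "\<bar>x\<bar> \<le> \<bar>z\<bar>"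
      by (metis linorder_cases linorder_le_cases mult_eq_0_iff)
    then show ?case
    proof cases
      case 1
      then show ?thesis using zero[of x w y] det by simp
    next
      case 2
      have "mat2 z w (- x) (- y) \<in> ?H" using zero[of z "- y" w] det 2 by (simp add: mult.commute)
      note IH = this
      show ?thesis by (rule left[of "B3.u"]) (use IH det in \<open>simp_all add: lam_uvc mat2_mult det_mat2\<close>)
    next
      case 3
      have "mat2 (x - z) (y - w) z w \<in> ?H"
      proof (rule less.hyps)
        show "nat (\<bar>x - z\<bar> + \<bar>z\<bar>) < nat (\<bar>x\<bar> + \<bar>z\<bar>)" using 3 by (auto simp: zero_less_mult_iff)
      qed (use det in \<open>simp add: algebra_simps\<close>)
      note IH = this
      show ?thesis by (rule left[of "inv\<^bsub>B3\<^esub> sb"]) (use IH det in \<open>simp_all add: inv_ab mat2_mult det_mat2 sab_carrier\<close>)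
    next
      case 4
      have "mat2 x y (z - x) (w - y) \<in> ?H"
      proof (rule less.hyps)
        show "nat (\<bar>x\<bar> + \<bar>z - x\<bar>) < nat (\<bar>x\<bar> + \<bar>z\<bar>)" using 4 by (auto simp: zero_less_mult_iff)
      qed (use det in \<open>simp add: algebra_simps\<close>)
      note IH = this
      show ?thesis by (rule left[of sa]) (use IH det in \<open>simp_all add: lam_sab mat2_mult det_mat2 sab_carrier\<close>)
    next
      case 5
      have "mat2 (x + z) (y + w) z w \<in> ?H"
      proof (rule less.hyps)
        show "nat (\<bar>x + z\<bar> + \<bar>z\<bar>) < nat (\<bar>x\<bar> + \<bar>z\<bar>)" using 5 by (auto simp: mult_less_0_iff)
      qed (use det in \<open>simp add: algebra_simps\<close>)
      note IH = this
      show ?thesis by (rule left[of sb]) (use IH det in \<open>simp_all add: lam_sab mat2_mult det_mat2 sab_carrier\<close>)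
    next
      case 6
      have "mat2 x y (x + z) (y + w) \<in> ?H"
      proof (rule less.hyps)
        show "nat (\<bar>x\<bar> + \<bar>x + z\<bar>) < nat (\<bar>x\<bar> + \<bar>z\<bar>)" using 6 by (auto simp: mult_less_0_iff)
      qed (use det in \<open>simp add: algebra_simps\<close>)
      note IH = this
      show ?thesis by (rule left[of "inv\<^bsub>B3\<^esub> sa"]) (use IH det in \<open>simp_all add: inv_ab mat2_mult det_mat2 sab_carrier\<close>)
    qed
  qed
  show "carrier SL2Z \<subseteq> ?H"
  proof
    fix A assume "A \<in> carrier SL2Z"
    then have "A$1$1 * A$2$2 - A$1$2 * A$2$1 = 1" by (simp add: det_2)
    from all[OF this] show "A \<in> ?H" by (simp only: mat2_eta)
  qed
qed

lemma SL2Z_generate: "generate SL2Z {mat2 1 0 (-1) 1, mat2 1 1 0 1} = carrier SL2Z"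
  using lam.generate_img[of "{sa, sb}"] by (simp add: sab_carrier B3_generate lam_surj lam_sab)

interpretation SL2Z: braid SL2Z "mat2 1 0 (-1) 1" "mat2 1 1 0 1"
proof (rule braid.intro[OF group_SL2Z], unfold_locales)
  show "mat2 1 0 (- 1) 1 \<in> carrier SL2Z" "mat2 1 1 0 1 \<in> carrier SL2Z" by (simp_all add: SL2Z_def det_mat2)
  show "mat2 1 0 (- 1) 1 \<otimes>\<^bsub>SL2Z\<^esub> mat2 1 1 0 1 \<otimes>\<^bsub>SL2Z\<^esub> mat2 1 0 (- 1) 1 =
      mat2 1 1 0 1 \<otimes>\<^bsub>SL2Z\<^esub> mat2 1 0 (- 1) 1 \<otimes>\<^bsub>SL2Z\<^esub> mat2 1 1 0 1"
    by (simp add: SL2Z_def mat2_mult)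
qed (rule SL2Z_generate)

interpretation B3: sl2_group B3 lam
  by unfold_locales (rule lam_hom, rule lam_surj)

interpretation SL2Z: sl2_group SL2Z "\<lambda>A. A"
  by unfold_locales (auto simp: hom_def det_mul)

section \<open>Cocycles of the braid group\<close>

text \<open>A cocycle with values in \<open>M\<close> is a lift of \<open>lam\<close> to the semidirect product of \<open>M\<close> and \<open>SL\<^sub>2(\<int>)\<close>,
  hence determined on \<open>B\<^sub>3\<close> by a solution of the braid relation there.\<close>

definition aff :: "nat \<Rightarrow> (int poly poly \<times> (int^2^2)) monoid" where
  "aff n = \<lparr>carrier = {(m, A). m \<in> Mdeg n \<and> det A = 1},
    monoid.mult = (\<lambda>(m, A) (m', A'). (m + sl2_act A m', A ** A')), one = (0, mat 1)\<rparr>"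

lemma aff_simps [simp]:
  "(m, A) \<in> carrier (aff n) \<longleftrightarrow> m \<in> Mdeg n \<and> det A = 1"
  "(m, A) \<otimes>\<^bsub>aff n\<^esub> (m', A') = (m + sl2_act A m', A ** A')"
  "\<one>\<^bsub>aff n\<^esub> = (0, mat 1)"
  by (simp_all add: aff_def)

lemma group_aff: "group (aff n)"
proof (rule groupI)
  fix x assume x: "x \<in> carrier (aff n)"
  obtain m A where mA: "x = (m, A)" by force
  define B where "B = inv\<^bsub>SL2Z\<^esub> A"
  have A: "A \<in> carrier SL2Z" using x mA by simp
  then have B: "det B = 1" "B ** A = mat 1"
    using group.inv_closed[OF group_SL2Z A] group.l_inv[OF group_SL2Z A] by (simp_all add: B_def mat2_one)
  then show "\<exists>y\<in>carrier (aff n). y \<otimes>\<^bsub>aff n\<^esub> x = \<one>\<^bsub>aff n\<^esub>"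
    using x unfolding mA by (intro bexI[of _ "(- sl2_act B m, B)"]) (simp_all add: Mdeg_minus sl2_act_Mdeg)
next
  fix x y z assume "x \<in> carrier (aff n)" "y \<in> carrier (aff n)" "z \<in> carrier (aff n)"
  then show "x \<otimes>\<^bsub>aff n\<^esub> y \<otimes>\<^bsub>aff n\<^esub> z = x \<otimes>\<^bsub>aff n\<^esub> (y \<otimes>\<^bsub>aff n\<^esub> z)"
    by (cases x; cases y; cases z) (simp add: sl2_act_hom sl2_act_mult matrix_mul_assoc add.assoc)
next
  fix x y assume "x \<in> carrier (aff n)" "y \<in> carrier (aff n)"
  then show "x \<otimes>\<^bsub>aff n\<^esub> y \<in> carrier (aff n)"
    by (cases x; cases y) (simp add: Mdeg_add sl2_act_Mdeg det_mul)
next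
  fix x assume "x \<in> carrier (aff n)"
  then show "\<one>\<^bsub>aff n\<^esub> \<otimes>\<^bsub>aff n\<^esub> x = x" by (cases x) simp
qed simp

lemma eval_word_hom:
  assumes "group G" "group H" "h \<in> hom G H" "range \<phi> \<subseteq> carrier G"
  shows "h (eval_word G \<phi> w) = eval_word H (h \<circ> \<phi>) w"
proof -
  interpret group_hom G H h using assms(1-3) by (simp add: group_hom_def group_hom_axioms_def)
  show ?thesis
  proof (induction w)
    case (Cons l w)
    obtain x e where l: "l = (x, e)" by force
    have "\<phi> x \<in> carrier G" using assms(4) by auto
    then show ?case using Cons G.eval_word_closed[OF assms(4), of w] by (simp add: l eval_word_Cons)
  qed (simp add: eval_word_Nil)
qed

interpretation B3: sl2_module B3 lam n for n ..
interpretation SL2Z: sl2_module SL2Z "\<lambda>A. A" n for n ..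

text \<open>The matrix parts of (\<alpha>, \<open>lam sa\<close>) and (\<beta>,
  \<open>lam sb\<close>) already satisfy the braid relation, so in \<open>aff n\<close> it amounts
  to \<open>rel\<close>, the equation between the module parts.\<close>

lemma B3_cocycle_exists:
  assumes \<alpha>: "\<alpha> \<in> Mdeg n" and \<beta>: "\<beta> \<in> Mdeg n"
    and rel: "\<alpha> + sl2_act (lam sa) (\<beta> + sl2_act (lam sb) \<alpha>) = \<beta> + sl2_act (lam sb) (\<alpha> + sl2_act (lam sa) \<beta>)"
  obtains z where "z \<in> cocycles B3 (Mdeg n) B3.act 1" "z [sa] = \<alpha>" "z [sb] = \<beta>"
proof -
  define \<phi> where "\<phi> = (\<lambda>g. (if g = S1 then \<alpha> else \<beta>, braid_matrix g))"
  interpret aff: group "aff n" by (rule group_aff)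
  have det: "det (braid_matrix g) = 1" for g by (cases g) (simp_all add: det_2)
  have bm: "braid_matrix S1 = lam sa" "braid_matrix S2 = lam sb" by (simp_all add: lam_sab mat2_def)
  have \<phi>: "range \<phi> \<subseteq> carrier (aff n)" using \<alpha> \<beta> det by (auto simp: \<phi>_def)
  have resp: "eval_word (aff n) \<phi> r = eval_word (aff n) \<phi> s" if "(r, s) \<in> braid_rels" for r s
    using that rel unfolding \<phi>_def
    by (auto simp: braid_rels_def eval_word_Cons eval_word_Nil bm sl2_act_hom lam_sab mat2_mult add.assoc
      simp del: braid_matrix.simps)
  define h where "h = pres_hom (aff n) \<phi>"
  have h: "h \<in> hom B3 (aff n)" unfolding h_def B3_eq by (rule aff.pres_hom_hom[OF \<phi> resp])
  have hcls: "h (pres_class braid_rels w) = eval_word (aff n) \<phi> w" for w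
    unfolding h_def by (rule aff.pres_hom_class[OF \<phi> resp])
  have snd_hom: "snd \<in> hom (aff n) SL2Z" by (auto simp: hom_def aff_def)
  have snd_h: "snd (h g) = lam g" if g: "g \<in> carrier B3" for g
  proof -
    obtain w where w: "g = pres_class braid_rels w" using g by (auto simp: B3_eq presented_group_carrier)
    have "snd (h g) = eval_word SL2Z (snd \<circ> \<phi>) w"
      unfolding w hcls by (rule eval_word_hom[OF group_aff group_SL2Z snd_hom \<phi>])
    also have "snd \<circ> \<phi> = braid_matrix" by (simp add: \<phi>_def fun_eq_iff)
    also have "eval_word SL2Z braid_matrix w = lam g"
      unfolding w lam_def braid_rels_def
      by (rule group.pres_hom_class[OF group_SL2Z lam_respects(1), symmetric]) (rule lam_respects(2))
    finally show ?thesis .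
  qed
  define z where "z gs = (if gs \<in> tuples B3 1 then fst (h (hd gs)) else 0)" for gs
  have z_apply: "z [g] = fst (h g)" if "g \<in> carrier B3" for g
    using that B3.tuples_1[of "[g]"] by (simp add: z_def)
  have z: "z \<in> cocycles B3 (Mdeg n) B3.act 1"
    unfolding B3.cocycle_iff
  proof (intro conjI ballI allI impI)
    fix g assume g: "g \<in> carrier B3"
    then have "h g \<in> carrier (aff n)" by (rule hom_in_carrier[OF h])
    then show "z [g] \<in> Mdeg n" by (cases "h g") (simp add: z_apply[OF g])
  next
    fix g g' assume g: "g \<in> carrier B3" "g' \<in> carrier B3"
    have "h (g \<otimes>\<^bsub>B3\<^esub> g') = h g \<otimes>\<^bsub>aff n\<^esub> h g'" by (rule hom_mult[OF h g])
    then show "z [g \<otimes>\<^bsub>B3\<^esub> g'] = B3.act g (z [g']) + z [g]"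
      using snd_h[OF g(1)] g by (cases "h g"; cases "h g'") (simp add: z_apply B3.act_def add.commute)
  qed (simp add: z_def)
  have "z [sa] = \<alpha>" "z [sb] = \<beta>"
    unfolding z_apply[OF sab_carrier(1)] z_apply[OF sab_carrier(2)] unfolding sa_def sb_def hcls
    by (simp_all add: eval_word_Cons eval_word_Nil \<phi>_def sl2_act_hom)
  then show ?thesis using that z by blast
qed

section \<open>Cocycles with prescribed values at u and v\<close>

context group_module
begin

lemma cocycle_one: "z \<in> Z1 \<Longrightarrow> (\<And>m. m \<in> A \<Longrightarrow> \<rho> \<one> m = m) \<Longrightarrow> z [\<one>] = 0"
  using cocycleD(3)[of z \<one> \<one>] cocycleD(2)[of z \<one>] by simp

text \<open>Applied to u and v, which generate the group, this shows that a cocycle is determined by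
  its values there.\<close>

lemma cocycle_zero_subgroup:
  assumes "z \<in> Z1" "\<And>m. m \<in> A \<Longrightarrow> \<rho> \<one> m = m"
  shows "subgroup {g \<in> carrier G. z [g] = 0} G"
proof (rule subgroupI)
  fix g h assume "g \<in> {g \<in> carrier G. z [g] = 0}" "h \<in> {g \<in> carrier G. z [g] = 0}"
  then show "g \<otimes> h \<in> {g \<in> carrier G. z [g] = 0}" by (simp add: cocycleD(3)[OF assms(1)] act_0)
next
  fix g assume g: "g \<in> {g \<in> carrier G. z [g] = 0}"
  then have "z [inv g \<otimes> g] = z [inv g]" using cocycleD(3)[OF assms(1), of "inv g" g] by (simp add: act_0 del: l_inv)
  moreover have "inv g \<otimes> g = \<one>" using g by simp
  ultimately show "inv g \<in> {g \<in> carrier G. z [g] = 0}" using g cocycle_one[OF assms] by simp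
qed (use cocycle_one[OF assms] in auto)

end

lemma sl2_act_neg_one:
  assumes "f \<in> Mdeg (2 * d)" shows "sl2_act (mat2 (-1) 0 0 (-1)) f = (-1) ^ d * f"
proof -
  have "sl2_act (mat2 (-1) 0 0 (-1)) f = eval2 f (- var_x) (- var_y)" by (simp add: sl2_act_eq)
  also have "\<dots> = (\<Sum>j\<le>d. (-1) ^ d * (of_int (hcoeff d f j) * var_x ^ (d - j) * var_y ^ j))"
    unfolding eval2_homog[OF assms]
  proof (rule sum.cong)
    fix j assume "j \<in> {..d}"
    then have "(-1 :: int poly poly) ^ (d - j) * (-1) ^ j = (-1) ^ d" by (simp flip: power_add)
    moreover have "of_int (hcoeff d f j) * (- var_x) ^ (d - j) * (- var_y) ^ j =
        ((-1) ^ (d - j) * (-1) ^ j) * (of_int (hcoeff d f j) * var_x ^ (d - j) * var_y ^ j)"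
      by (simp only: power_minus[of var_x] power_minus[of var_y] mult_ac)
    ultimately show "of_int (hcoeff d f j) * (- var_x) ^ (d - j) * (- var_y) ^ j =
        (-1) ^ d * (of_int (hcoeff d f j) * var_x ^ (d - j) * var_y ^ j)" by simp
  qed simp
  also have "\<dots> = (-1) ^ d * f" by (simp only: homog_expand[OF assms, symmetric] sum_distrib_left[symmetric])
  finally show ?thesis .
qed

locale sl2_braid = sl2_group G lam + braid G a b for G (structure) and lam a b +
  assumes lam_a: "lam a = mat2 1 0 (-1) 1" and lam_b: "lam b = mat2 1 1 0 1"
begin

lemma lam_u: "lam u = mat2 0 1 (-1) 0" and lam_v: "lam v = mat2 1 1 (-1) 0" and lam_c: "lam c = mat2 (-1) 0 0 (-1)"
  by (simp_all add: u_def v_def c_def lam_mult lam_a lam_b mat2_mult)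

lemma lam_one: "lam \<one> = mat 1"
  using group_hom.hom_one[of G SL2Z lam] lam_hom is_group group_SL2Z
  by (simp add: group_hom_def group_hom_axioms_def mat2_one)

lemma act_one: "act \<one> f = f"
  by (simp add: act_def lam_one)

sublocale M: sl2_module G lam n for n ..

lemma cocycle_zero:
  assumes z: "z \<in> cocycles G (Mdeg n) act 1" "z [u] = 0" "z [v] = 0" and g: "g \<in> carrier G"
  shows "z [g] = 0"
proof -
  have S: "subgroup {g \<in> carrier G. z [g] = 0} G"
    by (rule M.cocycle_zero_subgroup[OF z(1)]) (rule act_one)
  have uv: "u \<in> {g \<in> carrier G. z [g] = 0}" "v \<in> {g \<in> carrier G. z [g] = 0}"
    by (simp_all add: z(2,3))
  have "a \<in> {g \<in> carrier G. z [g] = 0}"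
    using subgroup.m_closed[OF S subgroup.m_inv_closed[OF S uv(2)] uv(1)] by (simp only: a_eq[symmetric])
  moreover have "b \<in> {g \<in> carrier G. z [g] = 0}"
    using subgroup.m_closed[OF S uv(1) subgroup.m_inv_closed[OF S uv(2)]] by (simp only: b_eq[symmetric])
  ultimately have "generate G {a, b} \<subseteq> {g \<in> carrier G. z [g] = 0}"
    by (intro generate_subgroup_incl S) blast
  then show ?thesis using g unfolding gen by blast
qed

end

interpretation B3: sl2_braid B3 lam sa sb
  by unfold_locales (rule lam_sab)+

interpretation SL2Z: sl2_braid SL2Z "\<lambda>A. A" "mat2 1 0 (-1) 1" "mat2 1 1 0 1"
  by unfold_locales simp_all

text \<open>B_3 is presented by u and v with the relation u^2 = v^3. The values z(v) = 0 and z(u) =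
  (u - 1) m are compatible with it once (u^2 - 1) m = 0, and c = u^2 acts trivially in even
  polynomial degree. Such a z need not be a coboundary.\<close>

lemma B3_cocycle_uv:
  assumes d: "even d" and m: "m \<in> Mdeg (2 * d)"
  obtains z where "z \<in> cocycles B3 (Mdeg (2 * d)) B3.act 1" "z [B3.v] = 0" "z [B3.u] = B3.act B3.u m - m"
proof -
  \<comment> \<open>\<open>?W\<close> is the inverse of \<open>?V\<close>. As a = v^(-1) u and b = u
    v^(-1), the required values are z(a) = v^(-1) f and z(b) = f with f = z(u).\<close>
  let ?U = "mat2 0 1 (-1) 0" and ?V = "mat2 1 1 (-1) 0" and ?W = "mat2 0 (-1) 1 1"
  define f where "f = sl2_act ?U m - m"
  have f: "f \<in> Mdeg (2 * d)" unfolding f_def by (intro Mdeg_diff sl2_act_Mdeg m)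
  have "sl2_act ?U (sl2_act ?U m) = m"
    using sl2_act_neg_one[OF m] d by (simp add: mat2_mult flip: sl2_act_mult)
  then have Uf: "sl2_act ?U f = - f" by (simp add: f_def sl2_act_hom)
  have af: "sl2_act (lam sa) f = - sl2_act ?W f"
  proof -
    have "lam sa = ?W ** ?U" by (simp add: lam_sab mat2_mult)
    then show ?thesis by (simp add: sl2_act_mult Uf sl2_act_hom)
  qed
  have VW: "sl2_act ?V (sl2_act ?W f) = f" by (simp add: mat2_mult flip: sl2_act_mult mat2_one)
  have abW: "sl2_act (lam sa) (sl2_act (lam sb) (sl2_act ?W f)) = f"
    using VW by (simp add: lam_sab mat2_mult flip: sl2_act_mult)
  have rel: "sl2_act ?W f + sl2_act (lam sa) (f + sl2_act (lam sb) (sl2_act ?W f)) =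
      f + sl2_act (lam sb) (sl2_act ?W f + sl2_act (lam sa) f)"
    by (simp add: sl2_act_hom abW af)
  obtain z where z: "z \<in> cocycles B3 (Mdeg (2 * d)) B3.act 1" "z [sa] = sl2_act ?W f" "z [sb] = f"
    by (rule B3_cocycle_exists[OF sl2_act_Mdeg[OF f] f rel])
  have zv: "z [B3.v] = 0"
    unfolding B3.v_def using B3.cocycleD(3)[OF z(1) sab_carrier] by (simp add: z B3.act_def af)
  have "z [B3.v \<otimes>\<^bsub>B3\<^esub> sa] = f"
    unfolding B3.cocycleD(3)[OF z(1) B3.uvc(2) sab_carrier(1)] by (simp add: z zv B3.act_def lam_uvc VW)
  then have "z [B3.u] = B3.act B3.u m - m" by (simp add: B3.v_a f_def B3.act_def lam_uvc)
  then show ?thesis using that z(1) zv by blast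
qed

text \<open>The kernel of \<open>lam\<close> consists of powers of c, at which a cocycle vanishing
  at c vanishes too, so z is constant on the fibres of \<open>lam\<close>.\<close>

lemma SL2Z_cocycle_descend:
  assumes z: "z \<in> cocycles B3 (Mdeg n) B3.act 1" and zc: "z [B3.c] = 0"
  obtains z' where "z' \<in> cocycles SL2Z (Mdeg n) SL2Z.act 1" "\<And>g. g \<in> carrier B3 \<Longrightarrow> z' [lam g] = z [g]"
proof -
  have S: "subgroup {g \<in> carrier B3. z [g] = 0} B3"
    by (rule B3.cocycle_zero_subgroup[OF z]) (rule B3.act_one)
  have c: "B3.c \<in> {g \<in> carrier B3. z [g] = 0}" using zc by simp
  have ck: "z [B3.c [^]\<^bsub>B3\<^esub> k] = 0" for k :: int
    using B3.subgroup_int_pow_closed[OF S c, of k] by simp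
  have wd: "z [g] = z [h]" if gh: "g \<in> carrier B3" "h \<in> carrier B3" "lam g = lam h" for g h
  proof -
    have "lam (inv\<^bsub>B3\<^esub> h \<otimes>\<^bsub>B3\<^esub> g) = inv\<^bsub>SL2Z\<^esub> (lam h) \<otimes>\<^bsub>SL2Z\<^esub> lam h" using gh by simp
    also have "\<dots> = mat 1" using lam.H.l_inv[of "lam h"] gh(2) by (simp add: det_lam mat2_one)
    finally obtain k :: int where k: "inv\<^bsub>B3\<^esub> h \<otimes>\<^bsub>B3\<^esub> g = B3.c [^]\<^bsub>B3\<^esub> k"
      using lam_kernel[of "inv\<^bsub>B3\<^esub> h \<otimes>\<^bsub>B3\<^esub> g"] gh by auto
    have "g = h \<otimes>\<^bsub>B3\<^esub> (inv\<^bsub>B3\<^esub> h \<otimes>\<^bsub>B3\<^esub> g)" using gh by (simp add: B3.cancel_r)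
    then have "z [g] = z [h \<otimes>\<^bsub>B3\<^esub> B3.c [^]\<^bsub>B3\<^esub> k]" by (simp only: k)
    also have "\<dots> = z [h]" using gh(2) by (simp add: B3.cocycleD(3)[OF z] ck B3.act_0)
    finally show ?thesis .
  qed
  define s where "s A = (SOME g. g \<in> carrier B3 \<and> lam g = A)" for A
  have s: "s A \<in> carrier B3 \<and> lam (s A) = A" if "det A = 1" for A
  proof -
    have "A \<in> lam ` carrier B3" using that lam_surj by simp
    then have "\<exists>g. g \<in> carrier B3 \<and> lam g = A" by blast
    then show ?thesis unfolding s_def by (rule someI_ex)
  qed
  define z' where "z' As = (if As \<in> tuples SL2Z 1 then z [s (hd As)] else 0)" for As
  have z'_apply: "z' [A] = z [s A]" if "det A = 1" for A
    using that SL2Z.tuples_1[of "[A]"] by (simp add: z'_def)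
  have z'_lam: "z' [lam g] = z [g]" if "g \<in> carrier B3" for g
    using that s[OF det_lam[OF that]] wd[of "s (lam g)" g] by (simp add: z'_apply det_lam)
  have "z' \<in> cocycles SL2Z (Mdeg n) SL2Z.act 1"
    unfolding SL2Z.cocycle_iff
  proof (intro conjI ballI allI impI)
    fix A assume "A \<in> carrier SL2Z"
    then show "z' [A] \<in> Mdeg n" using s[of A] B3.cocycleD(2)[OF z] by (simp add: z'_apply)
  next
    fix A B assume "A \<in> carrier SL2Z" "B \<in> carrier SL2Z"
    then have AB: "s A \<in> carrier B3" "lam (s A) = A" "s B \<in> carrier B3" "lam (s B) = B" using s by auto
    have "z' [lam (s A \<otimes>\<^bsub>B3\<^esub> s B)] = B3.act (s A) (z [s B]) + z [s A]"
      unfolding z'_lam[OF B3.m_closed[OF AB(1,3)]] by (rule B3.cocycleD(3)[OF z AB(1,3)])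
    moreover have "lam (s A \<otimes>\<^bsub>B3\<^esub> s B) = A ** B" using AB by simp
    ultimately show "z' [A \<otimes>\<^bsub>SL2Z\<^esub> B] = SL2Z.act A (z' [B]) + z' [A]"
      using z'_lam[OF AB(1)] z'_lam[OF AB(3)] AB by (simp add: B3.act_def SL2Z.act_def)
  qed (simp add: z'_def)
  then show ?thesis using that z'_lam by blast
qed

lemma SL2Z_cocycle_uv:
  assumes d: "even d" and m: "m \<in> Mdeg (2 * d)"
  obtains z where "z \<in> cocycles SL2Z (Mdeg (2 * d)) SL2Z.act 1" "z [SL2Z.v] = 0" "z [SL2Z.u] = SL2Z.act SL2Z.u m - m"
proof -
  obtain z where z: "z \<in> cocycles B3 (Mdeg (2 * d)) B3.act 1" "z [B3.v] = 0" "z [B3.u] = B3.act B3.u m - m"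
    by (rule B3_cocycle_uv[OF assms])
  have "z [B3.v \<otimes>\<^bsub>B3\<^esub> B3.v \<otimes>\<^bsub>B3\<^esub> B3.v] = 0"
    by (simp add: B3.cocycleD(3)[OF z(1)] z(2) B3.act_0)
  then have "z [B3.c] = 0" by (simp only: B3.v_cube)
  then obtain z' where z': "z' \<in> cocycles SL2Z (Mdeg (2 * d)) SL2Z.act 1" "\<And>g. g \<in> carrier B3 \<Longrightarrow> z' [lam g] = z [g]"
    using SL2Z_cocycle_descend[OF z(1)] by blast
  have "lam B3.u = SL2Z.u" "lam B3.v = SL2Z.v" using SL2Z.lam_u SL2Z.lam_v by (simp_all add: lam_uvc)
  then show ?thesis
    using that[OF z'(1)] z'(2)[of B3.u] z'(2)[of B3.v] z(2,3) by (simp add: B3.act_def SL2Z.act_def)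
qed

section \<open>The free part of an abelian group\<close>

lemma torsion_free_free_abelian:
  fixes L :: "'a monoid" (structure)
  assumes "group L" "subgroup K L" "free_abelian (restrict_group L K)" "x \<in> K" "x [^] (N::nat) = \<one>" "N > 0"
  shows "x = \<one>"
proof -
  interpret L: group L by fact
  have K: "group (restrict_group L K)" by (rule L.subgroup_imp_group) fact
  obtain S :: "'a set" where "restrict_group L K \<cong> free_Abelian_group S"
    using assms(3) unfolding free_abelian_def by blast
  then obtain g where g: "g \<in> iso (restrict_group L K) (free_Abelian_group S)" unfolding is_iso_def by blast
  interpret g: group_hom "restrict_group L K" "free_Abelian_group S" g
    using g K by (simp add: group_hom_def group_hom_axioms_def iso_def)
  have xN: "x [^]\<^bsub>restrict_group L K\<^esub> N = \<one>\<^bsub>restrict_group L K\<^esub>"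
    using L.nat_pow_consistent[of x N K] assms(5) by simp
  have "g (x [^]\<^bsub>restrict_group L K\<^esub> N) = frag_cmul (int N) (g x)"
    using g.hom_nat_pow[of x N] assms(4) by simp
  then have "frag_cmul (int N) (g x) = 0" unfolding xN using g.hom_one by simp
  then have "g x = 0" using assms(6) by simp
  then have "g x = g \<one>\<^bsub>restrict_group L K\<^esub>" using g.hom_one by simp
  moreover have "inj_on g (carrier (restrict_group L K))" using g by (simp add: iso_def bij_betw_def)
  ultimately show ?thesis using assms(4) subgroup.one_closed[OF assms(2)] by (simp add: inj_on_eq_iff)
qed

lemma free_abelian_trivial:
  fixes L :: "'a monoid" (structure)
  assumes "group L" shows "free_abelian (restrict_group L {\<one>})"
proof -
  interpret L: group L by fact
  have "(\<lambda>_. 0) \<in> iso (restrict_group L {\<one>}) (free_Abelian_group ({} :: 'a set))"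
    by (auto simp: iso_def hom_def bij_betw_def)
  then show ?thesis unfolding free_abelian_def is_iso_def by blast
qed

lemmas frag_induct [consumes 1, case_names zero diff single] = free_Abelian_group_induct

text \<open>\<open>free_abelian\<close> asks for a basis in the type of L. The new basis is
  therefore made of elements of L itself, the images of the old basis and t, which is fresh because
  independence keeps it out of K.\<close>

lemma free_abelian_extend:
  fixes L :: "'a monoid" (structure)
  assumes "comm_group L" and K: "subgroup K L" "free_abelian (restrict_group L K)" and t: "t \<in> carrier L"
    and indep: "\<And>k n. k \<in> K \<Longrightarrow> k \<otimes> t [^] (n::int) = \<one> \<Longrightarrow> n = 0"
  defines "K' \<equiv> {k \<otimes> t [^] (n::int) | k n. k \<in> K}"
  shows "subgroup K' L" "free_abelian (restrict_group L K')"
proof -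
  interpret L: comm_group L by fact
  interpret K: subgroup K L by fact
  show K': "subgroup K' L"
  proof (rule L.subgroupI)
    show "K' \<subseteq> carrier L" using t by (auto simp: K'_def)
    have "\<one> \<otimes> t [^] (0::int) \<in> K'" unfolding K'_def using K.one_closed by blast
    then show "K' \<noteq> {}" by blast
    fix x y assume "x \<in> K'" "y \<in> K'"
    then obtain k n l m where x: "x = k \<otimes> t [^] (n::int)" "k \<in> K"
      and y: "y = l \<otimes> t [^] (m::int)" "l \<in> K" by (auto simp: K'_def)
    have "x \<otimes> y = (k \<otimes> l) \<otimes> t [^] (n + m)"
      using x y t by (simp add: L.m_ac L.int_pow_mult)
    then show "x \<otimes> y \<in> K'" using K.m_closed[OF x(2) y(2)] unfolding K'_def by blast
    have "inv x = inv k \<otimes> t [^] (- n)"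
      using x t by (simp add: L.inv_mult L.int_pow_neg)
    then show "inv x \<in> K'" using K.m_inv_closed[OF x(2)] unfolding K'_def by blast
  qed
  have grp: "group (restrict_group L K)" by (rule L.subgroup_imp_group) fact
  obtain S0 :: "'a set" where "restrict_group L K \<cong> free_Abelian_group S0"
    using K(2) unfolding free_abelian_def by blast
  then have "free_Abelian_group S0 \<cong> restrict_group L K" by (rule group.iso_sym[OF grp])
  then obtain g where g: "g \<in> iso (free_Abelian_group S0) (restrict_group L K)" unfolding is_iso_def by blast
  have g_inj: "inj_on g (carrier (free_Abelian_group S0))" and g_img: "g ` carrier (free_Abelian_group S0) = K"
    using g by (simp_all add: iso_def bij_betw_def)
  have g_hom: "g \<in> hom (free_Abelian_group S0) L"
    using g K.subset by (force simp: iso_def hom_def)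
  interpret g: group_hom "free_Abelian_group S0" L g
    using g_hom by (simp add: group_hom_def group_hom_axioms_def)
  define f where "f x = g (frag_of x)" for x
  have fK: "f x \<in> K" if "x \<in> S0" for x using g_img that by (auto simp: f_def)
  have f_carr: "f x \<in> carrier L" if "x \<in> S0" for x using fK[OF that] by simp
  have tK: "t \<notin> K"
  proof
    assume "t \<in> K"
    then have "inv t \<in> K" by simp
    from indep[OF this, of 1] t show False by simp
  qed
  define S where "S = insert t (f ` S0)"
  have S_carr: "(\<lambda>x. x) ` S \<subseteq> carrier L" using t f_carr by (auto simp: S_def)
  obtain h where h: "h \<in> hom (free_Abelian_group S) L" "\<And>x. x \<in> S \<Longrightarrow> h (frag_of x) = x"
    by (rule L.free_Abelian_group_universal[OF S_carr]) blast
  interpret h: group_hom "free_Abelian_group S" L h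
    using h(1) by (simp add: group_hom_def group_hom_axioms_def)
  interpret FS: comm_group "free_Abelian_group S" by (rule abelian_free_Abelian_group)
  have "(\<lambda>x. frag_of (f x)) ` S0 \<subseteq> carrier (free_Abelian_group S)" by (auto simp: S_def)
  then obtain j where j: "j \<in> hom (free_Abelian_group S0) (free_Abelian_group S)"
    "\<And>x. x \<in> S0 \<Longrightarrow> j (frag_of x) = frag_of (f x)"
    by (rule FS.free_Abelian_group_universal) blast
  interpret j: group_hom "free_Abelian_group S0" "free_Abelian_group S" j
    using j(1) by (simp add: group_hom_def group_hom_axioms_def)
  have minus: "x - y = x \<otimes>\<^bsub>free_Abelian_group T\<^esub> inv\<^bsub>free_Abelian_group T\<^esub> y"
    if "Poly_Mapping.keys y \<subseteq> T" for x y :: "'a \<Rightarrow>\<^sub>0 int" and T using that by simp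
  have hj: "h (j w) = g w" if "Poly_Mapping.keys w \<subseteq> S0" for w
    using that
  proof (induction w rule: frag_induct)
    case zero
    then show ?case using h.hom_one j.hom_one g.hom_one by simp
  next
    case (diff x y)
    have xy: "x \<in> carrier (free_Abelian_group S0)" "y \<in> carrier (free_Abelian_group S0)" using diff(1,2) by simp_all
    have "h (j (x - y)) = h (j x) \<otimes> inv h (j y)"
      unfolding minus[OF diff(2)] using xy j.hom_closed[of x] j.hom_closed[of y]
      by (simp only: j.hom_mult j.hom_inv group.inv_closed[OF group_free_Abelian_group] h.hom_mult h.hom_inv group.inv_closed[OF group_free_Abelian_group])
    also have "\<dots> = g (x - y)"
      unfolding minus[OF diff(2)] diff(3,4) using xy by (simp only: g.hom_mult g.hom_inv group.inv_closed[OF group_free_Abelian_group])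
    finally show ?case .
  next
    case (single a)
    then show ?case using h(2)[of "f a"] j(2)[of a] by (simp add: S_def f_def)
  qed
  have decomp: "\<exists>w0 n. Poly_Mapping.keys w0 \<subseteq> S0 \<and> w = j w0 + frag_cmul n (frag_of t)" if "Poly_Mapping.keys w \<subseteq> S" for w
    using that
  proof (induction w rule: frag_induct)
    case zero
    then show ?case using j.hom_one by (intro exI[of _ 0]) simp
  next
    case (diff x y)
    then obtain x0 n y0 m where xy: "Poly_Mapping.keys x0 \<subseteq> S0" "x = j x0 + frag_cmul n (frag_of t)"
      "Poly_Mapping.keys y0 \<subseteq> S0" "y = j y0 + frag_cmul m (frag_of t)" by blast
    have c: "x0 \<in> carrier (free_Abelian_group S0)" "y0 \<in> carrier (free_Abelian_group S0)" using xy by simp_all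
    have "j (x0 - y0) = j x0 \<otimes>\<^bsub>free_Abelian_group S\<^esub> inv\<^bsub>free_Abelian_group S\<^esub> j y0"
      unfolding minus[OF xy(3)] using c by (simp only: j.hom_mult j.hom_inv group.inv_closed[OF group_free_Abelian_group])
    also have "\<dots> = j x0 - j y0" using j.hom_closed[OF c(2)] by simp
    finally have "x - y = j (x0 - y0) + frag_cmul (n - m) (frag_of t)"
      using xy by (simp add: frag_cmul_diff_distrib algebra_simps)
    moreover have "Poly_Mapping.keys (x0 - y0) \<subseteq> S0" using keys_diff[of x0 y0] xy by blast
    ultimately show ?case by blast
  next
    case (single a)
    show ?case
    proof (cases "a = t")
      case True
      then show ?thesis using j.hom_one by (intro exI[of _ 0] exI[of _ 1]) simp
    next
      case False
      then obtain x where "x \<in> S0" "a = f x" using single by (auto simp: S_def)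
      then show ?thesis using j(2)[of x] by (intro exI[of _ "frag_of x"] exI[of _ 0]) simp
    qed
  qed
  have ht: "frag_of t \<in> carrier (free_Abelian_group S)" by (simp add: S_def)
  have h_decomp: "h (j w0 + frag_cmul n (frag_of t)) = g w0 \<otimes> t [^] n"
    if "Poly_Mapping.keys w0 \<subseteq> S0" for w0 n
  proof -
    have w0: "w0 \<in> carrier (free_Abelian_group S0)" using that by simp
    have "frag_cmul n (frag_of t) = frag_of t [^]\<^bsub>free_Abelian_group S\<^esub> n" using ht by simp
    then have "h (j w0 + frag_cmul n (frag_of t)) = h (j w0 \<otimes>\<^bsub>free_Abelian_group S\<^esub> frag_of t [^]\<^bsub>free_Abelian_group S\<^esub> n)"
      by simp
    also have "\<dots> = h (j w0) \<otimes> h (frag_of t) [^] n"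
      using j.hom_closed[OF w0] ht by (simp only: h.hom_mult h.hom_int_pow group.int_pow_closed[OF group_free_Abelian_group])
    also have "\<dots> = g w0 \<otimes> t [^] n" using hj[OF that] h(2)[of t] by (simp add: S_def)
    finally show ?thesis .
  qed
  have img: "h ` carrier (free_Abelian_group S) = K'"
  proof
    show "h ` carrier (free_Abelian_group S) \<subseteq> K'"
    proof
      fix y assume "y \<in> h ` carrier (free_Abelian_group S)"
      then obtain w where "Poly_Mapping.keys w \<subseteq> S" "y = h w" by auto
      then obtain w0 n where w0: "Poly_Mapping.keys w0 \<subseteq> S0" "w = j w0 + frag_cmul n (frag_of t)"
        using decomp[of w] by blast
      then have "y = g w0 \<otimes> t [^] n" using \<open>y = h w\<close> h_decomp by simp
      moreover have "g w0 \<in> K" using w0(1) g_img by auto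
      ultimately show "y \<in> K'" unfolding K'_def by blast
    qed
    show "K' \<subseteq> h ` carrier (free_Abelian_group S)"
    proof
      fix y assume "y \<in> K'"
      then obtain k n where y: "y = k \<otimes> t [^] (n::int)" "k \<in> K" unfolding K'_def by blast
      then obtain w0 where w0: "Poly_Mapping.keys w0 \<subseteq> S0" "k = g w0" using g_img by auto
      have "j w0 \<otimes>\<^bsub>free_Abelian_group S\<^esub> frag_of t [^]\<^bsub>free_Abelian_group S\<^esub> n \<in> carrier (free_Abelian_group S)"
        using w0 ht by (intro group.is_monoid[OF group_free_Abelian_group, THEN monoid.m_closed] group.int_pow_closed[OF group_free_Abelian_group] j.hom_closed) simp_all
      then have "j w0 + frag_cmul n (frag_of t) \<in> carrier (free_Abelian_group S)" using ht by simp
      then show "y \<in> h ` carrier (free_Abelian_group S)" unfolding y w0 h_decomp[OF w0(1), symmetric] by blast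
    qed
  qed
  have "inj_on h (carrier (free_Abelian_group S))"
    unfolding h.inj_on_one_iff
  proof (intro allI impI)
    fix w assume "w \<in> carrier (free_Abelian_group S)" and hw: "h w = \<one>"
    then obtain w0 n where w0: "Poly_Mapping.keys w0 \<subseteq> S0" "w = j w0 + frag_cmul n (frag_of t)"
      using decomp[of w] by auto
    have gw: "g w0 \<otimes> t [^] n = \<one>" using hw h_decomp[OF w0(1), of n] w0(2) by simp
    have "g w0 \<in> K" using w0(1) g_img by auto
    then have n: "n = 0" using gw by (rule indep)
    then have "g w0 = \<one>" using gw \<open>g w0 \<in> K\<close> by simp
    then have "w0 = 0" using g_inj w0(1) unfolding g.inj_on_one_iff by simp
    then show "w = \<one>\<^bsub>free_Abelian_group S\<^esub>" using w0(2) n j.hom_one by simp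
  qed
  then have "h \<in> iso (free_Abelian_group S) (restrict_group L K')"
    using img h(1) by (auto simp: iso_def bij_betw_def hom_def)
  then have "free_Abelian_group S \<cong> restrict_group L K'" unfolding is_iso_def by blast
  then have "restrict_group L K' \<cong> free_Abelian_group S"
    by (rule group.iso_sym[OF group_free_Abelian_group])
  then show "free_abelian (restrict_group L K')" unfolding free_abelian_def by blast
qed

text \<open>The coordinates \<open>\<phi>\<close> identify \<open>L\<close> modulo torsion with \<open>\<int>\<^sup>r\<close>.\<close>

locale free_coords = comm_group L for L :: "'a monoid" (structure) +
  fixes \<phi> :: "nat \<Rightarrow> 'a \<Rightarrow> int" and r :: nat
  assumes \<phi>_hom: "i < r \<Longrightarrow> \<phi> i \<in> hom L integer_group"
    and \<phi>_torsion: "x \<in> carrier L \<Longrightarrow> (\<And>i. i < r \<Longrightarrow> \<phi> i x = 0) \<Longrightarrow> \<exists>N>0. x [^] (N::nat) = \<one>"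
    and \<phi>_dual: "i < r \<Longrightarrow> \<exists>x\<in>carrier L. \<forall>j<r. \<phi> j x = (if j = i then 1 else 0)"
begin

lemma \<phi>_group_hom: "i < r \<Longrightarrow> group_hom L integer_group (\<phi> i)"
  using \<phi>_hom by (simp add: group_hom_def group_hom_axioms_def)

lemma \<phi>_mult: "i < r \<Longrightarrow> x \<in> carrier L \<Longrightarrow> y \<in> carrier L \<Longrightarrow> \<phi> i (x \<otimes> y) = \<phi> i x + \<phi> i y"
  using group_hom.hom_mult[OF \<phi>_group_hom] by simp

lemma \<phi>_inv: "i < r \<Longrightarrow> x \<in> carrier L \<Longrightarrow> \<phi> i (inv x) = - \<phi> i x"
  using group_hom.hom_inv[OF \<phi>_group_hom] by simp

lemma \<phi>_one: "i < r \<Longrightarrow> \<phi> i \<one> = 0"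
  using group_hom.hom_one[OF \<phi>_group_hom] by simp

lemma \<phi>_pow: "i < r \<Longrightarrow> x \<in> carrier L \<Longrightarrow> \<phi> i (x [^] (n::int)) = n * \<phi> i x"
  using group_hom.hom_int_pow[OF \<phi>_group_hom, of i x n] by simp

lemma \<phi>_surj: "\<exists>x\<in>carrier L. \<forall>i<r. \<phi> i x = c i"
proof -
  have "\<exists>x\<in>carrier L. \<forall>i<r. \<phi> i x = (if i < m then c i else 0)" if "m \<le> r" for m
    using that
  proof (induction m)
    case 0
    then show ?case by (intro bexI[of _ "\<one>"]) (simp_all add: \<phi>_one)
  next
    case (Suc m)
    then obtain x where x: "x \<in> carrier L" "\<forall>i<r. \<phi> i x = (if i < m then c i else 0)" by auto
    obtain e where e: "e \<in> carrier L" "\<forall>i<r. \<phi> i e = (if i = m then 1 else 0)"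
      using \<phi>_dual[of m] Suc.prems by auto
    have "\<phi> i (x \<otimes> e [^] c m) = (if i < Suc m then c i else 0)" if "i < r" for i
      using x e that by (auto simp: \<phi>_mult \<phi>_pow less_Suc_eq)
    then show ?case using x e by (intro bexI[of _ "x \<otimes> e [^] c m"]) auto
  qed
  from this[of r] show ?thesis by auto
qed

text \<open>The torsion subgroup: its elements are torsion by \<open>\<phi>_torsion\<close>, and
  homomorphisms to Z kill torsion.\<close>

definition tors :: "'a set" where "tors = {x \<in> carrier L. \<forall>i<r. \<phi> i x = 0}"

lemma subgroup_tors: "subgroup tors L"
  by (rule subgroupI) (auto simp: tors_def \<phi>_mult \<phi>_inv \<phi>_one intro!: exI[of _ "\<one>"])

lemma tors_free_trivial:
  assumes "subgroup K L" "free_abelian (restrict_group L K)" "x \<in> K" "x \<in> tors"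
  shows "x = \<one>"
proof -
  obtain N :: nat where "N > 0" "x [^] N = \<one>"
    using \<phi>_torsion[of x] assms(4) unfolding tors_def by auto
  then show ?thesis using torsion_free_free_abelian[OF is_group assms(1-3)] by blast
qed

lemma set_multI: "h \<in> H \<Longrightarrow> k \<in> K \<Longrightarrow> h \<otimes> k \<in> H <#> K"
  unfolding set_mult_def by blast

text \<open>Elements dual to the coordinates are adjoined one at a time. At stage m the subgroup
  realises exactly the coordinate vectors supported below m.\<close>

lemma exists_free_complement:
  obtains K where "subgroup K L" "free_abelian (restrict_group L K)" "K <#> tors = carrier L"
    "K \<inter> tors = {\<one>}"
proof -
  have "\<exists>K. subgroup K L \<and> free_abelian (restrict_group L K) \<and>
      (\<forall>x\<in>K. \<forall>i<r. m \<le> i \<longrightarrow> \<phi> i x = 0) \<and>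
      (\<forall>x\<in>carrier L. (\<forall>i<r. m \<le> i \<longrightarrow> \<phi> i x = 0) \<longrightarrow> (\<exists>k\<in>K. \<forall>i<r. \<phi> i k = \<phi> i x))" if "m \<le> r" for m
    using that
  proof (induction m)
    case 0
    have "subgroup {\<one>} L" by (rule triv_subgroup)
    then show ?case
      using free_abelian_trivial[OF is_group] by (intro exI[of _ "{\<one>}"]) (simp add: \<phi>_one)
  next
    case (Suc m)
    then obtain K where K: "subgroup K L" "free_abelian (restrict_group L K)"
      "\<forall>x\<in>K. \<forall>i<r. m \<le> i \<longrightarrow> \<phi> i x = 0"
      "\<forall>x\<in>carrier L. (\<forall>i<r. m \<le> i \<longrightarrow> \<phi> i x = 0) \<longrightarrow> (\<exists>k\<in>K. \<forall>i<r. \<phi> i k = \<phi> i x)"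
      by auto
    interpret K: subgroup K L by fact
    obtain t where t: "t \<in> carrier L" "\<forall>i<r. \<phi> i t = (if i = m then 1 else 0)"
      using \<phi>_dual[of m] Suc.prems by auto
    have m: "m < r" using Suc.prems by simp
    define K' where "K' = {k \<otimes> t [^] (n::int) | k n. k \<in> K}"
    have indep: "n = 0" if "k \<in> K" "k \<otimes> t [^] (n::int) = \<one>" for k n
    proof -
      have "\<phi> m (k \<otimes> t [^] n) = n" using that(1) t m K(3) by (simp add: \<phi>_mult \<phi>_pow)
      then show ?thesis using that(2) m by (simp add: \<phi>_one)
    qed
    have K': "subgroup K' L" "free_abelian (restrict_group L K')"
      unfolding K'_def using free_abelian_extend[OF comm_group_axioms K(1,2) t(1) indep] by auto
    have 1: "\<phi> i x = 0" if x: "x \<in> K'" "i < r" "Suc m \<le> i" for x i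
    proof -
      obtain k and n :: int where kn: "x = k \<otimes> t [^] n" "k \<in> K" using x(1) unfolding K'_def by blast
      have "i \<noteq> m" "m \<le> i" using x(3) by simp_all
      moreover have "k \<in> carrier L" using kn(2) by simp
      moreover have "\<phi> i k = 0" using K(3) kn(2) x(2) \<open>m \<le> i\<close> by blast
      ultimately show ?thesis using t x(2) unfolding kn(1) by (simp add: \<phi>_mult \<phi>_pow)
    qed
    have 2: "\<exists>k\<in>K'. \<forall>i<r. \<phi> i k = \<phi> i x" if x: "x \<in> carrier L" "\<forall>i<r. Suc m \<le> i \<longrightarrow> \<phi> i x = 0" for x
    proof -
      define n where "n = \<phi> m x"
      have "x \<otimes> t [^] (- n) \<in> carrier L" using x t by simp
      moreover have "\<phi> i (x \<otimes> t [^] (- n)) = 0" if "i < r" "m \<le> i" for i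
      proof (cases "i = m")
        case True
        then show ?thesis using x(1) t that by (simp add: \<phi>_mult \<phi>_pow n_def)
      next
        case False
        then have "\<phi> i x = 0" using x(2) that by simp
        then show ?thesis using x(1) t that False by (simp add: \<phi>_mult \<phi>_pow)
      qed
      ultimately obtain k where k: "k \<in> K" "\<forall>i<r. \<phi> i k = \<phi> i (x \<otimes> t [^] (- n))"
        using K(4) by blast
      have "\<phi> i (k \<otimes> t [^] n) = \<phi> i x" if "i < r" for i
        using k x t that by (simp add: \<phi>_mult \<phi>_pow)
      moreover have "k \<otimes> t [^] n \<in> K'" unfolding K'_def using k(1) by blast
      ultimately show ?thesis by blast
    qed
    show ?case using K' 1 2 by blast
  qed
  from this[of r] obtain K where K: "subgroup K L" "free_abelian (restrict_group L K)"
    "\<forall>x\<in>carrier L. \<exists>k\<in>K. \<forall>i<r. \<phi> i k = \<phi> i x" by auto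
  interpret K: subgroup K L by fact
  have "x \<in> K <#> tors" if x: "x \<in> carrier L" for x
  proof -
    obtain k where k: "k \<in> K" "\<forall>i<r. \<phi> i k = \<phi> i x" using K(3) x by blast
    have "inv k \<otimes> x \<in> tors" using k x by (simp add: tors_def \<phi>_mult \<phi>_inv)
    then have "k \<otimes> (inv k \<otimes> x) \<in> K <#> tors" using k by (intro set_multI)
    then show ?thesis using k x by (simp add: cancel_r)
  qed
  moreover have "K <#> tors \<subseteq> carrier L" by (auto simp: set_mult_def tors_def)
  moreover have "K \<inter> tors = {\<one>}"
    using tors_free_trivial[OF K(1,2)] subgroup.one_closed[OF subgroup_tors] by auto
  ultimately show ?thesis using that[OF K(1,2)] by blast
qed

text \<open>If some coordinate is nonzero on T, an element t of T with its least positive value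
  splits T into the multiples of t and the kernel of that coordinate. Then K together with t is a
  larger free summand, against maximality.\<close>

lemma max_free_summand_complement:
  assumes K: "max_free_summand L K" and T: "subgroup T L" "K <#> T = carrier L" "K \<inter> T = {\<one>}"
  shows "T \<subseteq> tors"
proof (rule ccontr)
  assume "\<not> T \<subseteq> tors"
  interpret T: subgroup T L by fact
  have KL: "subgroup K L" "free_abelian (restrict_group L K)"
    using K by (simp_all add: max_free_summand_def free_summand_def direct_summand_def)
  interpret K: subgroup K L by fact
  obtain x i where xi: "x \<in> T" "i < r" "\<phi> i x \<noteq> 0" using \<open>\<not> T \<subseteq> tors\<close> by (auto simp: tors_def)
  define P where "P n \<longleftrightarrow> n > 0 \<and> (\<exists>t\<in>T. \<phi> i t = int n)" for n
  have "P (nat \<bar>\<phi> i x\<bar>)"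
  proof (cases "\<phi> i x > 0")
    case True
    then show ?thesis using xi(1) unfolding P_def by (intro conjI bexI[of _ x]) auto
  next
    case False
    then show ?thesis using xi unfolding P_def
      by (intro conjI bexI[of _ "inv x"]) (auto simp: \<phi>_inv)
  qed
  then have "P (LEAST n. P n)" by (rule LeastI)
  define m where "m = (LEAST n. P n)"
  have "P m" unfolding m_def by fact
  then obtain t where t: "t \<in> T" "\<phi> i t = int m" "m > 0" unfolding P_def by blast
  have dvd: "int m dvd \<phi> i s" if s: "s \<in> T" for s
  proof (rule ccontr)
    assume nd: "\<not> int m dvd \<phi> i s"
    define q where "q = \<phi> i s div int m"
    have "\<phi> i (s \<otimes> t [^] (- q)) = \<phi> i s mod int m"
      using s t xi(2) by (simp add: \<phi>_mult \<phi>_pow q_def minus_mult_div_eq_mod[symmetric] mult.commute)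
    moreover have "s \<otimes> t [^] (- q) \<in> T"
      using s subgroup_int_pow_closed[OF T(1) t(1)] by simp
    moreover have lt: "\<phi> i s mod int m < int m" by (rule pos_mod_bound) (use t(3) in linarith)
    moreover have pos: "0 < \<phi> i s mod int m"
    proof -
      have "0 \<le> \<phi> i s mod int m" by (rule pos_mod_sign) (use t(3) in linarith)
      moreover have "\<phi> i s mod int m \<noteq> 0" using nd by (rule contrapos_nn) (rule mod_0_imp_dvd)
      ultimately show ?thesis by linarith
    qed
    ultimately have "P (nat (\<phi> i s mod int m))"
      unfolding P_def by (intro conjI bexI[of _ "s \<otimes> t [^] (- q)"]) linarith+
    then have "m \<le> nat (\<phi> i s mod int m)" unfolding m_def by (rule Least_le)
    then show False using lt pos by linarith
  qed
  define K' where "K' = {k \<otimes> t [^] (n::int) | k n. k \<in> K}"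
  have tpow: "t [^] (n::int) \<in> T" for n by (rule subgroup_int_pow_closed[OF T(1) t(1)])
  have KT1: "k = \<one> \<and> s = \<one>" if "k \<in> K" "s \<in> T" "k \<otimes> s = \<one>" for k s
  proof -
    have "inv s = k" using that by (intro inv_equality) auto
    then have "k \<in> T" using that(2) T.m_inv_closed by metis
    then have k1: "k = \<one>" using that(1) T(3) by blast
    then show ?thesis using that by simp
  qed
  have pow_eq: "n = 0" if "\<phi> i (t [^] (n::int)) = 0" for n
    using that t xi(2) by (simp add: \<phi>_pow)
  have indep: "n = 0" if "k \<in> K" "k \<otimes> t [^] (n::int) = \<one>" for k n
    using KT1[OF that(1) tpow that(2)] pow_eq[of n] xi(2) by (simp add: \<phi>_one)
  have K': "subgroup K' L" "free_abelian (restrict_group L K')"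
    unfolding K'_def using free_abelian_extend[OF comm_group_axioms KL _ indep] t(1) by auto
  define T' where "T' = {s \<in> T. \<phi> i s = 0}"
  have T': "subgroup T' L"
    by (rule subgroupI) (use xi(2) in \<open>auto simp: T'_def \<phi>_mult \<phi>_inv \<phi>_one intro!: exI[of _ "\<one>"]\<close>)
  have "K' <#> T' = carrier L"
  proof
    show "K' <#> T' \<subseteq> carrier L" using subgroup.subset[OF K'(1)] by (auto simp: set_mult_def T'_def)
    show "carrier L \<subseteq> K' <#> T'"
    proof
      fix y assume "y \<in> carrier L"
      then obtain k s where y: "k \<in> K" "s \<in> T" "y = k \<otimes> s" unfolding T(2)[symmetric] set_mult_def by blast
      obtain q where q: "\<phi> i s = int m * q" using dvd[OF y(2)] by (rule dvdE)
      have "t [^] (- q) \<otimes> s \<in> T'" using y(2) tpow t xi(2) by (simp add: T'_def \<phi>_mult \<phi>_pow q)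
      moreover have "k \<otimes> t [^] q \<in> K'" unfolding K'_def using y(1) by blast
      ultimately have "(k \<otimes> t [^] q) \<otimes> (t [^] (- q) \<otimes> s) \<in> K' <#> T'" by (intro set_multI)
      moreover have "(k \<otimes> t [^] q) \<otimes> (t [^] (- q) \<otimes> s) = y"
        using y t(1) by (simp add: m_assoc int_pow_neg cancel_r)
      ultimately show "y \<in> K' <#> T'" by simp
    qed
  qed
  moreover have "K' \<inter> T' = {\<one>}"
  proof -
    have "y = \<one>" if yK: "y \<in> K'" "y \<in> T'" for y
    proof -
      obtain k n where y: "y = k \<otimes> t [^] (n::int)" "k \<in> K" using yK unfolding K'_def by blast
      have yT: "y \<in> T" "\<phi> i y = 0" using yK(2) by (auto simp: T'_def)
      have tn: "t [^] n \<in> carrier L" using t(1) by simp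
      have "k \<otimes> (t [^] n \<otimes> inv y) = y \<otimes> inv y"
        unfolding y(1)[symmetric, THEN arg_cong, of "\<lambda>x. x \<otimes> inv y", symmetric]
        by (rule m_assoc[symmetric]) (use y(2) tn yT(1) in auto)
      also have "\<dots> = \<one>" using yT(1) by simp
      finally have "k = \<one>" using KT1[OF y(2), of "t [^] n \<otimes> inv y"] tpow yT(1) by simp
      then have yt: "y = t [^] n" using y(1) tn by simp
      then have "n = 0" using pow_eq yT(2) by blast
      then show ?thesis using yt by simp
    qed
    then show ?thesis using subgroup.one_closed[OF K'(1)] subgroup.one_closed[OF T'] by blast
  qed
  ultimately have "free_summand L K'" unfolding free_summand_def direct_summand_def using K' T' by blast
  moreover have "K \<subseteq> K'"
  proof
    fix k assume "k \<in> K"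
    then have "k \<otimes> t [^] (0::int) \<in> K'" unfolding K'_def by blast
    then show "k \<in> K'" using \<open>k \<in> K\<close> by simp
  qed
  ultimately have "K' = K" using K unfolding max_free_summand_def by blast
  moreover have "\<one> \<otimes> t [^] (1::int) \<in> K'" unfolding K'_def using K.one_closed by blast
  ultimately have "t \<in> K" using t(1) by simp
  then have "t = \<one>" using t(1) T(3) by blast
  then show False using t(2,3) xi(2) by (simp add: \<phi>_one)
qed

text \<open>\<open>free_part_iso\<close> speaks of all maximal free summands. The complement of each
  lies in the torsion subgroup, so the coordinates map the summand isomorphically onto Z^r.\<close>

theorem free_part: "free_part_iso L (Z_power r)"
proof -
  obtain K where K: "subgroup K L" "free_abelian (restrict_group L K)" "K <#> tors = carrier L"
    "K \<inter> tors = {\<one>}"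
    by (rule exists_free_complement)
  have "max_free_summand L K"
    unfolding max_free_summand_def
  proof (intro conjI allI impI)
    show "free_summand L K" unfolding free_summand_def direct_summand_def using K subgroup_tors by blast
    fix K' assume K': "free_summand L K' \<and> K \<subseteq> K'"
    then have sub: "subgroup K' L" "free_abelian (restrict_group L K')"
      by (simp_all add: free_summand_def direct_summand_def)
    interpret K: subgroup K L by fact
    interpret K': subgroup K' L by (rule sub)
    have "x \<in> K" if x: "x \<in> K'" for x
    proof -
      have "x \<in> K <#> tors" using x by (simp add: K(3))
      then obtain k s where ks: "k \<in> K" "s \<in> tors" "x = k \<otimes> s" unfolding set_mult_def by blast
      have s: "s \<in> carrier L" using ks(2) by (simp add: tors_def)
      have "inv k \<otimes> x \<in> K'" using ks(1) K' x by (intro K'.m_closed K'.m_inv_closed) auto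
      then have "s \<in> K'" using ks(1,3) s by (simp add: cancel_l)
      then have "s = \<one>" using tors_free_trivial[OF sub] ks(2) by blast
      then show ?thesis using ks by simp
    qed
    then show "K' = K" using K' by blast
  qed
  moreover have "restrict_group L K \<cong> Z_power r" if K: "max_free_summand L K" for K
  proof -
    have KL: "subgroup K L" "free_abelian (restrict_group L K)"
      using K by (simp_all add: max_free_summand_def free_summand_def direct_summand_def)
    interpret K: subgroup K L by (rule KL)
    obtain T where T: "subgroup T L" "K <#> T = carrier L" "K \<inter> T = {\<one>}"
      using K unfolding max_free_summand_def free_summand_def direct_summand_def by blast
    have "T \<subseteq> tors" by (rule max_free_summand_complement[OF K T])
    define \<Phi> where "\<Phi> x = (\<lambda>i\<in>{..<r}. \<phi> i x)" for x
    have "\<Phi> \<in> hom (restrict_group L K) (Z_power r)"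
      by (auto simp: hom_def \<Phi>_def Z_power_def product_group_def \<phi>_mult fun_eq_iff)
    moreover have "inj_on \<Phi> K"
    proof (rule inj_onI)
      fix x y assume xy: "x \<in> K" "y \<in> K" "\<Phi> x = \<Phi> y"
      have "\<phi> i x = \<phi> i y" if "i < r" for i using fun_cong[OF xy(3), of i] that by (simp add: \<Phi>_def)
      then have "x \<otimes> inv y \<in> tors" using xy by (simp add: tors_def \<phi>_mult \<phi>_inv)
      then have "x \<otimes> inv y = \<one>" using xy by (intro tors_free_trivial[OF KL]) auto
      then show "x = y" using xy inv_equality[of x "inv y"] by simp
    qed
    moreover have "\<Phi> ` K = carrier (Z_power r)"
    proof
      show "\<Phi> ` K \<subseteq> carrier (Z_power r)" by (auto simp: \<Phi>_def Z_power_def intro!: restrict_PiE_iff[THEN iffD2])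
      show "carrier (Z_power r) \<subseteq> \<Phi> ` K"
      proof
        fix c assume c: "c \<in> carrier (Z_power r)"
        obtain x where x: "x \<in> carrier L" "\<forall>i<r. \<phi> i x = c i" using \<phi>_surj by blast
        then obtain k s where ks: "k \<in> K" "s \<in> T" "x = k \<otimes> s" unfolding T(2)[symmetric] set_mult_def by blast
        then have "s \<in> tors" using \<open>T \<subseteq> tors\<close> by blast
        then have "\<phi> i k = c i" if "i < r" for i using x(2) ks that by (auto simp: tors_def \<phi>_mult)
        then have "\<Phi> k = c" using c by (auto simp: \<Phi>_def fun_eq_iff Z_power_def product_group_def PiE_def extensional_def)
        then show "c \<in> \<Phi> ` K" using ks(1) by blast
      qed
    qed
    ultimately have "\<Phi> \<in> iso (restrict_group L K) (Z_power r)" by (simp add: iso_def bij_betw_def)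
    then show ?thesis unfolding is_iso_def by blast
  qed
  ultimately show ?thesis unfolding free_part_iso_def by blast
qed

end

section \<open>Integral coordinates\<close>

definition add_map :: "'a::ab_group_add set \<Rightarrow> ('a \<Rightarrow> int) \<Rightarrow> bool" where
  "add_map Z \<phi> \<longleftrightarrow> (\<forall>x\<in>Z. \<forall>y\<in>Z. \<phi> (x + y) = \<phi> x + \<phi> y)"

lemma add_mapD:
  assumes "add_map Z \<phi>" "add_sub Z"
  shows "x \<in> Z \<Longrightarrow> y \<in> Z \<Longrightarrow> \<phi> (x + y) = \<phi> x + \<phi> y" "\<phi> 0 = 0" "x \<in> Z \<Longrightarrow> \<phi> (- x) = - \<phi> x"
    "x \<in> Z \<Longrightarrow> y \<in> Z \<Longrightarrow> \<phi> (x - y) = \<phi> x - \<phi> y"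
proof -
  show add: "\<phi> (x + y) = \<phi> x + \<phi> y" if "x \<in> Z" "y \<in> Z" for x y using assms(1) that by (simp add: add_map_def)
  show 0: "\<phi> 0 = 0" using add[of 0 0] add_subD(1)[OF assms(2)] by simp
  show minus: "\<phi> (- x) = - \<phi> x" if "x \<in> Z" for x
    using add[of x "- x"] add_subD(3)[OF assms(2) that] that 0 by simp
  show "\<phi> (x - y) = \<phi> x - \<phi> y" if "x \<in> Z" "y \<in> Z" for x y
    using add[of x "- y"] add_subD(3)[OF assms(2)] minus that by simp
qed

lemma add_sub_of_int:
  fixes Z :: "'a::comm_ring_1 set"
  assumes "add_sub Z" "x \<in> Z" shows "of_int k * x \<in> Z"
proof -
  have nat: "of_nat n * x \<in> Z" for n
    by (induction n) (use add_subD(1,4)[OF assms(1)] assms(2) in \<open>simp_all add: distrib_right\<close>)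
  show ?thesis
  proof (cases k rule: int_cases2)
    case (nonneg n)
    then show ?thesis using nat[of n] by simp
  next
    case (nonpos n)
    then show ?thesis using add_subD(3)[OF assms(1) nat[of n]] by simp
  qed
qed

lemma add_map_of_int:
  fixes Z :: "'a::comm_ring_1 set"
  assumes "add_map Z \<phi>" "add_sub Z" "x \<in> Z" shows "\<phi> (of_int k * x) = k * \<phi> x"
proof -
  have nat: "\<phi> (of_nat n * x) = int n * \<phi> x" for n
  proof (induction n)
    case (Suc n)
    have "of_nat n * x \<in> Z" using add_sub_of_int[OF assms(2,3), of "int n"] by simp
    then show ?case using Suc add_mapD(1)[OF assms(1,2,3), of "of_nat n * x"] by (simp add: distrib_right)
  qed (use add_mapD(2)[OF assms(1,2)] in simp)
  show ?thesis
  proof (cases k rule: int_cases2)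
    case (nonneg n)
    then show ?thesis using nat[of n] by simp
  next
    case (nonpos n)
    have "of_nat n * x \<in> Z" using add_sub_of_int[OF assms(2,3), of "int n"] by simp
    then show ?thesis using nat[of n] add_mapD(3)[OF assms(1,2), of "of_nat n * x"] nonpos by simp
  qed
qed

text \<open>The values of \<phi> form a nonzero ideal of Z, generated by its least positive
  element.\<close>

lemma add_map_generator:
  assumes \<phi>: "add_map Z \<phi>" and Z: "add_sub (Z :: 'a::comm_ring_1 set)" and x: "x \<in> Z" "\<phi> x \<noteq> 0"
  obtains m y where "y \<in> Z" "\<phi> y = m" "m > 0" "\<And>z. z \<in> Z \<Longrightarrow> m dvd \<phi> z"
proof -
  define P where "P n \<longleftrightarrow> n > 0 \<and> (\<exists>t\<in>Z. \<phi> t = int n)" for n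
  have "\<exists>t\<in>Z. \<phi> t = \<bar>\<phi> x\<bar>"
    using x add_subD(3)[OF Z x(1)] add_mapD(3)[OF \<phi> Z x(1)] by (cases "\<phi> x > 0") force+
  then have "P (nat \<bar>\<phi> x\<bar>)" using x(2) by (simp add: P_def)
  then have "P (LEAST n. P n)" by (rule LeastI)
  define m where "m = (LEAST n. P n)"
  have "P m" unfolding m_def by fact
  then obtain t where t: "t \<in> Z" "\<phi> t = int m" "m > 0" unfolding P_def by blast
  have "int m dvd \<phi> z" if z: "z \<in> Z" for z
  proof (rule ccontr)
    assume nd: "\<not> int m dvd \<phi> z"
    have tq: "of_int (\<phi> z div int m) * t \<in> Z" by (rule add_sub_of_int[OF Z t(1)])
    have "\<phi> (z - of_int (\<phi> z div int m) * t) = \<phi> z mod int m"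
      unfolding add_mapD(4)[OF \<phi> Z z tq] add_map_of_int[OF \<phi> Z t(1)] t(2)
      by (rule minus_div_mult_eq_mod)
    moreover have "z - of_int (\<phi> z div int m) * t \<in> Z" by (rule add_subD(2)[OF Z z tq])
    moreover have lt: "\<phi> z mod int m < int m" by (rule pos_mod_bound) (use t(3) in linarith)
    moreover have pos: "0 < \<phi> z mod int m"
    proof -
      have "0 \<le> \<phi> z mod int m" by (rule pos_mod_sign) (use t(3) in linarith)
      moreover have "\<phi> z mod int m \<noteq> 0" using nd by (rule contrapos_nn) (rule mod_0_imp_dvd)
      ultimately show ?thesis by linarith
    qed
    ultimately have "P (nat (\<phi> z mod int m))"
      unfolding P_def by (intro conjI bexI[of _ "z - of_int (\<phi> z div int m) * t"]) linarith+
    then have "m \<le> nat (\<phi> z mod int m)" unfolding m_def by (rule Least_le)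
    then show False using lt pos by linarith
  qed
  then show ?thesis using that[of t "int m"] t by simp
qed

text \<open>Coordinates that are dual only up to factors are made integrally dual one at a time:
  divide \<open>\<phi> k\<close> by the generator m of its image, take y with value m, and apply the
  induction to the kernel of \<open>\<phi> k\<close>, onto which \<open>pr\<close> projects along
  y.\<close>

lemma dual_coordinates:
  fixes Z :: "'a::comm_ring_1 set"
  assumes "finite J" "add_sub Z" "\<And>j. j \<in> J \<Longrightarrow> add_map Z (\<phi> j)"
    "\<And>j. j \<in> J \<Longrightarrow> \<exists>x\<in>Z. \<phi> j x \<noteq> 0 \<and> (\<forall>i\<in>J. i \<noteq> j \<longrightarrow> \<phi> i x = 0)"
  shows "\<exists>\<psi>. (\<forall>j\<in>J. add_map Z (\<psi> j)) \<and> (\<forall>x\<in>Z. (\<forall>j\<in>J. \<psi> j x = 0) \<longleftrightarrow> (\<forall>j\<in>J. \<phi> j x = 0)) \<and>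
    (\<forall>j\<in>J. \<exists>x\<in>Z. \<forall>i\<in>J. \<psi> i x = (if i = j then 1 else 0))"
  using assms
proof (induction J arbitrary: Z rule: finite_induct)
  case empty
  then show ?case by simp
next
  case (insert k J)
  note Z = insert.prems(1)
  have \<phi>: "add_map Z (\<phi> j)" if "j \<in> insert k J" for j using insert.prems(2) that by blast
  obtain x0 where "x0 \<in> Z" "\<phi> k x0 \<noteq> 0" using insert.prems(3)[of k] by blast
  then obtain m y where y: "y \<in> Z" "\<phi> k y = m" "m > 0" and dvd: "\<And>z. z \<in> Z \<Longrightarrow> m dvd \<phi> k z"
    by (rule add_map_generator[OF \<phi>[OF insertI1] Z]) blast
  define \<psi>k where "\<psi>k z = \<phi> k z div m" for z
  have \<psi>k: "add_map Z \<psi>k" unfolding add_map_def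
  proof (intro ballI)
    fix u v assume uv: "u \<in> Z" "v \<in> Z"
    have "\<phi> k (u + v) = \<phi> k u + \<phi> k v" using add_mapD(1)[OF \<phi>[OF insertI1] Z] uv by simp
    then show "\<psi>k (u + v) = \<psi>k u + \<psi>k v" unfolding \<psi>k_def using div_add[OF dvd[OF uv(1)] dvd[OF uv(2)]] by simp
  qed
  have \<psi>ky: "\<psi>k y = 1" using y by (simp add: \<psi>k_def)
  have \<psi>k_zero: "\<psi>k z = 0 \<longleftrightarrow> \<phi> k z = 0" if "z \<in> Z" for z
    using dvd[OF that] y(3) by (auto simp: \<psi>k_def)
  define Z' where "Z' = {z \<in> Z. \<phi> k z = 0}"
  have Z': "add_sub Z'" "Z' \<subseteq> Z"
    unfolding add_sub_def using add_subD[OF Z] add_mapD[OF \<phi>[OF insertI1] Z] by (auto simp: Z'_def)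
  have \<phi>': "add_map Z' (\<phi> j)" if "j \<in> J" for j
    using \<phi>[of j] that Z'(2) by (auto simp: add_map_def subset_iff)
  have dual': "\<exists>x\<in>Z'. \<phi> j x \<noteq> 0 \<and> (\<forall>i\<in>J. i \<noteq> j \<longrightarrow> \<phi> i x = 0)" if j: "j \<in> J" for j
  proof -
    obtain x where x: "x \<in> Z" "\<phi> j x \<noteq> 0" "\<forall>i\<in>insert k J. i \<noteq> j \<longrightarrow> \<phi> i x = 0"
      using insert.prems(3)[of j] j by blast
    have "k \<noteq> j" using insert.hyps(2) j by blast
    then have "x \<in> Z'" using x by (simp add: Z'_def)
    then show ?thesis using x by blast
  qed
  obtain \<psi>' where \<psi>': "\<And>j. j \<in> J \<Longrightarrow> add_map Z' (\<psi>' j)"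
    "\<And>x. x \<in> Z' \<Longrightarrow> (\<forall>j\<in>J. \<psi>' j x = 0) \<longleftrightarrow> (\<forall>j\<in>J. \<phi> j x = 0)"
    "\<And>j. j \<in> J \<Longrightarrow> \<exists>x\<in>Z'. \<forall>i\<in>J. \<psi>' i x = (if i = j then 1 else 0)"
    using insert.IH[OF Z'(1) \<phi>' dual'] by blast
  define pr where "pr z = z - of_int (\<psi>k z) * y" for z
  have pr: "pr z \<in> Z'" if z: "z \<in> Z" for z
  proof -
    have yz: "of_int (\<psi>k z) * y \<in> Z" by (rule add_sub_of_int[OF Z y(1)])
    have "\<phi> k (pr z) = \<phi> k z - \<psi>k z * m"
      using add_mapD(4)[OF \<phi>[of k] Z z yz] add_map_of_int[OF \<phi>[of k] Z y(1)] y(2) by (simp add: pr_def)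
    also have "\<dots> = 0" using dvd[OF z] by (simp add: \<psi>k_def)
    finally show ?thesis using add_subD(2)[OF Z z yz] by (simp add: Z'_def pr_def)
  qed
  have pr_add: "pr (u + v) = pr u + pr v" if "u \<in> Z" "v \<in> Z" for u v
    using add_mapD(1)[OF \<psi>k Z that] by (simp add: pr_def algebra_simps)
  have pr_id: "pr z = z" if "z \<in> Z'" for z
    using that \<psi>k_zero[of z] by (simp add: pr_def Z'_def)
  define \<psi> where "\<psi> j z = (if j = k then \<psi>k z else \<psi>' j (pr z))" for j z
  have nk: "j \<noteq> k" if "j \<in> J" for j using insert.hyps(2) that by blast
  have 1: "\<forall>j\<in>insert k J. add_map Z (\<psi> j)"
  proof
    fix j assume j: "j \<in> insert k J"
    show "add_map Z (\<psi> j)"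
    proof (cases "j = k")
      case True
      then show ?thesis using \<psi>k by (simp add: \<psi>_def add_map_def)
    next
      case False
      then have "add_map Z' (\<psi>' j)" using \<psi>'(1) j by blast
      then show ?thesis using False pr by (simp add: \<psi>_def add_map_def pr_add)
    qed
  qed
  have 2: "\<forall>x\<in>Z. (\<forall>j\<in>insert k J. \<psi> j x = 0) \<longleftrightarrow> (\<forall>j\<in>insert k J. \<phi> j x = 0)"
  proof
    fix x assume x: "x \<in> Z"
    show "(\<forall>j\<in>insert k J. \<psi> j x = 0) \<longleftrightarrow> (\<forall>j\<in>insert k J. \<phi> j x = 0)"
    proof (cases "\<phi> k x = 0")
      case True
      then have x': "x \<in> Z'" using x by (simp add: Z'_def)
      have "\<psi> k x = 0" using \<psi>k_zero[OF x] True by (simp add: \<psi>_def)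
      moreover have "\<psi> j x = \<psi>' j x" if "j \<in> J" for j using nk[OF that] pr_id[OF x'] by (simp add: \<psi>_def)
      ultimately show ?thesis using True \<psi>'(2)[OF x'] by simp
    next
      case False
      then show ?thesis using \<psi>k_zero[OF x] by (simp add: \<psi>_def)
    qed
  qed
  have 3: "\<forall>j\<in>insert k J. \<exists>x\<in>Z. \<forall>i\<in>insert k J. \<psi> i x = (if i = j then 1 else 0)"
  proof
    fix j assume j: "j \<in> insert k J"
    show "\<exists>x\<in>Z. \<forall>i\<in>insert k J. \<psi> i x = (if i = j then 1 else 0)"
    proof (cases "j = k")
      case True
      have "pr y = 0" by (simp add: pr_def \<psi>ky)
      then have "\<psi> i y = (if i = j then 1 else 0)" if "i \<in> insert k J" for i
        using that True nk \<psi>ky add_mapD(2)[OF \<psi>'(1) Z'(1)] by (auto simp: \<psi>_def)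
      then show ?thesis using y(1) by blast
    next
      case False
      then obtain x where x: "x \<in> Z'" "\<forall>i\<in>J. \<psi>' i x = (if i = j then 1 else 0)" using \<psi>'(3)[of j] j by blast
      have xZ: "x \<in> Z" "\<phi> k x = 0" using x(1) by (simp_all add: Z'_def)
      have "\<psi> i x = (if i = j then 1 else 0)" if "i \<in> insert k J" for i
        using that False x(2) nk \<psi>k_zero[OF xZ(1)] xZ(2) pr_id[OF x(1)] by (auto simp: \<psi>_def)
      then show ?thesis using xZ(1) by blast
    qed
  qed
  show ?case using 1 2 3 by blast
qed

text \<open>By induction on \<open>s\<close>: each new vector eliminates a coordinate in which it is nonzero, and \<open>N\<close> collects the denominators.\<close>

lemma quotient_coordinates:
  fixes M :: "'a::comm_ring_1 set"
  assumes M: "add_sub M" and I: "finite I" and \<kappa>: "\<And>i. i \<in> I \<Longrightarrow> add_map M (\<kappa> i)"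
    and inj: "\<And>f. f \<in> M \<Longrightarrow> (\<And>i. i \<in> I \<Longrightarrow> \<kappa> i f = 0) \<Longrightarrow> f = 0"
    and e: "\<And>i. i \<in> I \<Longrightarrow> e i \<in> M" "\<And>i j. i \<in> I \<Longrightarrow> j \<in> I \<Longrightarrow> \<kappa> j (e i) = (if i = j then 1 else 0)"
    and b: "\<And>k. k < s \<Longrightarrow> b k \<in> M"
    and indep: "\<And>c. (\<Sum>k<s. of_int (c k) * b k) = 0 \<Longrightarrow> \<forall>k<s. c k = 0"
  shows "\<exists>J \<pi> N. J \<subseteq> I \<and> card J + s = card I \<and> (\<forall>j\<in>J. add_map M (\<pi> j)) \<and>
    (\<forall>j\<in>J. \<forall>k<s. \<pi> j (b k) = 0) \<and>
    (\<forall>f\<in>M. (\<forall>j\<in>J. \<pi> j f = 0) \<longrightarrow> (\<exists>N c. N \<noteq> 0 \<and> of_int N * f = (\<Sum>k<s. of_int (c k) * b k))) \<and>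
    N \<noteq> (0 :: int) \<and> (\<forall>i\<in>J. \<forall>j\<in>J. \<pi> j (e i) = (if i = j then N else 0))"
  using b indep
proof (induction s)
  case 0
  have "\<exists>N c. N \<noteq> 0 \<and> of_int N * f = (\<Sum>k<0. of_int (c k) * b k)" if "f \<in> M" "\<forall>i\<in>I. \<kappa> i f = 0" for f
    using inj[OF that(1)] that(2) by (intro exI[of _ 1]) simp
  then show ?case using \<kappa> e(2) by (intro exI[of _ I] exI[of _ \<kappa>] exI[of _ 1]) simp
next
  case (Suc s)
  have b: "b k \<in> M" if "k < s" for k using Suc.prems(1) that by simp
  have indep: "\<forall>k<s. c k = 0" if "(\<Sum>k<s. of_int (c k) * b k) = 0" for c
  proof -
    have "(\<Sum>k<Suc s. of_int ((c(s := 0)) k) * b k) = 0" using that by simp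
    from Suc.prems(2)[OF this, rule_format] show ?thesis by (metis fun_upd_other less_Suc_eq less_irrefl)
  qed
  obtain J \<pi> N where J: "J \<subseteq> I" "card J + s = card I" and \<pi>: "\<forall>j\<in>J. add_map M (\<pi> j)"
    and \<pi>b: "\<forall>j\<in>J. \<forall>k<s. \<pi> j (b k) = 0"
    and ker: "\<And>f. f \<in> M \<Longrightarrow> (\<forall>j\<in>J. \<pi> j f = 0) \<Longrightarrow> (\<exists>N c. N \<noteq> 0 \<and> of_int N * f = (\<Sum>k<s. of_int (c k) * b k))"
    and N: "N \<noteq> 0" and dual: "\<forall>i\<in>J. \<forall>j\<in>J. \<pi> j (e i) = (if i = j then N else 0)"
    using Suc.IH[OF b indep] by blast
  have bs: "b s \<in> M" using Suc.prems(1) by simp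
  have "\<exists>i\<in>J. \<pi> i (b s) \<noteq> 0"
  proof (rule ccontr)
    assume "\<not> (\<exists>i\<in>J. \<pi> i (b s) \<noteq> 0)"
    then obtain K c where K: "K \<noteq> 0" "of_int K * b s = (\<Sum>k<s. of_int (c k) * b k)"
      using ker[OF bs] by blast
    have "(\<Sum>k<Suc s. of_int ((c(s := - K)) k) * b k) = 0" using K(2) by simp
    from Suc.prems(2)[OF this] K(1) show False by (auto split: if_splits)
  qed
  then obtain i where i: "i \<in> J" "\<pi> i (b s) \<noteq> 0" by blast
  define \<beta> where "\<beta> = \<pi> i (b s)"
  define J' where "J' = J - {i}"
  \<comment> \<open>Elimination without fractions: each new coordinate vanishes at
    \<open>b s\<close>, where coordinate i has the nonzero value \<beta>.\<close>
  define \<pi>' where "\<pi>' j f = \<beta> * \<pi> j f - \<pi> j (b s) * \<pi> i f" for j f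
  have finJ: "finite J" using J(1) I by (rule finite_subset)
  have "card J' + Suc s = card I" using i(1) finJ J(2) card_Suc_Diff1[of J i] by (simp add: J'_def)
  moreover have "J' \<subseteq> I" using J(1) by (auto simp: J'_def)
  moreover have "\<forall>j\<in>J'. add_map M (\<pi>' j)"
    using \<pi> i(1) by (auto simp: J'_def \<pi>'_def add_map_def algebra_simps)
  moreover have "\<forall>j\<in>J'. \<forall>k<Suc s. \<pi>' j (b k) = 0"
    using \<pi>b i(1) by (auto simp: J'_def \<pi>'_def less_Suc_eq \<beta>_def)
  moreover have "\<exists>N c. N \<noteq> 0 \<and> of_int N * f = (\<Sum>k<Suc s. of_int (c k) * b k)"
    if f: "f \<in> M" and f0: "\<forall>j\<in>J'. \<pi>' j f = 0" for f
  proof -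
    define g where "g = of_int \<beta> * f - of_int (\<pi> i f) * b s"
    have fb: "of_int \<beta> * f \<in> M" "of_int (\<pi> i f) * b s \<in> M"
      using add_sub_of_int[OF M] f bs by simp_all
    have g: "g \<in> M" unfolding g_def by (rule add_subD(2)[OF M fb])
    have "\<pi> j g = 0" if j: "j \<in> J" for j
    proof -
      have "\<pi> j g = \<pi>' j f"
        using add_mapD(4)[OF \<pi>[rule_format, OF j] M fb] add_map_of_int[OF \<pi>[rule_format, OF j] M] f bs
        by (simp add: g_def \<pi>'_def mult.commute)
      also have "\<dots> = 0"
      proof (cases "j = i")
        case True
        then show ?thesis by (simp add: \<pi>'_def \<beta>_def mult.commute)
      qed (use f0 j in \<open>simp add: J'_def\<close>)
      finally show ?thesis .
    qed
    then obtain K c where K: "K \<noteq> 0" "of_int K * g = (\<Sum>k<s. of_int (c k) * b k)" using ker[OF g] by blast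
    have "of_int (K * \<beta>) * f = of_int K * g + of_int (K * \<pi> i f) * b s" by (simp add: g_def algebra_simps)
    also have "\<dots> = (\<Sum>k<Suc s. of_int ((c(s := K * \<pi> i f)) k) * b k)" by (simp add: K(2))
    finally show ?thesis using K(1) i(2) by (intro exI[of _ "K * \<beta>"] exI[of _ "c(s := K * \<pi> i f)"]) (simp add: \<beta>_def)
  qed
  moreover have "\<beta> * N \<noteq> 0" using i(2) N by (simp add: \<beta>_def)
  moreover have "\<forall>i\<in>J'. \<forall>j\<in>J'. \<pi>' j (e i) = (if i = j then \<beta> * N else 0)"
    using dual i(1) by (auto simp: J'_def \<pi>'_def)
  ultimately show ?case by (intro exI[of _ J'] exI[of _ \<pi>'] exI[of _ "\<beta> * N"]) blast
qed

text \<open>\<open>dual_coordinates\<close> turns the given coordinates into integrally dual ones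
  with the same common kernel, which \<open>ker\<close> makes torsion modulo B; they then descend to
  the quotient as required by \<open>free_coords\<close>.\<close>

lemma free_part_add_quotient:
  fixes Z :: "'a::comm_ring_1 set"
  assumes "add_quotient Z B" "finite J" and \<phi>: "\<And>j. j \<in> J \<Longrightarrow> add_map Z (\<phi> j)"
    and kills: "\<And>j x. j \<in> J \<Longrightarrow> x \<in> B \<Longrightarrow> \<phi> j x = 0"
    and ker: "\<And>x. x \<in> Z \<Longrightarrow> (\<And>j. j \<in> J \<Longrightarrow> \<phi> j x = 0) \<Longrightarrow> \<exists>N>0. of_nat N * x \<in> B"
    and dual: "\<And>j. j \<in> J \<Longrightarrow> \<exists>x\<in>Z. \<phi> j x \<noteq> 0 \<and> (\<forall>i\<in>J. i \<noteq> j \<longrightarrow> \<phi> i x = 0)"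
  shows "free_part_iso (add_grp Z Mod B) (Z_power (card J))"
proof -
  interpret add_quotient Z B by fact
  obtain \<psi> where \<psi>: "\<And>j. j \<in> J \<Longrightarrow> add_map Z (\<psi> j)"
    and \<psi>0: "\<And>x. x \<in> Z \<Longrightarrow> (\<forall>j\<in>J. \<psi> j x = 0) \<longleftrightarrow> (\<forall>j\<in>J. \<phi> j x = 0)"
    and \<psi>d: "\<And>j. j \<in> J \<Longrightarrow> \<exists>x\<in>Z. \<forall>i\<in>J. \<psi> i x = (if i = j then 1 else 0)"
    using dual_coordinates[OF assms(2) Z \<phi> dual] by blast
  obtain \<epsilon> where \<epsilon>: "bij_betw \<epsilon> {..<card J} J" using ex_bij_betw_nat_finite[OF assms(2)] by (auto simp: atLeast0LessThan)
  have \<epsilon>J: "\<epsilon> i \<in> J" if "i < card J" for i using \<epsilon> that by (auto simp: bij_betw_def)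
  have \<epsilon>_inj: "\<epsilon> i = \<epsilon> j \<longleftrightarrow> i = j" if "i < card J" "j < card J" for i j
    using \<epsilon> that by (auto simp: bij_betw_def inj_on_eq_iff)
  define \<theta> where "\<theta> i C = \<psi> (\<epsilon> i) (SOME z. z \<in> Z \<and> cls z = C)" for i C
  have \<theta>: "\<theta> i (cls z) = \<psi> (\<epsilon> i) z" if z: "z \<in> Z" and i: "i < card J" for i z
  proof -
    define w where "w = (SOME w. w \<in> Z \<and> cls w = cls z)"
    have w: "w \<in> Z \<and> cls w = cls z" unfolding w_def by (rule someI_ex) (use z in blast)
    then have wz: "w - z \<in> B" by (simp only: cls_eq_iff)
    then have "\<psi> (\<epsilon> i) (w - z) = 0" using \<psi>0[of "w - z"] BZ kills \<epsilon>J[OF i] by blast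
    then show ?thesis using add_mapD(4)[OF \<psi>[OF \<epsilon>J[OF i]] Z] w z by (simp add: \<theta>_def w_def)
  qed
  interpret Q: comm_group Q by (rule comm_group_Q)
  interpret fc: free_coords Q \<theta> "card J"
  proof
    fix i assume i: "i < card J"
    show "\<theta> i \<in> hom Q integer_group"
    proof (rule homI)
      fix x y assume "x \<in> carrier Q" "y \<in> carrier Q"
      then obtain a c where "x = cls a" "y = cls c" "a \<in> Z" "c \<in> Z" unfolding carrier_Q by blast
      then show "\<theta> i (x \<otimes>\<^bsub>Q\<^esub> y) = \<theta> i x \<otimes>\<^bsub>integer_group\<^esub> \<theta> i y"
        using i add_mapD(1)[OF \<psi>[OF \<epsilon>J[OF i]] Z] add_subD(4)[OF Z] by (simp add: mult_Q \<theta> del: mult_FactGroup)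
    qed simp
    obtain x where x: "x \<in> Z" "\<forall>j\<in>J. \<psi> j x = (if j = \<epsilon> i then 1 else 0)" using \<psi>d[OF \<epsilon>J[OF i]] by blast
    then have "\<forall>j<card J. \<theta> j (cls x) = (if j = i then 1 else 0)" using \<epsilon>J i by (simp add: \<theta> \<epsilon>_inj)
    then show "\<exists>x\<in>carrier Q. \<forall>j<card J. \<theta> j x = (if j = i then 1 else 0)" using x(1) unfolding carrier_Q by blast
  next
    fix C assume "C \<in> carrier Q" and C0: "\<And>i. i < card J \<Longrightarrow> \<theta> i C = 0"
    then obtain x where x: "C = cls x" "x \<in> Z" unfolding carrier_Q by blast
    have "\<psi> j x = 0" if j: "j \<in> J" for j
    proof -
      obtain i where "i < card J" "j = \<epsilon> i" using \<epsilon> j by (auto simp: bij_betw_def)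
      then show ?thesis using C0[of i] x by (simp add: \<theta>)
    qed
    then obtain N :: nat where N: "N > 0" "of_nat N * x \<in> B" using ker[OF x(2)] \<psi>0[OF x(2)] by blast
    have "((+) x ^^ N) 0 = of_nat N * x" by (induction N) (simp_all add: distrib_right)
    then have "C [^]\<^bsub>Q\<^esub> N = \<one>\<^bsub>Q\<^esub>" using pow_Q[OF x(2), of N] N(2) cls_eq_one_iff x(1) by metis
    then show "\<exists>N>0. C [^]\<^bsub>Q\<^esub> (N::nat) = \<one>\<^bsub>Q\<^esub>" using N(1) by blast
  qed
  show ?thesis by (rule fc.free_part)
qed

section \<open>Ranks of the invariants of elements of finite order\<close>

text \<open>A basis of the rational span of S consisting of elements of S, phrased over Z by
  clearing denominators.\<close>

definition rat_basis :: "nat \<Rightarrow> (nat \<Rightarrow> 'a::comm_ring_1) \<Rightarrow> 'a set \<Rightarrow> bool" where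
  "rat_basis s b S \<longleftrightarrow> (\<forall>k<s. b k \<in> S) \<and> (\<forall>c. (\<Sum>k<s. of_int (c k) * b k) = 0 \<longrightarrow> (\<forall>k<s. c k = 0)) \<and>
    (\<forall>f\<in>S. \<exists>N c. N \<noteq> 0 \<and> of_int N * f = (\<Sum>k<s. of_int (c k) * b k))"

lemma rat_basisD:
  assumes "rat_basis s b S"
  shows "k < s \<Longrightarrow> b k \<in> S" "(\<Sum>k<s. of_int (c k) * b k) = 0 \<Longrightarrow> k < s \<Longrightarrow> c k = 0"
    "f \<in> S \<Longrightarrow> \<exists>N c. N \<noteq> 0 \<and> of_int N * f = (\<Sum>k<s. of_int (c k) * b k)"
  using assms unfolding rat_basis_def by blast+

lemma sum_lessThan_add:
  fixes g :: "nat \<Rightarrow> 'a::comm_monoid_add"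
  shows "(\<Sum>k<s + t. g k) = (\<Sum>k<s. g k) + (\<Sum>k<t. g (s + k))"
  by (induction t) (simp_all add: add.assoc)

lemma span_in_add_sub:
  fixes S :: "'a::comm_ring_1 set"
  assumes "add_sub S" "\<And>k. k < s \<Longrightarrow> b k \<in> S"
  shows "(\<Sum>k<(s::nat). of_int (c k) * b k) \<in> S"
  using assms(2)
proof (induction s)
  case (Suc s)
  then show ?case using add_subD(4)[OF assms(1)] add_sub_of_int[OF assms(1), of "b s" "c s"] by simp
qed (simp add: add_subD(1)[OF assms(1)])

lemma rat_basis_sum:
  assumes S: "add_sub S" "rat_basis s b S" and T: "add_sub T" "rat_basis t b' T" and disj: "S \<inter> T \<subseteq> {0}"
  shows "rat_basis (s + t) (\<lambda>k. if k < s then b k else b' (k - s)) {x + y | x y. x \<in> S \<and> y \<in> T}"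
    (is "rat_basis _ ?b _")
proof -
  have split: "(\<Sum>k<s + t. of_int (c k) * ?b k) = (\<Sum>k<s. of_int (c k) * b k) + (\<Sum>k<t. of_int (c (s + k)) * b' k)" for c
    by (simp add: sum_lessThan_add)
  have "?b k \<in> {x + y | x y. x \<in> S \<and> y \<in> T}" if "k < s + t" for k
  proof (cases "k < s")
    case True
    then show ?thesis using rat_basisD(1)[OF S(2)] add_subD(1)[OF T(1)] by (intro CollectI exI[of _ "b k"] exI[of _ 0]) simp
  next
    case False
    then have "k - s < t" using that by simp
    then show ?thesis using False rat_basisD(1)[OF T(2)] add_subD(1)[OF S(1)]
      by (intro CollectI exI[of _ 0] exI[of _ "b' (k - s)"]) simp
  qed
  moreover have "c k = 0" if c0: "(\<Sum>k<s + t. of_int (c k) * ?b k) = 0" and k: "k < s + t" for c k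
  proof -
    define x where "x = (\<Sum>k<s. of_int (c k) * b k)"
    define y where "y = (\<Sum>k<t. of_int (c (s + k)) * b' k)"
    have xy: "x \<in> S" "y \<in> T" "x + y = 0"
      using c0 unfolding split x_def y_def
      by (auto intro!: span_in_add_sub S(1) T(1) rat_basisD(1)[OF S(2)] rat_basisD(1)[OF T(2)])
    then have "x = - y" by (simp add: eq_neg_iff_add_eq_0)
    then have "x \<in> T" using add_subD(3)[OF T(1) xy(2)] by simp
    then have x0: "x = 0" using xy(1) disj by blast
    then have y0: "y = 0" using xy(3) by simp
    show ?thesis
    proof (cases "k < s")
      case True
      then show ?thesis using rat_basisD(2)[OF S(2), of c k] x0 by (simp add: x_def)
    next
      case False
      then show ?thesis using rat_basisD(2)[OF T(2), of "\<lambda>k. c (s + k)" "k - s"] y0 k by (simp add: y_def)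
    qed
  qed
  moreover have "\<exists>N c. N \<noteq> 0 \<and> of_int N * f = (\<Sum>k<s + t. of_int (c k) * ?b k)"
    if "f \<in> {x + y | x y. x \<in> S \<and> y \<in> T}" for f
  proof -
    from that obtain x y where f: "f = x + y" and x: "x \<in> S" and y: "y \<in> T" by blast
    obtain N c where N: "N \<noteq> 0" "of_int N * x = (\<Sum>k<s. of_int (c k) * b k)" using rat_basisD(3)[OF S(2) x] by blast
    obtain K d where K: "K \<noteq> 0" "of_int K * y = (\<Sum>k<t. of_int (d k) * b' k)" using rat_basisD(3)[OF T(2) y] by blast
    have "of_int (N * K) * f = of_int K * (of_int N * x) + of_int N * (of_int K * y)" by (simp add: f algebra_simps)
    also have "\<dots> = (\<Sum>k<s + t. of_int (if k < s then K * c k else N * d (k - s)) * ?b k)"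
      unfolding split N(2) K(2) by (simp add: sum_distrib_left mult.assoc)
    finally show ?thesis using N(1) K(1)
      by (intro exI[of _ "N * K"] exI[of _ "\<lambda>k. if k < s then K * c k else N * d (k - s)"]) simp
  qed
  ultimately show ?thesis unfolding rat_basis_def by blast
qed

text \<open>The matrix with companion polynomial \<open>\<zeta>\<^sup>2 - c \<zeta> + 1\<close> fixes the form \<open>x\<^sup>2 - c x y + y\<^sup>2\<close> and multiplies
  the value of a form at \<open>(\<zeta>, 1)\<close> by a power of \<open>\<zeta>\<close>.\<close>

locale rotation =
  fixes c :: int and n :: nat and \<zeta> :: complex
  assumes root: "\<zeta>\<^sup>2 = of_int c * \<zeta> - 1" and Im: "Im \<zeta> \<noteq> 0" and n: "n > 0"
    and order: "\<And>e f. f \<in> Mdeg (4 * e) \<Longrightarrow> (sl2_act (mat2 c 1 (-1) 0) ^^ n) f = f"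
    and root_order: "\<And>e. \<zeta> ^ (2 * e) = 1 \<longleftrightarrow> n dvd e"
begin

abbreviation rot :: "int poly poly \<Rightarrow> int poly poly" where "rot \<equiv> sl2_act (mat2 c 1 (-1) 0)"

definition q :: "int poly poly" where "q = var_x\<^sup>2 - of_int c * var_x * var_y + var_y\<^sup>2"

definition ev :: "int poly poly \<Rightarrow> complex" where "ev f = eval2 f \<zeta> 1"

definition inv_forms :: "nat \<Rightarrow> int poly poly set" where "inv_forms m = {f \<in> Mdeg m. rot f = f}"

lemma rot_q: "rot q = q"
  by (simp add: q_def sl2_act_eq eval2_hom power2_eq_square algebra_simps)

lemma q_Mdeg: "q \<in> Mdeg 4"
proof -
  have xy: "var_x * var_x \<in> Mdeg 4" "var_x * var_y \<in> Mdeg 4" "var_y * var_y \<in> Mdeg 4"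
    using Mdeg_mult[OF Mdeg_vars(1) Mdeg_vars(1)] Mdeg_mult[OF Mdeg_vars(1) Mdeg_vars(2)]
      Mdeg_mult[OF Mdeg_vars(2) Mdeg_vars(2)] by simp_all
  show ?thesis unfolding q_def power2_eq_square mult.assoc by (intro Mdeg_add Mdeg_diff Mdeg_of_int_mult xy)
qed

lemma q_nonzero: "q \<noteq> 0"
proof
  assume "q = 0"
  then have "eval2 q 0 (1::int) = 0" by simp
  then show False by (simp add: q_def eval2_hom)
qed

lemma ev_q: "ev q = 0"
  using root by (simp add: ev_def q_def eval2_hom)

lemma ev_rot:
  assumes "f \<in> Mdeg (2 * d)" shows "ev (rot f) = \<zeta> ^ d * ev f"
proof -
  \<comment> \<open>At (\<zeta>, 1) the substitution x -> c x - y, y -> x gives (c \<zeta> - 1,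
    \<zeta>) = (\<zeta>^2, \<zeta>), which is \<zeta> times (\<zeta>, 1).\<close>
  have "ev (rot f) = eval2 f (\<zeta> * \<zeta>) \<zeta>"
    using root by (simp add: ev_def eval2_sl2_act power2_eq_square)
  also have "\<dots> = (\<Sum>j\<le>d. \<zeta> ^ d * (of_int (hcoeff d f j) * \<zeta> ^ (d - j)))"
    unfolding eval2_homog[OF assms]
  proof (rule sum.cong)
    fix j assume "j \<in> {..d}"
    then have "\<zeta> ^ (d - j) * \<zeta> ^ j = \<zeta> ^ d" by (simp flip: power_add)
    then show "of_int (hcoeff d f j) * (\<zeta> * \<zeta>) ^ (d - j) * \<zeta> ^ j = \<zeta> ^ d * (of_int (hcoeff d f j) * \<zeta> ^ (d - j))"
      by (simp add: power_mult_distrib mult_ac)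
  qed simp
  also have "\<dots> = \<zeta> ^ d * ev f" by (simp add: ev_def eval2_homog[OF assms] sum_distrib_left)
  finally show ?thesis .
qed

lemma lin_indep: "of_int \<alpha> * \<zeta> + of_int \<beta> = 0 \<Longrightarrow> \<alpha> = 0 \<and> \<beta> = 0"
proof -
  assume *: "of_int \<alpha> * \<zeta> + of_int \<beta> = 0"
  then have "Im (of_int \<alpha> * \<zeta> + of_int \<beta>) = 0" by simp
  then have "\<alpha> = 0" using Im by simp
  then show ?thesis using * by simp
qed

text \<open>q is monic in x, so division by it leaves a remainder of degree at most 1 in x.\<close>

lemma q_division:
  assumes f: "f \<in> Mdeg (2 * (d + 2))"
  obtains h \<alpha> \<beta> where "h \<in> Mdeg (2 * d)"
    "f = q * h + of_int \<alpha> * (var_x * var_y ^ (d + 1)) + of_int \<beta> * var_y ^ (d + 2)"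
proof -
  define R where "R = {f. \<exists>h\<in>Mdeg (2 * d). \<exists>\<alpha> \<beta>. f = q * h + of_int \<alpha> * (var_x * var_y ^ (d + 1)) + of_int \<beta> * var_y ^ (d + 2)}"
  have add: "f + g \<in> R" if fg: "f \<in> R" "g \<in> R" for f g
  proof -
    obtain h \<alpha> \<beta> h' \<alpha>' \<beta>' where "h \<in> Mdeg (2 * d)" "h' \<in> Mdeg (2 * d)"
      "f = q * h + of_int \<alpha> * (var_x * var_y ^ (d + 1)) + of_int \<beta> * var_y ^ (d + 2)"
      "g = q * h' + of_int \<alpha>' * (var_x * var_y ^ (d + 1)) + of_int \<beta>' * var_y ^ (d + 2)"
      using fg unfolding R_def by blast
    then show ?thesis unfolding R_def
      by (intro CollectI bexI[of _ "h + h'"] exI[of _ "\<alpha> + \<alpha>'"] exI[of _ "\<beta> + \<beta>'"])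
        (simp_all add: Mdeg_add algebra_simps del: power_Suc)
  qed
  have scale: "of_int k * f \<in> R" if f: "f \<in> R" for f k
  proof -
    obtain h \<alpha> \<beta> where "h \<in> Mdeg (2 * d)"
      "f = q * h + of_int \<alpha> * (var_x * var_y ^ (d + 1)) + of_int \<beta> * var_y ^ (d + 2)"
      using f unfolding R_def by blast
    then have "of_int k * h \<in> Mdeg (2 * d)" "of_int k * f =
        q * (of_int k * h) + of_int (k * \<alpha>) * (var_x * var_y ^ (d + 1)) + of_int (k * \<beta>) * var_y ^ (d + 2)"
      by (simp_all only: Mdeg_of_int_mult of_int_mult distrib_left mult.left_commute mult.assoc)
    then show ?thesis unfolding R_def by blast
  qed
  have qR: "q * h \<in> R" if "h \<in> Mdeg (2 * d)" for h
    unfolding R_def using that by (intro CollectI bexI[of _ h] exI[of _ 0]) simp_all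
  have "i + j = d + 2 \<Longrightarrow> var_x ^ i * var_y ^ j \<in> R" for i j
  proof (induction i arbitrary: j rule: induct_nat_012)
    case 0
    then show ?case unfolding R_def by (intro CollectI bexI[of _ 0] exI[of _ 0] exI[of _ 1]) simp_all
  next
    case 1
    then have "j = d + 1" by simp
    then show ?case unfolding R_def by (intro CollectI bexI[of _ 0] exI[of _ 1] exI[of _ 0]) simp_all
  next
    case (ge2 i)
    have "var_x ^ i * var_y ^ j \<in> Mdeg (i * 2 + j * 2)" by (intro Mdeg_mult Mdeg_power Mdeg_vars)
    also have "i * 2 + j * 2 = 2 * d" using ge2.prems by simp
    finally have h: "var_x ^ i * var_y ^ j \<in> Mdeg (2 * d)" .
    have "var_x ^ Suc i * var_y ^ Suc j \<in> R" "var_x ^ i * var_y ^ (j + 2) \<in> R"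
      using ge2.prems by (auto intro!: ge2.IH simp del: power_Suc)
    then have "q * (var_x ^ i * var_y ^ j) + (of_int c * (var_x ^ Suc i * var_y ^ Suc j) + of_int (-1) * (var_x ^ i * var_y ^ (j + 2))) \<in> R"
      by (intro add scale qR h)
    also have "q * (var_x ^ i * var_y ^ j) + (of_int c * (var_x ^ Suc i * var_y ^ Suc j) + of_int (-1) * (var_x ^ i * var_y ^ (j + 2)))
      = var_x ^ Suc (Suc i) * var_y ^ j" by (simp add: q_def algebra_simps power2_eq_square)
    finally show ?case .
  qed
  then have mono: "var_x ^ (d + 2 - j) * var_y ^ j \<in> R" if "j \<le> d + 2" for j using that by simp
  have "(\<Sum>j\<in>K. of_int (hcoeff (d + 2) f j) * (var_x ^ (d + 2 - j) * var_y ^ j)) \<in> R" if "K \<subseteq> {..d + 2}" for K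
    using finite_subset[OF that finite_atMost] that
  proof (induction K rule: finite_induct)
    case empty
    then show ?case using qR[of 0] by simp
  next
    case (insert j K)
    have "of_int (hcoeff (d + 2) f j) * (var_x ^ (d + 2 - j) * var_y ^ j) \<in> R"
      using insert.prems by (intro scale mono) simp
    moreover have "(\<Sum>j\<in>K. of_int (hcoeff (d + 2) f j) * (var_x ^ (d + 2 - j) * var_y ^ j)) \<in> R"
      using insert.prems by (intro insert.IH) simp
    ultimately show ?case unfolding sum.insert[OF insert.hyps] by (rule add)
  qed
  from this[of "{..d + 2}"] have "f \<in> R" using homog_expand[OF f] by (simp add: mult.assoc)
  then show ?thesis unfolding R_def using that by blast
qed

lemma ev_hom: "ev (f + g) = ev f + ev g" "ev (f - g) = ev f - ev g" "ev (f * g) = ev f * ev g" "ev (of_int k) = of_int k"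
  "ev (\<Sum>k\<in>K. F k) = (\<Sum>k\<in>K. ev (F k))" "ev 0 = 0"
  by (simp_all add: ev_def eval2_hom)

text \<open>1 and \<zeta> are linearly independent over Z, so the remainder modulo q vanishes
  together with the value at (\<zeta>, 1).\<close>

lemma ev_division:
  assumes f: "f \<in> Mdeg (2 * (d + 2))"
  obtains \<alpha> \<beta> where "ev f = of_int \<alpha> * \<zeta> + of_int \<beta>"
    "ev f = 0 \<Longrightarrow> \<exists>h\<in>Mdeg (2 * d). f = q * h"
proof -
  obtain h \<alpha> \<beta> where h: "h \<in> Mdeg (2 * d)"
    "f = q * h + of_int \<alpha> * (var_x * var_y ^ (d + 1)) + of_int \<beta> * var_y ^ (d + 2)"
    by (rule q_division[OF f])
  have e: "ev f = of_int \<alpha> * \<zeta> + of_int \<beta>"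
    unfolding h(2) ev_hom ev_q by (simp add: ev_def eval2_hom)
  moreover have "\<exists>h\<in>Mdeg (2 * d). f = q * h" if "ev f = 0"
    using lin_indep[of \<alpha> \<beta>] e that h by auto
  ultimately show ?thesis using that by blast
qed

lemma add_sub_inv_forms: "add_sub (inv_forms m)"
  by (auto simp: add_sub_def inv_forms_def sl2_act_hom Mdeg_diff)

lemma inv_forms_mult_q: "q * h \<in> inv_forms (m + 4) \<longleftrightarrow> h \<in> inv_forms m" if "h \<in> Mdeg m"
  using that Mdeg_mult[OF q_Mdeg that] q_nonzero by (auto simp: inv_forms_def sl2_act_hom rot_q add.commute)

text \<open>n times the rational projection onto the invariants of the rotation, in degrees where
  its n-th power is the identity.\<close>

definition orbit_sum :: "int poly poly \<Rightarrow> int poly poly" where "orbit_sum f = (\<Sum>k<n. (rot ^^ k) f)"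

lemma rot_pow_Mdeg: "f \<in> Mdeg m \<Longrightarrow> (rot ^^ k) f \<in> Mdeg m"
  by (induction k) (simp_all add: sl2_act_Mdeg)

lemma orbit_sum_inv:
  assumes f: "f \<in> Mdeg (4 * e)" shows "orbit_sum f \<in> inv_forms (4 * e)"
proof -
  have "rot (orbit_sum f) + f = (\<Sum>k<Suc n. (rot ^^ k) f)"
    unfolding sum.lessThan_Suc_shift by (simp add: orbit_sum_def sl2_act_hom)
  also have "\<dots> = orbit_sum f + f" using order[OF f] by (simp add: orbit_sum_def)
  finally show ?thesis
    unfolding inv_forms_def using f by (simp add: orbit_sum_def Mdeg_sum rot_pow_Mdeg)
qed

lemma ev_orbit_sum:
  assumes f: "f \<in> Mdeg (4 * e)" and "n dvd e" shows "ev (orbit_sum f) = of_nat n * ev f"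
proof -
  have z: "\<zeta> ^ (2 * e) = 1" using assms(2) root_order by simp
  have "ev ((rot ^^ k) f) = ev f" for k
  proof (induction k)
    case (Suc k)
    have "(rot ^^ k) f \<in> Mdeg (2 * (2 * e))" using rot_pow_Mdeg[OF f] by simp
    from ev_rot[OF this] show ?case using Suc z by simp
  qed simp
  then show ?thesis by (simp add: orbit_sum_def ev_hom)
qed

text \<open>An invariant form of polynomial degree 2 e satisfies ev f = \<zeta>^(2 e) ev f. Unless n
  | e it vanishes at (\<zeta>, 1) and is q times an invariant form. If n | e > 0, the orbit sums of
  y^(2 e) and x y^(2 e - 1) have the values n and n \<zeta>, so the rank grows by 2.\<close>

lemma inv_forms_rank: "\<exists>b. rat_basis (2 * (e div n) + 1) b (inv_forms (4 * e))"
proof (induction e)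
  case 0
  have "\<exists>N c. N \<noteq> 0 \<and> of_int N * f = (\<Sum>k<Suc 0. of_int (c k) * 1)" if "f \<in> inv_forms 0" for f
  proof -
    have "f = of_int (hcoeff 0 f 0)" using homog_expand[of f 0] that by (simp add: inv_forms_def)
    then have "of_int 1 * f = (\<Sum>k<Suc 0. of_int (hcoeff 0 f 0) * 1)" by simp
    then show ?thesis by (intro exI[of _ 1] exI[of _ "\<lambda>_. hcoeff 0 f 0"]) simp
  qed
  moreover have "(1 :: int poly poly) \<in> inv_forms 0"
    using Mdeg_of_int[of 1] by (simp add: inv_forms_def sl2_act_hom)
  moreover have "c k = 0" if "(\<Sum>k<Suc 0. of_int (c k) * (1 :: int poly poly)) = 0" "k < Suc 0" for c k
    using that by simp
  ultimately have "rat_basis (Suc 0) (\<lambda>_. 1) (inv_forms 0)"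
    unfolding rat_basis_def by blast
  then show ?case by (auto simp: One_nat_def)
next
  case (Suc e)
  then obtain b where b: "rat_basis (2 * (e div n) + 1) b (inv_forms (4 * e))" by blast
  define s where "s = 2 * (e div n) + 1"
  note b = b[folded s_def]
  have Suc4: "4 * Suc e = 4 * e + 4" by simp
  have bM: "b k \<in> Mdeg (4 * e)" if "k < s" for k using rat_basisD(1)[OF b that] by (simp add: inv_forms_def)
  have qb: "q * b k \<in> inv_forms (4 * Suc e)" if "k < s" for k
    unfolding Suc4 using inv_forms_mult_q[OF bM[OF that]] rat_basisD(1)[OF b that] by simp
  have div_q: "\<exists>N c. N \<noteq> 0 \<and> of_int N * f = (\<Sum>k<s. of_int (c k) * (q * b k))"
    if f: "f \<in> inv_forms (4 * Suc e)" and f0: "ev f = 0" for f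
  proof -
    have eq4: "2 * (2 * e + 2) = 4 * Suc e" by simp
    have "f \<in> Mdeg (2 * (2 * e + 2))" using f unfolding inv_forms_def eq4 by blast
    then obtain h where h: "h \<in> Mdeg (2 * (2 * e))" "f = q * h"
      by (rule ev_division) (use f0 in blast)
    then have "h \<in> inv_forms (4 * e)" using f inv_forms_mult_q[of h "4 * e"] unfolding Suc4 by simp
    then obtain N c where N: "N \<noteq> 0" "of_int N * h = (\<Sum>k<s. of_int (c k) * b k)" using rat_basisD(3)[OF b] by blast
    have "of_int N * f = q * (of_int N * h)" by (simp add: h(2) mult.left_commute)
    also have "\<dots> = (\<Sum>k<s. of_int (c k) * (q * b k))" by (simp add: N(2) sum_distrib_left mult.left_commute)
    finally show ?thesis using N(1) by blast
  qed
  have indep: "c k = 0" if "(\<Sum>k<s. of_int (c k) * (q * b k)) = 0" "k < s" for c k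
  proof -
    have "q * (\<Sum>k<s. of_int (c k) * b k) = 0" using that(1) by (simp add: sum_distrib_left mult.left_commute)
    then have "(\<Sum>k<s. of_int (c k) * b k) = 0" using q_nonzero by simp
    then show ?thesis by (rule rat_basisD(2)[OF b _ that(2)])
  qed
  show ?case
  proof (cases "n dvd Suc e")
    case False
    have "ev f = 0" if f: "f \<in> inv_forms (4 * Suc e)" for f
    proof -
      have eq4: "2 * (2 * Suc e) = 4 * Suc e" by simp
      have "f \<in> Mdeg (2 * (2 * Suc e))" "rot f = f" using f unfolding inv_forms_def eq4 by blast+
      then have "ev f = \<zeta> ^ (2 * Suc e) * ev f" using ev_rot[of f "2 * Suc e"] by simp
      then show ?thesis using root_order[of "Suc e"] False by simp
    qed
    then have "rat_basis s (\<lambda>k. q * b k) (inv_forms (4 * Suc e))"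
      unfolding rat_basis_def using qb indep div_q by blast
    moreover have "2 * (Suc e div n) + 1 = s" using False by (simp add: s_def div_Suc dvd_eq_mod_eq_0)
    ultimately show ?thesis by auto
  next
    case True
    have sz: "2 * (Suc e div n) + 1 = Suc (Suc s)" using True by (simp add: s_def div_Suc dvd_eq_mod_eq_0)
    have "var_y ^ (2 * Suc e) \<in> Mdeg (2 * Suc e * 2)" by (intro Mdeg_power Mdeg_vars)
    also have "2 * Suc e * 2 = 4 * Suc e" by simp
    finally have yM: "var_y ^ (2 * Suc e) \<in> Mdeg (4 * Suc e)" .
    have "var_x * var_y ^ (2 * e + 1) \<in> Mdeg (2 + (2 * e + 1) * 2)" by (intro Mdeg_mult Mdeg_power Mdeg_vars)
    also have "2 + (2 * e + 1) * 2 = 4 * Suc e" by simp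
    finally have xM: "var_x * var_y ^ (2 * e + 1) \<in> Mdeg (4 * Suc e)" .
    define w where "w = orbit_sum (var_y ^ (2 * Suc e))"
    define w' where "w' = orbit_sum (var_x * var_y ^ (2 * e + 1))"
    have w: "w \<in> inv_forms (4 * Suc e)" "w' \<in> inv_forms (4 * Suc e)"
      unfolding w_def w'_def by (intro orbit_sum_inv xM yM)+
    have evw: "ev w = of_nat n" "ev w' = of_nat n * \<zeta>"
      unfolding w_def w'_def ev_orbit_sum[OF yM True] ev_orbit_sum[OF xM True]
      by (simp_all add: ev_def eval2_hom)
    define b' where "b' k = (if k < s then q * b k else if k = s then w else w')" for k
    have sum_b': "(\<Sum>k<Suc (Suc s). of_int (c k) * b' k) =
        (\<Sum>k<s. of_int (c k) * (q * b k)) + of_int (c s) * w + of_int (c (Suc s)) * w'" for c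
      by (simp add: b'_def)
    have ev_sum: "ev (\<Sum>k<s. of_int (c k) * (q * b k)) = 0" for c
      by (simp add: ev_hom ev_q)
    have "c k = 0" if c0: "(\<Sum>k<Suc (Suc s). of_int (c k) * b' k) = 0" and k: "k < Suc (Suc s)" for c k
    proof -
      have "ev (\<Sum>k<Suc (Suc s). of_int (c k) * b' k) = 0" unfolding c0 by (rule ev_hom)
      then have "of_int (c (Suc s) * int n) * \<zeta> + of_int (c s * int n) = 0"
        unfolding sum_b' ev_hom(1) ev_sum by (simp add: ev_hom evw mult_ac add_ac)
      from lin_indep[OF this] have cs: "c s = 0" "c (Suc s) = 0" using n by simp_all
      have "c k = 0" if "k < s" for k
        using c0 unfolding sum_b' cs by (intro indep[OF _ that, of c]) simp
      then show ?thesis using cs k by (auto simp: less_Suc_eq)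
    qed
    moreover have "\<exists>N c. N \<noteq> 0 \<and> of_int N * f = (\<Sum>k<Suc (Suc s). of_int (c k) * b' k)"
      if f: "f \<in> inv_forms (4 * Suc e)" for f
    proof -
      have eq4: "2 * (2 * e + 2) = 4 * Suc e" by simp
      have "f \<in> Mdeg (2 * (2 * e + 2))" using f unfolding inv_forms_def eq4 by blast
      then obtain \<alpha> \<beta> where evf: "ev f = of_int \<alpha> * \<zeta> + of_int \<beta>" by (rule ev_division)
      define g where "g = of_int (int n) * f - of_int \<alpha> * w' - of_int \<beta> * w"
      have "g \<in> inv_forms (4 * Suc e)"
        unfolding g_def by (intro add_subD(2)[OF add_sub_inv_forms] add_sub_of_int add_sub_inv_forms f w)
      moreover have "ev g = 0" unfolding g_def ev_hom evw evf by (simp add: algebra_simps)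
      ultimately obtain N d where N: "N \<noteq> 0" "of_int N * g = (\<Sum>k<s. of_int (d k) * (q * b k))" using div_q by blast
      have "of_int (N * int n) * f = of_int N * g + of_int (N * \<beta>) * w + of_int (N * \<alpha>) * w'"
        by (simp add: g_def algebra_simps)
      also have "\<dots> = (\<Sum>k<Suc (Suc s). of_int ((d(s := N * \<beta>, Suc s := N * \<alpha>)) k) * b' k)"
        unfolding sum_b' N(2) by simp
      finally show ?thesis using N(1) n
        by (intro exI[of _ "N * int n"] exI[of _ "d(s := N * \<beta>, Suc s := N * \<alpha>)"]) simp
    qed
    moreover have "\<forall>k<Suc (Suc s). b' k \<in> inv_forms (4 * Suc e)"
      using qb w by (auto simp: b'_def less_Suc_eq)
    ultimately have "rat_basis (Suc (Suc s)) b' (inv_forms (4 * Suc e))"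
      unfolding rat_basis_def by blast
    then show ?thesis unfolding sz by blast
  qed
qed

end

lemma int_power_of_minus_one: "(-1 :: complex) ^ e = 1 \<longleftrightarrow> even e"
  by (cases "even e") simp_all

text \<open>The matrix of u has characteristic polynomial t^2 + 1 and that of v has t^2 - t + 1. On
  forms of even polynomial degree they have orders dividing 2 and 3, because u^2 and v^3 are minus
  the identity matrix.\<close>

interpretation rot_u: rotation 0 2 \<i>
proof
  fix e f assume "f \<in> Mdeg (4 * e)"
  then have f: "f \<in> Mdeg (2 * (2 * e))" by simp
  show "(sl2_act (mat2 0 1 (-1) 0) ^^ 2) f = f"
    using sl2_act_neg_one[OF f, unfolded power_mult] by (simp add: numeral_2_eq_2 mat2_mult flip: sl2_act_mult)
next
  fix e
  have "\<i> ^ (2 * e) = (-1) ^ e" by (simp add: power_mult)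
  then show "\<i> ^ (2 * e) = 1 \<longleftrightarrow> 2 dvd e" using int_power_of_minus_one[of e] by simp
qed simp_all

definition zeta6 :: complex where "zeta6 = Complex (1/2) (sqrt 3 / 2)"

lemma zeta6_square: "zeta6 ^ 2 = zeta6 - 1"
  by (simp add: zeta6_def power2_eq_square complex_eq_iff field_simps)

interpretation rot_v: rotation 1 3 zeta6
proof
  show "zeta6\<^sup>2 = of_int 1 * zeta6 - 1" using zeta6_square by simp
  show "Im zeta6 \<noteq> 0" by (simp add: zeta6_def)
next
  fix e f assume "f \<in> Mdeg (4 * e)"
  then have f: "f \<in> Mdeg (2 * (2 * e))" by simp
  show "(sl2_act (mat2 1 1 (-1) 0) ^^ 3) f = f"
    using sl2_act_neg_one[OF f, unfolded power_mult] by (simp add: numeral_3_eq_3 mat2_mult flip: sl2_act_mult)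
next
  fix e
  \<comment> \<open>\<omega> is the square of \<open>zeta6\<close>, a primitive cube root of
    unity.\<close>
  define \<omega> where "\<omega> = zeta6 - 1"
  have \<omega>2: "\<omega> ^ 2 = - zeta6" using zeta6_square by (simp add: \<omega>_def power2_eq_square algebra_simps)
  have "\<omega> ^ 3 = \<omega> ^ 2 * \<omega>" by (simp add: power3_eq_cube power2_eq_square)
  also have "\<dots> = 1" unfolding \<omega>2 using zeta6_square by (simp add: \<omega>_def power2_eq_square algebra_simps)
  finally have \<omega>3: "\<omega> ^ 3 = 1" .
  have ne: "\<omega> \<noteq> 1" "\<omega> ^ 2 \<noteq> 1" unfolding \<omega>2 by (simp_all add: \<omega>_def zeta6_def complex_eq_iff)
  have "zeta6 ^ (2 * e) = \<omega> ^ e" by (simp add: power_mult zeta6_square \<omega>_def)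
  also have "\<dots> = \<omega> ^ (3 * (e div 3) + e mod 3)" by simp
  also have "\<dots> = \<omega> ^ (e mod 3)" unfolding power_add power_mult \<omega>3 by simp
  finally have eq: "zeta6 ^ (2 * e) = \<omega> ^ (e mod 3)" .
  have "e mod 3 = 0 \<or> e mod 3 = 1 \<or> e mod 3 = 2" by linarith
  then show "zeta6 ^ (2 * e) = 1 \<longleftrightarrow> 3 dvd e"
    unfolding eq using ne by (auto simp: dvd_eq_mod_eq_0)
qed simp

section \<open>The rank of the first cohomology\<close>

text \<open>Cochains carry the pointwise ring structure, in which an integral multiple is the
  product with a constant function.\<close>

lemma of_nat_mult_fun: "(of_nat N * x) y = of_nat N * (x y :: 'b::comm_ring_1)"
  by (induction N) (simp_all add: distrib_right)

lemma of_int_mult_fun: "(of_int N * x) y = of_int N * (x y :: 'b::comm_ring_1)"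
  by (cases N rule: int_cases2) (simp_all add: of_nat_mult_fun)

definition monomial :: "nat \<Rightarrow> nat \<Rightarrow> int poly poly" where
  "monomial d j = hpoly d (\<lambda>k. if k = j then 1 else 0)"

context sl2_braid
begin

lemma act_hom: "act g (f + h) = act g f + act g h" "act g (f - h) = act g f - act g h" "act g (- f) = - act g f"
  "act g (of_int k * f) = of_int k * act g f" "act g 0 = 0"
  by (simp_all add: act_def sl2_act_hom)

lemma act_Mdeg: "f \<in> Mdeg n \<Longrightarrow> act g f \<in> Mdeg n"
  by (simp add: act_def sl2_act_Mdeg)

text \<open>The coboundary of f vanishes at u and v, hence everywhere, so f is invariant under the
  whole group.\<close>

lemma fixed_uv:
  assumes f: "f \<in> Mdeg n" "n > 0" "act u f = f" "act v f = f"
  shows "f = 0"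
proof -
  have z: "M.cob f \<in> cocycles G (Mdeg n) act 1" by (rule M.cob_in_Z1[OF f(1)])
  have "M.cob f [u] = 0" "M.cob f [v] = 0" using f(3,4) by (simp_all add: M.cob_apply)
  then have "M.cob f [g] = 0" if "g \<in> carrier G" for g using cocycle_zero[OF z _ _ that] by blast
  then have "act g f = f" if "g \<in> carrier G" for g using M.cob_apply[OF that, of f] that by simp
  then show ?thesis using M.invariant_0[OF f(1,2)] by blast
qed

lemma coboundaryI:
  assumes z: "z \<in> cocycles G (Mdeg n) act 1" and h: "h \<in> Mdeg n" "z [u] = act u h - h" "z [v] = act v h - h"
  shows "z \<in> coboundaries G (Mdeg n) act 1"
proof -
  have cob: "M.cob h \<in> cocycles G (Mdeg n) act 1" by (rule M.cob_in_Z1[OF h(1)])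
  have d: "z - M.cob h \<in> cocycles G (Mdeg n) act 1" by (rule add_subD(2)[OF M.H1.Z z cob])
  have "(z - M.cob h) [u] = 0" "(z - M.cob h) [v] = 0" using h(2,3) by (simp_all add: M.cob_apply)
  then have "(z - M.cob h) [g] = 0" if "g \<in> carrier G" for g using cocycle_zero[OF d _ _ that] by blast
  then have "z = M.cob h" by (intro M.cocycle_eqI[OF z cob]) simp
  then show ?thesis using h(1) M.coboundaries_eq[of n] by simp
qed

text \<open>The central element \<open>c\<close> acts by \<open>-1\<close> in odd polynomial degree, hence by \<open>1\<close> and by \<open>-1\<close> on cohomology.\<close>

lemma rank_odd:
  assumes "\<not> 4 dvd n"
  shows "free_part_iso (cohomology 1 G (Mdeg n) act) (Z_power 0)"
proof -
  have "2 * z \<in> coboundaries G (Mdeg n) act 1" if z: "z \<in> cocycles G (Mdeg n) act 1" for z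
  proof -
    have c: "act c f = - f" if f: "f \<in> Mdeg n" for f
    proof (cases "odd n")
      case True
      then have "f = 0" using Mdeg_odd f by blast
      then show ?thesis by (simp add: act_hom)
    next
      case False
      then obtain d where d: "n = 2 * d" by blast
      then have "odd d" using assms by auto
      then show ?thesis using sl2_act_neg_one[of f d] f d by (simp add: act_def lam_c)
    qed
    have zM: "z [g] \<in> Mdeg n" if "g \<in> carrier G" for g by (rule M.cocycleD(2)[OF z that])
    \<comment> \<open>Comparing z(c g) with z(g c), where c is central and acts by -1, gives 2 z(g)
      = z(c) - g z(c).\<close>
    have "2 * z [g] = act g (- z [c]) - (- z [c])" if g: "g \<in> carrier G" for g
    proof -
      have "act c (z [g]) + z [c] = act g (z [c]) + z [g]"
        using M.cocycleD(3)[OF z uvc(3) g] M.cocycleD(3)[OF z g uvc(3)] c_comm[OF g] by simp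
      then show ?thesis by (simp add: c zM g act_hom algebra_simps)
    qed
    moreover have "2 * z \<in> cocycles G (Mdeg n) act 1" using add_subD(4)[OF M.H1.Z z z] by simp
    moreover have "(2 * z) gs = 2 * z gs" for gs using of_nat_mult_fun[of 2 z gs] by simp
    ultimately show ?thesis using zM Mdeg_minus by (intro coboundaryI[of _ _ "- z [c]"]) simp_all
  qed
  then have "\<exists>N>0. of_nat N * z \<in> coboundaries G (Mdeg n) act 1" if "z \<in> cocycles G (Mdeg n) act 1" for z
    using that by (intro exI[of _ 2]) simp
  from free_part_add_quotient[OF M.H1.add_quotient_axioms, of "{}", OF _ _ _ this]
  show ?thesis by (simp add: M.cohomology_1)
qed

text \<open>If \<open>z(u) = (u - 1) h\<close> and \<open>z(v) = (v - 1) h\<close> rationally, then \<open>h\<close> is \<open>- z(u) / 2\<close> modulo \<open>M\<^sup>u\<close> and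
  \<open>- (v + 2) z(v) / 3\<close> modulo \<open>M\<^sup>v\<close>. The map \<open>\<Phi>\<close> below is six times the difference of the two, so it
  detects the class of \<open>z\<close> in \<open>M / (M\<^sup>u + M\<^sup>v)\<close> up to torsion.\<close>

lemma rank_even:
  assumes e: "e > 0" and z_exists: "\<And>m. m \<in> Mdeg (4 * e) \<Longrightarrow>
      \<exists>z\<in>cocycles G (Mdeg (4 * e)) act 1. z [v] = 0 \<and> z [u] = act u m - m"
    and r: "r + 2 * (e div 2) + 2 * (e div 3) + 1 = 2 * e"
  shows "free_part_iso (cohomology 1 G (Mdeg (4 * e)) act) (Z_power r)"
proof -
  let ?M = "Mdeg (4 * e)"
  let ?Z = "cocycles G ?M act 1"
  define U where "U = rot_u.inv_forms (4 * e)"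
  define V where "V = rot_v.inv_forms (4 * e)"
  have U_iff: "f \<in> U \<longleftrightarrow> f \<in> ?M \<and> act u f = f" and V_iff: "f \<in> V \<longleftrightarrow> f \<in> ?M \<and> act v f = f" for f
    by (simp_all add: U_def V_def rot_u.inv_forms_def rot_v.inv_forms_def act_def lam_u lam_v)
  have Msub: "add_sub ?M" by (simp add: add_sub_def Mdeg_diff)
  have uu: "act u (act u f) = f" if "f \<in> ?M" for f
    using rot_u.order[OF that] by (simp add: act_def lam_u numeral_2_eq_2)
  have vvv: "act v (act v (act v f)) = f" if "f \<in> ?M" for f
    using rot_v.order[OF that] by (simp add: act_def lam_v numeral_3_eq_3)
  have Usub: "add_sub U" and Vsub: "add_sub V" unfolding U_def V_def
    by (rule rot_u.add_sub_inv_forms rot_v.add_sub_inv_forms)+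
  have UV: "U \<inter> V \<subseteq> {0}" using fixed_uv[of _ "4 * e"] e by (auto simp: U_iff V_iff)
  obtain b1 where b1: "rat_basis (2 * (e div 2) + 1) b1 U" using rot_u.inv_forms_rank unfolding U_def by blast
  obtain b2 where b2: "rat_basis (2 * (e div 3) + 1) b2 V" using rot_v.inv_forms_rank unfolding V_def by blast
  define S where "S = {x + y | x y. x \<in> U \<and> y \<in> V}"
  define s where "s = (2 * (e div 2) + 1) + (2 * (e div 3) + 1)"
  obtain b where b: "rat_basis s b S"
    using rat_basis_sum[OF Usub b1 Vsub b2 UV] unfolding S_def s_def by blast
  have SM: "f \<in> ?M" if "f \<in> S" for f using that by (auto simp: S_def U_iff V_iff Mdeg_add)
  have US: "x \<in> S" if "x \<in> U" for x using that add_subD(1)[OF Vsub] unfolding S_def by (metis (mono_tags, lifting) add.right_neutral mem_Collect_eq)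
  have VS: "x \<in> S" if "x \<in> V" for x using that add_subD(1)[OF Usub] unfolding S_def by (metis (mono_tags, lifting) add.left_neutral mem_Collect_eq)
  have bM: "b k \<in> ?M" if "k < s" for k using SM rat_basisD(1)[OF b that] by blast
  have M4: "4 * e = 2 * (2 * e)" by simp
  have \<kappa>: "add_map ?M (\<lambda>f. hcoeff (2 * e) f j)" for j by (simp add: add_map_def hcoeff_add)
  have inj: "f = 0" if f: "f \<in> ?M" "\<And>j. j \<in> {..2 * e} \<Longrightarrow> hcoeff (2 * e) f j = 0" for f
    using f unfolding M4 by (intro Mdeg_eqI[of f "2 * e" 0]) (auto simp: hcoeff_def)
  have mono: "monomial (2 * e) j \<in> ?M" for j
    unfolding monomial_def M4 by (rule hpoly_in_Mdeg)
  have mono_coeff: "hcoeff (2 * e) (monomial (2 * e) i) j = (if i = j then 1 else 0)" if "j \<in> {..2 * e}" for i j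
    using that by (simp add: monomial_def hcoeff_hpoly)
  have indep: "\<forall>k<s. c k = 0" if "(\<Sum>k<s. of_int (c k) * b k) = 0" for c
    using rat_basisD(2)[OF b that] by blast
  have "\<exists>J \<pi> N. J \<subseteq> {..2 * e} \<and> card J + s = card {..2 * e} \<and> (\<forall>j\<in>J. add_map ?M (\<pi> j)) \<and>
    (\<forall>j\<in>J. \<forall>k<s. \<pi> j (b k) = 0) \<and>
    (\<forall>f\<in>?M. (\<forall>j\<in>J. \<pi> j f = 0) \<longrightarrow> (\<exists>N c. N \<noteq> 0 \<and> of_int N * f = (\<Sum>k<s. of_int (c k) * b k))) \<and>
    N \<noteq> (0 :: int) \<and> (\<forall>i\<in>J. \<forall>j\<in>J. \<pi> j (monomial (2 * e) i) = (if i = j then N else 0))"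
  proof (rule quotient_coordinates[of ?M "{..2 * e}" "\<lambda>j f. hcoeff (2 * e) f j"])
    show "f = 0" if "f \<in> ?M" "\<And>j. j \<in> {..2 * e} \<Longrightarrow> hcoeff (2 * e) f j = 0" for f using inj[OF that] .
    show "\<forall>k<s. c k = 0" if "(\<Sum>k<s. of_int (c k) * b k) = 0" for c using indep[OF that] .
  qed (fact Msub finite_atMost \<kappa> mono, simp_all only: Msub finite_atMost \<kappa> mono mono_coeff bM)
  then obtain J \<pi> N where J: "J \<subseteq> {..2 * e}" "card J + s = card {..2 * e}" and \<pi>: "\<forall>j\<in>J. add_map ?M (\<pi> j)"
    and \<pi>b: "\<forall>j\<in>J. \<forall>k<s. \<pi> j (b k) = 0"
    and ker: "\<forall>f\<in>?M. (\<forall>j\<in>J. \<pi> j f = 0) \<longrightarrow> (\<exists>N c. N \<noteq> 0 \<and> of_int N * f = (\<Sum>k<s. of_int (c k) * b k))"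
    and N: "N \<noteq> (0::int)" and dual: "\<forall>i\<in>J. \<forall>j\<in>J. \<pi> j (monomial (2 * e) i) = (if i = j then N else 0)"
    by (elim exE conjE) (rule that)
  note \<pi> = \<pi>[rule_format] and \<pi>b = \<pi>b[rule_format] and dual = dual[rule_format]
  note ker = ker[THEN bspec, THEN mp]
  have Ssub: "add_sub S" unfolding add_sub_def
  proof (intro conjI ballI)
    show "0 \<in> S" by (rule US[OF add_subD(1)[OF Usub]])
    fix f f' assume "f \<in> S" "f' \<in> S"
    then obtain x y x' y' where xy: "x \<in> U" "y \<in> V" "f = x + y" "x' \<in> U" "y' \<in> V" "f' = x' + y'" unfolding S_def by blast
    then have "f - f' = (x - x') + (y - y')" "x - x' \<in> U" "y - y' \<in> V"
      using add_subD(2)[OF Usub] add_subD(2)[OF Vsub] by simp_all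
    then show "f - f' \<in> S" unfolding S_def by blast
  qed
  have \<pi>S: "\<pi> j f = 0" if j: "j \<in> J" and f: "f \<in> S" for j f
  proof -
    obtain K c where K: "K \<noteq> 0" "of_int K * f = (\<Sum>k<s. of_int (c k) * b k)" using rat_basisD(3)[OF b f] by blast
    define X where "X = {f \<in> ?M. \<pi> j f = 0}"
    have "add_sub X" using add_mapD[OF \<pi>[OF j] Msub] by (auto simp: add_sub_def X_def Mdeg_diff)
    moreover have "b k \<in> X" if "k < s" for k using that \<pi>b[OF j that] bM[OF that] by (simp add: X_def)
    ultimately have "of_int K * f \<in> X" unfolding K(2) by (rule span_in_add_sub)
    then have "K * \<pi> j f = 0" using add_map_of_int[OF \<pi>[OF j] Msub SM[OF f]] by (simp add: X_def)
    then show ?thesis using K(1) by simp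
  qed
  define \<Phi> where "\<Phi> z = 2 * (act v (z [v]) + 2 * z [v]) - 3 * z [u]" for z :: "'a list \<Rightarrow> int poly poly"
  have zM: "z [g] \<in> ?M" if "z \<in> ?Z" "g \<in> carrier G" for z g by (rule M.cocycleD(2)[OF that])
  have numM: "2 * f \<in> ?M" "3 * f \<in> ?M" if "f \<in> ?M" for f
    using Mdeg_of_int_mult[OF that, of 2] Mdeg_of_int_mult[OF that, of 3] by simp_all
  have \<Phi>M: "\<Phi> z \<in> ?M" if "z \<in> ?Z" for z
    unfolding \<Phi>_def using zM[OF that] by (intro Mdeg_diff Mdeg_add numM act_Mdeg) simp_all
  have \<Phi>_add: "\<Phi> (z + z') = \<Phi> z + \<Phi> z'" for z z' by (simp add: \<Phi>_def act_hom algebra_simps)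
  have act_num: "act g (2 * f) = 2 * act g f" "act g (3 * f) = 3 * act g f" for g f
    using act_hom(4)[of g 2 f] act_hom(4)[of g 3 f] by simp_all
  \<comment> \<open>For such z, \<Phi> z = -3 (u - 1) m = 6 m - 3 (u + 1) m, and (u + 1) m is
    invariant under u.\<close>
  have \<Phi>_mod: "\<Phi> z - 6 * m \<in> S" if m: "m \<in> ?M" and z: "z [v] = 0" "z [u] = act u m - m" for z m
  proof -
    have eq: "\<Phi> z - 6 * m = of_int (-3) * (act u m + m)" by (simp add: \<Phi>_def z act_hom algebra_simps)
    have "act u m + m \<in> U" using m uu[OF m] by (simp add: U_iff Mdeg_add act_Mdeg act_hom add.commute)
    then show ?thesis unfolding eq by (rule add_sub_of_int[OF Ssub US])
  qed
  \<comment> \<open>(v + 2)(v - 1) = (v^2 + v + 1) - 3 and u - 1 = (u + 1) - 2. The multiples of 6 h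
    cancel and two norms remain.\<close>
  have \<Phi>_cob: "\<Phi> (M.cob h) \<in> S" if h: "h \<in> ?M" for h
  proof -
    have eq: "\<Phi> (M.cob h) = of_int 2 * (act v (act v h) + act v h + h) - of_int 3 * (act u h + h)"
      by (simp add: \<Phi>_def M.cob_apply act_hom algebra_simps)
    have "act u h + h \<in> U" using h uu[OF h] by (simp add: U_iff Mdeg_add act_Mdeg act_hom add.commute)
    moreover have "act v (act v h) + act v h + h \<in> V" using h vvv[OF h] by (simp add: V_iff Mdeg_add act_Mdeg act_hom add_ac)
    ultimately show ?thesis unfolding eq by (intro add_subD(2)[OF Ssub] add_sub_of_int[OF Ssub] VS US)
  qed
  have \<Phi>_torsion: "\<exists>N>0. of_nat N * z \<in> coboundaries G ?M act 1" if z: "z \<in> ?Z" and z0: "\<And>j. j \<in> J \<Longrightarrow> \<pi> j (\<Phi> z) = 0" for z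
  proof -
    have zu: "z [u] \<in> ?M" and zv: "z [v] \<in> ?M" using zM[OF z] by simp_all
    \<comment> \<open>As c = u^2 = v^3, the value z(c) is fixed by u and by v, hence 0 in positive
      degree. This means (u + 1) z(u) = 0 and (v^2 + v + 1) z(v) = 0.\<close>
    have c1: "z [c] = act u (z [u]) + z [u]" using M.cocycleD(3)[OF z uvc(1) uvc(1)] by (simp add: c_def)
    have c2: "z [c] = act v (act v (z [v])) + act v (z [v]) + z [v]"
      using M.cocycleD(3)[OF z m_closed[OF uvc(2) uvc(2)] uvc(2)] M.cocycleD(3)[OF z uvc(2) uvc(2)] M.act_mult[OF uvc(2) uvc(2) zv]
      by (simp add: v_cube add_ac)
    have "act u (z [c]) = z [c]" unfolding c1 using uu[OF zu] by (simp add: act_hom add.commute)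
    moreover have "act v (z [c]) = z [c]" unfolding c2 using vvv[OF zv] by (simp add: act_hom add_ac)
    ultimately have "z [c] = 0" using zM[OF z uvc(3)] fixed_uv[of "z [c]" "4 * e"] e by simp
    then have zu_neg: "act u (z [u]) = - z [u]" and zv_neg: "act v (act v (z [v])) = - act v (z [v]) - z [v]"
      using c1 c2 by (simp_all add: eq_neg_iff_add_eq_0 algebra_simps)
    obtain K d where K: "K \<noteq> 0" "of_int K * \<Phi> z = (\<Sum>k<s. of_int (d k) * b k)" using ker[OF \<Phi>M[OF z]] z0 by blast
    have "of_int K * \<Phi> z \<in> S" unfolding K(2) by (rule span_in_add_sub[OF Ssub rat_basisD(1)[OF b]])
    then obtain x y where xy: "x \<in> U" "y \<in> V" "of_int K * \<Phi> z = x + y" unfolding S_def by blast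
    \<comment> \<open>K \<Phi> z = x + y equates two expressions for h. The one with z(u) gives (u -
      1) h = 6 K z(u), since x is fixed by u; the one with z(v) gives (v - 1) h = 6 K z(v), since y
      is fixed by v.\<close>
    define h where "h = of_int (-3 * K) * z [u] - x"
    have h': "h = y - of_int (2 * K) * (act v (z [v]) + 2 * z [v])"
      using xy(3) by (simp add: h_def \<Phi>_def algebra_simps)
    have hM: "h \<in> ?M" unfolding h_def using zu xy(1) by (intro Mdeg_diff Mdeg_of_int_mult) (simp_all add: U_iff)
    have hu: "of_int (6 * K) * z [u] = act u h - h"
      using xy(1) unfolding h_def act_hom U_iff by (simp add: zu_neg algebra_simps)
    have hv: "of_int (6 * K) * z [v] = act v h - h"
      using xy(2) unfolding h' act_hom V_iff by (simp add: act_num zv_neg algebra_simps)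
    have Kz: "of_int (6 * K) * z \<in> coboundaries G ?M act 1"
    proof (rule coboundaryI[OF _ hM])
      show "of_int (6 * K) * z \<in> ?Z" by (rule add_sub_of_int[OF M.H1.Z z])
      show "(of_int (6 * K) * z) [u] = act u h - h" "(of_int (6 * K) * z) [v] = act v h - h"
        unfolding of_int_mult_fun by (fact hu, fact hv)
    qed
    have "of_nat (nat \<bar>6 * K\<bar>) * z \<in> coboundaries G ?M act 1"
    proof (cases "K > 0")
      case True
      then show ?thesis using Kz by simp
    next
      case False
      then show ?thesis using add_subD(3)[OF M.H1.B Kz] by simp
    qed
    then show ?thesis using K(1) by (intro exI[of _ "nat \<bar>6 * K\<bar>"]) simp
  qed
  have "free_part_iso (add_grp ?Z Mod coboundaries G ?M act 1) (Z_power (card J))"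
  proof (rule free_part_add_quotient[OF M.H1.add_quotient_axioms, where \<phi> = "\<lambda>j z. \<pi> j (\<Phi> z)"])
    show "finite J" using J(1) by (rule finite_subset) simp
  next
    fix j assume j: "j \<in> J"
    show "add_map ?Z (\<lambda>z. \<pi> j (\<Phi> z))"
      unfolding add_map_def \<Phi>_add using add_mapD(1)[OF \<pi>[OF j] Msub] \<Phi>M by blast
    show "\<pi> j (\<Phi> z) = 0" if "z \<in> coboundaries G ?M act 1" for z
      using that \<pi>S[OF j \<Phi>_cob] unfolding M.coboundaries_eq by blast
    obtain z where z: "z \<in> ?Z" "z [v] = 0" "z [u] = act u (monomial (2 * e) j) - monomial (2 * e) j"
      using z_exists[OF mono] by blast
    have "\<pi> i (\<Phi> z) = (if i = j then 6 * N else 0)" if i: "i \<in> J" for i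
    proof -
      let ?m = "of_int 6 * monomial (2 * e) j"
      have m: "?m \<in> ?M" by (intro Mdeg_of_int_mult mono)
      have "\<pi> i (\<Phi> z - ?m) = 0" using \<pi>S[OF i \<Phi>_mod[OF mono z(2,3)]] by simp
      then have "\<pi> i (\<Phi> z) = \<pi> i ?m" using add_mapD(4)[OF \<pi>[OF i] Msub \<Phi>M[OF z(1)] m] by simp
      then show ?thesis using add_map_of_int[OF \<pi>[OF i] Msub mono, of 6 j] dual[OF j i] by auto
    qed
    then show "\<exists>z\<in>?Z. \<pi> j (\<Phi> z) \<noteq> 0 \<and> (\<forall>i\<in>J. i \<noteq> j \<longrightarrow> \<pi> i (\<Phi> z) = 0)"
      using z(1) j N by (intro bexI[of _ z]) simp_all
  next
    fix z assume "z \<in> ?Z" "\<And>j. j \<in> J \<Longrightarrow> \<pi> j (\<Phi> z) = 0"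
    then show "\<exists>N>0. of_nat N * z \<in> coboundaries G ?M act 1" by (rule \<Phi>_torsion)
  qed
  \<comment> \<open>Rank count: 2 e + 1 for all forms, minus 2 (e div 2) + 1 for those fixed by u
    and 2 (e div 3) + 1 for those fixed by v.\<close>
  moreover have "card J = r" using J(2) r by (simp add: s_def)
  ultimately show ?thesis by (simp add: M.cohomology_1)
qed

end

section \<open>Degree zero\<close>

lemma iso_integer_groupI:
  fixes H :: "('a, 'b) monoid_scheme"
  assumes "comm_group H" "\<And>k l. h (k + l) = h k \<otimes>\<^bsub>H\<^esub> h l" "range h = carrier H" "\<And>k :: int. h k = \<one>\<^bsub>H\<^esub> \<Longrightarrow> k = 0"
  shows "H \<cong> integer_group"
proof -
  have "h \<in> hom integer_group H" using assms(2,3) by (intro homI) auto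
  moreover from this have "group_hom integer_group H h"
    using assms(1) by (simp add: group_hom_def group_hom_axioms_def comm_group_def)
  then have "inj_on h (carrier integer_group)" using assms(4) unfolding group_hom.inj_on_one_iff[OF \<open>group_hom integer_group H h\<close>] by simp
  ultimately have "h \<in> iso integer_group H" using assms(3) by (simp add: iso_def bij_betw_def)
  then show ?thesis using group.iso_sym[OF group_integer_group] unfolding is_iso_def by blast
qed

lemma torsion_free_primary_part:
  assumes "group L" "L \<cong> integer_group" "p > 0" shows "carrier (primary_part p L) = {\<one>\<^bsub>L\<^esub>}"
proof -
  interpret L: group L by fact
  obtain h where h: "h \<in> iso L integer_group" using assms(2) unfolding is_iso_def by blast
  interpret h: group_hom L integer_group h using h assms(1) by (simp add: group_hom_def group_hom_axioms_def iso_def)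
  have "x = \<one>\<^bsub>L\<^esub>" if x: "x \<in> carrier L" "x [^]\<^bsub>L\<^esub> (p ^ k) = \<one>\<^bsub>L\<^esub>" for x k
  proof -
    have "int (p ^ k) * h x = 0" using h.hom_nat_pow[OF x(1), of "p ^ k"] x(2) h.hom_one by simp
    then have "h x = 0" using assms(3) by simp
    moreover have "inj_on h (carrier L)" using h by (simp add: iso_def bij_betw_def)
    ultimately show ?thesis using x(1) unfolding h.inj_on_one_iff by simp
  qed
  moreover have "\<one>\<^bsub>L\<^esub> [^]\<^bsub>L\<^esub> (p ^ 0) = \<one>\<^bsub>L\<^esub>" by simp
  ultimately show ?thesis by (auto simp: primary_part_def)
qed

lemma trivial_iso_Mod_UNIV:
  assumes "comm_group H" "carrier H = {\<one>\<^bsub>H\<^esub>}"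
  shows "H \<cong> add_grp (UNIV :: 'b::ab_group_add set) Mod UNIV"
proof (rule iso_add_grp_Mod[OF assms(1), where h = "\<lambda>_. \<one>\<^bsub>H\<^esub>"])
  interpret H: comm_group H by fact
  show "\<one>\<^bsub>H\<^esub> = \<one>\<^bsub>H\<^esub> \<otimes>\<^bsub>H\<^esub> \<one>\<^bsub>H\<^esub>" by simp
qed (use assms(2) in auto)

lemma sum_group_concentrated:
  fixes G :: "nat \<Rightarrow> 'a monoid"
  assumes "G 0 \<cong> H" "\<And>n. group (G n)" "\<And>n. n > 0 \<Longrightarrow> trivial_group (G n)"
  shows "sum_group UNIV G \<cong> H"
proof -
  have carr: "carrier (sum_group UNIV G) = {x \<in> \<Pi>\<^sub>E i\<in>UNIV. carrier (G i). finite {i \<in> UNIV. x i \<noteq> \<one>\<^bsub>G i\<^esub>}}"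
    by (rule carrier_sum_group) (rule assms(2))
  have triv: "x n = \<one>\<^bsub>G n\<^esub>" if "x \<in> carrier (sum_group UNIV G)" "n > 0" for x n
    using that assms(3)[OF that(2)] unfolding carr trivial_group_def by auto
  have "(\<lambda>x. x 0) \<in> iso (sum_group UNIV G) (G 0)"
    unfolding iso_def bij_betw_def
  proof (intro CollectI conjI)
    show "(\<lambda>x. x 0) \<in> hom (sum_group UNIV G) (G 0)" by (rule homI) (auto simp: carr)
    show "inj_on (\<lambda>x. x 0) (carrier (sum_group UNIV G))"
    proof (rule inj_onI, rule ext)
      fix x y n assume xy: "x \<in> carrier (sum_group UNIV G)" "y \<in> carrier (sum_group UNIV G)" "x 0 = y 0"
      show "x n = y n" using xy triv[OF xy(1)] triv[OF xy(2)] by (cases "n = 0") simp_all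
    qed
    show "(\<lambda>x. x 0) ` carrier (sum_group UNIV G) = carrier (G 0)"
    proof (intro equalityI subsetI)
      fix g assume g: "g \<in> carrier (G 0)"
      define x where "x n = (if n = 0 then g else \<one>\<^bsub>G n\<^esub>)" for n
      have "{i \<in> UNIV. x i \<noteq> \<one>\<^bsub>G i\<^esub>} \<subseteq> {0}" by (auto simp: x_def)
      then have "finite {i \<in> UNIV. x i \<noteq> \<one>\<^bsub>G i\<^esub>}" by (rule finite_subset) simp
      moreover have "x n \<in> carrier (G n)" for n using g assms(2)[of n] by (simp add: x_def group.is_monoid)
      ultimately have "x \<in> carrier (sum_group UNIV G)" by (simp add: carr PiE_UNIV_domain)
      then show "g \<in> (\<lambda>x. x 0) ` carrier (sum_group UNIV G)" by (rule rev_image_eqI) (simp add: x_def)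
    qed (auto simp: carr)
  qed
  then have "sum_group UNIV G \<cong> G 0" unfolding is_iso_def by blast
  then show ?thesis using assms(1) by (rule iso_trans)
qed

lemma Mdeg_0_iff: "f \<in> Mdeg 0 \<longleftrightarrow> f \<in> range of_int"
proof
  assume "f \<in> Mdeg 0"
  then have "f = of_int (hcoeff 0 f 0)" using homog_expand[of f 0] by simp
  then show "f \<in> range of_int" by blast
qed (auto simp: Mdeg_of_int)

context group_module
begin

abbreviation Z0 :: "('g list \<Rightarrow> 'm) set" where "Z0 \<equiv> cocycles G A \<rho> 0"

definition const0 :: "'m \<Rightarrow> 'g list \<Rightarrow> 'm" where "const0 m gs = (if gs = [] then m else 0)"

lemma cocycles_0: "Z0 = const0 ` {m \<in> A. \<forall>g\<in>carrier G. \<rho> g m = m}"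
proof (intro equalityI subsetI)
  have tup: "gs \<in> tuples G (Suc 0) \<longleftrightarrow> (\<exists>g\<in>carrier G. gs = [g])" for gs using tuples_1[of gs] by (simp only: One_nat_def)
  fix f assume f: "f \<in> Z0"
  have "\<rho> g (f []) = f []" if g: "g \<in> carrier G" for g
  proof -
    have "coboundary G \<rho> 0 f [g] = 0" using f by (simp add: cocycles_def)
    moreover have "[g] \<in> tuples G (Suc 0)" using g unfolding tup by blast
    ultimately show ?thesis by (simp add: coboundary_def alt_def)
  qed
  moreover have "f [] \<in> A" "f = const0 (f [])"
    using f by (auto simp: cocycles_def cochains_def tuples_0 const0_def fun_eq_iff)
  ultimately show "f \<in> const0 ` {m \<in> A. \<forall>g\<in>carrier G. \<rho> g m = m}" by blast
next
  have tup: "gs \<in> tuples G (Suc 0) \<longleftrightarrow> (\<exists>g\<in>carrier G. gs = [g])" for gs using tuples_1[of gs] by (simp only: One_nat_def)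
  fix f assume "f \<in> const0 ` {m \<in> A. \<forall>g\<in>carrier G. \<rho> g m = m}"
  then obtain m where m: "f = const0 m" "m \<in> A" "\<forall>g\<in>carrier G. \<rho> g m = m" by blast
  then have "coboundary G \<rho> 0 f gs = 0" for gs by (auto simp: coboundary_def alt_def const0_def tup)
  then show "f \<in> Z0" using m(1,2) by (auto simp: cocycles_def cochains_def tuples_0 const0_def)
qed

lemma add_quotient_0: "add_quotient Z0 {0}"
proof
  show "add_sub Z0" unfolding add_sub_def
  proof (intro conjI ballI)
    have "0 = const0 0" by (auto simp: const0_def)
    then show "0 \<in> Z0" unfolding cocycles_0 using add_subD(1)[OF A] act_0 by blast
    fix x y assume "x \<in> Z0" "y \<in> Z0"
    then obtain m m' where m: "x = const0 m" "y = const0 m'" "m \<in> A" "m' \<in> A"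
      "\<forall>g\<in>carrier G. \<rho> g m = m" "\<forall>g\<in>carrier G. \<rho> g m' = m'" unfolding cocycles_0 by blast
    have "x - y = const0 (m - m')" by (simp add: m const0_def fun_eq_iff)
    moreover have "m - m' \<in> A" "\<forall>g\<in>carrier G. \<rho> g (m - m') = m - m'"
      using m add_subD(2)[OF A] by (simp_all add: act_diff)
    ultimately show "x - y \<in> Z0" unfolding cocycles_0 by blast
  qed
  then show "{0} \<subseteq> Z0" using add_subD(1) by blast
qed (simp add: add_sub_def)

lemma cohomology_0: "cohomology 0 G A \<rho> = add_grp Z0 Mod {0}"
proof -
  have "(+) = (\<lambda>f h (gs :: 'g list). f gs + (h gs :: 'm))" by (simp add: fun_eq_iff)
  moreover have "coboundaries G A \<rho> 0 = {0}" by (simp add: coboundaries_def zero_fun_def)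
  ultimately show ?thesis by (simp only: cohomology_def add_grp_def zero_fun_def)
qed

end

section \<open>H^0, and H^1 with trivial coefficients\<close>

context sl2_braid
begin

lemma comm_group_H0: "comm_group (cohomology 0 G (Mdeg n) act)"
  unfolding M.cohomology_0 by (rule add_quotient.comm_group_Q[OF M.add_quotient_0])

lemma comm_group_H1: "comm_group (cohomology 1 G (Mdeg n) act)"
  unfolding M.cohomology_1 by (rule M.H1.comm_group_Q)

lemma H0_pos: assumes "n > 0" shows "trivial_group (cohomology 0 G (Mdeg n) act)"
proof -
  interpret Q: add_quotient "cocycles G (Mdeg n) act 0" "{0}" by (rule M.add_quotient_0)
  have "{m \<in> Mdeg n. \<forall>g\<in>carrier G. act g m = m} = {0}" using M.invariant_0[OF _ assms] act_hom(5) by auto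
  then have "cocycles G (Mdeg n) act 0 = {0}" unfolding M.cocycles_0 by (auto simp: M.const0_def fun_eq_iff)
  then have "carrier Q.Q = {\<one>\<^bsub>Q.Q\<^esub>}" unfolding Q.carrier_Q Q.one_Q by simp
  then show ?thesis unfolding trivial_group_def M.cohomology_0 using Q.group_Q by simp
qed

lemma act_Mdeg_0: "f \<in> Mdeg 0 \<Longrightarrow> act g f = f"
  by (auto simp: Mdeg_0_iff act_def sl2_act_hom)

lemma H0_zero: "cohomology 0 G (Mdeg 0) act \<cong> integer_group"
proof -
  interpret Q: add_quotient "cocycles G (Mdeg 0) act 0" "{0}" by (rule M.add_quotient_0)
  have Z0: "cocycles G (Mdeg 0) act 0 = range (\<lambda>k. M.const0 (of_int k))"
    unfolding M.cocycles_0 using act_Mdeg_0 by (auto simp: Mdeg_0_iff)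
  show ?thesis unfolding M.cohomology_0
  proof (rule iso_integer_groupI[OF Q.comm_group_Q, where h = "\<lambda>k. Q.cls (M.const0 (of_int k))"])
    fix k l :: int
    have "M.const0 (of_int (k + l)) = M.const0 (of_int k) + (M.const0 (of_int l) :: 'a list \<Rightarrow> int poly poly)"
      by (simp add: M.const0_def fun_eq_iff)
    then show "Q.cls (M.const0 (of_int (k + l))) = Q.cls (M.const0 (of_int k)) \<otimes>\<^bsub>Q.Q\<^esub> Q.cls (M.const0 (of_int l))"
      using Q.mult_Q[of "M.const0 (of_int k)" "M.const0 (of_int l)"] by (simp add: Z0 del: mult_FactGroup)
  next
    show "range (\<lambda>k. Q.cls (M.const0 (of_int k))) = carrier Q.Q" unfolding Q.carrier_Q by (simp only: Z0 image_image)
  next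
    fix k :: int assume "Q.cls (M.const0 (of_int k)) = \<one>\<^bsub>Q.Q\<^esub>"
    then have "M.const0 (of_int k) = (0 :: 'a list \<Rightarrow> int poly poly)" unfolding Q.cls_eq_one_iff by blast
    from fun_cong[OF this, of "[]"] show "k = 0" by (simp add: M.const0_def)
  qed
qed

text \<open>The action on constants is trivial, so a cocycle is a homomorphism to Z, and b v = v a
  forces equal values at a and b.\<close>

lemma cocycle_deg_0:
  assumes z: "z \<in> cocycles G (Mdeg 0) act 1"
  shows "g \<in> carrier G \<Longrightarrow> h \<in> carrier G \<Longrightarrow> z [g \<otimes> h] = z [h] + z [g]" "z [a] = z [b]"
proof -
  show mult: "z [g \<otimes> h] = z [h] + z [g]" if "g \<in> carrier G" "h \<in> carrier G" for g h
    using M.cocycleD(2,3)[OF z] that by (simp add: act_Mdeg_0)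
  have "z [b \<otimes> v] = z [v \<otimes> a]" by (simp only: b_v v_a)
  then show "z [a] = z [b]" by (simp add: mult del: b_v v_a)
qed

lemma coboundaries_deg_0: "coboundaries G (Mdeg 0) act 1 = {0}"
proof -
  have "M.cob m = 0" if "m \<in> Mdeg 0" for m using that by (simp add: M.cob_def fun_eq_iff act_Mdeg_0)
  then have "M.cob ` Mdeg 0 = (\<lambda>_. 0) ` Mdeg 0" by (rule image_cong[OF HOL.refl])
  also have "\<dots> = {0}" using Mdeg_0[of 0] by blast
  finally show ?thesis unfolding M.coboundaries_eq .
qed

lemma cocycle_deg_0_zero:
  assumes z: "z \<in> cocycles G (Mdeg 0) act 1" and "z [a] = 0" shows "z = 0"
proof -
  have 0: "0 \<in> cocycles G (Mdeg 0) act 1" by (rule add_subD(1)[OF M.H1.Z])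
  have "z [b] = 0" using cocycle_deg_0(2)[OF z] assms(2) by simp
  then have "z [v] = 0" "z [u] = 0"
    using cocycle_deg_0(1)[OF z] assms(2) by (simp_all add: v_def u_def)
  then have "z [g] = 0" if "g \<in> carrier G" for g using cocycle_zero[OF z _ _ that] by blast
  then show ?thesis by (intro M.cocycle_eqI[OF z 0]) simp
qed

end

text \<open>The group is Hom(B_3, Z). The cocycle with value 1 at both generators is the exponent
  sum, and every homomorphism is the multiple of it given by its value at \<open>sa\<close>.\<close>

lemma B3_H1_deg_0: "cohomology 1 B3 (Mdeg 0) B3.act \<cong> integer_group"
proof -
  have one: "(1 :: int poly poly) \<in> Mdeg 0" using Mdeg_of_int[of 1] by simp
  obtain z where z: "z \<in> cocycles B3 (Mdeg 0) B3.act 1" "z [sa] = 1" "z [sb] = 1"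
    by (rule B3_cocycle_exists[OF one one]) (simp_all add: sl2_act_hom sl2_act_hom(3)[of _ 2, simplified])
  have zk: "of_int k * z \<in> cocycles B3 (Mdeg 0) B3.act 1" for k by (rule add_sub_of_int[OF B3.H1.Z z(1)])
  show ?thesis unfolding B3.cohomology_1
  proof (rule iso_integer_groupI[OF B3.H1.comm_group_Q, where h = "\<lambda>k. B3.H1.cls 0 (of_int k * z)"])
    fix k l :: int
    show "B3.H1.cls 0 (of_int (k + l) * z) =
        B3.H1.cls 0 (of_int k * z) \<otimes>\<^bsub>add_grp (cocycles B3 (Mdeg 0) B3.act 1) Mod coboundaries B3 (Mdeg 0) B3.act 1\<^esub>
        B3.H1.cls 0 (of_int l * z)"
      unfolding B3.H1.mult_Q[OF zk zk] by (simp add: distrib_right)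
  next
    have "w \<in> range (\<lambda>k. of_int k * z)" if w: "w \<in> cocycles B3 (Mdeg 0) B3.act 1" for w
    proof -
      obtain k where k: "w [sa] = of_int k" using B3.cocycleD(2)[OF w sab_carrier(1)] Mdeg_0_iff by auto
      have "w - of_int k * z \<in> cocycles B3 (Mdeg 0) B3.act 1" by (rule add_subD(2)[OF B3.H1.Z w zk])
      then have "w - of_int k * z = 0"
        by (rule B3.cocycle_deg_0_zero) (simp add: of_int_mult_fun k z(2) del: times_fun_apply)
      then show ?thesis by simp
    qed
    then have "range (\<lambda>k. of_int k * z) = cocycles B3 (Mdeg 0) B3.act 1" using zk by blast
    then show "range (\<lambda>k. B3.H1.cls 0 (of_int k * z)) =
        carrier (add_grp (cocycles B3 (Mdeg 0) B3.act 1) Mod coboundaries B3 (Mdeg 0) B3.act 1)"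
      unfolding B3.H1.carrier_Q by (metis image_image)
  next
    fix k assume "B3.H1.cls 0 (of_int k * z) = \<one>\<^bsub>add_grp (cocycles B3 (Mdeg 0) B3.act 1) Mod coboundaries B3 (Mdeg 0) B3.act 1\<^esub>"
    then have "of_int k * z \<in> coboundaries B3 (Mdeg 0) B3.act 1" by (rule B3.H1.cls_eq_one_iff[THEN iffD1])
    then have "of_int k * z = 0" unfolding B3.coboundaries_deg_0 by (rule singletonD)
    from fun_cong[OF this, of "[sa]"] show "k = 0" by (simp add: of_int_mult_fun z(2) del: times_fun_apply)
  qed
qed

text \<open>The central element of \<open>SL\<^sub>2(\<int>)\<close> has order two, while a cocycle with trivial coefficients takes
  there six times its value at the generators.\<close>

lemma SL2Z_H1_deg_0: "trivial_group (cohomology 1 SL2Z (Mdeg 0) SL2Z.act)"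
proof -
  have "z = 0" if z: "z \<in> cocycles SL2Z (Mdeg 0) SL2Z.act 1" for z
  proof -
    note mult = SL2Z.cocycle_deg_0(1)[OF z]
    let ?a = "mat2 1 0 (-1) 1" and ?b = "mat2 1 1 0 1"
    have ab: "z [?a] = z [?b]" by (rule SL2Z.cocycle_deg_0(2)[OF z])
    have "z [SL2Z.v] = 2 * z [?a]" unfolding SL2Z.v_def mult[OF SL2Z.uvc(4,5)] using ab by simp
    then have "z [SL2Z.u] = 3 * z [?a]"
      unfolding SL2Z.v_a[symmetric] mult[OF SL2Z.uvc(2,4)] by simp
    then have "z [SL2Z.c] = 6 * z [?a]" unfolding SL2Z.c_def mult[OF SL2Z.uvc(1,1)] by simp
    then have "z [SL2Z.c \<otimes>\<^bsub>SL2Z\<^esub> SL2Z.c] = 12 * z [?a]" unfolding mult[OF SL2Z.uvc(3,3)] by simp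
    moreover have "SL2Z.c \<otimes>\<^bsub>SL2Z\<^esub> SL2Z.c = \<one>\<^bsub>SL2Z\<^esub>" using SL2Z.lam_c by (simp add: mat2_mult)
    moreover have "z [\<one>\<^bsub>SL2Z\<^esub>] = 0" by (rule SL2Z.cocycle_one[OF z SL2Z.act_one])
    ultimately have "12 * z [?a] = 0" by simp
    then have "z [?a] = 0" by simp
    then show ?thesis by (rule SL2Z.cocycle_deg_0_zero[OF z])
  qed
  then have Z: "cocycles SL2Z (Mdeg 0) SL2Z.act 1 = {0}" using add_subD(1)[OF SL2Z.H1.Z] by blast
  have "carrier (cohomology 1 SL2Z (Mdeg 0) SL2Z.act) = {\<one>\<^bsub>cohomology 1 SL2Z (Mdeg 0) SL2Z.act\<^esub>}"
    unfolding SL2Z.cohomology_1 SL2Z.H1.carrier_Q SL2Z.H1.one_Q unfolding Z by simp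
  then show ?thesis using SL2Z.comm_group_H1 unfolding trivial_group_def comm_group_def by blast
qed

section \<open>The ranks and their generating function\<close>

text \<open>For n = 4 e > 0 this is (2 e + 1) - (2 (e div 2) + 1) - (2 (e div 3) + 1), the rank of
  M_n minus the ranks of the invariants of u and v. The difference is never negative, so nothing is
  truncated.\<close>

definition h1_rank :: "nat \<Rightarrow> nat" where
  "h1_rank n = (if 4 dvd n \<and> n > 0 then 2 * (n div 4) - 1 - 2 * (n div 4 div 2) - 2 * (n div 4 div 3) else 0)"

lemma h1_rank_eq: "e > 0 \<Longrightarrow> h1_rank (4 * e) + 2 * (e div 2) + 2 * (e div 3) + 1 = 2 * e"
  unfolding h1_rank_def by simp

text \<open>The left side is the n-th coefficient of the series times (1 - t^8)(1 - t^12) = 1 - t^8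
  - t^12 + t^20. For n = 4 e the shifts lead to e - 2, e - 3 and e - 5, under which the linear part
  and both floor functions cancel.\<close>

lemma h1_rank_recurrence:
  "int (h1_rank n) - (if n < 8 then 0 else int (h1_rank (n - 8))) - (if n < 12 then 0 else int (h1_rank (n - 12))) +
    (if n < 20 then 0 else int (h1_rank (n - 20))) =
   (if n = 4 then 1 else 0) + (if n = 8 then 1 else 0) - (if n = 16 then 1 else 0) + (if n = 20 then 1 else 0)"
proof (cases "4 dvd n")
  case False
  have "\<not> 4 dvd n - 4 * k" if "4 * k \<le> n" for k
  proof
    assume "4 dvd n - 4 * k"
    then have "4 dvd n - 4 * k + 4 * k" by (rule dvd_add) simp
    then show False using that False by simp
  qed
  from this[of 2] this[of 3] this[of 5] show ?thesis using False by (auto simp: h1_rank_def)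
next
  case True
  then obtain e where n: "n = 4 * e" by blast
  have sub: "4 * e - 8 = 4 * (e - 2)" "4 * e - 12 = 4 * (e - 3)" "4 * e - 20 = 4 * (e - 5)" by simp_all
  have r: "int (h1_rank (4 * k)) = (if k = 0 then 0 else 2 * int k - 1 - 2 * int (k div 2) - 2 * int (k div 3))" for k
  proof (cases "k = 0")
    case False
    then have "k > 0" by simp
    then show ?thesis unfolding if_not_P[OF False] using h1_rank_eq[of k] by linarith
  qed (simp add: h1_rank_def)
  show ?thesis
  \<comment> \<open>The whole numerator arises for e < 6. It records the missing terms of negative
    index and the value 0 at e = 0, where the closed formula would give -1.\<close>
  proof (cases "e < 6")
    case True
    then have "e = 0 \<or> e = 1 \<or> e = 2 \<or> e = 3 \<or> e = 4 \<or> e = 5" by linarith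
    then show ?thesis unfolding n sub r by (elim disjE) simp_all
  next
    case False
    then obtain k where k: "e = k + 6" by (metis add.commute le_Suc_ex not_less)
    have "(k + 6) div 2 = (k + 4) div 2 + 1" "(k + 3) div 2 = (k + 1) div 2 + 1"
      "(k + 6) div 3 = (k + 3) div 3 + 1" "(k + 4) div 3 = (k + 1) div 3 + 1" by presburger+
    then have d: "int ((k + 6) div 2) = int ((k + 4) div 2) + 1" "int ((k + 3) div 2) = int ((k + 1) div 2) + 1"
      "int ((k + 6) div 3) = int ((k + 3) div 3) + 1" "int ((k + 4) div 3) = int ((k + 1) div 3) + 1"
      by (simp_all only: of_nat_add of_nat_1)
    have e: "e - 2 = k + 4" "e - 3 = k + 3" "e - 5 = k + 1" using k by simp_all
    have "int (h1_rank (4 * (k + 6))) - int (h1_rank (4 * (k + 4))) - int (h1_rank (4 * (k + 3))) + int (h1_rank (4 * (k + 1))) = 0"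
      unfolding r using d by simp
    moreover have "\<not> n < 8" "\<not> n < 12" "\<not> n < 20" "n \<noteq> 4" "n \<noteq> 8" "n \<noteq> 16" "n \<noteq> 20" using n k by simp_all
    ultimately show ?thesis unfolding n sub e k by (simp add: add_ac)
  qed
qed

lemma h1_rank_fps:
  "Abs_fps (\<lambda>n. of_nat (h1_rank n) :: rat) =
    fps_X ^ 4 * (1 + fps_X ^ 4 - fps_X ^ 12 + fps_X ^ 16) / ((1 - fps_X ^ 8) * (1 - fps_X ^ 12))"
proof -
  let ?F = "Abs_fps (\<lambda>n. of_nat (h1_rank n) :: rat)"
  let ?D = "(1 - fps_X ^ 8) * (1 - fps_X ^ 12) :: rat fps"
  let ?N = "fps_X ^ 4 * (1 + fps_X ^ 4 - fps_X ^ 12 + fps_X ^ 16) :: rat fps"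
  have D: "?D = 1 - fps_X ^ 8 - fps_X ^ 12 + fps_X ^ 20" by (simp add: algebra_simps flip: power_add)
  have N: "?N = fps_X ^ 4 + fps_X ^ 8 - fps_X ^ 16 + fps_X ^ 20" by (simp add: algebra_simps flip: power_add)
  have "?F * ?D = ?N"
  proof (rule fps_ext)
    fix n
    have "fps_nth (?F * ?D) n = of_int (int (h1_rank n) - (if n < 8 then 0 else int (h1_rank (n - 8))) -
        (if n < 12 then 0 else int (h1_rank (n - 12))) + (if n < 20 then 0 else int (h1_rank (n - 20))))"
      unfolding D by (simp add: distrib_left right_diff_distrib fps_X_power_mult_right_nth)
    also have "\<dots> = fps_nth ?N n" unfolding h1_rank_recurrence N by (simp add: fps_X_power_nth)
    finally show "fps_nth (?F * ?D) n = fps_nth ?N n" .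
  qed
  moreover have "?D \<noteq> 0"
  proof
    assume "?D = 0"
    then have "fps_nth ?D 0 = fps_nth 0 0" by (rule arg_cong)
    then show False by simp
  qed
  ultimately show ?thesis by (metis nonzero_mult_div_cancel_right)
qed

lemma (in sl2_braid) free_part_H1:
  assumes n: "n > 0" and z_exists: "\<And>d m. even d \<Longrightarrow> m \<in> Mdeg (2 * d) \<Longrightarrow>
      \<exists>z\<in>cocycles G (Mdeg (2 * d)) act 1. z [v] = 0 \<and> z [u] = act u m - m"
  shows "free_part_iso (cohomology 1 G (Mdeg n) act) (Z_power (h1_rank n))"
proof (cases "4 dvd n")
  case True
  then obtain e where e: "n = 4 * e" by blast
  have "4 * e = 2 * (2 * e)" by simp
  then show ?thesis
    unfolding e using n e z_exists[of "2 * e"] by (intro rank_even h1_rank_eq) simp_all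
next
  case False
  then show ?thesis using rank_odd by (simp add: h1_rank_def)
qed

lemma B3_free_part: "n > 0 \<Longrightarrow> free_part_iso (cohomology 1 B3 (Mdeg n) B3.act) (Z_power (h1_rank n))"
  by (rule B3.free_part_H1) (auto elim: B3_cocycle_uv)

lemma SL2Z_free_part: "n > 0 \<Longrightarrow> free_part_iso (cohomology 1 SL2Z (Mdeg n) SL2Z.act) (Z_power (h1_rank n))"
  by (rule SL2Z.free_part_H1) (auto elim: SL2Z_cocycle_uv)

lemma (in gamma_prime) group_degree_component: "group (Gamma_p2_plus_deg p a b n)"
proof -
  have "W.W.cls (mono_tensor k) \<in> carrier W.W.Q" for k unfolding W.W.carrier_Q using mono_tensor_Fc by blast
  moreover have "pure_tensor TA TA (divpow_class p i) (divpow_class p j) = W.W.cls (mono_tensor (i, j))" for i j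
    unfolding W.pure_tensor_eq divpow_class_gam mono_tensor_def by simp
  ultimately have "subgroup (generate W.W.Q {pure_tensor TA TA (divpow_class p i) (divpow_class p j) | i j.
      i * a + j * b = n \<and> n > 0}) W.W.Q"
    by (intro group.generate_is_subgroup[OF W.W.group_Q]) auto
  then show ?thesis unfolding Gamma_p2_plus_deg_def Gamma_p2_eq by (rule group.subgroup_imp_group[OF W.W.group_Q])
qed

section \<open>Primary parts in all degrees\<close>

text \<open>Degree 0 is treated apart, as M_0 has nonzero invariants: there H^1 is Z, without
  torsion, and \<open>dick_rel p 0\<close> contains every family.\<close>

lemma primary_part_H1_B3:
  assumes "prime p"
  shows "primary_part p (cohomology 1 B3 (Mdeg n) B3.act) \<cong> add_grp UNIV Mod dick_rel p n"
proof (cases "n = 0")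
  case True
  let ?L = "cohomology 1 B3 (Mdeg 0) B3.act"
  have "group ?L" using B3.comm_group_H1 by (simp add: comm_group_def)
  from torsion_free_primary_part[OF this B3_H1_deg_0 prime_gt_0_nat[OF assms]]
  have "carrier (primary_part p ?L) = {\<one>\<^bsub>primary_part p ?L\<^esub>}" by (simp add: primary_part_def)
  then show ?thesis unfolding True dick_rel_def
    using trivial_iso_Mod_UNIV[OF comm_group_primary_part[OF B3.comm_group_H1]] by simp
next
  case False
  then show ?thesis using B3.primary_part_H1_pos assms by blast
qed

lemma primary_part_H1_SL2Z:
  assumes "prime p"
  shows "primary_part p (cohomology 1 SL2Z (Mdeg n) SL2Z.act) \<cong> add_grp UNIV Mod dick_rel p n"
proof (cases "n = 0")
  case True
  let ?L = "cohomology 1 SL2Z (Mdeg 0) SL2Z.act"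
  have "carrier ?L = {\<one>\<^bsub>?L\<^esub>}" "group ?L" using SL2Z_H1_deg_0 by (simp_all add: trivial_group_def)
  then have "carrier (primary_part p ?L) = {\<one>\<^bsub>primary_part p ?L\<^esub>}"
    using monoid.nat_pow_one[OF group.is_monoid[OF \<open>group ?L\<close>]] by (auto simp: primary_part_def)
  then show ?thesis unfolding True dick_rel_def
    using trivial_iso_Mod_UNIV[OF comm_group_primary_part[OF SL2Z.comm_group_H1]] by simp
next
  case False
  then show ?thesis using SL2Z.primary_part_H1_pos assms by blast
qed

lemma b3_act_eq: "b3_act = B3.act" and sl2_act_eq_act: "sl2_act = SL2Z.act"
  by (simp_all add: fun_eq_iff b3_act_def B3.act_def SL2Z.act_def)

theorem theorem3p7:
  shows
    "(sum_group UNIV (H_B3 0) \<cong> integer_group \<and> sum_group UNIV (H_SL2 0) \<cong> integer_group \<and>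
      H_B3 0 0 \<cong> integer_group \<and> H_SL2 0 0 \<cong> integer_group \<and>
      (\<forall>n>0. trivial_group (H_B3 0 n) \<and> trivial_group (H_SL2 0 n))) \<and>
     (\<forall>p n :: nat. prime p \<longrightarrow>
        primary_part p (H_B3 1 n) \<cong> primary_part p (H_SL2 1 n) \<and>
        primary_part p (H_SL2 1 n) \<cong> Gamma_p2_plus_deg p (2 * (p + 1)) (2 * p * (p - 1)) n) \<and>
     (trivial_group (H_SL2 1 0) \<and> H_B3 1 0 \<cong> integer_group) \<and>
     (\<exists>f :: nat \<Rightarrow> nat.
        Abs_fps (\<lambda>n. of_nat (f n) :: rat) =
          fps_X ^ 4 * (1 + fps_X ^ 4 - fps_X ^ 12 + fps_X ^ 16) /
          ((1 - fps_X ^ 8) * (1 - fps_X ^ 12)) \<and>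
        (\<forall>n>0. free_part_iso (H_B3 1 n) (Z_power (f n)) \<and>
               free_part_iso (H_SL2 1 n) (Z_power (f n))))"
  unfolding b3_act_eq sl2_act_eq_act
proof (intro conjI allI impI exI[of _ h1_rank])
  show "sum_group UNIV (\<lambda>n. cohomology 0 B3 (Mdeg n) B3.act) \<cong> integer_group"
    using B3.H0_zero B3.comm_group_H0 B3.H0_pos by (intro sum_group_concentrated) (auto simp: comm_group_def)
  show "sum_group UNIV (\<lambda>n. cohomology 0 SL2Z (Mdeg n) SL2Z.act) \<cong> integer_group"
    using SL2Z.H0_zero SL2Z.comm_group_H0 SL2Z.H0_pos by (intro sum_group_concentrated) (auto simp: comm_group_def)
  show "cohomology 0 B3 (Mdeg 0) B3.act \<cong> integer_group" by (rule B3.H0_zero)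
  show "cohomology 0 SL2Z (Mdeg 0) SL2Z.act \<cong> integer_group" by (rule SL2Z.H0_zero)
  show "trivial_group (cohomology 1 SL2Z (Mdeg 0) SL2Z.act)" by (rule SL2Z_H1_deg_0)
  show "cohomology 1 B3 (Mdeg 0) B3.act \<cong> integer_group" by (rule B3_H1_deg_0)
  show "Abs_fps (\<lambda>n. of_nat (h1_rank n) :: rat) =
      fps_X ^ 4 * (1 + fps_X ^ 4 - fps_X ^ 12 + fps_X ^ 16) / ((1 - fps_X ^ 8) * (1 - fps_X ^ 12))"
    by (rule h1_rank_fps)
next
  fix n :: nat assume n: "n > 0"
  show "trivial_group (cohomology 0 B3 (Mdeg n) B3.act)" by (rule B3.H0_pos[OF n])
  show "trivial_group (cohomology 0 SL2Z (Mdeg n) SL2Z.act)" by (rule SL2Z.H0_pos[OF n])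
  show "free_part_iso (cohomology 1 B3 (Mdeg n) B3.act) (Z_power (h1_rank n))" by (rule B3_free_part[OF n])
  show "free_part_iso (cohomology 1 SL2Z (Mdeg n) SL2Z.act) (Z_power (h1_rank n))" by (rule SL2Z_free_part[OF n])
next
  fix p n :: nat assume p: "prime p"
  interpret gamma_prime p by unfold_locales (rule p)
  have "group (primary_part p (cohomology 1 SL2Z (Mdeg n) SL2Z.act))"
    using comm_group_primary_part[OF SL2Z.comm_group_H1] by (simp add: comm_group_def)
  from group.iso_sym[OF this primary_part_H1_SL2Z[OF p]]
  show "primary_part p (cohomology 1 B3 (Mdeg n) B3.act) \<cong> primary_part p (cohomology 1 SL2Z (Mdeg n) SL2Z.act)"
    by (rule iso_trans[OF primary_part_H1_B3[OF p]])
  from group.iso_sym[OF group_degree_component degree_component_iso]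
  show "primary_part p (cohomology 1 SL2Z (Mdeg n) SL2Z.act) \<cong> Gamma_p2_plus_deg p (2 * (p + 1)) (2 * p * (p - 1)) n"
    by (rule iso_trans[OF primary_part_H1_SL2Z[OF p]])
qed

end
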